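(* Let $k,t:\mathbb{N}\to\mathbb{N}$ be functions (constructible in quadratic time) such that $\log\log n=o(k(n))$, $k(n)=o(t(n))$ and $t(n)=o(n)$. Then for every $n\in\mathbb{N}$ there is an algorithm that learns $\mathrm{PAR}(k)$ in the mistake-bound model with mistake bound at most $(1+o(1))\frac{kn}{t}+\log\binom{t}{k}$ and running time per round $e^{-k/4.01}\cdot\binom{t}{k}\cdot\tilde O\!\left(\left(\frac{kn}{t}\right)^2\right)$.
   Context: $\mathrm{PAR}(k)$ is the set of $x\in\{0,1\}^n$ of Hamming weight $k$, identified with the parity $a\mapsto\sum_i x_ia_i\pmod 2$. Mistake-bound model: learning proceeds in rounds; in each round the learner receives an arbitrary $a\in\{0,1\}^n$, predicts the value $f(a)$ of an unknown target $f\in\mathrm{PAR}(k)$, and then is told the true value $f(a)$. The mistake bound is the worst-case number of wrong predictions over all example sequences and all targets $f\in\mathrm{PAR}(k)$. *)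

theory Defs
  imports
    Complex_Main
    "HOL-Library.Landau_Symbols"
    "HOL-Library.Extended_Real"
    "HOL-Library.Discrete_Functions"
begin

section \<open>Parities\<close>

definition cube :: "nat \<Rightarrow> nat list set" where
  "cube n = {a. length a = n \<and> set a \<subseteq> {0, 1}}"

definition hamming_weight :: "nat list \<Rightarrow> nat" where
  "hamming_weight x = card {i. i < length x \<and> x ! i \<noteq> 0}"

definition PAR :: "nat \<Rightarrow> nat \<Rightarrow> nat list set" where
  "PAR n k = {x \<in> cube n. hamming_weight x = k}"

definition parity :: "nat list \<Rightarrow> nat list \<Rightarrow> nat" where
  "parity x a = (\<Sum>i<length x. x ! i * a ! i) mod 2"


section \<open>Random access machines with logarithmic cost\<close>

text \<open>
  Running time is measured on a random access machine with unbounded registers, addition,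
  truncated subtraction and indirect addressing, under the logarithmic cost criterion: an
  instruction costs the total binary length of the register indices and numbers it handles.
  So neither large registers nor large addresses are free. Programs are uniform: a program is a
  fixed finite text. Control flow is structured (conditionals and loops instead of jumps), and
  the input is a read-only vector a of which \<open>Read r i\<close> fetches the entry indexed by register i.
\<close>

type_synonym mem = "nat \<Rightarrow> nat"

datatype com =
    Skip
  | Const nat nat
  | Add nat nat nat
  | Sub nat nat nat
  | Load nat nat
  | Store nat nat
  | Read nat nat
  | Seq com com
  | Cond nat com com
  | While nat com

text \<open>The number of binary digits; it is 1 at 0, because \<open>floor_log 0 = 0\<close>.\<close>

definition len :: "nat \<Rightarrow> nat" where
  "len v = floor_log v + 1"

definition input_at :: "nat list \<Rightarrow> nat \<Rightarrow> nat" where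
  "input_at a i = (if i < length a then a ! i else 0)"

text \<open>
  \<open>exec a c m \<tau> m'\<close>: on input a and memory m, the program c halts after time \<open>\<tau>\<close> with memory m'.
\<close>

inductive exec :: "nat list \<Rightarrow> com \<Rightarrow> mem \<Rightarrow> nat \<Rightarrow> mem \<Rightarrow> bool" for a :: "nat list" where
  Skip: "exec a Skip m 1 m"
| Const: "exec a (Const r v) m (len r + len v) (m(r := v))"
| Add: "exec a (Add r i j) m (len r + len i + len j + len (m i) + len (m j))
          (m(r := m i + m j))"
| Sub: "exec a (Sub r i j) m (len r + len i + len j + len (m i) + len (m j))
          (m(r := m i - m j))"
| Load: "exec a (Load r i) m (len r + len i + len (m i) + len (m (m i)))
          (m(r := m (m i)))"
| Store: "exec a (Store i j) m (len i + len j + len (m i) + len (m j))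
          (m(m i := m j))"
| Read: "exec a (Read r i) m (len r + len i + len (m i) + len (input_at a (m i)))
          (m(r := input_at a (m i)))"
| Seq: "exec a c1 m \<tau>1 m1 \<Longrightarrow> exec a c2 m1 \<tau>2 m2 \<Longrightarrow> exec a (Seq c1 c2) m (\<tau>1 + \<tau>2) m2"
| CondTrue: "m r \<noteq> 0 \<Longrightarrow> exec a c1 m \<tau> m' \<Longrightarrow>
          exec a (Cond r c1 c2) m (len r + len (m r) + \<tau>) m'"
| CondFalse: "m r = 0 \<Longrightarrow> exec a c2 m \<tau> m' \<Longrightarrow>
          exec a (Cond r c1 c2) m (len r + len (m r) + \<tau>) m'"
| WhileFalse: "m r = 0 \<Longrightarrow> exec a (While r c) m (len r + len (m r)) m"
| WhileTrue: "m r \<noteq> 0 \<Longrightarrow> exec a c m \<tau>1 m1 \<Longrightarrow> exec a (While r c) m1 \<tau>2 m2 \<Longrightarrow>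
          exec a (While r c) m (len r + len (m r) + \<tau>1 + \<tau>2) m2"

text \<open>
  A computation starts with n in register 0 and 0 in all other registers; register 1 is used for
  results.
\<close>

definition init_mem :: "nat \<Rightarrow> mem" where
  "init_mem n = (\<lambda>i. if i = 0 then n else 0)"

definition quadratic_time_constructible :: "(nat \<Rightarrow> nat) \<Rightarrow> bool" where
  "quadratic_time_constructible f \<longleftrightarrow>
     (\<exists>c \<tau>. (\<forall>n. \<exists>m. exec [] c (init_mem n) (\<tau> n) m \<and> m 1 = f n) \<and>
            (\<lambda>n. real (\<tau> n)) \<in> O(\<lambda>n. real n ^ 2))"


section \<open>Learning in the mistake-bound model\<close>

text \<open>
  The first program of a learner computes a prediction from the example; the second one is run
  once the true value is known. The memory persists between the two and from round to round.
  There is no separate setup phase: whatever the learner prepares is charged to some round.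
\<close>

type_synonym learner = "com \<times> com"

text \<open>
  One round with example a and true value y, of the given prediction and running time. The true
  value is supplied in register 1.
\<close>

inductive learning_round ::
    "learner \<Rightarrow> nat list \<Rightarrow> nat \<Rightarrow> mem \<Rightarrow> nat \<Rightarrow> nat \<Rightarrow> mem \<Rightarrow> bool" where
  "exec a p m \<tau>1 m1 \<Longrightarrow> exec a u (m1(1 := y)) \<tau>2 m2 \<Longrightarrow>
   learning_round (p, u) a y m (m1 1) (\<tau>1 + \<tau>2) m2"

text \<open>
  \<open>play L x m as tr\<close>: starting from memory m, the learner L goes through the examples as with
  target x; for each round, tr records whether the prediction was wrong, and the running time.
\<close>

inductive play :: "learner \<Rightarrow> nat list \<Rightarrow> mem \<Rightarrow> nat list list \<Rightarrow> (bool \<times> nat) list \<Rightarrow> bool"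
  for L :: learner and x :: "nat list" where
  "play L x m [] []"
| "learning_round L a (parity x a) m b \<tau> m' \<Longrightarrow> play L x m' as tr \<Longrightarrow>
   play L x m (a # as) ((b \<noteq> parity x a, \<tau>) # tr)"

definition plays :: "learner \<Rightarrow> nat \<Rightarrow> nat \<Rightarrow> (bool \<times> nat) list set" where
  "plays L n k = {tr. \<exists>x \<in> PAR n k. \<exists>as \<in> lists (cube n). play L x (init_mem n) as tr}"

definition mistake_bound :: "learner \<Rightarrow> nat \<Rightarrow> nat \<Rightarrow> enat" where
  "mistake_bound L n k = (SUP tr \<in> plays L n k. enat (length (filter fst tr)))"

definition time_per_round :: "learner \<Rightarrow> nat \<Rightarrow> nat \<Rightarrow> enat" where
  "time_per_round L n k = (SUP tr \<in> plays L n k. SUP (w, \<tau>) \<in> set tr. enat \<tau>)"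

definition learns_PAR :: "learner \<Rightarrow> nat \<Rightarrow> nat \<Rightarrow> bool" where
  "learns_PAR L n k \<longleftrightarrow>
     (\<forall>x \<in> PAR n k. \<forall>as \<in> lists (cube n). \<exists>tr. play L x (init_mem n) as tr) \<and>
     mistake_bound L n k < \<infinity>"


section \<open>Soft-O\<close>

definition soft_O :: "(nat \<Rightarrow> real) \<Rightarrow> (nat \<Rightarrow> real) set" where
  "soft_O g = {f. \<exists>c::nat. f \<in> O(\<lambda>n. g n * ln (g n) ^ c)}"

end

theory Submission
  imports Defs
begin

text \<open>
  Weighted majority vote over experts: an expert is a list of positions, assumes that the target is
  supported there, and keeps the linear system over the field with two elements that the examples
  impose. It abstains with weight halved whenever the next answer is independent of its system, and
  dies when it contradicts the true value. With N experts of at most D positions each, the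
  potential (the number of assignments that are still possible, summed over the experts) starts
  below \<open>N * 2^D\<close> and is at least halved by every mistake, which gives \<open>log N + D\<close>.

  A partition of the positions into t cells and all k-sets of cells would give \<open>D = k * n / t\<close>, but
  \<open>N = (t choose k)\<close>, which is too slow by \<open>exp (k / 4.01)\<close>. Instead the experts cover the k target
  positions in groups of A = 20, in the order of their cells. Cut the span of a group into
  \<open>A * M\<close> intervals of width w. If the group hits every interval at most once, then some polynomial
  of degree below A modulo a number close to w names its cell in each interval; so \<open>w^A\<close>
  choices suffice, each of them covering \<open>A * M\<close> cells. If two positions share an interval, they can be
  searched for on a finer scale, which is cheap enough for \<open>M = A^(A - 1)\<close>. Compared with
  picking one cell for each position this saves \<open>A^A\<close> per group, while the unknown lengths of the spans
  cost about \<open>(A / e)^A * e^A\<close>; altogether N is about \<open>(c * t / k)^k\<close> with \<open>c < exp (3 / 8)\<close>,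
  whereas \<open>(t choose k)\<close> is about \<open>(e * t / k)^k\<close>. The gap also absorbs the size of the
  numbers, since log log n = o(k).
\<close>

section \<open>Embedding programs\<close>

text \<open>The factor 1 + o(1) before kn / t fixes how many cells one target position may use, so
  both kinds of block get the same A * M cells. The choice of M balances them: A - 2 single
  residues, one of A * M intervals and two residues inside it make (l A M v)^(A - 2) * (A M) * (l
  v)^2 choices; for M = A^(A - 1) this equals (l M v)^A, about the number of polynomials. There are
  about M * t cells; rounding their sizes up costs k * M positions, which is o(kn / t) because t =
  o(n).

  The machine neither multiplies nor divides. Hence the binomial basis for polynomials (tabulated by
  differences), moduli congruent to 1 modulo a factorial (found by stepping) and one fixed stride
  for all records. There is no setup phase either: the first round builds the family in a queue
  whose length a potential bounds.

  Logarithmic cost: indices have O(k log n) digits, and log n is eventually at most exp (k / 1000).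
  Weights are about D times as long, but an expert touches them only O(D) times, no more than its
  elimination costs anyway.\<close>

inductive_cases exec_SkipE: "exec a Skip m \<tau> m'"
inductive_cases exec_ConstE: "exec a (Const r v) m \<tau> m'"
inductive_cases exec_AddE: "exec a (Add r i j) m \<tau> m'"
inductive_cases exec_SubE: "exec a (Sub r i j) m \<tau> m'"
inductive_cases exec_LoadE: "exec a (Load r i) m \<tau> m'"
inductive_cases exec_StoreE: "exec a (Store i j) m \<tau> m'"
inductive_cases exec_ReadE: "exec a (Read r i) m \<tau> m'"
inductive_cases exec_SeqE: "exec a (Seq c1 c2) m \<tau> m'"
inductive_cases exec_CondE: "exec a (Cond r c1 c2) m \<tau> m'"
inductive_cases exec_WhileE: "exec a (While r c) m \<tau> m'"

text \<open>\<open>plays\<close> collects every run that the semantics allows, and both bounds are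
  suprema over it. Determinism makes the run exhibited later the only one.\<close>

lemma exec_det: "exec a c m \<tau> m' \<Longrightarrow> exec a c m \<tau>' m'' \<Longrightarrow> \<tau>' = \<tau> \<and> m'' = m'"
proof (induction arbitrary: \<tau>' m'' rule: exec.induct)
  case (Seq c1 m \<tau>1 m1 c2 \<tau>2 m2)
  from Seq.prems show ?case
  proof (rule exec_SeqE)
    fix t1 m1' t2
    assume *: "\<tau>' = t1 + t2" "exec a c1 m t1 m1'" "exec a c2 m1' t2 m''"
    from Seq.IH(1)[OF *(2)] Seq.IH(2) *(1,3) show ?thesis by simp
  qed
next
  case (CondTrue m r c1 \<tau> m' c2)
  from CondTrue.prems show ?case
  proof (rule exec_CondE)
    fix t
    assume *: "\<tau>' = len r + len (m r) + t" "exec a c1 m t m''"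
    from CondTrue.IH[OF *(2)] *(1) show ?thesis by simp
  qed (use CondTrue.hyps in simp)
next
  case (CondFalse m r c2 \<tau> m' c1)
  from CondFalse.prems show ?case
  proof (rule exec_CondE)
    fix t
    assume *: "\<tau>' = len r + len 0 + t" "exec a c2 m t m''"
    from CondFalse.IH[OF *(2)] *(1) show ?thesis using CondFalse.hyps by simp
  qed (use CondFalse.hyps in simp)
next
  case (WhileFalse m r c)
  from WhileFalse.prems show ?case by (rule exec_WhileE) (use WhileFalse.hyps in simp_all)
next
  case (WhileTrue m r c \<tau>1 m1 \<tau>2 m2)
  from WhileTrue.prems show ?case
  proof (rule exec_WhileE)
    fix t1 m1' t2
    assume *: "\<tau>' = len r + len (m r) + t1 + t2" "exec a c m t1 m1'" "exec a (While r c) m1' t2 m''"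
    from WhileTrue.IH(1)[OF *(2)] WhileTrue.IH(2) *(1,3) show ?thesis by simp
  qed (use WhileTrue.hyps in simp)
qed (auto elim: exec_SkipE exec_ConstE exec_AddE exec_SubE exec_LoadE exec_StoreE exec_ReadE)

lemma len_le: "v < 2 ^ b \<Longrightarrow> 0 < b \<Longrightarrow> len v \<le> b"
proof -
  assume v: "v < 2 ^ b" and b: "0 < b"
  show "len v \<le> b"
  proof (cases "v = 0")
    case True then show ?thesis using b by (simp add: len_def)
  next
    case False
    then have "(2::nat) ^ floor_log v \<le> v" by (simp add: floor_log_exp2_le)
    then have "(2::nat) ^ floor_log v < 2 ^ b" using v by linarith
    then have "floor_log v < b" by (metis power_strict_increasing_iff one_less_numeral_iff semiring_norm(76))
    then show ?thesis by (simp add: len_def)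
  qed
qed

lemma less_two_power_len: "v < 2 ^ len v"
proof (cases "v = 0")
  case False then show ?thesis using floor_log_exp2_gt[of v] by (simp add: len_def)
qed (simp add: len_def)

lemma len_pos: "1 \<le> len v"
  by (simp add: len_def)

text \<open>Moving an address into a residue class adds at most four digits; as every length is at
  least 1, this costs a constant factor.\<close>

lemma len_le_16: "q < 16 \<Longrightarrow> len (16 * v + q) \<le> len v + 4"
  by (rule len_le) (use less_two_power_len[of v] in \<open>auto simp: power_add\<close>)

lemma len_mono: "u \<le> v \<Longrightarrow> len u \<le> len v"
  by (rule len_le) (use less_two_power_len[of v] len_pos[of v] in auto)

lemma loc_eq_iff: 
  assumes "q < 16" "q' < 16" shows "16 * i + q = 16 * i' + q' \<longleftrightarrow> q = q' \<and> i = (i'::nat)"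
proof
  assume *: "16 * i + q = 16 * i' + q'"
  then have "(q + 16 * i) mod 16 = (q' + 16 * i') mod 16" by (simp add: add.commute)
  then have "q = q'" using assms unfolding mod_mult_self2 by simp
  then show "q = q' \<and> i = i'" using * by simp
qed simp

text \<open>Memory is split into residue classes modulo 16: independent arrays that cannot alias.
  The class 14 holds the scratch cells 14 and 30 used to compute addresses.\<close>

definition addr :: "nat \<Rightarrow> nat \<Rightarrow> com" where
  "addr q i = Seq (Add 14 i i) (Seq (Add 14 14 14) (Seq (Add 14 14 14) (Seq (Add 14 14 14)
     (Seq (Const 30 q) (Add 14 14 30)))))"

text \<open>Without multiplication, \<open>16 * m i + q\<close> comes from four doublings and an
  addition; no intermediate value is more than four digits longer than \<open>m i\<close>.\<close>

lemma exec_addr: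
  assumes q: "q < 16" and i: "i \<noteq> 14" "i \<noteq> 30"
  shows "\<exists>\<tau>. exec a (addr q i) m \<tau> (m(30 := q, 14 := 16 * m i + q)) \<and> \<tau> \<le> 120 * len (m i) + 2 * len i"
proof -
  let ?x = "m i"
  have *: "exec a (addr q i) m
    ((len 14 + len i + len i + len ?x + len ?x) + ((len 14 + len 14 + len 14 + len (2*?x) + len (2*?x)) +
     ((len 14 + len 14 + len 14 + len (4*?x) + len (4*?x)) + ((len 14 + len 14 + len 14 + len (8*?x) + len (8*?x)) +
      ((len 30 + len q) + (len 14 + len 14 + len 30 + len (16*?x) + len q))))))
    ((m(14 := 2*?x))(14 := 4*?x, 14 := 8 *?x, 14 := 16*?x, 30 := q, 14 := 16*?x+q))"
    unfolding addr_def
    apply (rule exec.Seq)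
     apply (rule exec.Add[of a 14 i i m, folded mult_2])
    apply (rule exec.Seq)
     apply (rule exec.Add[of a 14 14 14 "m(14 := 2*?x)", simplified])
    apply (rule exec.Seq)
     apply (rule exec.Add[of a 14 14 14 "m(14 := 2*?x, 14 := 4 * ?x)", simplified])
    apply (rule exec.Seq)
     apply (rule exec.Add[of a 14 14 14 "m(14 := 2*?x, 14 := 4 * ?x, 14 := 8 * ?x)", simplified])
    apply (rule exec.Seq)
     apply (rule exec.Const)
    using exec.Add[of a 14 14 30 "m(14 := 2*?x, 14 := 4 * ?x, 14 := 8 * ?x, 14 := 16 * ?x, 30 := q)"] by simp
  have 14: "len 14 \<le> 4" by (rule len_le) auto
  have 30: "len 30 \<le> 5" by (rule len_le) auto
  have 16: "len q \<le> 4" using q by (intro len_le) auto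
  have le: "len (c * ?x) \<le> len ?x + 4" if "c \<le> 16" for c
  proof -
    have "len (c * ?x) \<le> len (16 * ?x + 0)" using that by (intro len_mono) simp
    also have "\<dots> \<le> len ?x + 4" by (rule len_le_16) simp
    finally show ?thesis .
  qed
  have "1 \<le> len ?x" "1 \<le> len i" by (rule len_pos)+
  with 14 30 16 le[of 2] le[of 4] le[of 8] le[of 16] *
  have "(len 14 + len i + len i + len ?x + len ?x) + ((len 14 + len 14 + len 14 + len (2*?x) + len (2*?x)) +
     ((len 14 + len 14 + len 14 + len (4*?x) + len (4*?x)) + ((len 14 + len 14 + len 14 + len (8*?x) + len (8*?x)) +
      ((len 30 + len q) + (len 14 + len 14 + len 30 + len (16*?x) + len q))))) \<le> 120 * len ?x + 2 * len i"
    by simp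
  moreover have "(m(14 := 2*?x))(14 := 4*?x, 14 := 8 *?x, 14 := 16*?x, 30 := q, 14 := 16*?x+q) = m(30 := q, 14 := 16 * m i + q)"
    by auto
  ultimately show ?thesis using * by auto
qed

text \<open>The programs that compute k and t are arbitrary, so each is confined to a class of its
  own. Register names are translated statically, only indirect addresses at run time.
  Constructibility refers to the empty input, on which every \<open>Read\<close> yields 0.\<close>

primrec emb :: "nat \<Rightarrow> com \<Rightarrow> com" where
  "emb q Skip = Skip"
| "emb q (Const r v) = Const (16 * r + q) v"
| "emb q (Add r i j) = Add (16 * r + q) (16 * i + q) (16 * j + q)"
| "emb q (Sub r i j) = Sub (16 * r + q) (16 * i + q) (16 * j + q)"
| "emb q (Load r i) = Seq (addr q (16 * i + q)) (Load (16 * r + q) 14)"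
| "emb q (Store i j) = Seq (addr q (16 * i + q)) (Store 14 (16 * j + q))"
| "emb q (Read r i) = Const (16 * r + q) 0"
| "emb q (Seq c1 c2) = Seq (emb q c1) (emb q c2)"
| "emb q (Cond r c1 c2) = Cond (16 * r + q) (emb q c1) (emb q c2)"
| "emb q (While r c) = While (16 * r + q) (emb q c)"

text \<open>Inside the class q the program runs as on the empty input.\<close>

lemma exec_emb:
  assumes "exec [] c m \<tau> m'" and q: "q < 14" and "\<And>i. \<mu> (16 * i + q) = m i"
  shows "\<exists>\<tau>' \<mu>'. exec a (emb q c) \<mu> \<tau>' \<mu>' \<and> \<tau>' \<le> 200 * \<tau> \<and> (\<forall>i. \<mu>' (16 * i + q) = m' i) \<and>
    (\<forall>x. x mod 16 \<noteq> q \<and> x mod 16 \<noteq> 14 \<longrightarrow> \<mu>' x = \<mu> x)"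
  using assms(1,3)
proof (induction arbitrary: \<mu> rule: exec.induct)
  case (Skip m)
  then show ?case by (intro exI[of _ 1] exI[of _ \<mu>]) (auto intro: exec.Skip[unfolded One_nat_def] exec.Skip)
next
  case (Const r v m)
  have "len (16 * r + q) \<le> len r + 4" using q by (intro len_le_16) simp
  then show ?case using Const q len_pos[of r] loc_eq_iff[of q q] exec.Const[of a "16 * r + q" v \<mu>]
    by (intro exI[of _ "len (16 * r + q) + len v"] exI[of _ "\<mu>(16 * r + q := v)"])
       (auto simp: fun_upd_def)
next
  case (Add r i j m)
  have "len (16 * x + q) \<le> len x + 4" for x using q by (intro len_le_16) simp
  from this[of r] this[of i] this[of j] show ?case
    using Add q len_pos[of r] len_pos[of i] len_pos[of j]  loc_eq_iff[of q q]
      exec.Add[of a "16 * r + q" "16 * i + q" "16 * j + q" \<mu>]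
    by (intro exI[of _ "len (16 * r + q) + len (16 * i + q) + len (16 * j + q) + len (m i) + len (m j)"]
        exI[of _ "\<mu>(16 * r + q := m i + m j)"]) (auto simp: fun_upd_def)
next
  case (Sub r i j m)
  have "len (16 * x + q) \<le> len x + 4" for x using q by (intro len_le_16) simp
  from this[of r] this[of i] this[of j] show ?case
    using Sub q len_pos[of r] len_pos[of i] len_pos[of j]  loc_eq_iff[of q q]
      exec.Sub[of a "16 * r + q" "16 * i + q" "16 * j + q" \<mu>]
    by (intro exI[of _ "len (16 * r + q) + len (16 * i + q) + len (16 * j + q) + len (m i) + len (m j)"]
        exI[of _ "\<mu>(16 * r + q := m i - m j)"]) (auto simp: fun_upd_def)
next
  case (Load r i m)
  let ?\<mu> = "\<mu>(30 := q, 14 := 16 * m i + q)"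
  have ne: "16 * x + q \<noteq> 14" "16 * x + q \<noteq> 30" for x using q by presburger+
  from exec_addr[of q "16 * i + q" a \<mu>] q ne Load
  obtain \<tau>1 where 1: "exec a (addr q (16 * i + q)) \<mu> \<tau>1 ?\<mu>" "\<tau>1 \<le> 120 * len (m i) + 2 * len (16 * i + q)"
    by auto
  have 2: "exec a (Load (16 * r + q) 14) ?\<mu> (len (16 * r + q) + len 14 + len (16 * m i + q) + len (m (m i)))
      (?\<mu>(16 * r + q := m (m i)))"
    using exec.Load[of a "16 * r + q" 14 ?\<mu>] Load ne by simp
  have le: "len (16 * x + q) \<le> len x + 4" for x using q by (intro len_le_16) simp
  have 14: "len 14 \<le> 4" by (rule len_le) auto
  \<comment> \<open>The address costs 120 * len (m i) plus twice a relocated index. Since all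
    lengths are at least 1, the factor 200 also swallows the additive constants.\<close>
  have "\<tau>1 + (len (16 * r + q) + len 14 + len (16 * m i + q) + len (m (m i))) \<le> 200 * (len r + len i + len (m i) + len (m (m i)))"
    using 1 le[of r] le[of i] le[of "m i"] 14 len_pos[of r] len_pos[of i] len_pos[of "m i"] by simp
  then show ?case using exec.Seq[OF 1(1) 2] Load ne q loc_eq_iff[of q q]
    by (intro exI[of _ "\<tau>1 + (len (16 * r + q) + len 14 + len (16 * m i + q) + len (m (m i)))"]
        exI[of _ "?\<mu>(16 * r + q := m (m i))"]) (auto simp: fun_upd_def)
next
  case (Store i j m)
  let ?\<mu> = "\<mu>(30 := q, 14 := 16 * m i + q)"
  have ne: "16 * x + q \<noteq> 14" "16 * x + q \<noteq> 30" for x using q by presburger+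
  from exec_addr[of q "16 * i + q" a \<mu>] q ne Store
  obtain \<tau>1 where 1: "exec a (addr q (16 * i + q)) \<mu> \<tau>1 ?\<mu>" "\<tau>1 \<le> 120 * len (m i) + 2 * len (16 * i + q)"
    by auto
  have 2: "exec a (Store 14 (16 * j + q)) ?\<mu> (len 14 + len (16 * j + q) + len (16 * m i + q) + len (m j))
      (?\<mu>(16 * m i + q := m j))"
    using exec.Store[of a 14 "16 * j + q" ?\<mu>] Store ne by simp
  have le: "len (16 * x + q) \<le> len x + 4" for x using q by (intro len_le_16) simp
  have 14: "len 14 \<le> 4" by (rule len_le) auto
  have "\<tau>1 + (len 14 + len (16 * j + q) + len (16 * m i + q) + len (m j)) \<le> 200 * (len i + len j + len (m i) + len (m j))"
    using 1 le[of j] le[of i] le[of "m i"] 14 len_pos[of j] len_pos[of i] len_pos[of "m i"] by simp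
  then show ?case using exec.Seq[OF 1(1) 2] Store ne q loc_eq_iff[of q q]
    by (intro exI[of _ "\<tau>1 + (len 14 + len (16 * j + q) + len (16 * m i + q) + len (m j))"]
        exI[of _ "?\<mu>(16 * m i + q := m j)"]) (auto simp: fun_upd_def)
next
  case (Read r i m)
  have "len (16 * r + q) \<le> len r + 4" using q by (intro len_le_16) simp
  then show ?case using Read q len_pos[of r] loc_eq_iff[of q q] exec.Const[of a "16 * r + q" 0 \<mu>]
    by (intro exI[of _ "len (16 * r + q) + len 0"] exI[of _ "\<mu>(16 * r + q := 0)"])
       (auto simp: input_at_def fun_upd_def)
next
  case (Seq c1 m \<tau>1 m1 c2 \<tau>2 m2)
  from Seq.IH(1)[of \<mu>] Seq.prems obtain \<tau>1' \<mu>1 where 1: "exec a (emb q c1) \<mu> \<tau>1' \<mu>1" "\<tau>1' \<le> 200 * \<tau>1"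
     "\<forall>i. \<mu>1 (16 * i + q) = m1 i" "\<forall>x. x mod 16 \<noteq> q \<and> x mod 16 \<noteq> 14 \<longrightarrow> \<mu>1 x = \<mu> x" by blast
  from Seq.IH(2)[of \<mu>1] 1(3) obtain \<tau>2' \<mu>2 where 2: "exec a (emb q c2) \<mu>1 \<tau>2' \<mu>2" "\<tau>2' \<le> 200 * \<tau>2"
     "\<forall>i. \<mu>2 (16 * i + q) = m2 i" "\<forall>x. x mod 16 \<noteq> q \<and> x mod 16 \<noteq> 14 \<longrightarrow> \<mu>2 x = \<mu>1 x" by blast
  show ?case using exec.Seq[OF 1(1) 2(1)] 1 2
    by (intro exI[of _ "\<tau>1' + \<tau>2'"] exI[of _ \<mu>2]) (auto simp: fun_upd_def)
next
  case (CondTrue m r c1 \<tau> m' c2)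
  from CondTrue.IH[of \<mu>] CondTrue.prems obtain \<tau>1' \<mu>1 where 1: "exec a (emb q c1) \<mu> \<tau>1' \<mu>1" "\<tau>1' \<le> 200 * \<tau>"
     "\<forall>i. \<mu>1 (16 * i + q) = m' i" "\<forall>x. x mod 16 \<noteq> q \<and> x mod 16 \<noteq> 14 \<longrightarrow> \<mu>1 x = \<mu> x" by blast
  have "len (16 * r + q) \<le> len r + 4" using q by (intro len_le_16) simp
  then show ?case using exec.CondTrue[of \<mu> "16 * r + q", OF _ 1(1)] 1 CondTrue len_pos[of r]
    by (intro exI[of _ "len (16 * r + q) + len (m r) + \<tau>1'"] exI[of _ \<mu>1]) (auto simp: fun_upd_def)
next
  case (CondFalse m r c2 \<tau> m' c1)
  from CondFalse.IH[of \<mu>] CondFalse.prems obtain \<tau>1' \<mu>1 where 1: "exec a (emb q c2) \<mu> \<tau>1' \<mu>1" "\<tau>1' \<le> 200 * \<tau>"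
     "\<forall>i. \<mu>1 (16 * i + q) = m' i" "\<forall>x. x mod 16 \<noteq> q \<and> x mod 16 \<noteq> 14 \<longrightarrow> \<mu>1 x = \<mu> x" by blast
  have "len (16 * r + q) \<le> len r + 4" using q by (intro len_le_16) simp
  then show ?case using exec.CondFalse[of \<mu> "16 * r + q", OF _ 1(1)] 1 CondFalse len_pos[of r]
    by (intro exI[of _ "len (16 * r + q) + len (m r) + \<tau>1'"] exI[of _ \<mu>1]) (auto simp: fun_upd_def)
next
  case (WhileFalse m r c)
  have "len (16 * r + q) \<le> len r + 4" using q by (intro len_le_16) simp
  then show ?case using exec.WhileFalse[of \<mu> "16 * r + q" a "emb q c"] WhileFalse len_pos[of r]
    by (intro exI[of _ "len (16 * r + q) + len (m r)"] exI[of _ \<mu>]) (auto simp: fun_upd_def)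
next
  case (WhileTrue m r c \<tau>1 m1 \<tau>2 m2)
  from WhileTrue.IH(1)[of \<mu>] WhileTrue.prems obtain \<tau>1' \<mu>1 where 1: "exec a (emb q c) \<mu> \<tau>1' \<mu>1" "\<tau>1' \<le> 200 * \<tau>1"
     "\<forall>i. \<mu>1 (16 * i + q) = m1 i" "\<forall>x. x mod 16 \<noteq> q \<and> x mod 16 \<noteq> 14 \<longrightarrow> \<mu>1 x = \<mu> x" by blast
  from WhileTrue.IH(2)[of \<mu>1] 1(3) obtain \<tau>2' \<mu>2 where 2: "exec a (emb q (While r c)) \<mu>1 \<tau>2' \<mu>2" "\<tau>2' \<le> 200 * \<tau>2"
     "\<forall>i. \<mu>2 (16 * i + q) = m2 i" "\<forall>x. x mod 16 \<noteq> q \<and> x mod 16 \<noteq> 14 \<longrightarrow> \<mu>2 x = \<mu>1 x" by blast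
  have "len (16 * r + q) \<le> len r + 4" using q by (intro len_le_16) simp
  then show ?case using exec.WhileTrue[of \<mu> "16 * r + q", OF _ 1(1) 2(1)[simplified]] 1 2 WhileTrue len_pos[of r]
    by (intro exI[of _ "len (16 * r + q) + len (m r) + \<tau>1' + \<tau>2'"] exI[of _ \<mu>2]) (auto simp: fun_upd_def)
qed

section \<open>Programs on scalars and arrays\<close>

text \<open>The first argument is the residue class: 0 for the scalars, which programs address by
  name, the others for the arrays.\<close>

type_synonym state = "nat \<Rightarrow> nat \<Rightarrow> nat"

definition upd :: "state \<Rightarrow> nat \<Rightarrow> nat \<Rightarrow> nat \<Rightarrow> state" where
  "upd s q i v = s(q := (s q)(i := v))"

lemma upd_apply [simp]: "upd s q i v q' i' = (if q' = q \<and> i' = i then v else s q' i')"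
  by (simp add: upd_def)

lemma upd_other [simp]: "q' \<noteq> q \<Longrightarrow> upd s q i v q' = s q'"
  by (simp add: upd_def)

datatype hl =
    HSkip
  | HConst nat nat
  | HAdd nat nat nat
  | HSub nat nat nat
  | HGet nat nat nat
  | HPut nat nat nat
  | HRead nat nat
  | HSeq hl hl (infixr \<open>;;\<close> 60)
  | HIf nat hl hl
  | HWhile nat hl

primrec cmp :: "hl \<Rightarrow> com" where
  "cmp HSkip = Skip"
| "cmp (HConst x v) = Const (16 * x) v"
| "cmp (HAdd x y z) = Add (16 * x) (16 * y) (16 * z)"
| "cmp (HSub x y z) = Sub (16 * x) (16 * y) (16 * z)"
| "cmp (HGet x q i) = Seq (addr q (16 * i)) (Load (16 * x) 14)"
| "cmp (HPut q i x) = Seq (addr q (16 * i)) (Store 14 (16 * x))"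
| "cmp (HRead x i) = Read (16 * x) (16 * i)"
| "cmp (c ;; d) = Seq (cmp c) (cmp d)"
| "cmp (HIf x c d) = Cond (16 * x) (cmp c) (cmp d)"
| "cmp (HWhile x c) = While (16 * x) (cmp c)"

text \<open>Classes 1 and 2 are left to the embedded programs for k and t, class 14 to the
  computation of addresses.\<close>

definition classes :: "nat set" where
  "classes = insert 0 {3..<14}"

definition rel :: "mem \<Rightarrow> state \<Rightarrow> bool" where
  "rel m s \<longleftrightarrow> (\<forall>q \<in> classes. \<forall>i. m (16 * i + q) = s q i)"

text \<open>The scalars 4 to 7 hold weights, which are long numbers; all others are short.\<close>

definition heavy :: "nat \<Rightarrow> bool" where
  "heavy x \<longleftrightarrow> 4 \<le> x \<and> x \<le> 7"

text \<open>Two sizes of numbers: \<beta> digits for values and indices, \<beta> * \<eta> digits for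
  the weights in the heavy scalars. An instruction on a weight is charged \<eta> units.\<close>

locale machine =
  fixes a :: "nat list" and \<beta> \<eta> :: nat
  assumes a01: "set a \<subseteq> {0, 1}" and \<beta>: "11 \<le> \<beta>" and \<eta>: "1 \<le> \<eta>"
begin

definition lim :: "nat \<Rightarrow> nat" where
  "lim x = (if heavy x then 2 ^ (\<beta> * \<eta>) else 2 ^ \<beta>)"

definition bnd :: "state \<Rightarrow> bool" where
  "bnd s \<longleftrightarrow> (\<forall>x. s 0 x < lim x) \<and> (\<forall>q \<in> {3..<14}. \<forall>i. s q i < 2 ^ \<beta>)"

definition unit :: nat where
  "unit = 300 * \<beta>"

text \<open>A total-correctness triple with a budget of k units. As \<open>bnd\<close> is assumed
  before and guaranteed after, logarithmic cost turns into counting instructions, and sizes matter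
  only where a number grows. The 300 in \<open>unit\<close> covers the dearest instruction, an
  indirect access including its address.\<close>

definition run :: "hl \<Rightarrow> state \<Rightarrow> nat \<Rightarrow> (state \<Rightarrow> bool) \<Rightarrow> bool" where
  "run c s k Q \<longleftrightarrow> (bnd s \<longrightarrow> (\<forall>m. rel m s \<longrightarrow>
     (\<exists>\<tau> m' s'. exec a (cmp c) m \<tau> m' \<and> rel m' s' \<and> bnd s' \<and> \<tau> \<le> unit * k \<and> Q s')))"

lemma runI:
  assumes "\<And>m. bnd s \<Longrightarrow> rel m s \<Longrightarrow> \<exists>\<tau> m' s'. exec a (cmp c) m \<tau> m' \<and> rel m' s' \<and> bnd s' \<and> \<tau> \<le> unit * k \<and> Q s'"
  shows "run c s k Q"
  using assms by (auto simp: run_def)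

lemma runE:
  assumes "run c s k Q" "bnd s" "rel m s"
  obtains \<tau> m' s' where "exec a (cmp c) m \<tau> m'" "rel m' s'" "bnd s'" "\<tau> \<le> unit * k" "Q s'"
  using assms by (auto simp: run_def)

lemma exec_witness:
  "exec a c m \<tau> m' \<Longrightarrow> rel m' s' \<Longrightarrow> bnd s' \<Longrightarrow> \<tau> \<le> k \<Longrightarrow> Q s' \<Longrightarrow>
   \<exists>\<tau> m' s'. exec a c m \<tau> m' \<and> rel m' s' \<and> bnd s' \<and> \<tau> \<le> k \<and> Q s'"
  by blast

lemma run_bnd: "(bnd s \<Longrightarrow> run c s k Q) \<Longrightarrow> run c s k Q"
  by (auto simp: run_def)

lemma run_mono: "run c s k Q \<Longrightarrow> k \<le> k' \<Longrightarrow> (\<And>s'. bnd s' \<Longrightarrow> Q s' \<Longrightarrow> Q' s') \<Longrightarrow> run c s k' Q'"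
  unfolding run_def by (meson le_trans mult_le_mono2)

lemma run_Seq:
  assumes 1: "run c s k1 P" and 2: "\<And>s'. bnd s' \<Longrightarrow> P s' \<Longrightarrow> run d s' k2 Q"
  shows "run (c ;; d) s (k1 + k2) Q"
proof (rule runI)
  fix m assume "bnd s" "rel m s"
  from runE[OF 1 this] obtain \<tau>1 m1 s1 where
    1: "exec a (cmp c) m \<tau>1 m1" "rel m1 s1" "bnd s1" "\<tau>1 \<le> unit * k1" "P s1" by blast
  from runE[OF 2[OF 1(3,5)] 1(3,2)] obtain \<tau>2 m2 s2 where
    2: "exec a (cmp d) m1 \<tau>2 m2" "rel m2 s2" "bnd s2" "\<tau>2 \<le> unit * k2" "Q s2" by blast
  show "\<exists>\<tau> m' s'. exec a (cmp (c ;; d)) m \<tau> m' \<and> rel m' s' \<and> bnd s' \<and> \<tau> \<le> unit * (k1 + k2) \<and> Q s'"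
    using exec.Seq[OF 1(1) 2(1)] 1 2
    by (intro exI[of _ "\<tau>1 + \<tau>2"] exI[of _ m2] exI[of _ s2]) (auto simp: algebra_simps)
qed

lemma run_Skip: "Q s \<Longrightarrow> run HSkip s 1 Q"
  by (rule runI) (use \<beta> in \<open>auto intro!: exI exec.Skip simp: unit_def\<close>)

lemma len_short: "v < 2 ^ \<beta> \<Longrightarrow> len v \<le> \<beta>"
  using \<beta> by (intro len_le) auto

lemma len_lim: "v < lim x \<Longrightarrow> len v \<le> \<beta> * (if heavy x then \<eta> else 1)"
  using \<beta> \<eta> by (intro len_le) (auto simp: lim_def)

lemma len_reg: "x < 100 \<Longrightarrow> len (16 * x) \<le> \<beta>"
  using \<beta> le_trans[OF len_le[of "16 * x" 11] \<beta>] by auto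

lemma relD: "rel m s \<Longrightarrow> m (16 * i) = s 0 i"
  unfolding rel_def classes_def by (metis add_0_right insertI1)

lemma relDq: "rel m s \<Longrightarrow> 3 \<le> q \<Longrightarrow> q < 14 \<Longrightarrow> m (16 * i + q) = s q i"
  unfolding rel_def classes_def by auto

lemma rel_upd:
  assumes "rel m s" "q \<in> classes" shows "rel (m(16 * i + q := v)) (upd s q i v)"
  unfolding rel_def
proof (intro ballI allI)
  fix q' i' assume "q' \<in> classes"
  then have "q' < 16" "q < 16" using assms(2) by (auto simp: classes_def)
  from loc_eq_iff[OF this] show "(m(16 * i + q := v)) (16 * i' + q') = upd s q i v q' i'"
    using assms(1) \<open>q' \<in> classes\<close> by (auto simp: rel_def)
qed

lemma rel_scratch:
  assumes "rel m s" "x = 14 \<or> x = 30" shows "rel (m(x := v)) s"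
  unfolding rel_def
proof (intro ballI allI)
  fix q i assume q: "q \<in> classes"
  have "(16 * i + q) mod 16 = q" using q by (auto simp: classes_def)
  moreover have "x mod 16 = 14" using assms(2) by auto
  ultimately have "16 * i + q \<noteq> x" using q by (auto simp: classes_def)
  then show "(m(x := v)) (16 * i + q) = s q i" using assms(1) q by (simp add: rel_def)
qed

lemma bnd_upd0: "bnd s \<Longrightarrow> v < lim x \<Longrightarrow> bnd (upd s 0 x v)"
  by (auto simp: bnd_def)

lemma bnd_updq: "bnd s \<Longrightarrow> v < 2 ^ \<beta> \<Longrightarrow> 3 \<le> q \<Longrightarrow> bnd (upd s q x v)"
  by (auto simp: bnd_def)

lemma bndD: "bnd s \<Longrightarrow> \<not> heavy x \<Longrightarrow> s 0 x < 2 ^ \<beta>"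
  by (metis bnd_def lim_def)

lemma bndD0: "bnd s \<Longrightarrow> s 0 x < lim x"
  by (metis bnd_def)

lemma bndDq: "bnd s \<Longrightarrow> 3 \<le> q \<Longrightarrow> q < 14 \<Longrightarrow> s q x < 2 ^ \<beta>"
  by (auto simp: bnd_def)

section \<open>Costs of single instructions\<close>

definition hcost :: "nat list \<Rightarrow> nat" where
  "hcost xs = (if \<exists>x \<in> set xs. heavy x then \<eta> else 1)"

lemma hcost_ge: "x \<in> set xs \<Longrightarrow> (if heavy x then \<eta> else 1) \<le> hcost xs"
  using \<eta> by (auto simp: hcost_def)

lemma hcost_ge1: "1 \<le> hcost xs"
  using \<eta> by (auto simp: hcost_def)

lemma unit_ge: "1 \<le> h \<Longrightarrow> 3 * \<beta> + 2 * (\<beta> * h) \<le> unit * h"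
  using mult_le_mono2[of 1 h \<beta>] by (simp add: unit_def)

lemma len_hcost:
  assumes "bnd s" "w \<in> set ws" shows "len (s 0 w) \<le> \<beta> * hcost ws"
  by (rule le_trans[OF len_lim[OF bndD0[OF assms(1)]]]) (rule mult_le_mono2, rule hcost_ge[OF assms(2)])

lemma run_Const:
  assumes "x < 100" "v < 2 ^ \<beta>" "Q (upd s 0 x v)"
  shows "run (HConst x v) s 1 Q"
proof (rule runI)
  fix m assume s: "bnd s" "rel m s"
  have "v < lim x" using assms(2) \<eta>
    by (auto simp: lim_def intro: less_le_trans power_increasing)
  then show "\<exists>\<tau> m' s'. exec a (cmp (HConst x v)) m \<tau> m' \<and> rel m' s' \<and> bnd s' \<and> \<tau> \<le> unit * 1 \<and> Q s'"
    using rel_upd[OF s(2), of 0 x v] assms len_reg[of x] len_short[of v] \<beta> bnd_upd0[OF s(1)]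
      exec.Const[of a "16 * x" v m]
    by (intro exI[of _ "len (16 * x) + len v"] exI[of _ "m(16 * x := v)"] exI[of _ "upd s 0 x v"])
       (auto simp: unit_def classes_def)
qed

lemma run_Add:
  assumes "x < 100" "y < 100" "z < 100" "s 0 y + s 0 z < lim x" "Q (upd s 0 x (s 0 y + s 0 z))"
  shows "run (HAdd x y z) s (hcost [x, y, z]) Q"
proof (rule runI)
  fix m assume s: "bnd s" "rel m s"
  let ?\<tau> = "len (16 * x) + len (16 * y) + len (16 * z) + len (m (16 * y)) + len (m (16 * z))"
  have e: "exec a (cmp (HAdd x y z)) m ?\<tau> (m(16 * x := s 0 y + s 0 z))"
    using exec.Add[of a "16 * x" "16 * y" "16 * z" m] s by (simp add: relD)
  from len_hcost[OF s(1), of y "[x, y, z]"] len_hcost[OF s(1), of z "[x, y, z]"] have "?\<tau> \<le> 3 * \<beta> + 2 * (\<beta> * hcost [x, y, z])"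
    using len_reg[of x] len_reg[of y] len_reg[of z] assms s by (simp add: relD)
  also have "\<dots> \<le> unit * hcost [x, y, z]"
    by (rule unit_ge[OF hcost_ge1])
  finally show "\<exists>\<tau> m' s'. exec a (cmp (HAdd x y z)) m \<tau> m' \<and> rel m' s' \<and> bnd s' \<and> \<tau> \<le> unit * hcost [x, y, z] \<and> Q s'"
    using rel_upd[OF s(2), of 0 x] bnd_upd0[OF s(1) assms(4)] assms(5)
    by (intro exec_witness[OF e, of "upd s 0 x (s 0 y + s 0 z)"]) (auto simp: classes_def)
qed

lemma run_Sub:
  assumes "x < 100" "y < 100" "z < 100" "heavy y \<Longrightarrow> heavy x" "Q (upd s 0 x (s 0 y - s 0 z))"
  shows "run (HSub x y z) s (hcost [x, y, z]) Q"
proof (rule runI)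
  fix m assume s: "bnd s" "rel m s"
  let ?\<tau> = "len (16 * x) + len (16 * y) + len (16 * z) + len (m (16 * y)) + len (m (16 * z))"
  have e: "exec a (cmp (HSub x y z)) m ?\<tau> (m(16 * x := s 0 y - s 0 z))"
    using exec.Sub[of a "16 * x" "16 * y" "16 * z" m] s by (simp add: relD)
  from len_hcost[OF s(1), of y "[x, y, z]"] len_hcost[OF s(1), of z "[x, y, z]"] have "?\<tau> \<le> 3 * \<beta> + 2 * (\<beta> * hcost [x, y, z])"
    using len_reg[of x] len_reg[of y] len_reg[of z] assms s by (simp add: relD)
  also have "\<dots> \<le> unit * hcost [x, y, z]"
    by (rule unit_ge[OF hcost_ge1])
  finally have \<tau>: "?\<tau> \<le> unit * hcost [x, y, z]" .
  have "lim y \<le> lim x" using assms(4) \<eta> by (auto simp: lim_def intro: power_increasing)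
  then have "s 0 y - s 0 z < lim x" using bndD0[OF s(1), of y] by linarith
  then show "\<exists>\<tau> m' s'. exec a (cmp (HSub x y z)) m \<tau> m' \<and> rel m' s' \<and> bnd s' \<and> \<tau> \<le> unit * hcost [x, y, z] \<and> Q s'"
    using \<tau> rel_upd[OF s(2), of 0 x] bnd_upd0[OF s(1)] assms(5)
    by (intro exec_witness[OF e, of "upd s 0 x (s 0 y - s 0 z)"]) (auto simp: classes_def)
qed

lemma run_Get:
  assumes "x < 100" "i < 100" "\<not> heavy i" "3 \<le> q" "q < 14" "Q (upd s 0 x (s q (s 0 i)))"
  shows "run (HGet x q i) s 1 Q"
proof (rule runI)
  fix m assume s: "bnd s" "rel m s"
  let ?l = "16 * s 0 i + q"
  have ne: "16 * y \<noteq> 14" "16 * y \<noteq> 30" for y :: nat by presburger+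
  from exec_addr[of q "16 * i" a m] ne assms relD[OF s(2)] obtain \<tau> where
    1: "exec a (addr q (16 * i)) m \<tau> (m(30 := q, 14 := ?l))" "\<tau> \<le> 120 * len (s 0 i) + 2 * len (16 * i)"
    by auto
  let ?m = "m(30 := q, 14 := ?l)"
  have r: "rel ?m s" by (intro rel_scratch s(2)) auto
  have 2: "exec a (Load (16 * x) 14) ?m (len (16 * x) + len 14 + len ?l + len (s q (s 0 i))) (?m(16 * x := s q (s 0 i)))"
    using exec.Load[of a "16 * x" 14 ?m] relDq[OF r assms(4,5)] by simp
  have 14: "len 14 \<le> 4" by (rule len_le) auto
  have "s q (s 0 i) < lim x" using bndDq[OF s(1) assms(4,5), of "s 0 i"] \<eta>
    by (auto simp: lim_def intro: less_le_trans power_increasing)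
  moreover have "\<tau> + (len (16 * x) + len 14 + len ?l + len (s q (s 0 i))) \<le> unit * 1"
    using 1 14 len_reg[of x] len_reg[of i] len_le_16[of q "s 0 i"] assms \<beta>
      len_short[OF bndD[OF s(1), of i]] len_short[OF bndDq[OF s(1) assms(4,5), of "s 0 i"]]
    by (simp add: unit_def)
  ultimately show "\<exists>\<tau> m' s'. exec a (cmp (HGet x q i)) m \<tau> m' \<and> rel m' s' \<and> bnd s' \<and> \<tau> \<le> unit * 1 \<and> Q s'"
    using rel_upd[OF r, of 0 x] bnd_upd0[OF s(1)] assms
    by (intro exec_witness[OF exec.Seq[OF 1(1) 2, folded cmp.simps], of "upd s 0 x (s q (s 0 i))"]) (auto simp: classes_def)
qed

lemma run_Put:
  assumes "x < 100" "i < 100" "\<not> heavy i" "\<not> heavy x" "3 \<le> q" "q < 14" "Q (upd s q (s 0 i) (s 0 x))"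
  shows "run (HPut q i x) s 1 Q"
proof (rule runI)
  fix m assume s: "bnd s" "rel m s"
  let ?l = "16 * s 0 i + q"
  have ne: "16 * y \<noteq> 14" "16 * y \<noteq> 30" for y :: nat by presburger+
  from exec_addr[of q "16 * i" a m] ne assms relD[OF s(2)] obtain \<tau> where
    1: "exec a (addr q (16 * i)) m \<tau> (m(30 := q, 14 := ?l))" "\<tau> \<le> 120 * len (s 0 i) + 2 * len (16 * i)"
    by auto
  let ?m = "m(30 := q, 14 := ?l)"
  have r: "rel ?m s" by (intro rel_scratch s(2)) auto
  have 2: "exec a (Store 14 (16 * x)) ?m (len 14 + len (16 * x) + len ?l + len (s 0 x)) (?m(?l := s 0 x))"
    using exec.Store[of a 14 "16 * x" ?m] relD[OF r] by simp
  have 14: "len 14 \<le> 4" by (rule len_le) auto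
  have "\<tau> + (len 14 + len (16 * x) + len ?l + len (s 0 x)) \<le> unit * 1"
    using 1 14 len_reg[of x] len_reg[of i] len_le_16[of q "s 0 i"] assms \<beta>
      len_short[OF bndD[OF s(1), of i]] len_short[OF bndD[OF s(1), of x]]
    by (simp add: unit_def)
  then show "\<exists>\<tau> m' s'. exec a (cmp (HPut q i x)) m \<tau> m' \<and> rel m' s' \<and> bnd s' \<and> \<tau> \<le> unit * 1 \<and> Q s'"
    using rel_upd[OF r, of q "s 0 i"] bnd_updq[OF s(1) bndD[OF s(1), of x]] assms
    by (intro exec_witness[OF exec.Seq[OF 1(1) 2, folded cmp.simps], of "upd s q (s 0 i) (s 0 x)"]) (auto simp: classes_def)
qed

lemma input_at_le: "input_at a i \<le> 1"
proof (cases "i < length a")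
  case True
  then have "a ! i \<in> {0, 1}" using a01 nth_mem by blast
  then show ?thesis by (auto simp: input_at_def)
qed (simp add: input_at_def)

lemma run_Read:
  assumes "x < 100" "i < 100" "\<not> heavy i" "Q (upd s 0 x (input_at a (s 0 i)))"
  shows "run (HRead x i) s 1 Q"
proof (rule runI)
  fix m assume s: "bnd s" "rel m s"
  let ?v = "input_at a (s 0 i)"
  have "1 < (2::nat) ^ \<beta>" using \<beta> by (intro one_less_power) auto
  then have v: "?v < 2 ^ \<beta>" using input_at_le[of "s 0 i"] by linarith
  then have "?v < lim x" using \<eta> by (auto simp: lim_def intro: less_le_trans power_increasing)
  moreover have "len (16 * x) + len (16 * i) + len (s 0 i) + len ?v \<le> unit * 1"
    using len_reg[of x] len_reg[of i] assms len_short[OF bndD[OF s(1), of i]] len_short[OF v]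
    by (simp add: unit_def)
  ultimately show "\<exists>\<tau> m' s'. exec a (cmp (HRead x i)) m \<tau> m' \<and> rel m' s' \<and> bnd s' \<and> \<tau> \<le> unit * 1 \<and> Q s'"
    using rel_upd[OF s(2), of 0 x] bnd_upd0[OF s(1)] assms
    by (intro exec_witness[OF exec.Read[of a "16 * x" "16 * i" m, folded cmp.simps], of "upd s 0 x ?v"])
       (auto simp: classes_def relD[OF s(2)])
qed

lemma len_test:
  assumes "bnd s" "x < 100" shows "len (16 * x) + len (s 0 x) \<le> unit * hcost [x]"
proof -
  have "len (s 0 x) \<le> \<beta> * hcost [x]" by (rule len_hcost[OF assms(1)]) simp
  then show ?thesis using len_reg[OF assms(2)] unit_ge[OF hcost_ge1, of "[x]"] by linarith
qed

lemma run_If: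
  assumes "x < 100" "s 0 x \<noteq> 0 \<Longrightarrow> run c s k Q" "s 0 x = 0 \<Longrightarrow> run d s k Q"
  shows "run (HIf x c d) s (hcost [x] + k) Q"
proof (rule runI)
  fix m assume s: "bnd s" "rel m s"
  show "\<exists>\<tau> m' s'. exec a (cmp (HIf x c d)) m \<tau> m' \<and> rel m' s' \<and> bnd s' \<and> \<tau> \<le> unit * (hcost [x] + k) \<and> Q s'"
  proof (cases "s 0 x = 0")
    case True
    from runE[OF assms(3)[OF True] s] obtain \<tau> m' s' where
      *: "exec a (cmp d) m \<tau> m'" "rel m' s'" "bnd s'" "\<tau> \<le> unit * k" "Q s'" by blast
    show ?thesis using exec.CondFalse[OF _ *(1), of "16 * x" "cmp c"] * True len_test[OF s(1) assms(1)] relD[OF s(2), of x]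
      by (intro exI[of _ "len (16 * x) + len (m (16 * x)) + \<tau>"] exI[of _ m'] exI[of _ s'])
         (auto simp: distrib_left)
  next
    case False
    from runE[OF assms(2)[OF False] s] obtain \<tau> m' s' where
      *: "exec a (cmp c) m \<tau> m'" "rel m' s'" "bnd s'" "\<tau> \<le> unit * k" "Q s'" by blast
    show ?thesis using exec.CondTrue[OF _ *(1), of "16 * x" "cmp d"] * False len_test[OF s(1) assms(1)] relD[OF s(2), of x]
      by (intro exI[of _ "len (16 * x) + len (m (16 * x)) + \<tau>"] exI[of _ m'] exI[of _ s'])
         (auto simp: distrib_left)
  qed
qed

text \<open>Symbolic execution of loop-free code: \<open>eval\<close> is its effect,
  \<open>safe\<close> its side conditions, \<open>cost\<close> its time. The clauses for loops are
  dummies, as \<open>safe\<close> rejects loops.\<close>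

primrec eval :: "hl \<Rightarrow> state \<Rightarrow> state" where
  "eval HSkip s = s"
| "eval (HConst x v) s = upd s 0 x v"
| "eval (HAdd x y z) s = upd s 0 x (s 0 y + s 0 z)"
| "eval (HSub x y z) s = upd s 0 x (s 0 y - s 0 z)"
| "eval (HGet x q i) s = upd s 0 x (s q (s 0 i))"
| "eval (HPut q i x) s = upd s q (s 0 i) (s 0 x)"
| "eval (HRead x i) s = upd s 0 x (input_at a (s 0 i))"
| "eval (c ;; d) s = eval d (eval c s)"
| "eval (HIf x c d) s = (if s 0 x \<noteq> 0 then eval c s else eval d s)"
| "eval (HWhile x c) s = s"

primrec safe :: "hl \<Rightarrow> state \<Rightarrow> bool" where
  "safe HSkip s = True"
| "safe (HConst x v) s = (x < 100 \<and> v < 2 ^ \<beta>)"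
| "safe (HAdd x y z) s = (x < 100 \<and> y < 100 \<and> z < 100 \<and> s 0 y + s 0 z < lim x)"
| "safe (HSub x y z) s = (x < 100 \<and> y < 100 \<and> z < 100 \<and> (heavy y \<longrightarrow> heavy x))"
| "safe (HGet x q i) s = (x < 100 \<and> i < 100 \<and> \<not> heavy i \<and> 3 \<le> q \<and> q < 14)"
| "safe (HPut q i x) s = (x < 100 \<and> i < 100 \<and> \<not> heavy i \<and> \<not> heavy x \<and> 3 \<le> q \<and> q < 14)"
| "safe (HRead x i) s = (x < 100 \<and> i < 100 \<and> \<not> heavy i)"
| "safe (c ;; d) s = (safe c s \<and> safe d (eval c s))"
| "safe (HIf x c d) s = (x < 100 \<and> (if s 0 x \<noteq> 0 then safe c s else safe d s))"
| "safe (HWhile x c) s = False"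

primrec cost :: "hl \<Rightarrow> nat" where
  "cost HSkip = 1"
| "cost (HConst x v) = 1"
| "cost (HAdd x y z) = hcost [x, y, z]"
| "cost (HSub x y z) = hcost [x, y, z]"
| "cost (HGet x q i) = 1"
| "cost (HPut q i x) = 1"
| "cost (HRead x i) = 1"
| "cost (c ;; d) = cost c + cost d"
| "cost (HIf x c d) = hcost [x] + max (cost c) (cost d)"
| "cost (HWhile x c) = 1"

lemma run_eval: "safe c s \<Longrightarrow> run c s (cost c) (\<lambda>s'. s' = eval c s)"
proof (induction c arbitrary: s)
  case (HSeq c d)
  then show ?case by (auto intro!: run_Seq[of c s "cost c" "\<lambda>s'. s' = eval c s"])
next
  case (HIf x c d)
  then show ?case
    by (auto intro!: run_If run_mono[OF HIf.IH(1)[of s]] run_mono[OF HIf.IH(2)[of s]])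
qed (simp_all add: run_Skip run_Const run_Add run_Sub run_Get run_Put run_Read del: One_nat_def)

lemma run_simple: "safe c s \<Longrightarrow> cost c \<le> k \<Longrightarrow> Q (eval c s) \<Longrightarrow> run c s k Q"
  by (rule run_mono[OF run_eval]) auto

end

section \<open>The family of position lists\<close>

text \<open>Split i - j into (i - l) + (l - j) and absorb i - l into the binomial
  coefficient.\<close>

lemma falling_step:
  "(int i - int j) * int (i choose l) = int (Suc l) * int (i choose Suc l) + (int l - int j) * int (i choose l)"
proof -
  have "int (Suc l) * int (i choose Suc l) = (int i - int l) * int (i choose l)"
  proof (cases "l \<le> i")
    case True
    have "Suc l * (i choose Suc l) = (i - l) * (i choose l)"
      by (metis binomial_absorb_comp binomial_absorption mult.commute diff_diff_left plus_1_eq_Suc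
          add.commute Suc_eq_plus1 choose_reduce_nat diff_is_0_eq neq0_conv)
    then show ?thesis using True by (metis of_nat_diff of_nat_mult)
  next
    case False then show ?thesis by (simp add: binomial_eq_0)
  qed
  then show ?thesis by (simp add: algebra_simps)
qed

text \<open>Each further factor raises the degree by one, by \<open>falling_step\<close>. The
  coefficients stay integral, which powers of i would also give; but only in the binomial basis does
  Pascal's rule let the program tabulate values by additions.\<close>

lemma prod_diff_binomial_span:
  assumes "finite S"
  shows "\<exists>b. \<forall>i::nat. (\<Prod>j\<in>S. int i - int j) = (\<Sum>l<Suc (card S). b l * int (i choose l))"
  using assms
proof (induction S)
  case empty
  then show ?case by (intro exI[of _ "\<lambda>_. 1"]) simp
next
  case (insert x S)
  then obtain b where b: "\<And>i. (\<Prod>j\<in>S. int i - int j) = (\<Sum>l<Suc (card S). b l * int (i choose l))" by blast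
  let ?m = "Suc (card S)"
  \<comment> \<open>The factor i - x moves a coefficient from l - 1 to l with multiplier l, and
    leaves l - x times the old coefficient at l.\<close>
  let ?b = "\<lambda>l. (if l = 0 then 0 else b (l - 1) * int l) + (if l < ?m then b l * (int l - int x) else 0)"
  have "(\<Prod>j\<in>insert x S. int i - int j) = (\<Sum>l<Suc (card (insert x S)). ?b l * int (i choose l))" for i
  proof -
    have "(\<Prod>j\<in>insert x S. int i - int j) = (\<Sum>l<?m. b l * ((int i - int x) * int (i choose l)))"
      using insert b by (simp add: sum_distrib_left algebra_simps)
    also have "\<dots> = (\<Sum>l<?m. b l * int (Suc l) * int (i choose Suc l)) + (\<Sum>l<?m. b l * (int l - int x) * int (i choose l))"
      unfolding falling_step sum.distrib[symmetric] by (intro sum.cong refl) (simp add: algebra_simps)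
    also have "(\<Sum>l<?m. b l * int (Suc l) * int (i choose Suc l)) =
        (\<Sum>l<Suc ?m. (if l = 0 then 0 else b (l - 1) * int l) * int (i choose l))"
      by (subst (2) sum.lessThan_Suc_shift) simp
    also have "(\<Sum>l<?m. b l * (int l - int x) * int (i choose l)) =
        (\<Sum>l<Suc ?m. (if l < ?m then b l * (int l - int x) else 0) * int (i choose l))"
      by simp
    finally show ?thesis using insert by (simp add: sum.distrib algebra_simps del: sum.lessThan_Suc)
  qed
  then show ?case by (intro exI[of _ ?b] allI)
qed

text \<open>Newton interpolation modulo p, in the basis of binomial coefficients.\<close>

lemma interpolation_int:
  fixes g :: "nat \<Rightarrow> int"
  assumes "finite S" "S \<subseteq> {..<s}" "\<And>d. 0 < d \<Longrightarrow> d < s \<Longrightarrow> coprime (int d) p"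
  shows "\<exists>b. \<forall>i\<in>S. p dvd (\<Sum>l<card S. b l * int (i choose l)) - g i"
  using assms(1,2)
proof (induction S)
  case (insert x S)
  then obtain b where b: "\<And>i. i \<in> S \<Longrightarrow> p dvd (\<Sum>l<card S. b l * int (i choose l)) - g i" by auto
  obtain c where c: "\<And>i::nat. (\<Prod>j\<in>S. int i - int j) = (\<Sum>l<Suc (card S). c l * int (i choose l))"
    using prod_diff_binomial_span[OF insert.hyps(1)] by blast
  let ?q = "\<Prod>j\<in>S. int x - int j"
  have "coprime ?q p"
  proof (rule prod_coprime_left)
    fix j assume j: "j \<in> S"
    show "coprime (int x - int j) p"
    proof (cases "j < x")
      case True
      then have "int x - int j = int (x - j)" by simp
      then show ?thesis using assms(3)[of "x - j"] True insert.prems by auto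
    next
      case False
      then have "int x - int j = - int (j - x)" "j \<noteq> x" using j insert.hyps by auto
      moreover have "coprime (int (j - x)) p" using assms(3)[of "j - x"] False insert.prems j calculation(2) by auto
      ultimately show ?thesis by (simp only: coprime_minus_left_iff)
    qed
  qed
  then obtain u w where uw: "u * ?q + w * p = 1"
    using bezout_int[of ?q p] by (auto simp: coprime_iff_gcd_eq_1)
  define f where "f i = (\<Sum>l<card S. b l * int (i choose l))" for i
  \<comment> \<open>As u inverts \<open>?q\<close> modulo p, this Newton coefficient repairs the
    value at x; at the points of S the added product vanishes.\<close>
  define t where "t = u * (g x - f x)"
  let ?b = "\<lambda>l. (if l < card S then b l else 0) + t * c l"
  have eq: "(\<Sum>l<card (insert x S). ?b l * int (i choose l)) = f i + t * (\<Prod>j\<in>S. int i - int j)" for i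
  proof -
    have "(\<Sum>l<Suc (card S). (if l < card S then b l else 0) * int (i choose l)) = f i"
      by (simp add: f_def)
    then show ?thesis using insert.hyps c[of i]
      by (simp add: distrib_right sum.distrib sum_distrib_left mult.assoc del: sum.lessThan_Suc)
  qed
  have "p dvd (\<Sum>l<card (insert x S). ?b l * int (i choose l)) - g i" if i: "i \<in> insert x S" for i
  proof (cases "i = x")
    case True
    have "f x + t * ?q - g x = (f x - g x) * (1 - u * ?q)" by (simp add: t_def algebra_simps)
    also have "1 - u * ?q = w * p" using uw by simp
    finally show ?thesis using True eq by simp
  next
    case False
    then have "i \<in> S" using i by simp
    then have "(\<Prod>j\<in>S. int i - int j) = 0" using insert.hyps by (auto simp: prod_zero_iff)
    then show ?thesis using b[OF \<open>i \<in> S\<close>] eq by (simp add: f_def)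
  qed
  then show ?case by (intro exI[of _ ?b] ballI)
qed simp

text \<open>A codeword of Reed-Solomon type: the polynomial with coefficients ys in the binomial
  basis, evaluated at i. The modulus need not be prime.\<close>

definition rs :: "nat \<Rightarrow> nat list \<Rightarrow> nat \<Rightarrow> nat" where
  "rs p ys i = (\<Sum>l<length ys. ys ! l * (i choose l)) mod p"

text \<open>Coefficients from \<open>card S\<close> on are set to 0, so that smaller groups are
  still found among the c-tuples.\<close>

lemma rs_interpolation:
  assumes "S \<subseteq> {..<s}" "card S \<le> c" "0 < p" "\<And>d. 0 < d \<Longrightarrow> d < s \<Longrightarrow> coprime d p"
    and g: "\<And>i. i \<in> S \<Longrightarrow> g i < p"
  shows "\<exists>ys. length ys = c \<and> (\<forall>y\<in>set ys. y < p) \<and> (\<forall>i\<in>S. rs p ys i = g i)"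
proof -
  have "finite S" using assms(1) finite_subset by blast
  then obtain b where b: "\<And>i. i \<in> S \<Longrightarrow> int p dvd (\<Sum>l<card S. b l * int (i choose l)) - int (g i)"
    using interpolation_int[of S s "int p" "\<lambda>i. int (g i)"] assms(1,4) by (auto simp: coprime_int_iff)
  define b' where "b' l = (if l < card S then b l else 0)" for l
  define ys where "ys = map (\<lambda>l. nat (b' l mod int p)) [0..<c]"
  have "rs p ys i = g i" if i: "i \<in> S" for i
  proof -
    have "int (\<Sum>l<length ys. ys ! l * (i choose l)) mod int p = (\<Sum>l<c. (b' l mod int p) * int (i choose l)) mod int p"
      using assms(3) by (simp add: ys_def)
    also have "\<dots> = (\<Sum>l<c. (b' l mod int p) * int (i choose l) mod int p) mod int p"
      by (simp add: mod_sum_eq)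
    also have "\<dots> = (\<Sum>l<c. b' l * int (i choose l) mod int p) mod int p"
      by (simp add: mod_mult_left_eq)
    also have "\<dots> = (\<Sum>l<c. b' l * int (i choose l)) mod int p"
      by (simp add: mod_sum_eq)
    also have "(\<Sum>l<c. b' l * int (i choose l)) = (\<Sum>l<card S. b l * int (i choose l))"
      using assms(2) by (intro sum.mono_neutral_cong_right) (auto simp: b'_def)
    also have "\<dots> mod int p = int (g i) mod int p"
      using b[OF i] by (simp add: mod_eq_dvd_iff)
    also have "\<dots> = int (g i)" using g[OF i] by simp
    finally show ?thesis unfolding rs_def by (metis of_nat_eq_iff of_nat_mod)
  qed
  moreover have "length ys = c" "\<forall>y\<in>set ys. y < p" using assms(3) by (auto simp: ys_def nat_less_iff)
  ultimately show ?thesis by blast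
qed

text \<open>Selects the next group of target positions, those in the lowest blocks; ties are broken
  arbitrarily, hence the non-strict comparison.\<close>

lemma ex_smallest_subset:
  fixes key :: "'a \<Rightarrow> nat"
  assumes "finite Y" "c \<le> card Y"
  shows "\<exists>Y1 \<subseteq> Y. card Y1 = c \<and> (\<forall>y\<in>Y1. \<forall>z\<in>Y - Y1. key y \<le> key z)"
  using assms(2)
proof (induction c)
  case 0 then show ?case by (intro exI[of _ "{}"]) simp
next
  case (Suc c)
  then obtain Y1 where Y1: "Y1 \<subseteq> Y" "card Y1 = c" "\<forall>y\<in>Y1. \<forall>z\<in>Y - Y1. key y \<le> key z" by auto
  have "finite Y1" using Y1 assms(1) finite_subset by blast
  have "Y - Y1 \<noteq> {}"
  proof
    assume "Y - Y1 = {}"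
    then have "card Y \<le> card Y1" using \<open>finite Y1\<close> by (intro card_mono) auto
    then show False using Suc.prems Y1(2) by simp
  qed
  then obtain x where x: "x \<in> Y - Y1" "\<And>z. z \<in> Y - Y1 \<Longrightarrow> key x \<le> key z"
    using arg_min_if_finite(1)[of "Y - Y1" key] arg_min_least[of "Y - Y1" _ key] assms(1)
    by blast
  show ?case
  proof (intro exI[of _ "insert x Y1"] conjI ballI)
    show "insert x Y1 \<subseteq> Y" using Y1(1) x(1) by blast
    show "card (insert x Y1) = Suc c" using Y1(2) x(1) \<open>finite Y1\<close> by simp
    fix y z assume yz: "y \<in> insert x Y1" "z \<in> Y - insert x Y1"
    then show "key y \<le> key z"
    proof (cases "y = x")
      case True then show ?thesis using x(2)[of z] yz by blast
    next
      case False then show ?thesis using Y1(3) yz by blast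
    qed
  qed
qed

text \<open>The tuples in the order in which nested loops visit them, the first digit varying
  slowest.\<close>

primrec box :: "nat list \<Rightarrow> nat list list" where
  "box [] = [[]]"
| "box (b # bs) = concat (map (\<lambda>y. map ((#) y) (box bs)) [0..<b])"

lemma length_box: "length (box bs) = prod_list bs"
  by (induction bs) (simp_all add: length_concat comp_def sum_list_triv)

lemma in_box: "ys \<in> set (box bs) \<longleftrightarrow> list_all2 (<) ys bs"
proof (induction bs arbitrary: ys)
  case (Cons b bs)
  then show ?case by (cases ys) (auto simp: image_iff)
qed simp

text \<open>With 20 positions per group, the constant overhead 70 of a group becomes at most exp (1
  / 4) per position, since 70 is at most exp 5.\<close>

definition A :: nat where "A = 20"
definition M :: nat where "M = A ^ (A - 1)"
text \<open>Every positive number below A * M divides F, so a number congruent to 1 modulo F is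
  coprime to all differences of interpolation points.\<close>

definition F :: nat where "F = fact (A * M)"

lemma A_bounds: "2 \<le> A" "A \<le> 20"
  by (simp_all add: A_def)

lemma M_pos: "0 < M"
  by (simp add: M_def A_def)

lemma F_pos: "0 < F"
  by (simp add: F_def)

text \<open>Interpolation at points below A * M needs a modulus of at least w that is coprime to all
  their differences.\<close>

definition pmod :: "nat \<Rightarrow> nat" where
  "pmod w = 1 + F * ((w + F - 2) div F)"

lemma pmod_ge: "w \<le> pmod w"
proof -
  have "w - 1 \<le> F * ((w + F - 2) div F)"
  proof (cases "w \<le> 1")
    case False
    have "F * ((w + F - 2) div F) + (w + F - 2) mod F = w + F - 2" by simp
    moreover have "(w + F - 2) mod F < F" using F_pos by simp
    ultimately show ?thesis using False by linarith
  qed simp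
  then show ?thesis unfolding pmod_def by linarith
qed

text \<open>The rounding loses an additive constant only, negligible once t / k is large.\<close>

lemma pmod_le: "1 \<le> w \<Longrightarrow> pmod w \<le> w + F"
proof -
  assume "1 \<le> w"
  have "F * ((w + F - 2) div F) \<le> w + F - 2" by simp
  then show ?thesis using \<open>1 \<le> w\<close> F_pos unfolding pmod_def by linarith
qed

lemma pmod_pos: "1 \<le> pmod w"
  by (simp add: pmod_def)

lemma pmod_coprime: "0 < d \<Longrightarrow> d < A * M \<Longrightarrow> coprime d (pmod w)"
proof -
  assume d: "0 < d" "d < A * M"
  then have "d dvd F" unfolding F_def by (intro dvd_fact) auto
  then have *: "d dvd F * ((w + F - 2) div F)" by simp
  show ?thesis
  proof (rule coprimeI)
    fix c assume "c dvd d" "c dvd pmod w"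
    with * show "is_unit c" unfolding pmod_def
      by (metis dvd_add_left_iff dvd_trans)
  qed
qed

section \<open>Cells, blocks and the tree of records\<close>

locale family =
  fixes n K v :: nat
  assumes K: "1 \<le> K" and v: "1 \<le> v"
begin

text \<open>The factors let a span of l blocks be cut in two ways: into A * M intervals of width l *
  M * v, and into M intervals of width l * A * M * v.\<close>

definition L :: nat where "L = A * M * M * v"
definition C :: nat where "C = K * L"

lemma L_pos: "0 < L"
  using v M_pos A_bounds by (simp add: L_def)

lemma C_pos: "0 < C"
  using L_pos K by (simp add: C_def)

text \<open>The cell z consists of the positions below n that are congruent to z modulo C
  (if z is less than C).\<close>

definition cellpos :: "nat \<Rightarrow> nat list" where
  "cellpos z = map (\<lambda>i. z + i * C) [0..<(n - z + C - 1) div C]"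

lemma cell_index: "i < (n - z + C - 1) div C \<longleftrightarrow> z + i * C < n"
proof -
  have "i < (n - z + C - 1) div C \<longleftrightarrow> Suc i * C \<le> n - z + C - 1"
    using C_pos by (metis Suc_le_eq less_eq_div_iff_mult_less_eq)
  also have "\<dots> \<longleftrightarrow> z + i * C < n" using C_pos by auto
  finally show ?thesis .
qed

lemma set_cellpos: "set (cellpos z) = {x. x < n \<and> (\<exists>i. x = z + i * C)}"
proof -
  have "set (cellpos z) = {z + i * C |i. i < (n - z + C - 1) div C}" by (auto simp: cellpos_def)
  then show ?thesis unfolding cell_index by auto
qed

definition bc :: nat where "bc = n div C + 1"

lemma length_cellpos: "length (cellpos z) \<le> bc"
proof -
  have "(n - z + C - 1) div C \<le> (n + C) div C" by (intro div_le_mono) auto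
  then show ?thesis using C_pos by (simp add: cellpos_def bc_def)
qed

lemma pos_in_cell: "x < n \<Longrightarrow> x \<in> set (cellpos (x mod C))"
  unfolding set_cellpos by (simp, metis add.commute mult.commute mult_div_mod_eq)

type_synonym rec = "nat \<times> nat \<times> nat list"

text \<open>The guess y is the residue modulo \<open>step\<close> of one offset from
  \<open>base\<close>. The M cells with this residue contain the position whenever its offset is
  below M * \<open>step\<close>.\<close>

definition sgl :: "nat \<Rightarrow> nat \<Rightarrow> nat \<Rightarrow> nat list" where
  "sgl base step y = concat (map (\<lambda>i. cellpos (base + i * step + y)) [0..<M])"

text \<open>A polynomial value may exceed the width of its interval, so cells, and hence positions,
  may repeat in a list.\<close>

definition blk1 :: "nat \<Rightarrow> nat \<Rightarrow> nat list \<Rightarrow> nat list" where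
  "blk1 \<sigma> l ys = concat (map (\<lambda>i. cellpos (\<sigma> * L + i * (l * M * v) + rs (pmod (l * M * v)) ys i)) [0..<A * M])"

text \<open>The digits: A - 2 residues of single positions in the whole span, the interval shared by
  two positions, and their two residues inside it. An interval has width M * (l * v), so M cells
  again suffice for each of the two.\<close>

definition blk2 :: "nat \<Rightarrow> nat \<Rightarrow> nat list \<Rightarrow> nat list" where
  "blk2 \<sigma> l ys = concat (map (\<lambda>j. sgl (\<sigma> * L) (l * A * M * v) (ys ! j)) [0..<A - 2]) @
     sgl (\<sigma> * L + ys ! (A - 2) * (l * M * v)) (l * v) (ys ! (A - 1)) @
     sgl (\<sigma> * L + ys ! (A - 2) * (l * M * v)) (l * v) (ys ! A)"

text \<open>For the last positions, fewer than A, taken one at a time. Their number is bounded by a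
  constant, so this waste does not matter.\<close>

definition blk3 :: "nat \<Rightarrow> nat \<Rightarrow> nat list \<Rightarrow> nat list" where
  "blk3 \<sigma> l ys = sgl (\<sigma> * L) (l * A * M * v) (ys ! 0)"

definition box1 :: "nat \<Rightarrow> nat list" where
  "box1 l = replicate A (pmod (l * M * v))"

definition box2 :: "nat \<Rightarrow> nat list" where
  "box2 l = replicate (A - 2) (l * A * M * v) @ [A * M, l * v, l * v]"

definition box3 :: "nat \<Rightarrow> nat list" where
  "box3 l = [l * A * M * v]"

text \<open>In a record (r, \<open>\<sigma>\<close>, ps) the list ps contains the positions chosen so far, and at most r
  positions of the target remain, all in cells from \<open>\<sigma>\<close> * L on. The parameter l is the number of
  blocks of L cells that the next A of them span.\<close>

fun kids :: "rec \<Rightarrow> nat \<Rightarrow> rec list" where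
  "kids (r, \<sigma>, ps) l =
     (if A \<le> r then
        map (\<lambda>ys. (r - A, \<sigma> + l - 1, ps @ blk1 \<sigma> l ys)) (box (box1 l)) @
        map (\<lambda>ys. (r - A, \<sigma> + l - 1, ps @ blk2 \<sigma> l ys)) (box (box2 l))
      else map (\<lambda>ys. (r - 1, \<sigma> + l - 1, ps @ blk3 \<sigma> l ys)) (box (box3 l)))"

fun kidsall :: "rec \<Rightarrow> rec list" where
  "kidsall (r, \<sigma>, ps) = (if r = 0 then [] else concat (map (kids (r, \<sigma>, ps)) [1..<Suc (K - \<sigma>)]))"

lemma length_sgl: "length (sgl b s y) \<le> M * bc"
proof -
  have "length (sgl b s y) \<le> (\<Sum>i\<leftarrow>[0..<M]. bc)"
    unfolding sgl_def length_concat map_map by (intro sum_list_mono) (auto simp: length_cellpos)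
  then show ?thesis by (simp add: sum_list_triv)
qed

lemma length_blk1: "length (blk1 \<sigma> l ys) \<le> A * M * bc"
proof -
  have "length (blk1 \<sigma> l ys) \<le> (\<Sum>i\<leftarrow>[0..<A * M]. bc)"
    unfolding blk1_def length_concat map_map by (intro sum_list_mono) (auto simp: length_cellpos)
  then show ?thesis by (simp add: sum_list_triv)
qed

lemma length_blk2: "length (blk2 \<sigma> l ys) \<le> A * M * bc"
proof -
  have "length (concat (map (\<lambda>j. sgl (\<sigma> * L) (l * A * M * v) (ys ! j)) [0..<A - 2])) \<le> (\<Sum>i\<leftarrow>[0..<A - 2]. M * bc)"
    unfolding length_concat map_map by (intro sum_list_mono) (auto simp: length_sgl)
  then have "length (blk2 \<sigma> l ys) \<le> (A - 2) * (M * bc) + M * bc + M * bc"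
    unfolding blk2_def
    using length_sgl[of "\<sigma> * L + ys ! (A - 2) * (l * M * v)" "l * v" "ys ! (A - 1)"]
      length_sgl[of "\<sigma> * L + ys ! (A - 2) * (l * M * v)" "l * v" "ys ! A"]
    by (simp add: sum_list_triv)
  also have "\<dots> = (A - 2 + 2) * (M * bc)" by (simp add: algebra_simps)
  also have "A - 2 + 2 = A" using A_bounds by simp
  finally show ?thesis by (simp add: mult.assoc)
qed

lemma length_blk3: "length (blk3 \<sigma> l ys) \<le> M * bc"
  by (simp add: blk3_def length_sgl)

text \<open>Every target position already accounted for has paid for M * bc list entries, whichever
  kind of block was used. This gives the final length K * M * bc.\<close>

fun good :: "rec \<Rightarrow> bool" where
  "good (r, \<sigma>, ps) \<longleftrightarrow> r \<le> K \<and> \<sigma> < K \<and> length ps \<le> (K - r) * (M * bc)"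

lemma good_kids:
  assumes "good (r, \<sigma>, ps)" "r \<noteq> 0" "1 \<le> l" "\<sigma> + l \<le> K" "c \<in> set (kids (r, \<sigma>, ps) l)"
  shows "good c"
proof (cases "A \<le> r")
  case True
  have "(K - (r - A)) * (M * bc) = (K - r) * (M * bc) + A * M * bc"
  proof -
    have "K - (r - A) = (K - r) + A" using True assms(1) by simp
    then show ?thesis by (simp add: add_mult_distrib mult.assoc)
  qed
  then show ?thesis using assms True length_blk1[of \<sigma> l] length_blk2[of \<sigma> l]
    by (auto intro!: add_mono)
next
  case False
  have "(K - (r - 1)) * (M * bc) = (K - r) * (M * bc) + M * bc"
  proof -
    have "K - (r - 1) = (K - r) + 1" using assms(1,2) by auto
    then show ?thesis by (simp add: add_mult_distrib)
  qed
  then show ?thesis using assms False length_blk3[of \<sigma> l]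
    by (auto intro!: add_mono)
qed

lemma in_cellpos: "x < n \<Longrightarrow> x mod C = z \<Longrightarrow> x \<in> set (cellpos z)"
  using pos_in_cell by blast

lemma sgl_cover:
  assumes "y < n" "base \<le> y mod C" "y mod C < base + M * step"
  shows "y \<in> set (sgl base step ((y mod C - base) mod step))" "(y mod C - base) mod step < step"
proof -
  let ?o = "y mod C - base"
  have o: "?o < M * step" using assms by linarith
  then have step: "0 < step" by (metis mult_0_right not_less0 neq0_conv)
  have i: "?o div step < M" using o by (simp add: less_mult_imp_div_less)
  have "base + ?o div step * step + ?o mod step = y mod C" using assms(2) by simp
  then have "y \<in> set (cellpos (base + ?o div step * step + ?o mod step))"
    using assms(1) by (intro in_cellpos) auto
  moreover have "?o div step \<in> set [0..<M]" using i by simp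
  ultimately show "y \<in> set (sgl base step (?o mod step))" unfolding sgl_def set_concat set_map by blast
  show "?o mod step < step" using step by simp
qed

lemma blk_cover:
  assumes Y: "Y \<subseteq> {..<n}" "card Y \<le> A" and l: "1 \<le> l"
    and reg: "\<And>y. y \<in> Y \<Longrightarrow> \<sigma> * L \<le> y mod C" "\<And>y. y \<in> Y \<Longrightarrow> y mod C < (\<sigma> + l) * L"
  shows "(\<exists>ys \<in> set (box (box1 l)). Y \<subseteq> set (blk1 \<sigma> l ys)) \<or> (\<exists>ys \<in> set (box (box2 l)). Y \<subseteq> set (blk2 \<sigma> l ys))"
proof -
  define w where "w = l * M * v"
  define o' where "o' y = y mod C - \<sigma> * L" for y
  define col where "col y = o' y div w" for y
  have w: "0 < w" using l v M_pos by (simp add: w_def)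
  have finY: "finite Y" using Y(1) finite_subset by blast
  have lL: "l * L = A * M * w" by (simp add: w_def L_def algebra_simps)
  have o: "o' y < A * M * w" "\<sigma> * L + o' y = y mod C" if "y \<in> Y" for y
    using reg[OF that] lL by (auto simp: o'_def add_mult_distrib)
  have col: "col y < A * M" if "y \<in> Y" for y
    using o[OF that] by (simp add: col_def less_mult_imp_div_less)
  show ?thesis
  proof (cases "inj_on col Y")
    case True
    \<comment> \<open>By injectivity \<open>inv_into\<close> returns the only position in column i.
      Interpolating the offsets inside the columns then catches all of Y.\<close>
    define g where "g i = o' (inv_into Y col i) mod w" for i
    have "\<exists>ys. length ys = A \<and> (\<forall>y\<in>set ys. y < pmod w) \<and> (\<forall>i\<in>col ` Y. rs (pmod w) ys i = g i)"
    proof (rule rs_interpolation[where s = "A * M"])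
      show "card (col ` Y) \<le> A" using card_image_le[OF finY, of col] Y(2) by linarith
      show "g i < pmod w" for i using w pmod_ge[of w] unfolding g_def
        by (meson less_le_trans mod_less_divisor)
    qed (use col pmod_pos[of w] pmod_coprime in auto)
    then obtain ys where ys: "length ys = A" "\<forall>y\<in>set ys. y < pmod w" "\<forall>i\<in>col ` Y. rs (pmod w) ys i = g i" by blast
    have "ys \<in> set (box (box1 l))" using ys(1,2)
      by (auto simp: in_box box1_def w_def list_all2_conv_all_nth)
    moreover have "Y \<subseteq> set (blk1 \<sigma> l ys)"
    proof
      fix y assume y: "y \<in> Y"
      have "rs (pmod w) ys (col y) = o' y mod w" using ys(3) y True by (simp add: g_def)
      then have "\<sigma> * L + col y * w + rs (pmod w) ys (col y) = y mod C"
        using o(2)[OF y] by (simp add: col_def)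
      then have "y \<in> set (cellpos (\<sigma> * L + col y * w + rs (pmod w) ys (col y)))"
        using y Y(1) by (intro in_cellpos) auto
      then show "y \<in> set (blk1 \<sigma> l ys)" using col[OF y] unfolding blk1_def w_def by auto
    qed
    ultimately show ?thesis by blast
  next
    case False
    then obtain y1 y2 where y12: "y1 \<in> Y" "y2 \<in> Y" "y1 \<noteq> y2" "col y1 = col y2" by (auto simp: inj_on_def)
    have "card (Y - {y1, y2}) = card Y - 2" using y12 finY by (simp add: card_Diff_subset)
    then obtain zs where zs: "set zs = Y - {y1, y2}" "length zs \<le> A - 2"
      using finite_distinct_list[of "Y - {y1, y2}"] finY Y(2) by (metis diff_le_mono distinct_card finite_Diff)
    define w1 where "w1 = l * A * M * v"
    define base where "base = \<sigma> * L + col y1 * w"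
    define e where "e y = (y mod C - base) mod (l * v)" for y
    \<comment> \<open>The digits of absent positions are set to 0; Y may have fewer than A
      elements.\<close>
    define us where "us = map (\<lambda>j. if j < length zs then (zs ! j mod C - \<sigma> * L) mod w1 else 0) [0..<A - 2]"
    define ys where "ys = us @ [col y1, e y1, e y2]"
    have w1: "0 < w1" "A * M * w = M * w1" using l v M_pos A_bounds by (auto simp: w1_def w_def)
    have lenus: "length us = A - 2" by (simp add: us_def)
    have us: "\<forall>u \<in> set us. u < w1" using w1 by (auto simp: us_def)
    have lv: "0 < l * v" using l v by simp
    have "list_all2 (<) us (replicate (A - 2) w1)" using us lenus by (auto simp: list_all2_conv_all_nth)
    then have "ys \<in> set (box (box2 l))" using col[OF y12(1)] lv
      unfolding in_box box2_def ys_def w1_def[symmetric] by (auto simp: e_def intro!: list_all2_appendI)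
    moreover have "Y \<subseteq> set (blk2 \<sigma> l ys)"
    proof
      fix y assume y: "y \<in> Y"
      have nths: "ys ! (A - 2) = col y1" "ys ! (A - 1) = e y1" "ys ! A = e y2"
        using A_bounds lenus by (auto simp: ys_def nth_append numeral_2_eq_2 Suc_diff_Suc)
      show "y \<in> set (blk2 \<sigma> l ys)"
      proof (cases "y \<in> {y1, y2}")
        case True
        have "col y = col y1" using True y12 by auto
        have "o' y = col y * w + o' y mod w" by (simp add: col_def)
        then have "o' y = col y1 * w + o' y mod w" unfolding \<open>col y = col y1\<close> .
        moreover have "o' y mod w < w" using w by simp
        moreover have "w = M * (l * v)" by (simp add: w_def)
        ultimately have "base \<le> y mod C" "y mod C < base + M * (l * v)"
          using o(2)[OF y] unfolding base_def by linarith+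
        from sgl_cover(1)[OF _ this] have "y \<in> set (sgl base (l * v) (e y))" using y Y(1) by (auto simp: e_def)
        then show ?thesis using True unfolding blk2_def nths base_def w_def by auto
      next
        case False
        then have "y \<in> set zs" using y zs(1) by blast
        then obtain j where j: "j < length zs" "zs ! j = y" by (meson in_set_conv_nth)
        have "y \<in> set (sgl (\<sigma> * L) w1 ((y mod C - \<sigma> * L) mod w1))"
          using sgl_cover(1)[of y "\<sigma> * L" w1] o[OF y] w1(2) y Y(1) by auto
        moreover have "ys ! j = (y mod C - \<sigma> * L) mod w1" using j zs(2) by (simp add: ys_def us_def nth_append)
        ultimately have "y \<in> set (sgl (\<sigma> * L) (l * A * M * v) (ys ! j))" by (simp add: w1_def)
        moreover have "j \<in> set [0..<A - 2]" using j zs(2) by simp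
        ultimately show ?thesis unfolding blk2_def set_append set_concat set_map by blast
      qed
    qed
    ultimately show ?thesis by blast
  qed
qed

lemma key_bound: "(y mod C) div L < K"
proof -
  have "y mod C < K * L" using C_pos by (simp add: C_def)
  then show ?thesis by (simp add: less_mult_imp_div_less)
qed

text \<open>R may be any set closed under children, so nothing about the order of the queue enters.
  Taking the positions of the lowest blocks first keeps all remaining ones at or above the last
  block reached.\<close>

lemma cover:
  assumes closed: "\<And>\<rho> c. \<rho> \<in> R \<Longrightarrow> c \<in> set (kidsall \<rho>) \<Longrightarrow> c \<in> R"
  shows "(r, \<sigma>, ps) \<in> R \<Longrightarrow> \<sigma> < K \<Longrightarrow> Y \<subseteq> {..<n} \<Longrightarrow> card Y \<le> r \<Longrightarrow> (\<And>y. y \<in> Y \<Longrightarrow> \<sigma> \<le> (y mod C) div L) \<Longrightarrow>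
    \<exists>r' \<sigma>' ps'. (r', \<sigma>', ps') \<in> R \<and> set ps \<union> Y \<subseteq> set ps'"
proof (induction r arbitrary: \<sigma> ps Y rule: less_induct)
  case (less r)
  show ?case
  proof (cases "Y = {}")
    case True
    then show ?thesis using less.prems(1) by blast
  next
    case False
    have finY: "finite Y" using less.prems(3) finite_subset by blast
    define key where "key y = (y mod C) div L" for y
    define c where "c = (if A \<le> r then A else 1)"
    have r: "r \<noteq> 0" using False finY less.prems(4) by auto
    have c: "1 \<le> c" "c \<le> r" using r A_bounds by (auto simp: c_def)
    obtain Y1 where Y1: "Y1 \<subseteq> Y" "card Y1 = min c (card Y)" "\<forall>y\<in>Y1. \<forall>z\<in>Y - Y1. key y \<le> key z"
      using ex_smallest_subset[OF finY, of "min c (card Y)" key] by auto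
    have finY1: "finite Y1" using Y1(1) finY finite_subset by blast
    have "card Y \<noteq> 0" using False finY by simp
    then have ne: "Y1 \<noteq> {}" using Y1(2) c(1) by (metis card.empty min_def not_one_le_zero)
    define \<sigma>' where "\<sigma>' = Max (key ` Y1)"
    have "\<sigma>' \<in> key ` Y1" unfolding \<sigma>'_def using finY1 ne by (intro Max_in) auto
    then obtain y0 where y0: "y0 \<in> Y1" "key y0 = \<sigma>'" by auto
    have max: "key y \<le> \<sigma>'" if "y \<in> Y1" for y unfolding \<sigma>'_def using finY1 that by (intro Max_ge) auto
    have \<sigma>': "\<sigma> \<le> \<sigma>'" "\<sigma>' < K" using y0 Y1(1) less.prems(5)[of y0] key_bound[of y0] by (auto simp: key_def)
    \<comment> \<open>The last block \<sigma>' may contain positions of the next group as well, so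
      it belongs to both spans; the child therefore continues at \<sigma> + l - 1.\<close>
    define l where "l = \<sigma>' - \<sigma> + 1"
    have l: "1 \<le> l" "\<sigma> + l = Suc \<sigma>'" "\<sigma> + l - 1 = \<sigma>'" using \<sigma>' by (auto simp: l_def)
    have lo: "\<sigma> * L \<le> y mod C" if "y \<in> Y1" for y
      using less.prems(5)[of y] that Y1(1) L_pos by (metis in_mono less_eq_div_iff_mult_less_eq)
    have hi: "y mod C < (\<sigma> + l) * L" if "y \<in> Y1" for y
      using max[OF that] L_pos l(2) unfolding key_def by (metis le_imp_less_Suc div_less_iff_less_mult)
    have "\<exists>ps1. (r - c, \<sigma>', ps @ ps1) \<in> set (kids (r, \<sigma>, ps) l) \<and> Y1 \<subseteq> set ps1"
    proof (cases "A \<le> r")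
      case True
      have "(\<exists>ys \<in> set (box (box1 l)). Y1 \<subseteq> set (blk1 \<sigma> l ys)) \<or> (\<exists>ys \<in> set (box (box2 l)). Y1 \<subseteq> set (blk2 \<sigma> l ys))"
        using Y1 less.prems(3) True by (intro blk_cover l lo hi) (auto simp: c_def)
      then show ?thesis using True l(3) by (auto simp: c_def)
    next
      case False
      then have "card Y1 = 1" using Y1(2) ne finY1 by (metis One_nat_def Suc_leI c_def card_gt_0_iff min.cobounded1 le_antisym)
      then obtain y where y: "Y1 = {y}" by (auto simp: card_1_singleton_iff)
      have "y mod C < \<sigma> * L + M * (l * A * M * v)" using hi[of y] y by (simp add: L_def algebra_simps)
      from sgl_cover[OF _ lo[of y] this] have *: "y \<in> set (sgl (\<sigma> * L) (l * A * M * v) ((y mod C - \<sigma> * L) mod (l * A * M * v)))"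
        "(y mod C - \<sigma> * L) mod (l * A * M * v) < l * A * M * v" using y Y1(1) less.prems(3) by auto
      then have "[(y mod C - \<sigma> * L) mod (l * A * M * v)] \<in> set (box (box3 l))"
        by (simp add: in_box box3_def)
      from imageI[OF this, of "\<lambda>ys. (r - 1, \<sigma> + l - 1, ps @ blk3 \<sigma> l ys)"]
      have "(r - c, \<sigma>', ps @ blk3 \<sigma> l [(y mod C - \<sigma> * L) mod (l * A * M * v)]) \<in> set (kids (r, \<sigma>, ps) l)"
        using False l(3) by (simp add: c_def)
      moreover have "Y1 \<subseteq> set (blk3 \<sigma> l [(y mod C - \<sigma> * L) mod (l * A * M * v)])"
        using * y by (simp add: blk3_def)
      ultimately show ?thesis by blast
    qed
    then obtain ps1 where ps1: "(r - c, \<sigma>', ps @ ps1) \<in> set (kids (r, \<sigma>, ps) l)" "Y1 \<subseteq> set ps1" by blast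
    then have "(r - c, \<sigma>', ps @ ps1) \<in> set (kidsall (r, \<sigma>, ps))"
    proof -
      have "l \<in> set [1..<Suc (K - \<sigma>)]" using l \<sigma>' by auto
      then show ?thesis using ps1(1) r unfolding kidsall.simps set_concat set_map by (simp del: kids.simps set_upt) blast
    qed
    then have R: "(r - c, \<sigma>', ps @ ps1) \<in> R" using closed less.prems(1) by blast
    have "card (Y - Y1) = card Y - card Y1" using Y1(1) finY1 by (simp add: card_Diff_subset)
    then have "card (Y - Y1) \<le> r - c" using Y1(2) less.prems(4) by (auto simp: min_def)
    moreover have "\<sigma>' \<le> (y mod C) div L" if "y \<in> Y - Y1" for y
      using Y1(3) y0 that by (auto simp: key_def)
    moreover have "Y - Y1 \<subseteq> {..<n}" using less.prems(3) by blast
    ultimately obtain r' \<sigma>'' ps' where "(r', \<sigma>'', ps') \<in> R" "set (ps @ ps1) \<union> (Y - Y1) \<subseteq> set ps'"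
      using less.IH[of "r - c" \<sigma>' "ps @ ps1" "Y - Y1"] R r c \<sigma>' less.prems(3) by auto
    then show ?thesis using ps1(2) by (intro exI[of _ r'] exI[of _ \<sigma>''] exI[of _ ps']) auto
  qed
qed

end

section \<open>Loops\<close>

text \<open>The test b - i lives in register 1 and is recomputed after each pass, so all nested
  loops can share this register.\<close>

definition FOR :: "nat \<Rightarrow> nat \<Rightarrow> hl \<Rightarrow> hl" where
  "FOR i b c = HConst i 0 ;; HSub 1 b i ;; HWhile 1 (c ;; HConst 1 1 ;; HAdd i i 1 ;; HSub 1 b i)"

definition COPY :: "nat \<Rightarrow> nat \<Rightarrow> hl" where
  "COPY x y = HConst x 0 ;; HAdd x x y"

primrec nest :: "(nat \<times> nat) list \<Rightarrow> hl \<Rightarrow> hl" where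
  "nest [] c = c"
| "nest (d # ds) c = FOR (fst d) (snd d) (nest ds c)"

primrec nest_cost :: "nat list \<Rightarrow> nat \<Rightarrow> nat" where
  "nest_cost [] k = k"
| "nest_cost (b # bs) k = b * (nest_cost bs k + 4) + 3"

lemma nest_cost_le:
  assumes "\<forall>b \<in> set bs. 1 \<le> b" shows "nest_cost bs k \<le> prod_list bs * (k + 7 * length bs)"
  using assms
proof (induction bs)
  case (Cons b bs)
  have 1: "1 \<le> prod_list bs" using Cons.prems by (induction bs) auto
  have b: "1 \<le> b * prod_list bs" using Cons.prems 1 by simp
  have "nest_cost (b # bs) k \<le> b * (prod_list bs * (k + 7 * length bs) + 4) + 3"
    using Cons by simp
  also have "\<dots> = b * prod_list bs * (k + 7 * length bs) + 4 * b + 3" by (simp add: algebra_simps)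
  also have "\<dots> \<le> b * prod_list bs * (k + 7 * length bs) + 4 * (b * prod_list bs) + 3 * (b * prod_list bs)"
    using b 1 by (intro add_mono mult_le_mono2) auto
  also have "\<dots> = prod_list (b # bs) * (k + 7 * length (b # bs))" by (simp add: algebra_simps)
  finally show ?case .
qed simp

definition frame :: "nat set \<Rightarrow> nat set \<Rightarrow> state \<Rightarrow> state \<Rightarrow> bool" where
  "frame X Y s s' \<longleftrightarrow> (\<forall>x. x \<notin> X \<longrightarrow> s' 0 x = s 0 x) \<and> (\<forall>q. q \<noteq> 0 \<longrightarrow> q \<notin> Y \<longrightarrow> s' q = s q)"

lemma frame_refl [simp]: "frame X Y s s"
  by (simp add: frame_def)

lemma frame_trans: "frame X Y s s' \<Longrightarrow> frame X Y s' s'' \<Longrightarrow> frame X Y s s''"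
  by (simp add: frame_def)

lemma frame_mono: "frame X Y s s' \<Longrightarrow> X \<subseteq> X' \<Longrightarrow> Y \<subseteq> Y' \<Longrightarrow> frame X' Y' s s'"
  by (auto simp: frame_def)

lemma frame_upd0 [simp]: "x \<in> X \<Longrightarrow> frame X Y s (upd s' 0 x v) \<longleftrightarrow> frame X Y s s'"
  by (auto simp: frame_def)

lemma frame_updq [simp]: "q \<in> Y \<Longrightarrow> q \<noteq> 0 \<Longrightarrow> frame X Y s (upd s' q x v) \<longleftrightarrow> frame X Y s s'"
  unfolding frame_def by (metis upd_apply upd_other)

lemma frameD0: "frame X Y s s' \<Longrightarrow> x \<notin> X \<Longrightarrow> s' 0 x = s 0 x"
  by (simp add: frame_def)

lemma frameDq: "frame X Y s s' \<Longrightarrow> q \<noteq> 0 \<Longrightarrow> q \<notin> Y \<Longrightarrow> s' q = s q"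
  by (simp add: frame_def)

context machine
begin

lemma hcost_light [simp]: "(\<forall>x \<in> set xs. \<not> heavy x) \<Longrightarrow> hcost xs = 1"
  by (auto simp: hcost_def)

lemma lim_light [simp]: "\<not> heavy x \<Longrightarrow> lim x = 2 ^ \<beta>"
  by (simp add: lim_def)

lemma run_step:
  "safe c s \<Longrightarrow> cost c \<le> k1 \<Longrightarrow> run d (eval c s) k2 Q \<Longrightarrow> run (c ;; d) s (k1 + k2) Q"
  by (rule run_Seq[OF run_simple[where Q = "\<lambda>s'. s' = eval c s"]]) auto

text \<open>The first argument t of I is a time budget.\<close>

lemma run_While_budget:
  assumes x: "x < 100" "\<not> heavy x"
    and body: "\<And>t s. bnd s \<Longrightarrow> I t s \<Longrightarrow> s 0 x \<noteq> 0 \<Longrightarrow> \<exists>k t'. k + 1 + t' \<le> t \<and> run c s k (I t')"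
    and fin: "\<And>t s. bnd s \<Longrightarrow> I t s \<Longrightarrow> s 0 x = 0 \<Longrightarrow> Q s"
  shows "I t s \<Longrightarrow> run (HWhile x c) s (t + 1) Q"
proof (induction t arbitrary: s rule: less_induct)
  case (less t)
  show ?case
  proof (rule runI)
    fix m assume s: "bnd s" "rel m s"
    show "\<exists>\<tau> m' s'. exec a (cmp (HWhile x c)) m \<tau> m' \<and> rel m' s' \<and> bnd s' \<and> \<tau> \<le> unit * (t + 1) \<and> Q s'"
    proof (cases "s 0 x = 0")
      case True
      then show ?thesis
        using exec.WhileFalse[of m "16 * x" a "cmp c"] s len_test[OF s(1) x(1)] x fin[OF s(1) less.prems]
        by (intro exI[of _ "len (16 * x) + len (m (16 * x))"] exI[of _ m] exI[of _ s])
           (auto simp: relD[OF s(2)])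
    next
      case False
      from body[OF s(1) less.prems False] obtain k t' where
        k: "k + 1 + t' \<le> t" and r: "run c s k (I t')" by blast
      from runE[OF r s] obtain \<tau>1 m1 s1 where
        1: "exec a (cmp c) m \<tau>1 m1" "rel m1 s1" "bnd s1" "\<tau>1 \<le> unit * k" "I t' s1" by blast
      have "run (HWhile x c) s1 (t' + 1) Q" using less.IH[OF _ 1(5)] k by simp
      from runE[OF this 1(3,2)] obtain \<tau>2 m2 s2 where
        2: "exec a (cmp (HWhile x c)) m1 \<tau>2 m2" "rel m2 s2" "bnd s2" "\<tau>2 \<le> unit * (t' + 1)" "Q s2" by blast
      have "len (16 * x) + len (s 0 x) + \<tau>1 + \<tau>2 \<le> unit + unit * k + unit * (t' + 1)"
        using len_test[OF s(1) x(1)] x 1(4) 2(4) by auto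
      also have "\<dots> = unit * (k + 1 + t' + 1)" by (simp add: algebra_simps)
      also have "\<dots> \<le> unit * (t + 1)" using k by (intro mult_le_mono2) simp
      finally show ?thesis
        using exec.WhileTrue[OF _ 1(1) 2(1)[unfolded cmp.simps]] False 2 relD[OF s(2), of x]
        by (intro exI[of _ "len (16 * x) + len (m (16 * x)) + \<tau>1 + \<tau>2"] exI[of _ m2] exI[of _ s2]) auto
    qed
  qed
qed

text \<open>The invariant must hold for every content t of register 1, where the loop keeps its
  test. Of the 4 units per pass, three pay for increment and test value, one for the branch.\<close>

lemma run_FOR:
  fixes I :: "nat \<Rightarrow> state \<Rightarrow> bool" and k :: "nat \<Rightarrow> nat"
  assumes regs: "i < 100" "b < 100" "\<not> heavy i" "\<not> heavy b" "i \<noteq> 1" "b \<noteq> 1" "i \<noteq> b"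
    and n: "s 0 b = n"
    and init: "\<And>t. I 0 (upd (upd s 0 i 0) 0 1 t)"
    and body: "\<And>j s'. j < n \<Longrightarrow> bnd s' \<Longrightarrow> I j s' \<Longrightarrow> s' 0 i = j \<Longrightarrow> s' 0 b = n \<Longrightarrow>
        run c s' (k j) (\<lambda>s''. s'' 0 i = j \<and> s'' 0 b = n \<and> (\<forall>t. I (Suc j) (upd (upd s'' 0 i (Suc j)) 0 1 t)))"
    and fin: "\<And>s'. bnd s' \<Longrightarrow> I n s' \<Longrightarrow> s' 0 i = n \<Longrightarrow> s' 0 b = n \<Longrightarrow> Q s'"
  shows "run (FOR i b c) s ((\<Sum>j<n. k j + 4) + 3) Q"
proof (cases "bnd s")
  case False
  then show ?thesis by (auto simp: run_def)
next
  case True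
  then have n\<beta>: "n < 2 ^ \<beta>" using bndD[of s b] regs n by simp
  have one: "(1::nat) < 2 ^ \<beta>" using \<beta> by (intro one_less_power) auto
  define J where "J t s' \<longleftrightarrow> (\<exists>j\<le>n. I j s' \<and> s' 0 i = j \<and> s' 0 b = n \<and> s' 0 1 = n - j \<and> t = (\<Sum>j'=j..<n. k j' + 4))" for t s'
  have w: "run (HWhile 1 (c ;; HConst 1 1 ;; HAdd i i 1 ;; HSub 1 b i)) s' ((\<Sum>j<n. k j + 4) + 1) Q"
    if "J (\<Sum>j<n. k j + 4) s'" for s'
  proof (rule run_While_budget[of _ J, OF _ _ _ _ that])
    fix t s' assume s': "bnd s'" "J t s'" "s' 0 1 \<noteq> 0"
    then obtain j where j: "j < n" "I j s'" "s' 0 i = j" "s' 0 b = n" "s' 0 1 = n - j" "t = (\<Sum>j'=j..<n. k j' + 4)"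
      by (auto simp: J_def)
    let ?t = "\<Sum>j'=Suc j..<n. k j' + 4"
    have "run (c ;; HConst 1 1 ;; HAdd i i 1 ;; HSub 1 b i) s' (k j + 3) (J ?t)"
    proof (rule run_Seq[OF body[OF j(1) s'(1) j(2-4)]])
      fix s'' assume s'': "bnd s''" "s'' 0 i = j \<and> s'' 0 b = n \<and> (\<forall>t. I (Suc j) (upd (upd s'' 0 i (Suc j)) 0 1 t))"
      have "upd (upd (upd s'' 0 1 (Suc 0)) 0 i (Suc j)) 0 1 u = upd (upd s'' 0 i (Suc j)) 0 1 u" for u
        using regs by (intro ext) auto
      then show "run (HConst 1 1 ;; HAdd i i 1 ;; HSub 1 b i) s'' 3 (J ?t)"
        using s'' regs j(1) n\<beta> one
        by (intro run_simple) (auto simp: J_def heavy_def)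
    qed
    moreover have "k j + 3 + 1 + ?t \<le> t" using j(1,6) by (simp add: sum.atLeast_Suc_lessThan)
    ultimately show "\<exists>k t'. k + 1 + t' \<le> t \<and> run (c ;; HConst 1 1 ;; HAdd i i 1 ;; HSub 1 b i) s' k (J t')"
      by blast
  qed (auto simp: J_def heavy_def intro: fin)
  have "run (FOR i b c) s (1 + (1 + ((\<Sum>j<n. k j + 4) + 1))) Q"
    unfolding FOR_def
  proof (intro run_step)
    show "run (HWhile 1 (c ;; HConst 1 1 ;; HAdd i i 1 ;; HSub 1 b i)) (eval (HSub 1 b i) (eval (HConst i 0) s))
        ((\<Sum>j<n. k j + 4) + 1) Q"
      using regs init n by (intro w) (auto simp: J_def atLeast0LessThan)
  qed (use regs in \<open>auto simp: heavy_def\<close>)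
  then show ?thesis by (rule run_mono) auto
qed

text \<open>Fixing the outer digit j turns f into \<open>\<lambda>ys. f (j # ys)\<close>, so the
  records are appended in the order of \<open>box\<close>. The bound N is carried along because the
  addresses of a new record must remain short.\<close>

lemma run_nest:
  fixes J :: "'r list \<Rightarrow> state \<Rightarrow> bool"
  assumes "length bs = length ds" "distinct (map fst ds)"
    and regs: "\<And>y b. (y, b) \<in> set ds \<Longrightarrow> y < 100 \<and> b < 100 \<and> \<not> heavy y \<and> \<not> heavy b \<and> y \<noteq> 1 \<and> b \<noteq> 1 \<and> b \<notin> fst ` set ds"
    and bds: "\<And>recs s i. i < length ds \<Longrightarrow> J recs s \<Longrightarrow> s 0 (snd (ds ! i)) = bs ! i"
    and irr: "\<And>recs s x t. J recs s \<Longrightarrow> x \<in> insert 1 (fst ` set ds) \<Longrightarrow> J recs (upd s 0 x t)"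
    and body: "\<And>recs s ys. bnd s \<Longrightarrow> J recs s \<Longrightarrow> ys \<in> set (box bs) \<Longrightarrow>
        (\<And>i. i < length ds \<Longrightarrow> s 0 (fst (ds ! i)) = ys ! i) \<Longrightarrow> length recs < N \<Longrightarrow>
        run c s k (\<lambda>s'. J (recs @ [f ys]) s' \<and> (\<forall>y \<in> fst ` set ds. s' 0 y = s 0 y))"
    and "J recs s" "length recs + prod_list bs \<le> N"
  shows "run (nest ds c) s (nest_cost bs k) (J (recs @ map f (box bs)))"
  using assms
proof (induction ds arbitrary: bs J f recs s)
  case Nil
  then have bs: "bs = []" by simp
  show ?case unfolding nest.simps
    by (rule run_bnd, rule run_mono[OF Nil.prems(6)[of s recs "[]"]]) (use Nil.prems(7,8) bs in auto)
next
  case (Cons d ds)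
  obtain b bs' where bs: "bs = b # bs'" using Cons.prems(1) by (cases bs) auto
  let ?y = "fst d" and ?b = "snd d"
  have d: "?y < 100" "?b < 100" "\<not> heavy ?y" "\<not> heavy ?b" "?y \<noteq> 1" "?b \<noteq> 1" "?y \<noteq> ?b" "?b \<notin> fst ` set (d # ds)"
    using Cons.prems(3)[of ?y ?b] by auto
  have y: "?y \<notin> fst ` set ds" using Cons.prems(2) by auto
  have by_bd: "s 0 ?b = b" if "J recs s" for recs s using Cons.prems(4)[of 0 recs s] that bs by simp
  define R where "R j = recs @ concat (map (\<lambda>y. map (\<lambda>ys. f (y # ys)) (box bs')) [0..<j])" for j
  have len: "length (R j) = length recs + j * prod_list bs'" for j
    by (simp add: R_def length_concat comp_def sum_list_triv length_box)
  have "run (nest (d # ds) c) s ((\<Sum>j<b. nest_cost bs' k + 4) + 3) (J (recs @ map f (box bs)))"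
    unfolding nest.simps
  proof (rule run_FOR[where I = "\<lambda>j s. J (R j) s"])
    show "s 0 ?b = b" using Cons.prems(7) by (rule by_bd)
    show "J (R 0) (upd (upd s 0 ?y 0) 0 1 t)" for t
      using Cons.prems(7) by (auto simp: R_def intro!: Cons.prems(5))
  next
    fix j s' assume j: "j < b" "bnd s'" "J (R j) s'" "s' 0 ?y = j" "s' 0 ?b = b"
    have "run (nest ds c) s' (nest_cost bs' k)
       (\<lambda>s''. J (R j @ map (\<lambda>ys. f (j # ys)) (box bs')) s'' \<and> s'' 0 ?y = j)"
    proof (rule Cons.IH[where J = "\<lambda>recs s. J recs s \<and> s 0 ?y = j" and f = "\<lambda>ys. f (j # ys)"])
      show "length bs' = length ds" "distinct (map fst ds)" using Cons.prems(1,2) bs by auto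
      show "y < 100 \<and> b < 100 \<and> \<not> heavy y \<and> \<not> heavy b \<and> y \<noteq> 1 \<and> b \<noteq> 1 \<and> b \<notin> fst ` set ds" if "(y, b) \<in> set ds" for y b
        using Cons.prems(3)[of y b] that by auto
      show "s 0 (snd (ds ! i)) = bs' ! i" if "i < length ds" "J recs s \<and> s 0 ?y = j" for recs s i
        using Cons.prems(4)[of "Suc i" recs s] that bs by simp
      show "J recs (upd s 0 x t) \<and> upd s 0 x t 0 ?y = j" if "J recs s \<and> s 0 ?y = j" "x \<in> insert 1 (fst ` set ds)" for recs s x t
      proof
        show "J recs (upd s 0 x t)" by (rule Cons.prems(5)) (use that in auto)
        show "upd s 0 x t 0 ?y = j" using that d y by auto
      qed
      show "J (R j) s' \<and> s' 0 ?y = j" using j by simp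
      have "length (R j) + prod_list bs' = length recs + Suc j * prod_list bs'" by (simp add: len)
      also have "\<dots> \<le> length recs + b * prod_list bs'" using j(1) by (intro add_left_mono mult_le_mono1) simp
      also have "\<dots> \<le> N" using Cons.prems(8) bs by simp
      finally show "length (R j) + prod_list bs' \<le> N" .
      show "run c s k (\<lambda>s'. (J (recs @ [f (j # ys)]) s' \<and> s' 0 ?y = j) \<and> (\<forall>y \<in> fst ` set ds. s' 0 y = s 0 y))"
        if "bnd s" "J recs s \<and> s 0 ?y = j" "ys \<in> set (box bs')"
          "\<And>i. i < length ds \<Longrightarrow> s 0 (fst (ds ! i)) = ys ! i" "length recs < N" for recs s ys
      proof (rule run_mono[OF Cons.prems(6)[of s recs "j # ys"]])
        show "j # ys \<in> set (box bs)" using that(3) j(1) bs by auto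
        show "s 0 (fst ((d # ds) ! i)) = (j # ys) ! i" if "i < length (d # ds)" for i
          using that \<open>J recs s \<and> s 0 ?y = j\<close> \<open>\<And>i. i < length ds \<Longrightarrow> s 0 (fst (ds ! i)) = ys ! i\<close>
          by (cases i) auto
      qed (use that in auto)
    qed
    then show "run (nest ds c) s' (nest_cost bs' k)
        (\<lambda>s''. s'' 0 ?y = j \<and> s'' 0 ?b = b \<and> (\<forall>t. J (R (Suc j)) (upd (upd s'' 0 ?y (Suc j)) 0 1 t)))"
    proof (rule run_mono)
      fix s'' assume s'': "J (R j @ map (\<lambda>ys. f (j # ys)) (box bs')) s'' \<and> s'' 0 ?y = j"
      moreover have "R j @ map (\<lambda>ys. f (j # ys)) (box bs') = R (Suc j)" by (simp add: R_def)
      ultimately show "s'' 0 ?y = j \<and> s'' 0 ?b = b \<and> (\<forall>t. J (R (Suc j)) (upd (upd s'' 0 ?y (Suc j)) 0 1 t))"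
        using by_bd by (auto intro!: Cons.prems(5))
    qed simp
  next
    fix s' assume "J (R b) s'"
    then show "J (recs @ map f (box bs)) s'" by (simp add: R_def bs map_concat comp_def)
  qed (use d in auto)
  then show ?case by (simp add: bs)
qed

end

section \<open>Computing the family\<close>

definition SEQ :: "hl list \<Rightarrow> hl" where
  "SEQ cs = foldr (;;) cs HSkip"

lemma SEQ_simps [simp]: "SEQ [] = HSkip" "SEQ (c # cs) = c ;; SEQ cs"
  by (simp_all add: SEQ_def)

text \<open>Scalars of the generation: 0 is n, 17 is C, 18 the stride; 19 and 22 are the number of
  records and the first free row; 20 and 21 the same for the record being expanded, 23 its remaining
  positions; 25 the start of the span, 24 the start of its last block; 26, 27, 28 the widths; 30 the
  length of the list being written, 32 the position to write, 33 the current interval.\<close>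

definition CELL :: hl where
  "CELL = HSub 1 0 32 ;; HWhile 1 (HAdd 2 22 30 ;; HPut 3 2 32 ;; HConst 2 1 ;; HAdd 30 30 2 ;;
     HAdd 32 32 17 ;; HSub 1 0 32)"

definition EMIT :: "nat \<Rightarrow> nat \<Rightarrow> hl \<Rightarrow> hl" where
  "EMIT cnt step c = FOR 34 cnt (HAdd 32 33 41 ;; CELL ;; c ;; HAdd 33 33 step)"

definition SGL :: "nat \<Rightarrow> nat \<Rightarrow> nat \<Rightarrow> hl" where
  "SGL dg base step = COPY 41 dg ;; COPY 33 base ;; EMIT 36 step HSkip"

definition COPYD :: hl where
  "COPYD = SEQ (map (\<lambda>j. COPY (41 + 2 * j) (40 + 2 * j)) [0..<A])"

text \<open>One step of a difference table modulo the number p in register 29. In ascending order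
  the next entry is still the old one; a sum of two residues needs at most one subtraction, and x +
  1 - p is nonzero exactly if x is at least p.\<close>

definition UPDD :: hl where
  "UPDD = SEQ (map (\<lambda>j. HAdd (41 + 2 * j) (41 + 2 * j) (43 + 2 * j) ;; HConst 2 1 ;; HAdd 2 2 (41 + 2 * j) ;;
     HSub 2 2 29 ;; HIf 2 (HSub (41 + 2 * j) (41 + 2 * j) 29) HSkip) [0..<A - 1])"

definition NEW :: hl where
  "NEW = HGet 3 11 20 ;; HConst 30 0 ;; FOR 31 3 (HAdd 2 21 31 ;; HGet 38 3 2 ;; HAdd 2 22 31 ;; HPut 3 2 38 ;;
     HConst 2 1 ;; HAdd 30 30 2)"

definition FIN :: "nat \<Rightarrow> hl" where
  "FIN c = HPut 11 19 30 ;; HConst 2 c ;; HSub 2 23 2 ;; HPut 9 19 2 ;; HPut 10 19 24 ;; HConst 2 1 ;;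
     HAdd 19 19 2 ;; HAdd 22 22 18"

definition BLK1 :: hl where
  "BLK1 = COPYD ;; COPY 33 25 ;; EMIT 37 27 UPDD"

text \<open>The loop over register 90 multiplies the interval number by the width; the number is
  below the constant A * M, so repeated addition is cheap.\<close>

definition BLK2 :: hl where
  "BLK2 = SEQ (map (\<lambda>j. SGL (40 + 2 * j) 25 28) [0..<A - 2]) ;; COPY 35 25 ;;
     FOR 90 (40 + 2 * (A - 2)) (HAdd 35 35 27) ;; SGL (40 + 2 * (A - 1)) 35 26 ;; SGL (40 + 2 * A) 35 26"

definition BLK3 :: hl where
  "BLK3 = SGL 40 25 28"

definition CHILD :: "hl \<Rightarrow> nat \<Rightarrow> hl" where
  "CHILD B c = NEW ;; B ;; FIN c"

text \<open>Truncated subtraction of A - 1 makes r - (A - 1) nonzero exactly if A is at most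
  r.\<close>

definition KIDS :: hl where
  "KIDS = HConst 2 (A - 1) ;; HSub 2 23 2 ;;
     HIf 2
       ((HConst 29 1 ;; HSub 1 27 29 ;; HWhile 1 (HConst 2 F ;; HAdd 29 29 2 ;; HSub 1 27 29)) ;;
        nest (map (\<lambda>j. (40 + 2 * j, 29)) [0..<A]) (CHILD BLK1 A) ;;
        nest (map (\<lambda>j. (40 + 2 * j, 28)) [0..<A - 2] @ [(40 + 2 * (A - 2), 37), (40 + 2 * (A - 1), 26), (40 + 2 * A, 26)])
          (CHILD BLK2 A))
       (nest [(40, 28)] (CHILD BLK3 1))"

definition REGION :: hl where
  "REGION = (COPY 24 25 ;; COPY 26 13 ;; COPY 27 14 ;; COPY 28 15 ;; HSub 1 17 24) ;;
     HWhile 1 (KIDS ;; (HAdd 24 24 16 ;; HAdd 26 26 13 ;; HAdd 27 27 14 ;; HAdd 28 28 15 ;; HSub 1 17 24))"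

text \<open>The queue is append-only: processed records are kept and become the experts, inner nodes
  of the tree included.\<close>

definition BFS :: hl where
  "BFS = (HConst 20 0 ;; HConst 21 0 ;; HSub 1 19 20) ;;
     HWhile 1 (HGet 23 9 20 ;; HIf 23 (HGet 25 10 20 ;; REGION) HSkip ;;
       (HConst 2 1 ;; HAdd 20 20 2 ;; HAdd 21 21 18 ;; HSub 1 19 20))"

text \<open>The odd scalars from 41 on are working copies of the digits held in their even
  neighbours, so a digit survives the body of its own loop.\<close>

definition tmps :: "nat set" where
  "tmps = {1, 2, 3, 30, 31, 32, 33, 34, 35, 38, 90} \<union> {x. odd x \<and> 41 \<le> x \<and> x < 82}"

context machine
begin

lemma run_SEQ:
  assumes "\<And>j s. j < m \<Longrightarrow> bnd s \<Longrightarrow> I j s \<Longrightarrow> run (c j) s k (I (Suc j))" "I 0 s"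
  shows "run (SEQ (map c [0..<m])) s (m * k + 1) (I m)"
proof -
  have "run (SEQ (map c [m - i..<m])) s (i * k + 1) (I m)" if "i \<le> m" "I (m - i) s" for i s
    using that
  proof (induction i arbitrary: s)
    case 0
    then show ?case by (simp add: run_Skip del: One_nat_def)
  next
    case (Suc i)
    have "[m - Suc i..<m] = (m - Suc i) # [m - i..<m]"
      using Suc.prems(1) by (metis Suc_diff_Suc Suc_le_lessD diff_less upt_conv_Cons zero_less_Suc less_le_trans diff_Suc_less)
    moreover have "run (c (m - Suc i) ;; SEQ (map c [m - i..<m])) s (k + (i * k + 1)) (I m)"
    proof (rule run_bnd, rule run_Seq[where P = "I (m - i)"])
      assume "bnd s"
      then show "run (c (m - Suc i)) s k (I (m - i))"
        using assms(1)[of "m - Suc i" s] Suc.prems by (simp add: Suc_diff_Suc Suc_le_lessD)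
    qed (use Suc in auto)
    ultimately show ?case by (simp add: add.assoc)
  qed
  from this[of m s] assms(2) show ?thesis by simp
qed

end

text \<open>Room for all addresses: the linear system of one expert is a square matrix with the
  stride as its side, hence the square. The factor 32 is slack for sums of such numbers.\<close>

locale gen = machine a \<beta> \<eta> + family n K v for a :: "nat list" and \<beta> \<eta> n K v :: nat +
  fixes Nmax :: nat
  assumes big: "32 * (C + n + F + A * M + (Nmax + 1) * (K * A * M * (n + 1) + 2) * (K * A * M * (n + 1) + 2)) \<le> 2 ^ \<beta>"
begin

text \<open>The stride. It only has to dominate every list length and to be reachable by additions;
  the exact bound would need the quotient of n by C.\<close>

definition rho :: nat where "rho = K * A * M * (n + 1)"

lemma bigs: "32 * C \<le> 2 ^ \<beta>" "32 * n \<le> 2 ^ \<beta>" "32 * F \<le> 2 ^ \<beta>" "32 * (A * M) \<le> 2 ^ \<beta>"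
  "32 * ((Nmax + 1) * (rho + 2) * (rho + 2)) \<le> 2 ^ \<beta>"
  "32 * (C + n + F + A * M + (Nmax + 1) * (rho + 2)) \<le> 2 ^ \<beta>"
proof -
  have "(Nmax + 1) * (rho + 2) * 1 \<le> (Nmax + 1) * (rho + 2) * (rho + 2)" by (intro mult_le_mono2) simp
  then have "32 * (C + n + F + A * M + (Nmax + 1) * (rho + 2)) \<le>
      32 * (C + n + F + A * M + (Nmax + 1) * (rho + 2) * (rho + 2))"
    by (intro mult_le_mono2 add_left_mono) simp
  also have "\<dots> \<le> 2 ^ \<beta>" using big by (simp only: rho_def)
  finally show "32 * (C + n + F + A * M + (Nmax + 1) * (rho + 2)) \<le> 2 ^ \<beta>" .
  define X where "X = (Nmax + 1) * (rho + 2) * (rho + 2)"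
  define Y where "Y = A * M"
  have "32 * (C + n + F + Y + X) \<le> 2 ^ \<beta>" using big by (simp only: rho_def X_def Y_def)
  note * = le_trans[OF _ this]
  have "32 * C \<le> 2 ^ \<beta> \<and> 32 * n \<le> 2 ^ \<beta> \<and> 32 * F \<le> 2 ^ \<beta> \<and> 32 * Y \<le> 2 ^ \<beta> \<and> 32 * X \<le> 2 ^ \<beta>"
    by (intro conjI *) simp_all
  then show "32 * C \<le> 2 ^ \<beta>" "32 * n \<le> 2 ^ \<beta>" "32 * F \<le> 2 ^ \<beta>" "32 * (A * M) \<le> 2 ^ \<beta>"
    "32 * ((Nmax + 1) * (rho + 2) * (rho + 2)) \<le> 2 ^ \<beta>" unfolding X_def Y_def by simp_all
qed

lemma bc_le: "K * M * bc \<le> rho"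
proof -
  have "bc \<le> n + 1" by (simp add: bc_def)
  then have "K * M * bc \<le> K * M * (n + 1) * 1" by (simp only: mult_1_right mult_le_mono2)
  also have "\<dots> \<le> K * M * (n + 1) * A" using A_bounds by (intro mult_le_mono2) simp
  finally show ?thesis by (simp add: rho_def algebra_simps)
qed

lemma good_length: "good (r, \<sigma>, ps) \<Longrightarrow> length ps \<le> K * M * bc"
proof -
  assume "good (r, \<sigma>, ps)"
  then have "length ps \<le> (K - r) * (M * bc)" by simp
  also have "\<dots> \<le> K * (M * bc)" by (intro mult_le_mono1) simp
  finally show ?thesis by (simp add: mult.assoc)
qed

section \<open>Invariants of the generation\<close>

definition params :: "state \<Rightarrow> bool" where
  "params s \<longleftrightarrow> s 0 0 = n \<and> s 0 10 = K \<and> s 0 13 = v \<and> s 0 14 = M * v \<and> s 0 15 = A * M * v \<and> s 0 16 = L \<and>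
     s 0 17 = C \<and> s 0 18 = rho \<and> s 0 36 = M \<and> s 0 37 = A * M"

text \<open>Array 3 holds one row of positions per record, array 11 the list lengths; both survive
  into the voting. Arrays 9 and 10 hold the work still to be done, and 9 is reused later.\<close>

definition recs_ok :: "rec list \<Rightarrow> state \<Rightarrow> bool" where
  "recs_ok recs s \<longleftrightarrow> (\<forall>e < length recs. s 9 e = fst (recs ! e) \<and> s 10 e = fst (snd (recs ! e)) * L \<and>
     s 11 e = length (snd (snd (recs ! e))) \<and>
     (\<forall>j < length (snd (snd (recs ! e))). s 3 (e * rho + j) = snd (snd (recs ! e)) ! j))"

definition queue :: "rec list \<Rightarrow> state \<Rightarrow> bool" where
  "queue recs s \<longleftrightarrow> params s \<and> s 0 19 = length recs \<and> s 0 22 = length recs * rho \<and> recs_ok recs s \<and>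
     (\<forall>c \<in> set recs. good c)"

text \<open>The list ps has been written to the position array of the record under construction.\<close>

definition app :: "state \<Rightarrow> nat list \<Rightarrow> state \<Rightarrow> bool" where
  "app s0 ps s \<longleftrightarrow> frame tmps {3} s0 s \<and> s 0 30 = length ps \<and> (\<forall>j < length ps. s 3 (s0 0 22 + j) = ps ! j) \<and>
     (\<forall>x < s0 0 22. s 3 x = s0 3 x)"

lemma app_frame0: "app s0 ps s \<Longrightarrow> x \<notin> tmps \<Longrightarrow> s 0 x = s0 0 x"
  unfolding app_def by (blast dest: frameD0)

lemma notin_tmps [simp]:
  "0 \<notin> tmps" "10 \<notin> tmps" "13 \<notin> tmps" "14 \<notin> tmps" "15 \<notin> tmps" "16 \<notin> tmps" "17 \<notin> tmps" "18 \<notin> tmps"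
  "19 \<notin> tmps" "20 \<notin> tmps" "21 \<notin> tmps" "22 \<notin> tmps" "23 \<notin> tmps" "24 \<notin> tmps" "25 \<notin> tmps" "26 \<notin> tmps" "27 \<notin> tmps"
  "28 \<notin> tmps" "29 \<notin> tmps" "36 \<notin> tmps" "37 \<notin> tmps" "40 + 2 * j \<notin> tmps \<longleftrightarrow> j \<noteq> 25"
  by (auto simp: tmps_def)

lemma in_tmps [simp]:
  "1 \<in> tmps" "Suc 0 \<in> tmps" "2 \<in> tmps" "3 \<in> tmps" "30 \<in> tmps" "31 \<in> tmps" "32 \<in> tmps" "33 \<in> tmps" "34 \<in> tmps" "35 \<in> tmps"
  "38 \<in> tmps" "90 \<in> tmps" "41 \<in> tmps" "j < 20 \<Longrightarrow> 41 + 2 * j \<in> tmps"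
  by (auto simp: tmps_def)

lemma app_upd: "x \<in> tmps \<Longrightarrow> x \<noteq> 30 \<Longrightarrow> app s0 ps (upd s 0 x t) \<longleftrightarrow> app s0 ps s"
  by (auto simp: app_def)

lemma app_mono: "app s0 ps s \<Longrightarrow> frame X {} s s' \<Longrightarrow> X \<subseteq> tmps - {30} \<Longrightarrow> app s0 ps s'"
  unfolding app_def
  by (auto intro: frame_trans frame_mono simp: frame_def)

lemma app_snoc:
  assumes "app s0 ps s" "s 0 2 = s0 0 22 + length ps"
  shows "app s0 (ps @ [x]) (upd (upd s 3 (s0 0 22 + length ps) x) 0 30 (Suc (length ps)))"
  using assms unfolding app_def by (auto simp: nth_append less_Suc_eq)

section \<open>Writing cells and blocks\<close>

lemma run_CELL:
  assumes "app s0 ps s" "params s0" "s 0 32 = z" "z + n + C < 2 ^ \<beta>" "s0 0 22 + length ps + bc < 2 ^ \<beta>"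
  shows "run CELL s (7 * bc + 2) (\<lambda>s'. app s0 (ps @ cellpos z) s' \<and> frame {1, 2, 30, 32} {3} s s')"
proof -
  let ?m = "length (cellpos z)"
  have m: "?m = (n - z + C - 1) div C" by (simp add: cellpos_def)
  define I where "I t s' \<longleftrightarrow> (\<exists>i \<le> ?m. app s0 (ps @ take i (cellpos z)) s' \<and> frame {1, 2, 30, 32} {3} s s' \<and>
     s' 0 32 = z + i * C \<and> s' 0 1 = n - (z + i * C) \<and> t = (?m - i) * 7)" for t s'
  have par: "s' 0 0 = n" "s' 0 17 = C" "s' 0 22 = s0 0 22" if "app s0 ps' s'" for ps' s'
    using that assms(2) by (auto simp: app_frame0 params_def)
  have w: "run (HWhile 1 (HAdd 2 22 30 ;; HPut 3 2 32 ;; HConst 2 1 ;; HAdd 30 30 2 ;; HAdd 32 32 17 ;; HSub 1 0 32))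
     s' (?m * 7 + 1) (\<lambda>s'. app s0 (ps @ cellpos z) s' \<and> frame {1, 2, 30, 32} {3} s s')" if "I (?m * 7) s'" for s'
  proof (rule run_While_budget[of _ I, OF _ _ _ _ that])
    fix t s' assume s': "bnd s'" "I t s'" "s' 0 1 \<noteq> 0"
    then obtain i where i: "i \<le> ?m" "app s0 (ps @ take i (cellpos z)) s'" "frame {1, 2, 30, 32} {3} s s'"
      "s' 0 32 = z + i * C" "s' 0 1 = n - (z + i * C)" "t = (?m - i) * 7" by (auto simp: I_def)
    have lt: "z + i * C < n" using i(5) s'(3) by simp
    then have im: "i < ?m" using cell_index m by metis
    have nth: "cellpos z ! i = z + i * C" using im by (simp add: cellpos_def)
    have len: "length (ps @ take i (cellpos z)) = length ps + i" using im by simp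
    have p30: "s' 0 30 = length ps + i" using i(2) len by (simp add: app_def)
    have bc: "length ps + i < length ps + bc" using im length_cellpos[of z] by simp
    let ?s = "eval (HAdd 2 22 30 ;; HPut 3 2 32 ;; HConst 2 1 ;; HAdd 30 30 2 ;; HAdd 32 32 17 ;; HSub 1 0 32) s'"
    have "run (HAdd 2 22 30 ;; HPut 3 2 32 ;; HConst 2 1 ;; HAdd 30 30 2 ;; HAdd 32 32 17 ;; HSub 1 0 32) s' 6
      (\<lambda>s''. I ((?m - Suc i) * 7) s'')"
    proof (rule run_simple)
      have "(1::nat) < 2 ^ \<beta>" using \<beta> by (intro one_less_power) auto
      then show "safe (HAdd 2 22 30 ;; HPut 3 2 32 ;; HConst 2 1 ;; HAdd 30 30 2 ;; HAdd 32 32 17 ;; HSub 1 0 32) s'"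
        using par[OF i(2)] p30 i(4) lt assms(4,5) bc by (auto simp: heavy_def)
      have "app s0 ((ps @ take i (cellpos z)) @ [cellpos z ! i])
         (upd (upd (upd s' 0 2 (s0 0 22 + (length ps + i))) 3 (s0 0 22 + length (ps @ take i (cellpos z))) (cellpos z ! i))
            0 30 (Suc (length (ps @ take i (cellpos z)))))"
        by (rule app_snoc) (use i(2) len in \<open>auto simp: app_upd\<close>)
      moreover have "(ps @ take i (cellpos z)) @ [cellpos z ! i] = ps @ take (Suc i) (cellpos z)"
        using im by (simp add: take_Suc_conv_app_nth)
      ultimately have "app s0 (ps @ take (Suc i) (cellpos z)) (upd (upd (upd s' 0 2 (s0 0 22 + (length ps + i))) 3
          (s0 0 22 + (length ps + i)) (z + i * C)) 0 30 (Suc (length ps + i)))"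
        using im by (simp add: nth min_absorb2 del: append_assoc)
      moreover have "?s = upd (upd (upd (upd (upd (upd s' 0 2 (s0 0 22 + (length ps + i))) 3 (s0 0 22 + (length ps + i)) (z + i * C))
          0 30 (Suc (length ps + i))) 0 2 1) 0 32 (z + i * C + C)) 0 1 (n - (z + i * C + C))"
        using par[OF i(2)] p30 i(4) by (intro ext) (auto simp: upd_apply)
      ultimately have "app s0 (ps @ take (Suc i) (cellpos z)) ?s" by (simp add: app_upd)
      then show "I ((?m - Suc i) * 7) ?s"
        unfolding I_def using im i(3) i(4) par[OF i(2)] by (intro exI[of _ "Suc i"]) (auto simp: algebra_simps)
    qed (auto simp: heavy_def)
    moreover have "6 + 1 + (?m - Suc i) * 7 \<le> t" using im i(6) by (simp add: Suc_diff_Suc[symmetric])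
    ultimately show "\<exists>k t'. k + 1 + t' \<le> t \<and> run (HAdd 2 22 30 ;; HPut 3 2 32 ;; HConst 2 1 ;; HAdd 30 30 2 ;;
        HAdd 32 32 17 ;; HSub 1 0 32) s' k (I t')" by blast
  next
    fix t s' assume s': "bnd s'" "I t s'" "s' 0 1 = 0"
    then obtain i where i: "i \<le> ?m" "app s0 (ps @ take i (cellpos z)) s'" "frame {1, 2, 30, 32} {3} s s'"
      "s' 0 1 = n - (z + i * C)" by (auto simp: I_def)
    then have "\<not> z + i * C < n" using s'(3) by simp
    then have "i = ?m" using i(1) cell_index[of i z] m by linarith
    then show "app s0 (ps @ cellpos z) s' \<and> frame {1, 2, 30, 32} {3} s s'" using i by simp
  qed (auto simp: heavy_def)
  have "run CELL s (1 + (?m * 7 + 1)) (\<lambda>s'. app s0 (ps @ cellpos z) s' \<and> frame {1, 2, 30, 32} {3} s s')"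
    unfolding CELL_def
  proof (rule run_step)
    have "I (?m * 7) (upd s 0 1 (n - z))"
      unfolding I_def using assms(1,3) by (intro exI[of _ 0]) (simp add: app_upd)
    then show "run (HWhile 1 (HAdd 2 22 30 ;; HPut 3 2 32 ;; HConst 2 1 ;; HAdd 30 30 2 ;; HAdd 32 32 17 ;; HSub 1 0 32))
     (eval (HSub 1 0 32) s) (?m * 7 + 1) (\<lambda>s'. app s0 (ps @ cellpos z) s' \<and> frame {1, 2, 30, 32} {3} s s')"
      using par[OF assms(1)] assms(3) by (intro w) simp
  qed (auto simp: heavy_def)
  then show ?thesis by (rule run_mono) (use length_cellpos[of z] in auto)
qed

text \<open>\<open>DS i\<close> describes the registers that supply the offset in interval i: one
  fixed residue for \<open>sgl\<close>, a difference table for \<open>blk1\<close>.\<close>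

lemma run_EMIT:
  assumes 1: "app s0 ps s" "params s0" "s 0 33 = z0" "cnt = 36 \<or> cnt = 37" "s0 0 cnt = m"
      "step = 26 \<or> step = 27 \<or> step = 28" "s0 0 step = w"
    and DS: "DS 0 s" "\<And>i s'. DS i s' \<Longrightarrow> s' 0 41 = f i"
      "\<And>i s' s''. DS i s' \<Longrightarrow> frame {1, 2, 30, 32, 33, 34} {3} s' s'' \<Longrightarrow> DS i s''"
    and c: "\<And>i s'. bnd s' \<Longrightarrow> DS i s' \<Longrightarrow> frame tmps {3} s0 s' \<Longrightarrow> run c s' k (\<lambda>s''. DS (Suc i) s'' \<and> frame X {} s' s'')"
    and X: "X \<subseteq> tmps - {30, 33, 34}"
    and zb: "\<And>i. i < m \<Longrightarrow> z0 + i * w + f i + n + C < 2 ^ \<beta>" "z0 + m * w < 2 ^ \<beta>"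
    and lb: "s0 0 22 + length ps + m * bc < 2 ^ \<beta>"
  shows "run (EMIT cnt step c) s (m * (k + 7 * bc + 8) + 3)
    (\<lambda>s'. app s0 (ps @ concat (map (\<lambda>i. cellpos (z0 + i * w + f i)) [0..<m])) s' \<and> DS m s')"
proof -
  define B where "B i = ps @ concat (map (\<lambda>i. cellpos (z0 + i * w + f i)) [0..<i])" for i
  have BS: "B (Suc i) = B i @ cellpos (z0 + i * w + f i)" for i by (simp add: B_def)
  have lenB: "length (B i) \<le> length ps + i * bc" for i
  proof (induction i)
    case (Suc i)
    then show ?case using length_cellpos[of "z0 + i * w + f i"] by (simp add: BS)
  qed (simp add: B_def)
  have cnt: "cnt \<notin> tmps" "step \<notin> tmps" "cnt < 100" "\<not> heavy cnt" "cnt \<noteq> 1" "cnt \<noteq> 34" "step < 100"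
    "step \<noteq> 33" "\<not> heavy step" using 1(4,6) by (auto simp: heavy_def)
  define I where "I i s' \<longleftrightarrow> app s0 (B i) s' \<and> s' 0 33 = z0 + i * w \<and> DS i s'" for i s'
  have "run (EMIT cnt step c) s ((\<Sum>j<m. (7 * bc + 4 + k) + 4) + 3) (\<lambda>s'. app s0 (B m) s' \<and> DS m s')"
    unfolding EMIT_def
  proof (rule run_FOR[where I = I])
    show "s 0 cnt = m" using 1 cnt by (auto simp: app_frame0)
    show "I 0 (upd (upd s 0 34 0) 0 1 t)" for t
      unfolding I_def using 1(1,3) DS(1) by (auto simp: B_def app_upd intro!: DS(3)[of 0 s])
  next
    fix i s' assume i: "i < m" "bnd s'" "I i s'" "s' 0 34 = i" "s' 0 cnt = m"
    have a: "app s0 (B i) s'" and z: "s' 0 33 = z0 + i * w" and ds: "DS i s'" using i(3) by (auto simp: I_def)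
    have iw: "z0 + i * w + w \<le> z0 + m * w" using i(1) mult_le_mono1[of "Suc i" m w] by simp
    have "i * bc + bc \<le> m * bc" using i(1) mult_le_mono1[of "Suc i" m bc] by simp
    then have lb': "s0 0 22 + length (B i) + bc < 2 ^ \<beta>" using lb lenB[of i] by linarith
    let ?s1 = "upd s' 0 32 (z0 + i * w + f i)"
    have e1: "eval (HAdd 32 33 41) s' = ?s1" using z DS(2)[OF ds] by simp
    have a1: "app s0 (B i) ?s1" using a by (simp add: app_upd)
    have ds1: "DS i ?s1" using DS(3)[OF ds, of ?s1] by simp
    have "run (HAdd 32 33 41 ;; CELL ;; c ;; HAdd 33 33 step) s' (1 + (7 * bc + 2 + (k + 1)))
      (\<lambda>s''. s'' 0 34 = i \<and> s'' 0 cnt = m \<and> (\<forall>t. I (Suc i) (upd (upd s'' 0 34 (Suc i)) 0 1 t)))"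
    proof (rule run_step)
      show "safe (HAdd 32 33 41) s'" using z DS(2)[OF ds] zb(1)[OF i(1)] by (simp add: heavy_def)
      show "run (CELL ;; c ;; HAdd 33 33 step) (eval (HAdd 32 33 41) s') (7 * bc + 2 + (k + 1))
        (\<lambda>s''. s'' 0 34 = i \<and> s'' 0 cnt = m \<and> (\<forall>t. I (Suc i) (upd (upd s'' 0 34 (Suc i)) 0 1 t)))"
        unfolding e1
      proof (rule run_Seq[OF run_CELL[OF a1 1(2), of "z0 + i * w + f i"]])
        fix s2 assume s2: "bnd s2" "app s0 (B i @ cellpos (z0 + i * w + f i)) s2 \<and> frame {1, 2, 30, 32} {3} ?s1 s2"
        have a2: "app s0 (B (Suc i)) s2" using s2(2) by (simp add: BS)
        have f2: "frame {1, 2, 30, 32, 33, 34} {3} s' s2"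
          by (rule frame_trans[of _ _ _ ?s1]) (use s2(2) in \<open>auto elim: frame_mono\<close>)
        have ds2: "DS i s2" by (rule DS(3)[OF ds f2])
        have k2: "s2 0 34 = i" "s2 0 33 = z0 + i * w" using s2(2) z i(4) by (auto simp: frame_def)
        show "run (c ;; HAdd 33 33 step) s2 (k + 1)
          (\<lambda>s''. s'' 0 34 = i \<and> s'' 0 cnt = m \<and> (\<forall>t. I (Suc i) (upd (upd s'' 0 34 (Suc i)) 0 1 t)))"
        proof (rule run_Seq[OF c[OF s2(1) ds2]])
          show "frame tmps {3} s0 s2" using a2 by (simp add: app_def)
          fix s3 assume s3: "bnd s3" "DS (Suc i) s3 \<and> frame X {} s2 s3"
          have a3: "app s0 (B (Suc i)) s3" by (rule app_mono[OF a2]) (use s3(2) X in auto)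
          have k3: "s3 0 34 = i" "s3 0 33 = z0 + i * w" using k2 s3(2) X by (auto simp: frame_def)
          have c3: "s3 0 cnt = m" "s3 0 step = w" using a3 1(5,7) cnt by (auto simp: app_frame0)
          show "run (HAdd 33 33 step) s3 1
            (\<lambda>s''. s'' 0 34 = i \<and> s'' 0 cnt = m \<and> (\<forall>t. I (Suc i) (upd (upd s'' 0 34 (Suc i)) 0 1 t)))"
          proof (rule run_simple)
            show "safe (HAdd 33 33 step) s3" using k3 c3 cnt iw zb(2) by (simp add: heavy_def)
            have "DS (Suc i) (upd (upd (upd s3 0 33 (z0 + i * w + w)) 0 34 (Suc i)) 0 1 t)" for t
              by (rule DS(3)[of "Suc i" s3]) (use s3 in auto)
            then show "eval (HAdd 33 33 step) s3 0 34 = i \<and> eval (HAdd 33 33 step) s3 0 cnt = m \<and>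
                (\<forall>t. I (Suc i) (upd (upd (eval (HAdd 33 33 step) s3) 0 34 (Suc i)) 0 1 t))"
              using k3 c3 cnt 1(4) a3 by (auto simp: I_def app_upd)
          qed (use cnt in \<open>auto simp: heavy_def\<close>)
        qed
      qed (use zb(1)[OF i(1)] lb' in \<open>auto\<close>)
    qed (auto simp: heavy_def)
    then show "run (HAdd 32 33 41 ;; CELL ;; c ;; HAdd 33 33 step) s' (7 * bc + 4 + k)
      (\<lambda>s''. s'' 0 34 = i \<and> s'' 0 cnt = m \<and> (\<forall>t. I (Suc i) (upd (upd s'' 0 34 (Suc i)) 0 1 t)))"
      by (rule run_mono) auto
  qed (use cnt in \<open>auto simp: heavy_def I_def\<close>)
  then show ?thesis unfolding B_def by (rule run_mono) (auto simp: algebra_simps)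
qed

end

context gen
begin

definition ctx :: "nat \<Rightarrow> nat \<Rightarrow> nat \<Rightarrow> nat \<Rightarrow> state \<Rightarrow> bool" where
  "ctx h r \<sigma> l s \<longleftrightarrow> s 0 20 = h \<and> s 0 21 = h * rho \<and> s 0 23 = r \<and> s 0 24 = (\<sigma> + l - 1) * L \<and> s 0 25 = \<sigma> * L \<and>
     s 0 26 = l * v \<and> s 0 27 = l * M * v \<and> s 0 28 = l * A * M * v"

lemma one_short: "1 < (2::nat) ^ \<beta>"
  using \<beta> by (intro one_less_power) auto

lemma region_le:
  assumes "1 \<le> l" "\<sigma> + l \<le> K"
  shows "\<sigma> * L + A * M * (l * M * v) \<le> C" "\<sigma> * L + M * (l * A * M * v) \<le> C" "l * M * v \<le> C" "l * v \<le> C"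
    "l * A * M * v \<le> C" "M * (l * v) \<le> C" "(\<sigma> + l) * L \<le> C" "A * M * (l * M * v) \<le> C"
proof -
  have 1: "\<sigma> * L + l * L \<le> C"
    using mult_le_mono1[OF assms(2), of L] by (simp add: C_def add_mult_distrib)
  then show "(\<sigma> + l) * L \<le> C" by (simp add: add_mult_distrib)
  have e: "l * L = A * M * (l * M * v)" "l * L = M * (l * A * M * v)" "l * L = A * M * (M * (l * v))"
    by (simp_all add: L_def)
  have 2: "l * L \<le> C" using 1 by (rule add_leD2)
  show "\<sigma> * L + A * M * (l * M * v) \<le> C" using 1 unfolding e(1) .
  show "\<sigma> * L + M * (l * A * M * v) \<le> C" using 1 unfolding e(2) .
  show "A * M * (l * M * v) \<le> C" using 2 unfolding e(1) .
  have AM: "1 \<le> A * M" "1 \<le> M" "1 \<le> A" using A_bounds M_pos by auto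
  have "1 * (l * M * v) \<le> A * M * (l * M * v)" by (rule mult_le_mono1[OF AM(1)])
  then show "l * M * v \<le> C" using 2 unfolding e(1) by (metis le_trans mult_1)
  have "1 * (l * A * M * v) \<le> M * (l * A * M * v)" by (rule mult_le_mono1[OF AM(2)])
  then show "l * A * M * v \<le> C" using 2 unfolding e(2) by (metis le_trans mult_1)
  have "1 * (M * (l * v)) \<le> A * M * (M * (l * v))" by (rule mult_le_mono1[OF AM(1)])
  then show Mlv: "M * (l * v) \<le> C" using 2 unfolding e(3) by (metis le_trans mult_1)
  have "1 * (l * v) \<le> M * (l * v)" by (rule mult_le_mono1[OF AM(2)])
  then show "l * v \<le> C" using Mlv by (metis le_trans mult_1)
qed

lemma short_sum: "x \<le> 8 * C + 8 * n + 8 * F + 8 * (A * M) \<Longrightarrow> x < 2 ^ \<beta>"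
proof -
  assume x: "x \<le> 8 * C + 8 * n + 8 * F + 8 * (A * M)"
  have "C + n + F + A * M \<le> C + n + F + A * M + (Nmax + 1) * (rho + 2)" by simp
  then have "32 * (C + n + F + A * M) \<le> 2 ^ \<beta>" using bigs(6) by (meson le_trans mult_le_mono2)
  moreover have "x < 32 * (C + n + F + A * M)" using x C_pos by simp
  ultimately show ?thesis by (rule less_le_trans[rotated])
qed

lemma row_short: "e \<le> Nmax \<Longrightarrow> j \<le> rho + 1 \<Longrightarrow> e * rho + j < 2 ^ \<beta>"
proof -
  assume "e \<le> Nmax" "j \<le> rho + 1"
  then have "e * rho + j \<le> Nmax * rho + (rho + 1)" by (intro add_mono mult_le_mono1)
  also have "\<dots> < 32 * ((Nmax + 1) * (rho + 2) * (rho + 2))" by (simp add: algebra_simps)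
  also have "\<dots> \<le> 2 ^ \<beta>" by (rule bigs)
  finally show ?thesis .
qed

lemma run_COPY:
  "x < 100 \<Longrightarrow> y < 100 \<Longrightarrow> \<not> heavy x \<Longrightarrow> \<not> heavy y \<Longrightarrow> x \<noteq> y \<Longrightarrow> run (COPY x y) s 2 (\<lambda>s'. s' = upd (upd s 0 x 0) 0 x (s 0 y))"
  by (rule run_bnd, unfold COPY_def, rule run_simple) (auto simp: heavy_def bndD)

lemma run_SGL:
  assumes a: "app s0 ps s" "params s0" and dg: "dg \<notin> tmps" "dg < 100" "\<not> heavy dg" "s0 0 dg = y"
    and b: "base = 25 \<or> base = 35" "s 0 base = b" and st: "step = 26 \<or> step = 28" "s0 0 step = w"
    and small: "b + M * w + y \<le> 4 * C" and lb: "s0 0 22 + length ps + M * bc < 2 ^ \<beta>"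
  shows "run (SGL dg base step) s (M * (7 * bc + 9) + 7) (\<lambda>s'. app s0 (ps @ sgl b w y) s' \<and> s' 0 35 = s 0 35)"
proof -
  have dg': "dg \<noteq> 41" "dg \<noteq> 33" using dg(1) by auto
  define s1 where "s1 = upd (upd s 0 41 0) 0 41 (s 0 dg)"
  define s2 where "s2 = upd (upd s1 0 33 0) 0 33 (s1 0 base)"
  have a2: "app s0 ps s2" using a(1) by (simp add: s1_def s2_def app_upd)
  have k2: "s2 0 41 = y" "s2 0 33 = b" "s2 0 35 = s 0 35"
    using app_frame0[OF a(1) dg(1)] dg dg' b by (auto simp: s1_def s2_def)
  have "run (SGL dg base step) s (2 + (2 + (M * (1 + 7 * bc + 8) + 3))) (\<lambda>s'. app s0 (ps @ sgl b w y) s' \<and> s' 0 35 = s 0 35)"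
    unfolding SGL_def
  proof (rule run_Seq[OF run_COPY])
    fix s' assume "s' = upd (upd s 0 41 0) 0 41 (s 0 dg)"
    then have s': "s' = s1" by (simp add: s1_def)
    show "run (COPY 33 base ;; EMIT 36 step HSkip) s' (2 + (M * (1 + 7 * bc + 8) + 3))
        (\<lambda>s'. app s0 (ps @ sgl b w y) s' \<and> s' 0 35 = s 0 35)"
      unfolding s'
    proof (rule run_Seq[OF run_COPY])
      fix s'' assume "s'' = upd (upd s1 0 33 0) 0 33 (s1 0 base)"
      then have s'': "s'' = s2" by (simp add: s2_def)
      show "run (EMIT 36 step HSkip) s'' (M * (1 + 7 * bc + 8) + 3) (\<lambda>s'. app s0 (ps @ sgl b w y) s' \<and> s' 0 35 = s 0 35)"
        unfolding s''
      proof (rule run_mono[OF run_EMIT[where DS = "\<lambda>i s'. s' 0 41 = y \<and> s' 0 35 = s 0 35" and f = "\<lambda>_. y" and X = "{}" and k = 1]])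
        show "app s0 ps s2" by (rule a2)
        show "s2 0 33 = b" "s2 0 41 = y \<and> s2 0 35 = s 0 35" using k2 by auto
        show "s0 0 36 = M" using a(2) by (simp add: params_def)
        show "b + i * w + y + n + C < 2 ^ \<beta>" if "i < M" for i
        proof (rule short_sum)
          have "i * w \<le> M * w" using that by simp
          then show "b + i * w + y + n + C \<le> 8 * C + 8 * n + 8 * F + 8 * (A * M)" using small by linarith
        qed
        show "b + M * w < 2 ^ \<beta>" using small by (intro short_sum) simp
        show "run HSkip s' 1 (\<lambda>s''. (s'' 0 41 = y \<and> s'' 0 35 = s 0 35) \<and> frame {} {} s' s'')"
          if "s' 0 41 = y \<and> s' 0 35 = s 0 35" for s'
          using that by (intro run_Skip) auto
      qed (use a st lb in \<open>auto simp: frame_def sgl_def\<close>)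
    qed (use b in \<open>auto simp: heavy_def\<close>)
  qed (use dg dg' in \<open>auto simp: heavy_def\<close>)
  then show ?thesis by (rule run_mono) auto
qed

text \<open>Pascal's rule. In the binomial basis the j-th difference of the polynomial is the
  polynomial whose coefficients are shifted by j.\<close>

lemma rs_step:
  fixes p :: nat
  assumes len: "length ys = A" and j: "j < A"
  defines "D \<equiv> \<lambda>j i. (\<Sum>q<A - j. ys ! (j + q) * (i choose q)) mod p"
  shows "D j (Suc i) = (D j i + D (Suc j) i) mod p"
proof -
  define m where "m = A - Suc j"
  have m: "A - j = Suc m" using j by (simp add: m_def)
  have "(\<Sum>q<A - j. ys ! (j + q) * (Suc i choose q)) = ys ! j + (\<Sum>q<m. ys ! (j + Suc q) * (Suc i choose Suc q))"
    unfolding m by (subst sum.lessThan_Suc_shift) simp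
  also have "\<dots> = (ys ! j + (\<Sum>q<m. ys ! (j + Suc q) * (i choose Suc q))) + (\<Sum>q<m. ys ! (Suc j + q) * (i choose q))"
    by (simp add: sum.distrib algebra_simps)
  also have "ys ! j + (\<Sum>q<m. ys ! (j + Suc q) * (i choose Suc q)) = (\<Sum>q<A - j. ys ! (j + q) * (i choose q))"
    unfolding m by (subst sum.lessThan_Suc_shift) simp
  finally show ?thesis unfolding D_def by (simp add: m_def mod_add_eq)
qed

lemma run_UPDD:
  assumes len: "length ys = A" and p: "0 < p" "2 * p < 2 ^ \<beta>"
    and D_def: "D = (\<lambda>j i. (\<Sum>q<A - j. ys ! (j + q) * (i choose q)) mod p)"
    and s: "\<forall>j<A. s 0 (41 + 2 * j) = D j i" "s 0 29 = p"
  shows "run UPDD s (6 * A) (\<lambda>s'. (\<forall>j<A. s' 0 (41 + 2 * j) = D j (Suc i)) \<and>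
     frame ({2} \<union> {x. odd x \<and> 41 \<le> x \<and> x < 82}) {} s s')"
proof -
  let ?X = "{2} \<union> {x. odd x \<and> 41 \<le> x \<and> x < 82} :: nat set"
  let ?c = "\<lambda>j. HAdd (41 + 2 * j) (41 + 2 * j) (43 + 2 * j) ;; HConst 2 1 ;; HAdd 2 2 (41 + 2 * j) ;;
     HSub 2 2 29 ;; HIf 2 (HSub (41 + 2 * j) (41 + 2 * j) 29) HSkip"
  define I where "I j s' \<longleftrightarrow> (\<forall>j'<A. s' 0 (41 + 2 * j') = D j' (if j' < j then Suc i else i)) \<and> frame ?X {} s s'" for j s'
  have lt: "D j i < p" for j i using p by (simp add: D_def)
  have st: "D j (Suc i) = (if p \<le> D j i + D (Suc j) i then D j i + D (Suc j) i - p else D j i + D (Suc j) i)" if "j < A" for j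
  proof -
    have "D j (Suc i) = (D j i + D (Suc j) i) mod p" using rs_step[OF len that, where p = p and i = i] by (simp add: D_def)
    then show ?thesis using lt[of j i] lt[of "Suc j" i] by (simp add: mod_if)
  qed
  have "run UPDD s ((A - 1) * 6 + 1) (I (A - 1))"
    unfolding UPDD_def
  proof (rule run_SEQ)
    show "I 0 s" using s by (simp add: I_def)
    fix j s' assume j: "j < A - 1" "bnd s'" "I j s'"
    have jA: "j < 19" using j(1) A_bounds by simp
    have v: "s' 0 (41 + 2 * j) = D j i" "s' 0 (43 + 2 * j) = D (Suc j) i" "s' 0 29 = p"
    proof -
      have *: "\<forall>j'<A. s' 0 (41 + 2 * j') = D j' (if j' < j then Suc i else i)" using j(3) by (simp add: I_def)
      show "s' 0 (41 + 2 * j) = D j i" using *[rule_format, of j] j(1) by simp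
      have "43 + 2 * j = 41 + 2 * Suc j" by simp
      then show "s' 0 (43 + 2 * j) = D (Suc j) i" using *[rule_format, of "Suc j"] j(1) by simp
      show "s' 0 29 = p" using j(3) s(2) by (auto simp: I_def frame_def)
    qed
    have b: "D j i + D (Suc j) i + 1 < 2 ^ \<beta>"
    proof -
      have "D j i + D (Suc j) i + 1 \<le> 2 * p" using lt[of j i] lt[of "Suc j" i] by simp
      then show ?thesis using p(2) by (rule le_less_trans)
    qed
    then have b': "D j i + D (Suc j) i < 2 ^ \<beta>" "Suc (D j i + D (Suc j) i) < 2 ^ \<beta>" by simp_all
    have e: "eval (?c j) s' = (let x = D j i + D (Suc j) i; s1 = upd (upd (upd (upd s' 0 (41 + 2 * j) x) 0 2 1) 0 2 (1 + x)) 0 2 (1 + x - p)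
       in if p \<le> x then upd s1 0 (41 + 2 * j) (x - p) else s1)"
      using v by (auto simp: Let_def)
    show "run (?c j) s' 6 (I (Suc j))"
    proof (rule run_simple)
      show "safe (?c j) s'" using v b' jA one_short by (auto simp: heavy_def)
      have new: "eval (?c j) s' 0 (41 + 2 * j) = D j (Suc i)"
        unfolding e using st[of j] j(1) by (auto simp: Let_def)
      have old: "eval (?c j) s' 0 x = s' 0 x" if "x \<noteq> 2" "x \<noteq> 41 + 2 * j" for x
        unfolding e using that by (auto simp: Let_def)
      have arr: "eval (?c j) s' q = s' q" if "q \<noteq> 0" for q
        unfolding e using that by (simp add: Let_def)
      show "I (Suc j) (eval (?c j) s')"
        unfolding I_def
      proof (intro conjI allI impI)
        fix j' assume j': "j' < A"
        show "eval (?c j) s' 0 (41 + 2 * j') = D j' (if j' < Suc j then Suc i else i)"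
        proof (cases "j' = j")
          case True then show ?thesis using new by simp
        next
          case False
          then have "eval (?c j) s' 0 (41 + 2 * j') = s' 0 (41 + 2 * j')" by (intro old) auto
          then show ?thesis using False j(3) j' by (simp add: I_def less_Suc_eq)
        qed
      next
        have "frame ?X {} s' (eval (?c j) s')"
          unfolding frame_def using old arr jA by auto
        then show "frame ?X {} s (eval (?c j) s')" using j(3) by (auto simp: I_def intro: frame_trans)
      qed
    qed (auto simp: heavy_def)
  qed
  then show ?thesis
  proof (rule run_mono)
    fix s' assume s': "I (A - 1) s'"
    have "s' 0 (41 + 2 * j) = D j (Suc i)" if "j < A" for j
    proof (cases "j < A - 1")
      case False
      \<comment> \<open>The highest difference is the constant last coefficient, so A - 1 additions
        advance all A entries.\<close>
      then have j: "j = A - 1" using that by simp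
      have "D j (Suc i) = D j i" using st[OF that] lt[of j i] by (simp add: D_def j)
      then show ?thesis using s' that j by (simp add: I_def)
    qed (use s' that in \<open>simp add: I_def\<close>)
    then show "(\<forall>j<A. s' 0 (41 + 2 * j) = D j (Suc i)) \<and> frame ?X {} s s'" using s' by (simp add: I_def)
  qed (use A_bounds in auto)
qed

lemma run_BLK1:
  assumes a: "app s0 ps s" "params s0" "ctx h r \<sigma> l s0" "s0 0 29 = pmod (l * M * v)"
    and l: "1 \<le> l" "\<sigma> + l \<le> K"
    and ys: "ys \<in> set (box (box1 l))" "\<And>j. j < A \<Longrightarrow> s0 0 (40 + 2 * j) = ys ! j"
    and lb: "s0 0 22 + length ps + A * M * bc < 2 ^ \<beta>"
  shows "run BLK1 s (A * 2 + A * M * (6 * A + 7 * bc + 8) + 6)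
    (app s0 (ps @ blk1 \<sigma> l ys))"
proof -
  define p where "p = pmod (l * M * v)"
  define D where "D = (\<lambda>j i. (\<Sum>q<A - j. ys ! (j + q) * (i choose q)) mod p)"
  note reg = region_le[OF l]
  have len: "length ys = A" and ysp: "\<And>j. j < A \<Longrightarrow> ys ! j < p"
    using ys(1) by (auto simp: in_box box1_def list_all2_conv_all_nth p_def)
  have p0: "0 < p" using pmod_pos[of "l * M * v"] by (simp add: p_def)
  have lMv: "1 \<le> l * M * v" using l v M_pos by simp
  have ple: "p \<le> C + F" using pmod_le[OF lMv] reg(3) by (simp add: p_def)
  have p2: "2 * p < 2 ^ \<beta>" using ple by (intro short_sum) simp
  \<comment> \<open>At i = 0 only the binomial coefficient of 0 over 0 survives: the digits
    themselves are the initial difference table.\<close>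
  have D0: "D j 0 = ys ! j" if "j < A" for j
  proof -
    have "A - j \<noteq> 0" using that by simp
    then obtain m where m: "A - j = Suc m" using not0_implies_Suc by blast
    have "(\<Sum>q<A - j. ys ! (j + q) * (0 choose q)) = ys ! j"
      unfolding m by (subst sum.lessThan_Suc_shift) simp
    then show ?thesis using ysp[OF that] by (simp add: D_def)
  qed
  have rsD: "rs p ys i = D 0 i" for i by (simp add: rs_def D_def len)
  have rslt: "rs p ys i < p" for i using p0 by (simp add: rs_def)
  define I where "I j s' \<longleftrightarrow> app s0 ps s' \<and> (\<forall>j'<j. s' 0 (41 + 2 * j') = ys ! j')" for j s'
  have "run BLK1 s ((A * 2 + 1) + (2 + (A * M * (6 * A + 7 * bc + 8) + 3))) (app s0 (ps @ blk1 \<sigma> l ys))"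
    unfolding BLK1_def
  proof (rule run_Seq)
    show "run COPYD s (A * 2 + 1) (I A)"
      unfolding COPYD_def
    proof (rule run_SEQ)
      show "I 0 s" using a(1) by (simp add: I_def)
      fix j s' assume j: "j < A" "bnd s'" "I j s'"
      have j20: "j < 20" using j(1) A_bounds by simp
      have d: "s' 0 (40 + 2 * j) = ys ! j"
        using app_frame0[of s0 ps s' "40 + 2 * j"] j ys(2)[OF j(1)] j20 by (simp add: I_def)
      show "run (COPY (41 + 2 * j) (40 + 2 * j)) s' 2 (I (Suc j))"
      proof (rule run_mono[OF run_COPY])
        fix s'' assume s'': "s'' = upd (upd s' 0 (41 + 2 * j) 0) 0 (41 + 2 * j) (s' 0 (40 + 2 * j))"
        then show "I (Suc j) s''" using j(3) d j20 by (auto simp: I_def app_upd less_Suc_eq)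
      qed (use j20 in \<open>auto simp: heavy_def\<close>)
    qed
  next
    fix s1 assume s1: "bnd s1" "I A s1"
    then have a1: "app s0 ps s1" and d1: "\<forall>j<A. s1 0 (41 + 2 * j) = ys ! j" by (auto simp: I_def)
    have k1: "s1 0 25 = \<sigma> * L" "s1 0 29 = p" using a1 a(3,4) by (auto simp: app_frame0 ctx_def p_def)
    define s2 where "s2 = upd (upd s1 0 33 0) 0 33 (s1 0 25)"
    show "run (COPY 33 25 ;; EMIT 37 27 UPDD) s1 (2 + (A * M * (6 * A + 7 * bc + 8) + 3)) (app s0 (ps @ blk1 \<sigma> l ys))"
    proof (rule run_Seq[OF run_COPY])
      fix s' assume "s' = upd (upd s1 0 33 0) 0 33 (s1 0 25)"
      then have s': "s' = s2" by (simp add: s2_def)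
      show "run (EMIT 37 27 UPDD) s' (A * M * (6 * A + 7 * bc + 8) + 3) (app s0 (ps @ blk1 \<sigma> l ys))"
        unfolding s'
      proof (rule run_mono[OF run_EMIT[where DS = "\<lambda>i s'. (\<forall>j<A. s' 0 (41 + 2 * j) = D j i) \<and> s' 0 29 = p"
              and f = "rs p ys" and k = "6 * A" and X = "{2} \<union> {x. odd x \<and> 41 \<le> x \<and> x < 82}"]])
        show "app s0 ps s2" using a1 by (simp add: s2_def app_upd)
        show "params s0" by (rule a)
        show "s2 0 33 = \<sigma> * L" using k1 by (simp add: s2_def)
        show "s0 0 37 = A * M" using a(2) by (simp add: params_def)
        show "s0 0 27 = l * M * v" using a(3) by (simp add: ctx_def)
        show "(\<forall>j<A. s2 0 (41 + 2 * j) = D j 0) \<and> s2 0 29 = p" using d1 k1 D0 by (simp add: s2_def)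
        show "s' 0 41 = rs p ys i" if "(\<forall>j<A. s' 0 (41 + 2 * j) = D j i) \<and> s' 0 29 = p" for i s'
          using that A_bounds by (auto simp: rsD dest: spec[of _ 0])
        show "(\<forall>j<A. s'' 0 (41 + 2 * j) = D j i) \<and> s'' 0 29 = p"
          if "(\<forall>j<A. s' 0 (41 + 2 * j) = D j i) \<and> s' 0 29 = p" "frame {1, 2, 30, 32, 33, 34} {3} s' s''" for i s' s''
          using that by (auto simp: frame_def)
        show "run UPDD s' (6 * A) (\<lambda>s''. ((\<forall>j<A. s'' 0 (41 + 2 * j) = D j (Suc i)) \<and> s'' 0 29 = p) \<and>
            frame ({2} \<union> {x. odd x \<and> 41 \<le> x \<and> x < 82}) {} s' s'')"
          if "(\<forall>j<A. s' 0 (41 + 2 * j) = D j i) \<and> s' 0 29 = p" for i s'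
          by (rule run_mono[OF run_UPDD[OF len p0 p2 D_def]]) (use that in \<open>auto simp: frame_def\<close>)
        show "{2} \<union> {x. odd x \<and> 41 \<le> x \<and> x < 82} \<subseteq> tmps - {30, 33, 34}" by (auto simp: tmps_def)
        show "\<sigma> * L + i * (l * M * v) + rs p ys i + n + C < 2 ^ \<beta>" if "i < A * M" for i
        proof (rule short_sum)
          have "i * (l * M * v) \<le> A * M * (l * M * v)" using that by (intro mult_le_mono1) simp
          then show "\<sigma> * L + i * (l * M * v) + rs p ys i + n + C \<le> 8 * C + 8 * n + 8 * F + 8 * (A * M)"
            using reg(1) rslt[of i] ple by linarith
        qed
        show "\<sigma> * L + A * M * (l * M * v) < 2 ^ \<beta>" using reg(1) by (intro short_sum) linarith
        show "s0 0 22 + length ps + A * M * bc < 2 ^ \<beta>" by (rule lb)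
      qed (auto simp: blk1_def p_def)
    qed (auto simp: heavy_def)
  qed
  then show ?thesis by (rule run_mono) auto
qed

end

context gen
begin

lemma run_BLK2:
  assumes a: "app s0 ps s" "params s0" "ctx h r \<sigma> l s0"
    and l: "1 \<le> l" "\<sigma> + l \<le> K"
    and ys: "ys \<in> set (box (box2 l))" "\<And>j. j \<le> A \<Longrightarrow> s0 0 (40 + 2 * j) = ys ! j"
    and lb: "s0 0 22 + length ps + A * M * bc < 2 ^ \<beta>"
  shows "run BLK2 s (A * (M * (7 * bc + 9) + 7) + A * M * 5 + 6) (app s0 (ps @ blk2 \<sigma> l ys))"
proof -
  note reg = region_le[OF l]
  define w1 where "w1 = l * A * M * v"
  define c where "c = ys ! (A - 2)"
  define cell where "cell = M * (7 * bc + 9) + 7"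
  have A2: "A - 2 + 3 = Suc A" using A_bounds by simp
  have y: "length ys = A + 1" "\<And>j. j < A - 2 \<Longrightarrow> ys ! j < w1" "c < A * M" "ys ! (A - 1) < l * v" "ys ! A < l * v"
  proof -
    have *: "list_all2 (<) ys (replicate (A - 2) w1 @ [A * M, l * v, l * v])"
      using ys(1) by (simp add: in_box box2_def w1_def)
    show "length ys = A + 1" using list_all2_lengthD[OF *] A2 by simp
    have nth: "i < A + 1 \<Longrightarrow> ys ! i < (replicate (A - 2) w1 @ [A * M, l * v, l * v]) ! i" for i
      using list_all2_nthD2[OF *, of i] A2 by simp
    show "ys ! j < w1" if "j < A - 2" for j using nth[of j] that by (simp add: nth_append)
    show "c < A * M" using nth[of "A - 2"] by (simp add: nth_append c_def)
    have d: "A - Suc 0 - (A - 2) = Suc 0" "A - (A - 2) = 2" "\<not> A - Suc 0 < A - 2" "\<not> A < A - 2" using A_bounds by auto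
    have "(replicate (A - 2) w1 @ [A * M, l * v, l * v]) ! (A - 1) = l * v"
      "(replicate (A - 2) w1 @ [A * M, l * v, l * v]) ! A = l * v"
      using d by (simp_all add: nth_append)
    then show "ys ! (A - 1) < l * v" "ys ! A < l * v" using nth[of "A - 1"] nth[of A] A_bounds by simp_all
  qed
  have ctx: "s0 0 25 = \<sigma> * L" "s0 0 28 = w1" "s0 0 26 = l * v" "s0 0 27 = l * M * v"
    using a(3) by (auto simp: ctx_def w1_def)
  define G where "G j = concat (map (\<lambda>j. sgl (\<sigma> * L) w1 (ys ! j)) [0..<j])" for j
  have GS: "G (Suc j) = G j @ sgl (\<sigma> * L) w1 (ys ! j)" for j by (simp add: G_def)
  have lenG: "length (G j) \<le> j * (M * bc)" for j
  proof (induction j)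
    case (Suc j) then show ?case using length_sgl[of "\<sigma> * L" w1 "ys ! j"] by (simp add: GS)
  qed (simp add: G_def)
  have lb': "s0 0 22 + length (ps @ G j @ xs) + M * bc < 2 ^ \<beta>" if "length xs \<le> i * (M * bc)" "j + i + 1 \<le> A" for j xs i
  proof -
    have "(j + i + 1) * (M * bc) \<le> A * (M * bc)" using that(2) by (rule mult_le_mono1)
    then have "length (G j) + length xs + M * bc \<le> A * M * bc"
      using lenG[of j] that(1) by (simp add: add_mult_distrib mult.assoc)
    then have "s0 0 22 + length (ps @ G j @ xs) + M * bc \<le> s0 0 22 + length ps + A * M * bc" by simp
    then show ?thesis using lb by (rule le_less_trans)
  qed
  have dgok: "40 + 2 * j \<notin> tmps" "40 + 2 * j < 100" "\<not> heavy (40 + 2 * j)" if "j \<le> A" for j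
    using that A_bounds by (auto simp: heavy_def tmps_def)
  define b where "b = \<sigma> * L + c * (l * M * v)"
  have bC: "b \<le> C"
  proof -
    have "c * (l * M * v) \<le> A * M * (l * M * v)" using y(3) by (intro mult_le_mono1) simp
    then show ?thesis using reg(1) unfolding b_def by linarith
  qed
  have small2: "b + M * (l * v) + u \<le> 4 * C" if "u < l * v" for u
    using bC reg(4,6) that by linarith
  have "run BLK2 s (((A - 2) * cell + 1) + (2 + ((c * 5 + 3) + (cell + cell)))) (app s0 (ps @ blk2 \<sigma> l ys))"
    unfolding BLK2_def
  proof (rule run_Seq[where P = "app s0 (ps @ G (A - 2))"])
    show "run (SEQ (map (\<lambda>j. SGL (40 + 2 * j) 25 28) [0..<A - 2])) s ((A - 2) * cell + 1) (app s0 (ps @ G (A - 2)))"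
    proof (rule run_SEQ[where I = "\<lambda>j. app s0 (ps @ G j)"])
      show "app s0 (ps @ G 0) s" using a(1) by (simp add: G_def)
      fix j s' assume j: "j < A - 2" "bnd s'" "app s0 (ps @ G j) s'"
      have "run (SGL (40 + 2 * j) 25 28) s' (M * (7 * bc + 9) + 7)
        (\<lambda>s''. app s0 ((ps @ G j) @ sgl (\<sigma> * L) w1 (ys ! j)) s'' \<and> s'' 0 35 = s' 0 35)"
      proof (rule run_SGL[OF j(3) a(2)])
        show "s' 0 25 = \<sigma> * L" using j(3) ctx by (simp add: app_frame0)
        show "\<sigma> * L + M * w1 + ys ! j \<le> 4 * C" using reg(2,5) y(2)[OF j(1)] unfolding w1_def by linarith
        show "s0 0 22 + length (ps @ G j) + M * bc < 2 ^ \<beta>" using lb'[of "[]" 0 j] j(1) by simp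
      qed (use dgok[of j] j(1) ys(2)[of j] ctx in auto)
      then show "run (SGL (40 + 2 * j) 25 28) s' cell (app s0 (ps @ G (Suc j)))"
        unfolding cell_def by (rule run_mono) (auto simp: GS)
    qed
  next
    fix s1 assume s1: "bnd s1" "app s0 (ps @ G (A - 2)) s1"
    define s2 where "s2 = upd (upd s1 0 35 0) 0 35 (s1 0 25)"
    have a2: "app s0 (ps @ G (A - 2)) s2" using s1 by (simp add: s2_def app_upd)
    have k2: "s2 0 35 = \<sigma> * L" using s1(2) ctx by (simp add: s2_def app_frame0)
    show "run (COPY 35 25 ;; FOR 90 (40 + 2 * (A - 2)) (HAdd 35 35 27) ;; SGL (40 + 2 * (A - 1)) 35 26 ;; SGL (40 + 2 * A) 35 26)
      s1 (2 + ((c * 5 + 3) + (cell + cell))) (app s0 (ps @ blk2 \<sigma> l ys))"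
    proof (rule run_Seq[OF run_COPY])
      fix s' assume "s' = upd (upd s1 0 35 0) 0 35 (s1 0 25)"
      then have s': "s' = s2" by (simp add: s2_def)
      show "run (FOR 90 (40 + 2 * (A - 2)) (HAdd 35 35 27) ;; SGL (40 + 2 * (A - 1)) 35 26 ;; SGL (40 + 2 * A) 35 26)
        s' ((c * 5 + 3) + (cell + cell)) (app s0 (ps @ blk2 \<sigma> l ys))"
        unfolding s'
      proof (rule run_Seq[where P = "\<lambda>s'. app s0 (ps @ G (A - 2)) s' \<and> s' 0 35 = b"])
        have "run (FOR 90 (40 + 2 * (A - 2)) (HAdd 35 35 27)) s2 ((\<Sum>j<c. 1 + 4) + 3)
          (\<lambda>s'. app s0 (ps @ G (A - 2)) s' \<and> s' 0 35 = b)"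
        proof (rule run_FOR[where I = "\<lambda>j s'. app s0 (ps @ G (A - 2)) s' \<and> s' 0 35 = \<sigma> * L + j * (l * M * v)"])
          show "s2 0 (40 + 2 * (A - 2)) = c"
            using a2 dgok[of "A - 2"] ys(2)[of "A - 2"] by (simp add: app_frame0 c_def)
          show "app s0 (ps @ G (A - 2)) (upd (upd s2 0 90 0) 0 1 t) \<and> upd (upd s2 0 90 0) 0 1 t 0 35 = \<sigma> * L + 0 * (l * M * v)" for t
            using a2 k2 by (simp add: app_upd)
          fix j s' assume j: "j < c" "app s0 (ps @ G (A - 2)) s' \<and> s' 0 35 = \<sigma> * L + j * (l * M * v)" "s' 0 90 = j"
            "s' 0 (40 + 2 * (A - 2)) = c"
          have w: "s' 0 27 = l * M * v" using app_frame0[OF j(2)[THEN conjunct1], of 27] ctx by simp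
          show "run (HAdd 35 35 27) s' 1 (\<lambda>s''. s'' 0 90 = j \<and> s'' 0 (40 + 2 * (A - 2)) = c \<and>
              (\<forall>t. app s0 (ps @ G (A - 2)) (upd (upd s'' 0 90 (Suc j)) 0 1 t) \<and>
                 upd (upd s'' 0 90 (Suc j)) 0 1 t 0 35 = \<sigma> * L + Suc j * (l * M * v)))"
          proof (rule run_simple)
            have "Suc j * (l * M * v) \<le> c * (l * M * v)" using j(1) by (intro mult_le_mono1) simp
            then have "\<sigma> * L + j * (l * M * v) + l * M * v \<le> C" using bC unfolding b_def by simp
            then have "\<sigma> * L + j * (l * M * v) + l * M * v < 2 ^ \<beta>" by (intro short_sum) linarith
            then show "safe (HAdd 35 35 27) s'" using j(2) w by (simp add: heavy_def)
          qed (use j w A_bounds in \<open>auto simp: heavy_def app_upd\<close>)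
        qed (use dgok[of "A - 2"] A_bounds in \<open>auto simp: heavy_def b_def\<close>)
        then show "run (FOR 90 (40 + 2 * (A - 2)) (HAdd 35 35 27)) s2 (c * 5 + 3)
          (\<lambda>s'. app s0 (ps @ G (A - 2)) s' \<and> s' 0 35 = b)" by (rule run_mono) auto
      next
        fix s3 assume s3: "bnd s3" "app s0 (ps @ G (A - 2)) s3 \<and> s3 0 35 = b"
        let ?g = "sgl b (l * v) (ys ! (A - 1))"
        show "run (SGL (40 + 2 * (A - 1)) 35 26 ;; SGL (40 + 2 * A) 35 26) s3 (cell + cell) (app s0 (ps @ blk2 \<sigma> l ys))"
        proof (rule run_Seq[where P = "\<lambda>s'. app s0 ((ps @ G (A - 2)) @ ?g) s' \<and> s' 0 35 = b"])
          have "run (SGL (40 + 2 * (A - 1)) 35 26) s3 (M * (7 * bc + 9) + 7)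
            (\<lambda>s'. app s0 ((ps @ G (A - 2)) @ ?g) s' \<and> s' 0 35 = s3 0 35)"
          proof (rule run_SGL[OF _ a(2)])
            show "s0 0 22 + length (ps @ G (A - 2)) + M * bc < 2 ^ \<beta>"
              using lb'[of "[]" 0 "A - 2"] A_bounds by simp
            show "b + M * (l * v) + ys ! (A - 1) \<le> 4 * C" by (rule small2[OF y(4)])
          qed (use dgok[of "A - 1"] ys(2)[of "A - 1"] ctx s3 in auto)
          then show "run (SGL (40 + 2 * (A - 1)) 35 26) s3 cell (\<lambda>s'. app s0 ((ps @ G (A - 2)) @ ?g) s' \<and> s' 0 35 = b)"
            unfolding cell_def by (rule run_mono) (use s3 in auto)
          fix s4 assume s4: "bnd s4" "app s0 ((ps @ G (A - 2)) @ ?g) s4 \<and> s4 0 35 = b"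
          have "run (SGL (40 + 2 * A) 35 26) s4 (M * (7 * bc + 9) + 7)
            (\<lambda>s'. app s0 (((ps @ G (A - 2)) @ ?g) @ sgl b (l * v) (ys ! A)) s' \<and> s' 0 35 = s4 0 35)"
          proof (rule run_SGL[OF _ a(2)])
            show "s0 0 22 + length ((ps @ G (A - 2)) @ ?g) + M * bc < 2 ^ \<beta>"
              using lb'[of ?g 1 "A - 2"] length_sgl[of b "l * v" "ys ! (A - 1)"] A_bounds by simp
            show "b + M * (l * v) + ys ! A \<le> 4 * C" by (rule small2[OF y(5)])
          qed (use dgok[of A] ys(2)[of A] ctx s4 in auto)
          then show "run (SGL (40 + 2 * A) 35 26) s4 cell (app s0 (ps @ blk2 \<sigma> l ys))"
            unfolding cell_def by (rule run_mono) (auto simp: blk2_def G_def w1_def b_def c_def)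
        qed
      qed
    qed (auto simp: heavy_def)
  qed
  then show ?thesis
  proof (rule run_mono)
    have "((A - 2) * cell + 1) + (2 + ((c * 5 + 3) + (cell + cell))) = (A - 2 + 2) * cell + c * 5 + 6"
      by (simp add: algebra_simps)
    also have "A - 2 + 2 = A" using A_bounds by simp
    finally show "((A - 2) * cell + 1) + (2 + ((c * 5 + 3) + (cell + cell))) \<le> A * (M * (7 * bc + 9) + 7) + A * M * 5 + 6"
      using y(3) unfolding cell_def by linarith
  qed
qed

lemma run_BLK3:
  assumes a: "app s0 ps s" "params s0" "ctx h r \<sigma> l s0"
    and l: "1 \<le> l" "\<sigma> + l \<le> K"
    and ys: "ys \<in> set (box (box3 l))" "s0 0 40 = ys ! 0"
    and lb: "s0 0 22 + length ps + M * bc < 2 ^ \<beta>"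
  shows "run BLK3 s (M * (7 * bc + 9) + 7) (app s0 (ps @ blk3 \<sigma> l ys))"
proof -
  note reg = region_le[OF l]
  have y: "ys ! 0 < l * A * M * v" using ys(1) by (auto simp: in_box box3_def list_all2_Cons2)
  have "run (SGL 40 25 28) s (M * (7 * bc + 9) + 7)
    (\<lambda>s'. app s0 (ps @ sgl (\<sigma> * L) (l * A * M * v) (ys ! 0)) s' \<and> s' 0 35 = s 0 35)"
  proof (rule run_SGL[OF a(1,2)])
    show "40 \<notin> tmps" "(40::nat) < 100" "\<not> heavy 40" by (auto simp: tmps_def heavy_def)
    show "s 0 25 = \<sigma> * L" using a by (simp add: app_frame0 ctx_def)
    show "\<sigma> * L + M * (l * A * M * v) + ys ! 0 \<le> 4 * C" using reg(2,5) y by linarith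
  qed (use a ys lb in \<open>auto simp: ctx_def\<close>)
  then show ?thesis unfolding BLK3_def by (rule run_mono) (auto simp: blk3_def)
qed

section \<open>Copying and completing a record\<close>

lemma run_NEW:
  assumes q: "queue recs s" and h: "h < length recs" "recs ! h = (r, \<sigma>, ps)" "s 0 20 = h" "s 0 21 = h * rho"
    and N: "length recs \<le> Nmax"
  shows "run NEW s (10 * (K * M * bc) + 5) (app s ps)"
proof -
  have rec: "s 11 h = length ps" "\<And>j. j < length ps \<Longrightarrow> s 3 (h * rho + j) = ps ! j"
    using q h by (auto simp: queue_def recs_ok_def dest!: spec[of _ h])
  have nb: "s 0 22 = length recs * rho" using q by (simp add: queue_def)
  have "good (r, \<sigma>, ps)" using q h nth_mem[of h recs] by (auto simp: queue_def simp del: good.simps)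
  then have len: "length ps \<le> K * M * bc" "length ps \<le> rho" using good_length bc_le by (force simp del: good.simps)+
  let ?c = "HAdd 2 21 31 ;; HGet 38 3 2 ;; HAdd 2 22 31 ;; HPut 3 2 38 ;; HConst 2 1 ;; HAdd 30 30 2"
  define s2 where "s2 = upd (upd s 0 3 (length ps)) 0 30 0"
  have "run NEW s (1 + (1 + ((\<Sum>j<length ps. 6 + 4) + 3))) (app s ps)"
    unfolding NEW_def
  proof (intro run_step)
    have "run (FOR 31 3 ?c) s2 ((\<Sum>j<length ps. 6 + 4) + 3) (app s ps)"
    proof (rule run_FOR[where I = "\<lambda>j s'. app s (take j ps) s'"])
      show "app s (take 0 ps) (upd (upd s2 0 31 0) 0 1 t)" for t by (auto simp: app_def s2_def)
      fix j s' assume j: "j < length ps" "app s (take j ps) s'" "s' 0 31 = j" "s' 0 3 = length ps"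
      have k: "s' 0 21 = h * rho" "s' 0 22 = length recs * rho" using j(2) h nb by (auto simp: app_frame0)
      have p30: "s' 0 30 = j" using j by (simp add: app_def)
      \<comment> \<open>The parent's row lies entirely below the row being written, so copying never
        reads what it has overwritten.\<close>
      have "Suc h * rho \<le> length recs * rho" using h(1) by (intro mult_le_mono1) simp
      then have "h * rho + j < s 0 22" using j(1) len nb by simp
      then have val: "s' 3 (h * rho + j) = ps ! j" using j(2) rec(2)[OF j(1)] by (simp add: app_def)
      have jr: "j \<le> rho + 1" "Suc j < 2 ^ \<beta>" using j(1) len row_short[of 0 "Suc j"] by auto
      let ?s' = "eval ?c s'"
      show "run ?c s' 6 (\<lambda>s''. s'' 0 31 = j \<and> s'' 0 3 = length ps \<and>
          (\<forall>t. app s (take (Suc j) ps) (upd (upd s'' 0 31 (Suc j)) 0 1 t)))"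
      proof (rule run_simple)
        show "safe ?c s'" using k j(3) p30 jr row_short[of h j] row_short[of "length recs" j] h(1) N one_short
          by (auto simp: heavy_def)
        have "app s (take j ps @ [ps ! j]) (upd (upd (upd (upd s' 0 38 (ps ! j)) 0 2 (s 0 22 + length (take j ps))) 3 (s 0 22 + length (take j ps)) (ps ! j))
           0 30 (Suc (length (take j ps))))"
          by (rule app_snoc) (use j in \<open>auto simp: app_upd\<close>)
        then have "app s (take (Suc j) ps) (upd (upd (upd (upd s' 0 38 (ps ! j)) 0 2 (s 0 22 + j)) 3 (s 0 22 + j) (ps ! j)) 0 30 (Suc j))"
          using j(1) by (simp add: take_Suc_conv_app_nth)
        then have "app s (take (Suc j) ps) (upd (upd (upd (upd (upd (upd (upd s' 0 38 (ps ! j)) 0 2 (s 0 22 + j)) 3 (s 0 22 + j) (ps ! j)) 0 30 (Suc j)) 0 2 1)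
           0 31 (Suc j)) 0 1 t)" for t by (simp add: app_upd)
        moreover have "upd (upd ?s' 0 31 (Suc j)) 0 1 t = upd (upd (upd (upd (upd (upd (upd s' 0 38 (ps ! j)) 0 2 (s 0 22 + j)) 3 (s 0 22 + j) (ps ! j)) 0 30 (Suc j)) 0 2 1)
           0 31 (Suc j)) 0 1 t" for t
          using k j(3) p30 val nb by (intro ext) (auto simp: upd_apply)
        ultimately show "?s' 0 31 = j \<and> ?s' 0 3 = length ps \<and> (\<forall>t. app s (take (Suc j) ps) (upd (upd ?s' 0 31 (Suc j)) 0 1 t))"
          using j by simp
      qed (auto simp: heavy_def)
    qed (auto simp: heavy_def s2_def)
    moreover have "eval (HConst 30 0) (eval (HGet 3 11 20) s) = s2" using rec h(3) by (simp add: s2_def)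
    ultimately show "run (FOR 31 3 ?c) (eval (HConst 30 0) (eval (HGet 3 11 20) s)) ((\<Sum>j<length ps. 6 + 4) + 3) (app s ps)" by simp
  qed (auto simp: heavy_def)
  then show ?thesis by (rule run_mono) (use len in auto)
qed

lemma run_FIN:
  assumes q: "queue recs s" and a: "app s ps s'" and c: "c \<le> 20"
    and k: "s 0 23 = r" "s 0 24 = \<sigma> * L" and g: "good (r - c, \<sigma>, ps)" and N: "length recs < Nmax"
  shows "run (FIN c) s' 8 (\<lambda>s''. queue (recs @ [(r - c, \<sigma>, ps)]) s'' \<and> frame (tmps \<union> {19, 22}) {3, 9, 10, 11} s s'')"
proof (rule run_simple)
  let ?N = "length recs"
  have par: "params s" and N19: "s 0 19 = ?N" "s 0 22 = ?N * rho" and ok: "recs_ok recs s" and gs: "\<forall>c \<in> set recs. good c"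
    using q by (auto simp: queue_def)
  have f: "frame tmps {3} s s'" using a by (simp add: app_def)
  have k': "s' 0 19 = ?N" "s' 0 22 = ?N * rho" "s' 0 18 = rho" "s' 0 23 = r" "s' 0 24 = \<sigma> * L" "s' 0 30 = length ps"
    using a N19 k par by (auto simp: app_frame0 params_def) (auto simp: app_def)
  have "20 < (2::nat) ^ 11" by simp
  also have "\<dots> \<le> 2 ^ \<beta>" using \<beta> by (intro power_increasing) auto
  finally have c': "c < 2 ^ \<beta>" using c by linarith
  have "0 < rho" using K A_bounds M_pos by (simp add: rho_def)
  then have "Suc ?N \<le> ?N * rho + rho" using mult_le_mono2[of 1 rho "Suc ?N"] by simp
  then have N': "?N * rho + rho < 2 ^ \<beta>" "Suc ?N < 2 ^ \<beta>" using row_short[of ?N rho] N by auto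
  show "safe (FIN c) s'" unfolding FIN_def using k' c' one_short N' by (auto simp: heavy_def)
  show "cost (FIN c) \<le> 8" unfolding FIN_def by (auto simp: heavy_def)
  define s'' where "s'' = eval (FIN c) s'"
  have e0: "s'' 0 x = (if x = 2 then 1 else if x = 19 then Suc ?N else if x = 22 then ?N * rho + rho else s' 0 x)" for x
    using k' by (auto simp: s''_def FIN_def)
  have eq: "s'' 11 e = (if e = ?N then length ps else s' 11 e)" "s'' 9 e = (if e = ?N then r - c else s' 9 e)"
    "s'' 10 e = (if e = ?N then \<sigma> * L else s' 10 e)" "s'' 3 e = s' 3 e" for e
    using k' by (auto simp: s''_def FIN_def)
  have eo: "s'' q = s' q" if "q \<notin> {0, 9, 10, 11}" for q
    using that by (simp add: s''_def FIN_def)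
  have f': "s' q = s q" if "q \<notin> {0, 3}" for q using f that by (simp add: frame_def)
  have "params s''"
    using par f e0 by (auto simp: params_def frame_def)
  moreover have "recs_ok (recs @ [(r - c, \<sigma>, ps)]) s''"
    unfolding recs_ok_def
  proof (intro allI impI)
    fix e assume "e < length (recs @ [(r - c, \<sigma>, ps)])"
    then consider "e < ?N" | "e = ?N" by fastforce
    then show "s'' 9 e = fst ((recs @ [(r - c, \<sigma>, ps)]) ! e) \<and> s'' 10 e = fst (snd ((recs @ [(r - c, \<sigma>, ps)]) ! e)) * L \<and>
       s'' 11 e = length (snd (snd ((recs @ [(r - c, \<sigma>, ps)]) ! e))) \<and>
       (\<forall>j < length (snd (snd ((recs @ [(r - c, \<sigma>, ps)]) ! e))). s'' 3 (e * rho + j) = snd (snd ((recs @ [(r - c, \<sigma>, ps)]) ! e)) ! j)"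
    proof cases
      case 1
      obtain r1 \<sigma>1 ps1 where r1: "recs ! e = (r1, \<sigma>1, ps1)" by (cases "recs ! e")
      have "good (r1, \<sigma>1, ps1)" using gs 1 r1 nth_mem[of e recs] by (auto simp del: good.simps)
      then have "length ps1 \<le> rho" using good_length bc_le le_trans by blast
      have "s' 3 (e * rho + j) = s 3 (e * rho + j)" if "j < length ps1" for j
      proof -
        have "Suc e * rho \<le> ?N * rho" using 1 by (intro mult_le_mono1) simp
        then have "e * rho + j < s 0 22" using that \<open>length ps1 \<le> rho\<close> N19 by simp
        then show ?thesis using a by (simp add: app_def)
      qed
      then show ?thesis using 1 r1 ok eq f' by (auto simp: recs_ok_def nth_append dest!: spec[of _ e])
    next
      case 2
      have "s' 3 (?N * rho + j) = ps ! j" if "j < length ps" for j using a that N19 by (simp add: app_def)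
      then show ?thesis using 2 eq by simp
    qed
  qed
  moreover have "frame (tmps \<union> {19, 22}) {3, 9, 10, 11} s s''"
    unfolding frame_def using f e0 eo f' by (auto simp: frame_def)
  ultimately show "queue (recs @ [(r - c, \<sigma>, ps)]) (eval (FIN c) s') \<and> frame (tmps \<union> {19, 22}) {3, 9, 10, 11} s (eval (FIN c) s')"
    using gs g e0 unfolding queue_def s''_def[symmetric] by (auto simp del: good.simps)
qed

lemma run_CHILD:
  assumes q: "queue recs s" and h: "h < length recs" "recs ! h = (r, \<sigma>, ps)" and ctx: "ctx h r \<sigma> l s"
    and N: "length recs < Nmax" and c: "c \<le> 20" and g: "good (r - c, \<sigma> + l - 1, ps @ new)"
    and B: "\<And>s1. bnd s1 \<Longrightarrow> app s ps s1 \<Longrightarrow> run B s1 kB (app s (ps @ new))"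
  shows "run (CHILD B c) s (10 * (K * M * bc) + 13 + kB)
    (\<lambda>s'. queue (recs @ [(r - c, \<sigma> + l - 1, ps @ new)]) s' \<and> frame (tmps \<union> {19, 22}) {3, 9, 10, 11} s s')"
proof -
  have "run (CHILD B c) s ((10 * (K * M * bc) + 5) + (kB + 8))
    (\<lambda>s'. queue (recs @ [(r - c, \<sigma> + l - 1, ps @ new)]) s' \<and> frame (tmps \<union> {19, 22}) {3, 9, 10, 11} s s')"
    unfolding CHILD_def
  proof (rule run_Seq[OF run_NEW[OF q h]])
    fix s1 assume s1: "bnd s1" "app s ps s1"
    show "run (B ;; FIN c) s1 (kB + 8)
      (\<lambda>s'. queue (recs @ [(r - c, \<sigma> + l - 1, ps @ new)]) s' \<and> frame (tmps \<union> {19, 22}) {3, 9, 10, 11} s s')"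
    proof (rule run_Seq[OF B[OF s1]])
      fix s2 assume "app s (ps @ new) s2"
      from run_FIN[OF q this c _ _ g N] ctx
      show "run (FIN c) s2 8
        (\<lambda>s'. queue (recs @ [(r - c, \<sigma> + l - 1, ps @ new)]) s' \<and> frame (tmps \<union> {19, 22}) {3, 9, 10, 11} s s')"
        by (simp add: ctx_def)
    qed
  qed (use ctx N in \<open>auto simp: ctx_def\<close>)
  then show ?thesis by (rule run_mono) auto
qed

end

context family
begin

text \<open>The cost of one child, linear in the length of its list up to constants: copying the
  parent's positions and appending a block.\<close>

definition KB :: nat where
  "KB = 10 * (K * M * bc) + A * M * (7 * bc + 6 * A + 30) + 30"

text \<open>Every span length l yields at least one child, which pays for the constant overhead of
  the loop over l.\<close>

lemma length_kids_pos: "1 \<le> l \<Longrightarrow> 1 \<le> length (kids \<rho> l)"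
proof -
  assume l: "1 \<le> l"
  have "1 \<le> prod_list (replicate A (pmod (l * M * v)))" using pmod_pos[of "l * M * v"]
    by (simp add: prod_list_replicate)
  moreover have "1 \<le> l * A * M * v" using l v A_bounds M_pos by simp
  ultimately show ?thesis by (cases \<rho>) (auto simp: length_box box1_def box3_def)
qed

end

context gen
begin

definition digs :: "nat set" where
  "digs = (\<lambda>j. 40 + 2 * j) ` {..A}"

definition gent :: "nat set" where
  "gent = tmps \<union> {19, 22} \<union> digs"

lemma digs_range: "x \<in> digs \<Longrightarrow> even x \<and> 40 \<le> x \<and> x \<le> 80"
  using A_bounds by (auto simp: digs_def)

lemma notin_gent [simp]:
  "0 \<notin> gent" "10 \<notin> gent" "13 \<notin> gent" "14 \<notin> gent" "15 \<notin> gent" "16 \<notin> gent" "17 \<notin> gent" "18 \<notin> gent"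
  "20 \<notin> gent" "21 \<notin> gent" "23 \<notin> gent" "24 \<notin> gent" "25 \<notin> gent" "26 \<notin> gent" "27 \<notin> gent"
  "28 \<notin> gent" "29 \<notin> gent" "36 \<notin> gent" "37 \<notin> gent"
  by (auto simp: gent_def dest: digs_range)

lemma in_gent: "x \<in> tmps \<Longrightarrow> x \<in> gent" "x \<in> digs \<Longrightarrow> x \<in> gent"
  by (auto simp: gent_def)

lemma queue_cong:
  assumes "queue recs s" "\<And>x. x \<in> {0, 10, 13, 14, 15, 16, 17, 18, 19, 22, 36, 37} \<Longrightarrow> s' 0 x = s 0 x"
    "\<And>q. q \<in> {3, 9, 10, 11} \<Longrightarrow> s' q = s q"
  shows "queue recs s'"
  using assms by (simp add: queue_def params_def recs_ok_def)

lemma queue_upd: "queue recs s \<Longrightarrow> x \<notin> {0, 10, 13, 14, 15, 16, 17, 18, 19, 22, 36, 37} \<Longrightarrow> queue recs (upd s 0 x t)"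
  by (erule queue_cong) auto

text \<open>The invariant of the digit loops: the queue may grow and digits may change, but the
  record under expansion, its span and the modulus p in register 29 stay fixed.\<close>

definition J :: "nat \<Rightarrow> nat \<Rightarrow> nat \<Rightarrow> nat list \<Rightarrow> nat \<Rightarrow> nat \<Rightarrow> state \<Rightarrow> rec list \<Rightarrow> state \<Rightarrow> bool" where
  "J h r \<sigma> ps l p s0 recs s \<longleftrightarrow> queue recs s \<and> h < length recs \<and> recs ! h = (r, \<sigma>, ps) \<and> ctx h r \<sigma> l s \<and>
     s 0 29 = p \<and> frame gent {3, 9, 10, 11} s0 s"

lemma J_child:
  assumes "J h r \<sigma> ps l p s0 recs s" "queue (recs @ [c]) s'" "frame (tmps \<union> {19, 22}) {3, 9, 10, 11} s s'"
  shows "J h r \<sigma> ps l p s0 (recs @ [c]) s'" "\<And>x. x \<in> digs \<Longrightarrow> s' 0 x = s 0 x"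
proof -
  have f: "s' 0 x = s 0 x" if "x \<notin> tmps \<union> {19, 22}" for x by (rule frameD0[OF assms(3) that])
  have "frame gent {3, 9, 10, 11} s0 s'"
    by (rule frame_trans[of _ _ _ s]) (use assms in \<open>auto simp: J_def gent_def elim: frame_mono\<close>)
  then show "J h r \<sigma> ps l p s0 (recs @ [c]) s'" using assms f by (auto simp: J_def ctx_def nth_append)
  fix x assume "x \<in> digs"
  then have "x \<notin> tmps \<union> {19, 22}" using digs_range[of x] A_bounds by (auto simp: tmps_def)
  then show "s' 0 x = s 0 x" by (rule f)
qed

lemma J_upd: "J h r \<sigma> ps l p s0 recs s \<Longrightarrow> x \<in> insert 1 digs \<Longrightarrow> J h r \<sigma> ps l p s0 recs (upd s 0 x t)"
proof -
  assume J: "J h r \<sigma> ps l p s0 recs s" and x: "x \<in> insert 1 digs"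
  have xr: "x = 1 \<or> (even x \<and> 40 \<le> x \<and> x \<le> 80)" using x digs_range by blast
  have "queue recs (upd s 0 x t)" by (rule queue_upd) (use J xr in \<open>auto simp: J_def\<close>)
  moreover have "x \<in> gent" using x in_gent(1)[of 1] in_gent(2)[of x] by auto
  ultimately show "J h r \<sigma> ps l p s0 recs (upd s 0 x t)" using J xr by (auto simp: J_def ctx_def)
qed

lemma run_nestJ:
  assumes J: "J h r \<sigma> ps l p s0 recs s" and len: "length bs = length ds" and N: "length recs + length (box bs) \<le> Nmax"
    and ds: "distinct (map fst ds)" "\<And>y b. (y, b) \<in> set ds \<Longrightarrow> y \<in> digs \<and> b \<in> {26, 28, 29, 37}"
    and bds: "\<And>recs s i. i < length ds \<Longrightarrow> J h r \<sigma> ps l p s0 recs s \<Longrightarrow> s 0 (snd (ds ! i)) = bs ! i"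
    and bs1: "\<forall>b \<in> set bs. 1 \<le> b" and lds: "length ds \<le> A + 1"
    and c: "c \<le> 20" and g: "\<And>ys. ys \<in> set (box bs) \<Longrightarrow> good (r - c, \<sigma> + l - 1, ps @ new ys)"
    and B: "\<And>recs s s1 ys. bnd s1 \<Longrightarrow> J h r \<sigma> ps l p s0 recs s \<Longrightarrow> length recs < Nmax \<Longrightarrow> app s ps s1 \<Longrightarrow> ys \<in> set (box bs) \<Longrightarrow>
       (\<And>i. i < length ds \<Longrightarrow> s 0 (fst (ds ! i)) = ys ! i) \<Longrightarrow> run B s1 kB (app s (ps @ new ys))"
    and kB: "10 * (K * M * bc) + 13 + kB \<le> KB"
  shows "run (nest ds (CHILD B c)) s (length (box bs) * (KB + 7 * (A + 1)))
    (J h r \<sigma> ps l p s0 (recs @ map (\<lambda>ys. (r - c, \<sigma> + l - 1, ps @ new ys)) (box bs)))"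
proof -
  have fst: "fst ` set ds \<subseteq> digs" using ds(2) by force
  have "run (nest ds (CHILD B c)) s (nest_cost bs KB)
    (J h r \<sigma> ps l p s0 (recs @ map (\<lambda>ys. (r - c, \<sigma> + l - 1, ps @ new ys)) (box bs)))"
  proof (rule run_nest[where N = Nmax])
    show "y < 100 \<and> b < 100 \<and> \<not> heavy y \<and> \<not> heavy b \<and> y \<noteq> 1 \<and> b \<noteq> 1 \<and> b \<notin> fst ` set ds" if "(y, b) \<in> set ds" for y b
      using ds(2)[OF that] digs_range[of y] digs_range[of b] fst by (auto simp: heavy_def)
    show "J h r \<sigma> ps l p s0 recs (upd s 0 x t)" if "J h r \<sigma> ps l p s0 recs s" "x \<in> insert 1 (fst ` set ds)" for recs s x t
      by (rule J_upd[OF that(1)]) (use that(2) fst in auto)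
    show "length recs + prod_list bs \<le> Nmax" using N by (simp add: length_box)
    fix recs s ys
    assume *: "bnd s" "J h r \<sigma> ps l p s0 recs s" "ys \<in> set (box bs)" "\<And>i. i < length ds \<Longrightarrow> s 0 (fst (ds ! i)) = ys ! i"
      "length recs < Nmax"
    have "run (CHILD B c) s (10 * (K * M * bc) + 13 + kB)
      (\<lambda>s'. queue (recs @ [(r - c, \<sigma> + l - 1, ps @ new ys)]) s' \<and> frame (tmps \<union> {19, 22}) {3, 9, 10, 11} s s')"
      by (rule run_CHILD[OF _ _ _ _ *(5) c g[OF *(3)] B[OF _ *(2) *(5) _ *(3,4)]]) (use *(2) in \<open>auto simp: J_def\<close>)
    then show "run (CHILD B c) s KB (\<lambda>s'. J h r \<sigma> ps l p s0 (recs @ [(r - c, \<sigma> + l - 1, ps @ new ys)]) s' \<and>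
        (\<forall>y\<in>fst ` set ds. s' 0 y = s 0 y))"
      by (rule run_mono[OF _ kB]) (use J_child[OF *(2)] fst in blast)
  qed (use assms in auto)
  then show ?thesis
  proof (rule run_mono)
    have "nest_cost bs KB \<le> prod_list bs * (KB + 7 * length bs)" by (rule nest_cost_le[OF bs1])
    also have "\<dots> \<le> prod_list bs * (KB + 7 * (A + 1))" using len lds by (intro mult_le_mono2) simp
    finally show "nest_cost bs KB \<le> length (box bs) * (KB + 7 * (A + 1))" by (simp add: length_box)
  qed
qed

lemma digsI: "j \<le> A \<Longrightarrow> 40 + 2 * j \<in> digs"
  by (auto simp: digs_def)

lemma J_lb:
  assumes "J h r \<sigma> ps l p s0 recs s" "length recs < Nmax" "X \<le> K * M * bc"
  shows "s 0 22 + length ps + X < 2 ^ \<beta>"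
proof -
  have "good (r, \<sigma>, ps)" using assms(1) nth_mem[of h recs] by (auto simp: J_def queue_def simp del: good.simps)
  then have len: "length ps \<le> rho" using good_length bc_le le_trans by blast
  have "s 0 22 = length recs * rho" using assms(1) by (simp add: J_def queue_def)
  then have "s 0 22 + length ps + X \<le> (Nmax - 1) * rho + 2 * rho"
    using len assms(2,3) bc_le mult_le_mono1[of "length recs" "Nmax - 1" rho] by linarith
  also have "\<dots> \<le> Nmax * rho + rho" using assms(2) by (cases Nmax) auto
  also have "\<dots> < 2 ^ \<beta>" by (rule row_short) auto
  finally show ?thesis .
qed

text \<open>The modulus is the first number at least w among 1, 1 + F, 1 + 2 F, and so on. The
  search may take w steps, but then there are also at least w children to pay for it.\<close>

lemma run_PLOOP:
  assumes w: "s 0 27 = w" "w \<le> C"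
  shows "run (HConst 29 1 ;; HSub 1 27 29 ;; HWhile 1 (HConst 2 F ;; HAdd 29 29 2 ;; HSub 1 27 29)) s (4 * w + 3)
    (\<lambda>s'. s' 0 29 = pmod w \<and> frame {1, 2, 29} {} s s')"
proof -
  define m where "m = (w + F - 2) div F"
  have m: "i < m \<longleftrightarrow> 1 + F * i < w" for i
  proof -
    have "i < m \<longleftrightarrow> Suc i * F \<le> w + F - 2" using F_pos unfolding m_def
      by (metis Suc_le_eq less_eq_div_iff_mult_less_eq)
    also have "\<dots> \<longleftrightarrow> 1 + F * i < w" using F_pos by (auto simp: algebra_simps)
    finally show ?thesis .
  qed
  have mw: "m \<le> w"
  proof (cases "m = 0")
    case False
    then have "1 + F * (m - 1) < w" using m[of "m - 1"] by simp
    moreover have "1 * (m - 1) \<le> F * (m - 1)" using F_pos by (intro mult_le_mono1) simp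
    ultimately show ?thesis by linarith
  qed simp
  define I where "I t s' \<longleftrightarrow> (\<exists>i \<le> m. s' 0 29 = 1 + F * i \<and> s' 0 1 = w - (1 + F * i) \<and> frame {1, 2, 29} {} s s' \<and> t = (m - i) * 4)" for t s'
  have "run (HConst 29 1 ;; HSub 1 27 29 ;; HWhile 1 (HConst 2 F ;; HAdd 29 29 2 ;; HSub 1 27 29)) s (1 + (1 + (m * 4 + 1)))
    (\<lambda>s'. s' 0 29 = pmod w \<and> frame {1, 2, 29} {} s s')"
  proof (intro run_step run_While_budget[where I = I])
    show "I (m * 4) (eval (HSub 1 27 29) (eval (HConst 29 1) s))"
      using w by (auto simp: I_def intro!: exI[of _ 0])
    fix t s' assume s': "bnd s'" "I t s'" "s' 0 1 \<noteq> 0"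
    then obtain i where i: "i \<le> m" "s' 0 29 = 1 + F * i" "s' 0 1 = w - (1 + F * i)" "frame {1, 2, 29} {} s s'" "t = (m - i) * 4"
      by (auto simp: I_def)
    then have lt: "1 + F * i < w" using s'(3) by simp
    then have im: "i < m" using m by blast
    have "run (HConst 2 F ;; HAdd 29 29 2 ;; HSub 1 27 29) s' 3 (I ((m - Suc i) * 4))"
    proof (rule run_simple)
      have "1 + F * i + F < 2 ^ \<beta>" "F < 2 ^ \<beta>" using lt w(2) by (intro short_sum; linarith)+
      then show "safe (HConst 2 F ;; HAdd 29 29 2 ;; HSub 1 27 29) s'" using i(2) by (simp add: heavy_def)
      have "s' 0 27 = w" using i(4) w by (simp add: frame_def)
      then show "I ((m - Suc i) * 4) (eval (HConst 2 F ;; HAdd 29 29 2 ;; HSub 1 27 29) s')"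
        using i im by (auto simp: I_def intro!: exI[of _ "Suc i"])
    qed (auto simp: heavy_def)
    then show "\<exists>k t'. k + 1 + t' \<le> t \<and> run (HConst 2 F ;; HAdd 29 29 2 ;; HSub 1 27 29) s' k (I t')"
      using im i(5) by (intro exI[of _ 3] exI[of _ "(m - Suc i) * 4"]) auto
  next
    fix t s' assume "I t s'" "s' 0 1 = 0"
    then obtain i where i: "i \<le> m" "s' 0 29 = 1 + F * i" "w - (1 + F * i) = 0" "frame {1, 2, 29} {} s s'"
      by (auto simp: I_def)
    then have "\<not> i < m" using m by simp
    then show "s' 0 29 = pmod w \<and> frame {1, 2, 29} {} s s'" using i by (simp add: pmod_def m_def)
  qed (use one_short in \<open>auto simp: heavy_def\<close>)
  then show ?thesis by (rule run_mono) (use mw in auto)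
qed

definition regt :: "nat set" where
  "regt = gent \<union> {24, 26, 27, 28, 29}"

lemma notin_regt [simp]:
  "0 \<notin> regt" "10 \<notin> regt" "13 \<notin> regt" "14 \<notin> regt" "15 \<notin> regt" "16 \<notin> regt" "17 \<notin> regt" "18 \<notin> regt"
  "20 \<notin> regt" "21 \<notin> regt" "23 \<notin> regt" "25 \<notin> regt" "36 \<notin> regt" "37 \<notin> regt"
  by (auto simp: regt_def)

lemma run_KIDS:
  assumes q: "queue recs s" and h: "h < length recs" "recs ! h = (r, \<sigma>, ps)" and ctx: "ctx h r \<sigma> l s"
    and l: "1 \<le> l" "\<sigma> + l \<le> K" and r: "r \<noteq> 0" and N: "length recs + length (kids (r, \<sigma>, ps) l) \<le> Nmax"
  shows "run KIDS s (length (kids (r, \<sigma>, ps) l) * (KB + 7 * A + 14) + 6)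
    (\<lambda>s'. queue (recs @ kids (r, \<sigma>, ps) l) s' \<and> ctx h r \<sigma> l s' \<and> frame regt {3, 9, 10, 11} s s')"
proof -
  have good: "good (r, \<sigma>, ps)" using q h nth_mem[of h recs] by (auto simp: queue_def simp del: good.simps)
  have rK: "r \<le> K" using good by simp
  define s1 where "s1 = upd (upd s 0 2 (A - 1)) 0 2 (r - (A - 1))"
  have e1: "eval (HSub 2 23 2) (eval (HConst 2 (A - 1)) s) = s1" using ctx by (simp add: s1_def ctx_def)
  have q1: "queue recs s1" unfolding s1_def by (intro queue_upd q) auto
  have ctx1: "ctx h r \<sigma> l s1" using ctx by (simp add: s1_def ctx_def)
  have f1: "frame {2} {} s s1" by (simp add: s1_def)
  have A20: "A - 1 < 2 ^ \<beta>"
  proof -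
    have "A - 1 < 2 ^ 11" using A_bounds by simp
    also have "(2::nat) ^ 11 \<le> 2 ^ \<beta>" using \<beta> by (intro power_increasing) auto
    finally show ?thesis .
  qed
  let ?w = "l * M * v" and ?kA = "KB + 7 * (A + 1)"
  have w: "?w \<le> C" "s1 0 27 = ?w" using region_le[OF l] ctx1 by (auto simp: ctx_def)
  have lv: "1 \<le> l * v" "1 \<le> ?w" "1 \<le> l * A * M * v" "1 \<le> A * M" using l v A_bounds M_pos by auto
  let ?D1 = "map (\<lambda>j. (40 + 2 * j, 29::nat)) [0..<A]"
  let ?D2 = "map (\<lambda>j. (40 + 2 * j, 28::nat)) [0..<A - 2] @ [(40 + 2 * (A - 2), 37), (40 + 2 * (A - 1), 26), (40 + 2 * A, 26)]"
  let ?P = "HConst 29 1 ;; HSub 1 27 29 ;; HWhile 1 (HConst 2 F ;; HAdd 29 29 2 ;; HSub 1 27 29)"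
  let ?Q = "\<lambda>s'. queue (recs @ kids (r, \<sigma>, ps) l) s' \<and> ctx h r \<sigma> l s' \<and> frame regt {3, 9, 10, 11} s s'"
  have fin: "?Q s'" if "J h r \<sigma> ps l p s2 (recs @ kids (r, \<sigma>, ps) l) s'" "frame {1, 2, 29} {} s1 s2" for p s2 s'
  proof -
    have "frame regt {3, 9, 10, 11} s s2"
      by (rule frame_trans[of _ _ _ s1]) (use f1 that(2) in \<open>auto elim!: frame_mono simp: regt_def gent_def\<close>)
    then have "frame regt {3, 9, 10, 11} s s'"
      by (rule frame_trans) (use that(1) in \<open>auto elim!: frame_mono simp: regt_def J_def\<close>)
    then show ?thesis using that(1) by (simp add: J_def)
  qed
  have kc: "10 * (K * M * bc) + 13 + (A * 2 + A * M * (6 * A + 7 * bc + 8) + 6) \<le> KB"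
    "10 * (K * M * bc) + 13 + (A * (M * (7 * bc + 9) + 7) + A * M * 5 + 6) \<le> KB"
    "10 * (K * M * bc) + 13 + (M * (7 * bc + 9) + 7) \<le> KB"
  proof -
    define X where "X = A * M"
    define Y where "Y = A * M * bc"
    define Z where "Z = A * M * A"
    have AM: "A \<le> X" "M \<le> X" "M * bc \<le> Y" using A_bounds M_pos by (auto simp: X_def Y_def)
    have e: "A * M * (7 * bc + 6 * A + 30) = 7 * Y + 6 * Z + 30 * X" "A * M * (6 * A + 7 * bc + 8) = 7 * Y + 6 * Z + 8 * X"
      "A * (M * (7 * bc + 9) + 7) = 7 * Y + 9 * X + 7 * A" "M * (7 * bc + 9) = 7 * (M * bc) + 9 * M" "A * M * 5 = 5 * X"
      by (simp_all add: X_def Y_def Z_def algebra_simps)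
    have "A * 2 + A * M * (6 * A + 7 * bc + 8) + 6 \<le> A * M * (7 * bc + 6 * A + 30) + 17"
      using AM unfolding e(1,2) by linarith
    moreover have "A * (M * (7 * bc + 9) + 7) + A * M * 5 + 6 \<le> A * M * (7 * bc + 6 * A + 30) + 17"
      using AM unfolding e(1,3,5) by linarith
    moreover have "M * (7 * bc + 9) + 7 \<le> A * M * (7 * bc + 6 * A + 30) + 17"
      using AM unfolding e(1,4) by linarith
    ultimately show "10 * (K * M * bc) + 13 + (A * 2 + A * M * (6 * A + 7 * bc + 8) + 6) \<le> KB"
      "10 * (K * M * bc) + 13 + (A * (M * (7 * bc + 9) + 7) + A * M * 5 + 6) \<le> KB"
      "10 * (K * M * bc) + 13 + (M * (7 * bc + 9) + 7) \<le> KB" unfolding KB_def by linarith+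
  qed
  let ?n = "length (kids (r, \<sigma>, ps) l)"
  have body: "run (HIf 2 (?P ;; nest ?D1 (CHILD BLK1 A) ;; nest ?D2 (CHILD BLK2 A)) (nest [(40, 28)] (CHILD BLK3 1))) s1
     (hcost [2] + (4 * ?n + 3 + ?n * ?kA)) ?Q"
  proof (rule run_If)
    assume "s1 0 2 \<noteq> 0"
    then have Ar: "A \<le> r" by (simp add: s1_def)
    let ?K1 = "map (\<lambda>ys. (r - A, \<sigma> + l - 1, ps @ blk1 \<sigma> l ys)) (box (box1 l))"
    let ?K2 = "map (\<lambda>ys. (r - A, \<sigma> + l - 1, ps @ blk2 \<sigma> l ys)) (box (box2 l))"
    have kids: "kids (r, \<sigma>, ps) l = ?K1 @ ?K2" using Ar by simp
    have n: "?n = length (box (box1 l)) + length (box (box2 l))" using Ar by simp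
    have AK: "A * M * bc \<le> K * M * bc" using Ar rK by (intro mult_le_mono1) simp
    \<comment> \<open>Pays for the search of the modulus: already the polynomials number
      \<open>pmod ?w ^ A\<close>.\<close>
    have wn: "?w \<le> ?n"
    proof -
      have "?w \<le> pmod ?w ^ 1" using pmod_ge[of ?w] by simp
      also have "\<dots> \<le> pmod ?w ^ A" using pmod_pos[of ?w] A_bounds by (intro power_increasing) auto
      finally show ?thesis unfolding n length_box box1_def prod_list_replicate by simp
    qed
    have "run (?P ;; nest ?D1 (CHILD BLK1 A) ;; nest ?D2 (CHILD BLK2 A)) s1
      ((4 * ?w + 3) + (length (box (box1 l)) * ?kA + length (box (box2 l)) * ?kA)) ?Q"
    proof (rule run_Seq[OF run_PLOOP[where s = s1 and w = ?w, OF w(2,1)]])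
      fix s2 assume s2: "bnd s2" "s2 0 29 = pmod ?w \<and> frame {1, 2, 29} {} s1 s2"
      have f2: "s2 0 x = s1 0 x" if "x \<notin> {1, 2, 29}" for x using s2(2) that by (simp add: frame_def)
      have a2: "s2 q = s1 q" if "q \<noteq> 0" for q using s2(2) that by (simp add: frame_def)
      have "queue recs s2" by (rule queue_cong[OF q1]) (use f2 a2 in auto)
      then have J0: "J h r \<sigma> ps l (pmod ?w) s2 recs s2" using h ctx1 f2 s2(2) by (simp add: J_def ctx_def)
      show "run (nest ?D1 (CHILD BLK1 A) ;; nest ?D2 (CHILD BLK2 A)) s2
        (length (box (box1 l)) * ?kA + length (box (box2 l)) * ?kA) ?Q"
      proof (rule run_Seq)
        show "run (nest ?D1 (CHILD BLK1 A)) s2 (length (box (box1 l)) * ?kA) (J h r \<sigma> ps l (pmod ?w) s2 (recs @ ?K1))"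
        proof (rule run_nestJ[OF J0])
          show "length recs + length (box (box1 l)) \<le> Nmax" using N n by simp
          show "good (r - A, \<sigma> + l - 1, ps @ blk1 \<sigma> l ys)" if "ys \<in> set (box (box1 l))" for ys
            by (rule good_kids[OF good r l]) (use that Ar in auto)
          show "s 0 (snd (?D1 ! i)) = box1 l ! i" if "i < length ?D1" "J h r \<sigma> ps l (pmod ?w) s2 recs s" for recs s i
            using that by (simp add: J_def box1_def)
          show "run BLK1 s1 (A * 2 + A * M * (6 * A + 7 * bc + 8) + 6) (app s (ps @ blk1 \<sigma> l ys))"
            if "J h r \<sigma> ps l (pmod ?w) s2 recs s" "length recs < Nmax" "app s ps s1" "ys \<in> set (box (box1 l))"
              "\<And>i. i < length ?D1 \<Longrightarrow> s 0 (fst (?D1 ! i)) = ys ! i" for recs s s1 ys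
            by (rule run_BLK1[OF that(3) _ _ _ l that(4)]) (use that J_lb[OF that(1,2) AK] in \<open>auto simp: J_def queue_def\<close>)
        qed (use kc(1) A_bounds pmod_pos[of ?w] digsI in \<open>auto simp: box1_def distinct_map inj_on_def\<close>)
        fix s3 assume s3: "J h r \<sigma> ps l (pmod ?w) s2 (recs @ ?K1) s3"
        have "run (nest ?D2 (CHILD BLK2 A)) s3 (length (box (box2 l)) * ?kA) (J h r \<sigma> ps l (pmod ?w) s2 ((recs @ ?K1) @ ?K2))"
        proof (rule run_nestJ[OF s3])
          show "length (recs @ ?K1) + length (box (box2 l)) \<le> Nmax" using N n by simp
          show "length (box2 l) = length ?D2" by (simp add: box2_def)
          show "length ?D2 \<le> A + 1" using A_bounds by simp
          have "A - 2 \<noteq> A - 1" "A - 2 \<noteq> A" "A - 1 \<noteq> A" using A_bounds by linarith+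
          then show "distinct (map fst ?D2)" by (auto simp: distinct_map inj_on_def comp_def)
          show "y \<in> digs \<and> b \<in> {26, 28, 29, 37}" if "(y, b) \<in> set ?D2" for y b
            using that digsI A_bounds by auto
          show "good (r - A, \<sigma> + l - 1, ps @ blk2 \<sigma> l ys)" if "ys \<in> set (box (box2 l))" for ys
            by (rule good_kids[OF good r l]) (use that Ar in auto)
          show "\<forall>b\<in>set (box2 l). 1 \<le> b" using lv by (auto simp: box2_def)
          show "s 0 (snd (?D2 ! i)) = box2 l ! i" if "i < length ?D2" "J h r \<sigma> ps l (pmod ?w) s2 recs s" for recs s i
          proof (cases "i < A - 2")
            case True then show ?thesis using that by (simp add: J_def ctx_def box2_def nth_append)
          next
            case False
            then have "i - (A - 2) = 0 \<or> i - (A - 2) = 1 \<or> i - (A - 2) = 2" using that(1) by auto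
            then show ?thesis using False that(2)
              by (auto simp: J_def ctx_def box2_def nth_append queue_def params_def)
          qed
          show "run BLK2 s1 (A * (M * (7 * bc + 9) + 7) + A * M * 5 + 6) (app s (ps @ blk2 \<sigma> l ys))"
            if "J h r \<sigma> ps l (pmod ?w) s2 recs s" "length recs < Nmax" "app s ps s1" "ys \<in> set (box (box2 l))"
              "\<And>i. i < length ?D2 \<Longrightarrow> s 0 (fst (?D2 ! i)) = ys ! i" for recs s s1 ys
          proof (rule run_BLK2[OF that(3) _ _ l that(4)])
            fix j assume j: "j \<le> A"
            have "fst (?D2 ! j) = 40 + 2 * j"
            proof (cases "j < A - 2")
              case True then show ?thesis by (simp add: nth_append)
            next
              case False
              then consider "j = A - 2" | "j = A - 1" "j - (A - 2) = 1" | "j = A" "j - (A - 2) = 2"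
                using j A_bounds by linarith
              then show ?thesis using False by cases (simp_all add: nth_append)
            qed
            then show "s 0 (40 + 2 * j) = ys ! j" using that(5)[of j] j A_bounds by simp
          qed (use that J_lb[OF that(1,2) AK] in \<open>auto simp: J_def queue_def\<close>)
        qed (use kc(2) A_bounds in auto)
        then show "run (nest ?D2 (CHILD BLK2 A)) s3 (length (box (box2 l)) * ?kA) ?Q"
        proof (rule run_mono)
          fix s' assume "J h r \<sigma> ps l (pmod ?w) s2 ((recs @ ?K1) @ ?K2) s'"
          then have "J h r \<sigma> ps l (pmod ?w) s2 (recs @ kids (r, \<sigma>, ps) l) s'" unfolding kids by simp
          then show "?Q s'" by (rule fin) (use s2 in simp)
        qed simp
      qed
    qed
    then show "run (?P ;; nest ?D1 (CHILD BLK1 A) ;; nest ?D2 (CHILD BLK2 A)) s1 (4 * ?n + 3 + ?n * ?kA) ?Q"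
    proof (rule run_mono)
      show "4 * ?w + 3 + (length (box (box1 l)) * ?kA + length (box (box2 l)) * ?kA) \<le> 4 * ?n + 3 + ?n * ?kA"
        using wn unfolding n by (simp add: add_mult_distrib)
    qed
  next
    assume "s1 0 2 = 0"
    then have Ar: "\<not> A \<le> r" using A_bounds by (auto simp: s1_def)
    let ?K3 = "map (\<lambda>ys. (r - 1, \<sigma> + l - 1, ps @ blk3 \<sigma> l ys)) (box (box3 l))"
    have kids: "kids (r, \<sigma>, ps) l = ?K3" using Ar by simp
    have n: "?n = length (box (box3 l))" unfolding kids by simp
    have J0: "J h r \<sigma> ps l (s1 0 29) s1 recs s1" using h ctx1 q1 by (simp add: J_def)
    have K1: "M * bc \<le> K * M * bc" using K by simp
    have "run (nest [(40, 28)] (CHILD BLK3 1)) s1 (length (box (box3 l)) * ?kA) (J h r \<sigma> ps l (s1 0 29) s1 (recs @ ?K3))"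
    proof (rule run_nestJ[OF J0])
      show "length recs + length (box (box3 l)) \<le> Nmax" using N n by simp
      show "good (r - 1, \<sigma> + l - 1, ps @ blk3 \<sigma> l ys)" if "ys \<in> set (box (box3 l))" for ys
        by (rule good_kids[OF good r l]) (use that Ar in auto)
      show "s 0 (snd ([(40, 28)] ! i)) = box3 l ! i" if "i < length [(40::nat, 28)]" "J h r \<sigma> ps l (s1 0 29) s1 recs s" for recs s i
        using that by (simp add: J_def ctx_def box3_def)
      show "run BLK3 s1' (M * (7 * bc + 9) + 7) (app s (ps @ blk3 \<sigma> l ys))"
        if "J h r \<sigma> ps l (s1 0 29) s1 recs s" "length recs < Nmax" "app s ps s1'" "ys \<in> set (box (box3 l))"
          "\<And>i. i < length [(40::nat, 28::nat)] \<Longrightarrow> s 0 (fst ([(40, 28::nat)] ! i)) = ys ! i" for recs s s1' ys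
        by (rule run_BLK3[OF that(3) _ _ l that(4)]) (use that J_lb[OF that(1,2) K1] in \<open>auto simp: J_def queue_def\<close>)
    qed (use kc(3) lv digsI[of 0] in \<open>auto simp: box3_def\<close>)
    then show "run (nest [(40, 28)] (CHILD BLK3 1)) s1 (4 * ?n + 3 + ?n * ?kA) ?Q"
    proof (rule run_mono)
      show "length (box (box3 l)) * ?kA \<le> 4 * ?n + 3 + ?n * ?kA" unfolding n by simp
      fix s' assume "J h r \<sigma> ps l (s1 0 29) s1 (recs @ ?K3) s'"
      then have "J h r \<sigma> ps l (s1 0 29) s1 (recs @ kids (r, \<sigma>, ps) l) s'" unfolding kids .
      then show "?Q s'" by (rule fin) simp
    qed
  qed simp
  have "run KIDS s (1 + (1 + (hcost [2] + (4 * ?n + 3 + ?n * ?kA)))) ?Q"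
    unfolding KIDS_def
  proof (intro run_step)
    show "run (HIf 2 (?P ;; nest ?D1 (CHILD BLK1 A) ;; nest ?D2 (CHILD BLK2 A)) (nest [(40, 28)] (CHILD BLK3 1)))
      (eval (HSub 2 23 2) (eval (HConst 2 (A - 1)) s)) (hcost [2] + (4 * ?n + 3 + ?n * ?kA)) ?Q"
      unfolding e1 by (rule body)
  qed (use A20 in \<open>auto simp: heavy_def\<close>)
  then show ?thesis by (rule run_mono) (auto simp: heavy_def algebra_simps)
qed

end

section \<open>Parameters and the queue of records\<close>

definition MUL :: "nat \<Rightarrow> nat \<Rightarrow> nat \<Rightarrow> hl" where
  "MUL d x c = HConst d 0 ;; FOR 31 c (HAdd d d x)"

text \<open>Truncated subtraction gives k + (1 - k) = max k 1, and likewise for t, so that the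
  program is sound also for those n where a value is 0. The loop computes v, the quotient of t by K
  * A * M rounded up. The root record needs only its entry K; its other entries are 0 in fresh
  memory.\<close>

definition PARAMS :: hl where
  "PARAMS =
     (HConst 2 1 ;; HSub 2 2 10 ;; HAdd 10 10 2 ;; HConst 2 1 ;; HSub 2 2 11 ;; HAdd 11 11 2 ;;
      HConst 36 M ;; HConst 37 (A * M)) ;;
     MUL 12 37 10 ;;
     (HConst 13 0 ;; HConst 38 0 ;; HSub 1 11 38) ;;
     HWhile 1 (HAdd 38 38 12 ;; HConst 2 1 ;; HAdd 13 13 2 ;; HSub 1 11 38) ;;
     MUL 14 13 36 ;; HConst 38 A ;; MUL 15 14 38 ;; MUL 16 15 36 ;; MUL 17 16 10 ;;
     (HConst 38 1 ;; HAdd 38 38 0) ;; MUL 18 12 38 ;;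
     (HConst 19 0 ;; HPut 9 19 10 ;; HConst 19 1 ;; HConst 22 0 ;; HAdd 22 22 18)"

definition SETUP :: hl where
  "SETUP = PARAMS ;; BFS"

context machine
begin

lemma run_MUL:
  assumes "d < 100" "x < 100" "c < 100" "\<not> heavy d" "\<not> heavy x" "\<not> heavy c" "d \<notin> {1, 31}" "x \<notin> {1, 31}" "c \<notin> {1, 31}"
    "d \<noteq> x" "d \<noteq> c" and small: "s 0 c * s 0 x < 2 ^ \<beta>"
  shows "run (MUL d x c) s (5 * s 0 c + 4) (\<lambda>s'. s' 0 d = s 0 c * s 0 x \<and> frame {1, 31, d} {} s s')"
proof -
  let ?n = "s 0 c" and ?x = "s 0 x"
  have "run (MUL d x c) s (1 + ((\<Sum>j<?n. 1 + 4) + 3)) (\<lambda>s'. s' 0 d = ?n * ?x \<and> frame {1, 31, d} {} s s')"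
    unfolding MUL_def
  proof (intro run_step run_FOR[where I = "\<lambda>j s'. s' 0 d = j * ?x \<and> frame {1, 31, d} {} s s'"])
    fix j s' assume j: "j < ?n" "bnd s'" "s' 0 d = j * ?x \<and> frame {1, 31, d} {} s s'" "s' 0 31 = j" "s' 0 c = ?n"
    have x: "s' 0 x = ?x" using j(3) assms by (auto simp: frame_def)
    have "Suc j * ?x \<le> ?n * ?x" using j(1) by (intro mult_le_mono1) simp
    then have "j * ?x + ?x < 2 ^ \<beta>" using small by simp
    then show "run (HAdd d d x) s' 1 (\<lambda>s''. s'' 0 31 = j \<and> s'' 0 c = ?n \<and>
      (\<forall>t. upd (upd s'' 0 31 (Suc j)) 0 1 t 0 d = Suc j * ?x \<and> frame {1, 31, d} {} s (upd (upd s'' 0 31 (Suc j)) 0 1 t)))"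
      using assms j x by (intro run_simple) auto
  qed (use assms in \<open>auto simp: heavy_def\<close>)
  then show ?thesis by (rule run_mono) auto
qed

end

context family
begin

definition KX :: nat where "KX = KB + 7 * A + 26"

lemma kidsall_eq: "r \<noteq> 0 \<Longrightarrow> kidsall (r, \<sigma>, ps) = concat (map (kids (r, \<sigma>, ps)) [1..<Suc (K - \<sigma>)])"
  by (simp add: kidsall.simps)

declare kids.simps [simp del] kidsall.simps [simp del]

lemma length_kidsall:
  "r \<noteq> 0 \<Longrightarrow> length (kidsall (r, \<sigma>, ps)) = (\<Sum>l = 1..<Suc (K - \<sigma>). length (kids (r, \<sigma>, ps) l))"
  unfolding kidsall_eq length_concat map_map
  by (simp add: comp_def sum_set_upt_conv_sum_list_nat[symmetric] del: upt_Suc)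

end

context gen
begin

lemma regtI: "1 \<in> regt" "2 \<in> regt" "24 \<in> regt" "26 \<in> regt" "27 \<in> regt" "28 \<in> regt"
  by (auto simp: regt_def gent_def)

lemma run_REGION:
  assumes q: "queue recs s" and h: "h < length recs" "recs ! h = (r, \<sigma>, ps)"
    and k: "s 0 20 = h" "s 0 21 = h * rho" "s 0 23 = r" "s 0 25 = \<sigma> * L" and r: "r \<noteq> 0"
    and N: "length recs + length (kidsall (r, \<sigma>, ps)) \<le> Nmax"
  shows "run REGION s (length (kidsall (r, \<sigma>, ps)) * KX + 10)
    (\<lambda>s'. queue (recs @ kidsall (r, \<sigma>, ps)) s' \<and> frame regt {3, 9, 10, 11} s s')"
proof -
  let ?k = "kids (r, \<sigma>, ps)"
  let ?n = "\<lambda>l. length (?k l)"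
  define R where "R l = recs @ concat (map ?k [1..<l])" for l
  have R1: "R 1 = recs" by (simp add: R_def)
  have RS: "R (Suc l) = R l @ ?k l" if "1 \<le> l" for l
    using that by (simp add: R_def)
  have good: "good (r, \<sigma>, ps)" using q h nth_mem[of h recs] by (auto simp: queue_def simp del: good.simps)
  then have \<sigma>K: "\<sigma> < K" by simp
  have RK: "R (Suc (K - \<sigma>)) = recs @ kidsall (r, \<sigma>, ps)" by (simp only: R_def kidsall_eq[OF r])
  have RN: "length (R l) \<le> Nmax" if "l \<le> Suc (K - \<sigma>)" for l
  proof -
    have "length (R l) = length recs + (\<Sum>l' = 1..<l. ?n l')"
      by (simp add: R_def length_concat comp_def sum_set_upt_conv_sum_list_nat[symmetric])
    also have "(\<Sum>l' = 1..<l. ?n l') \<le> (\<Sum>l' = 1..<Suc (K - \<sigma>). ?n l')" using that by (intro sum_mono2) auto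
    finally show ?thesis using N length_kidsall[OF r] by simp
  qed
  have Rh: "h < length (R l)" "R l ! h = (r, \<sigma>, ps)" for l using h by (auto simp: R_def nth_append)
  let ?B = "KIDS ;; (HAdd 24 24 16 ;; HAdd 26 26 13 ;; HAdd 27 27 14 ;; HAdd 28 28 15 ;; HSub 1 17 24)"
  \<comment> \<open>The counter l is not stored, only its multiples in 24, 26, 27 and 28; the loop
    ends when \<sigma> + l - 1 reaches K, that is when register 24 reaches C.\<close>
  define I where "I t s' \<longleftrightarrow> (\<exists>l. 1 \<le> l \<and> \<sigma> + l \<le> Suc K \<and> queue (R l) s' \<and> ctx h r \<sigma> l s' \<and> frame regt {3, 9, 10, 11} s s' \<and>
     s' 0 1 = C - (\<sigma> + l - 1) * L \<and> t = (\<Sum>l' = l..<Suc (K - \<sigma>). ?n l' * KX))" for t s'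
  have test: "C - (\<sigma> + l - 1) * L \<noteq> 0 \<longleftrightarrow> \<sigma> + l \<le> K" if "1 \<le> l" for l
  proof -
    have "C - (\<sigma> + l - 1) * L \<noteq> 0 \<longleftrightarrow> (\<sigma> + l - 1) * L < K * L" by (auto simp: C_def)
    also have "\<dots> \<longleftrightarrow> \<sigma> + l - 1 < K" using L_pos by simp
    also have "\<dots> \<longleftrightarrow> \<sigma> + l \<le> K" using that by auto
    finally show ?thesis .
  qed
  let ?post = "\<lambda>s'. queue (recs @ kidsall (r, \<sigma>, ps)) s' \<and> frame regt {3, 9, 10, 11} s s'"
  have w: "run (HWhile 1 ?B) s' ((\<Sum>l' = 1..<Suc (K - \<sigma>). ?n l' * KX) + 1) ?post"
    if "I (\<Sum>l' = 1..<Suc (K - \<sigma>). ?n l' * KX) s'" for s'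
  proof (rule run_While_budget[of _ I, OF _ _ _ _ that])
    fix t s' assume s': "bnd s'" "I t s'" "s' 0 1 \<noteq> 0"
    then obtain l where l: "1 \<le> l" "\<sigma> + l \<le> Suc K" "queue (R l) s'" "ctx h r \<sigma> l s'" "frame regt {3, 9, 10, 11} s s'"
       "s' 0 1 = C - (\<sigma> + l - 1) * L" "t = (\<Sum>l' = l..<Suc (K - \<sigma>). ?n l' * KX)" by (auto simp: I_def)
    have lK: "\<sigma> + l \<le> K" using test[OF l(1)] l(6) s'(3) by simp
    let ?t = "\<Sum>l' = Suc l..<Suc (K - \<sigma>). ?n l' * KX"
    have RlN: "length (R l) + ?n l \<le> Nmax" using RN[of "Suc l"] lK RS[OF l(1)] by simp
    have "run ?B s' ((?n l * (KB + 7 * A + 14) + 6) + 5) (I ?t)"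
    proof (rule run_Seq[OF run_KIDS[OF l(3) Rh l(4) l(1) lK r RlN]])
      fix s2 assume s2: "bnd s2" "queue (R l @ ?k l) s2 \<and> ctx h r \<sigma> l s2 \<and> frame regt {3, 9, 10, 11} s' s2"
      have q2: "queue (R (Suc l)) s2" using s2(2) RS[OF l(1)] by simp
      have p2: "s2 0 16 = L" "s2 0 13 = v" "s2 0 14 = M * v" "s2 0 15 = A * M * v" "s2 0 17 = C"
        using q2 by (auto simp: queue_def params_def)
      have c2: "s2 0 24 = (\<sigma> + l - 1) * L" "s2 0 26 = l * v" "s2 0 27 = l * M * v" "s2 0 28 = l * A * M * v"
        using s2(2) by (auto simp: ctx_def)
      have add: "(\<sigma> + l - 1) * L + L = (\<sigma> + l) * L" "l * v + v = Suc l * v" "l * M * v + M * v = Suc l * M * v"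
        "l * A * M * v + A * M * v = Suc l * A * M * v"
      proof -
        have "(\<sigma> + l - 1) * L + L = Suc (\<sigma> + l - 1) * L" by simp
        also have "Suc (\<sigma> + l - 1) = \<sigma> + l" using l(1) by simp
        finally show "(\<sigma> + l - 1) * L + L = (\<sigma> + l) * L" .
      qed (simp_all add: add_mult_distrib)
      let ?S = "HAdd 24 24 16 ;; HAdd 26 26 13 ;; HAdd 27 27 14 ;; HAdd 28 28 15 ;; HSub 1 17 24"
      have l1: "1 \<le> (1::nat)" "\<sigma> + 1 \<le> K" using \<sigma>K by auto
      note b = region_le[OF l(1) lK] region_le[OF l1]
      show "run ?S s2 5 (I ?t)"
      proof (rule run_simple)
        have "l * v + v \<le> 2 * C" "l * M * v + M * v \<le> 2 * C" "l * A * M * v + A * M * v \<le> 2 * C"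
          using add_mono[OF b(4) b(12)] add_mono[OF b(3) b(11)] add_mono[OF b(5) b(13)] by simp_all
        then have "l * v + v < 2 ^ \<beta>" "l * M * v + M * v < 2 ^ \<beta>" "l * A * M * v + A * M * v < 2 ^ \<beta>" "(\<sigma> + l - 1) * L + L < 2 ^ \<beta>"
          using b(7) unfolding add(1) by (intro short_sum; linarith)+
        then show "safe ?S s2" using p2 c2 by (simp add: heavy_def)
        define E where "E = eval ?S s2"
        have e: "E 0 x = (if x = 1 then C - (\<sigma> + l) * L else if x = 28 then Suc l * A * M * v else if x = 27 then Suc l * M * v
            else if x = 26 then Suc l * v else if x = 24 then (\<sigma> + l) * L else s2 0 x)" for x
          using p2 c2 add unfolding E_def by simp
        have eq: "E q = s2 q" if "q \<noteq> 0" for q using that by (simp add: E_def)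
        have "queue (R (Suc l)) E" by (rule queue_cong[OF q2]) (use e eq in auto)
        moreover have "ctx h r \<sigma> (Suc l) E" using s2(2) unfolding ctx_def e by simp
        moreover have "frame regt {3, 9, 10, 11} s E"
        proof (rule frame_trans[OF frame_trans[OF l(5)], of s2])
          show "frame regt {3, 9, 10, 11} s' s2" using s2(2) by simp
          show "frame regt {3, 9, 10, 11} s2 E" using regtI by (simp add: E_def)
        qed
        ultimately show "I ?t (eval ?S s2)" unfolding I_def E_def[symmetric] using e lK l(1)
          by (intro exI[of _ "Suc l"]) simp
      qed (auto simp: heavy_def)
    qed
    moreover have "?n l * (KB + 7 * A + 14) + 6 + 5 + 1 + ?t \<le> t"
    proof -
      have n1: "1 \<le> ?n l" by (rule length_kids_pos[OF l(1)])
      have "?n l * (KB + 7 * A + 14) + 12 \<le> ?n l * KX" using n1 unfolding KX_def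
        by (simp add: add_mult_distrib2)
      moreover have "t = ?n l * KX + ?t" using lK l(7) by (subst l(7), subst sum.atLeast_Suc_lessThan) auto
      ultimately show ?thesis by linarith
    qed
    ultimately show "\<exists>k t'. k + 1 + t' \<le> t \<and> run ?B s' k (I t')" by blast
  next
    fix t s' assume s': "bnd s'" "I t s'" "s' 0 1 = 0"
    then obtain l where l: "1 \<le> l" "\<sigma> + l \<le> Suc K" "queue (R l) s'" "frame regt {3, 9, 10, 11} s s'"
       "s' 0 1 = C - (\<sigma> + l - 1) * L" by (auto simp: I_def)
    have "\<not> \<sigma> + l \<le> K" using test[OF l(1)] l(5) s'(3) by simp
    then have "l = Suc (K - \<sigma>)" using l(2) \<sigma>K by linarith
    then show "?post s'" using l(3,4) RK by simp
  qed (auto simp: heavy_def)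
  have sum: "(\<Sum>l' = 1..<Suc (K - \<sigma>). ?n l' * KX) = length (kidsall (r, \<sigma>, ps)) * KX"
    unfolding length_kidsall[OF r] sum_distrib_right ..
  let ?S = "COPY 24 25 ;; COPY 26 13 ;; COPY 27 14 ;; COPY 28 15 ;; HSub 1 17 24"
  have "run REGION s (9 + ((\<Sum>l' = 1..<Suc (K - \<sigma>). ?n l' * KX) + 1)) ?post"
  proof (rule run_bnd)
    assume bs: "bnd s"
    show "run REGION s (9 + ((\<Sum>l' = 1..<Suc (K - \<sigma>). ?n l' * KX) + 1)) ?post"
      unfolding REGION_def
    proof (rule run_step)
      have p: "s 0 13 = v" "s 0 14 = M * v" "s 0 15 = A * M * v" "s 0 17 = C" using q by (auto simp: queue_def params_def)
      show "safe ?S s" using bndD[OF bs] by (auto simp: COPY_def heavy_def)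
      define E where "E = eval ?S s"
      have e: "E 0 x = (if x = 1 then C - \<sigma> * L else if x = 28 then A * M * v else if x = 27 then M * v
          else if x = 26 then v else if x = 24 then \<sigma> * L else s 0 x)" for x
        using p k by (simp add: COPY_def E_def)
      have eq: "E q = s q" if "q \<noteq> 0" for q using that by (simp add: COPY_def E_def)
      have "queue (R 1) E" unfolding R1 by (rule queue_cong[OF q]) (use e eq in auto)
      moreover have "ctx h r \<sigma> 1 E" using k e by (simp add: ctx_def)
      moreover have "frame regt {3, 9, 10, 11} s E" using regtI by (simp add: COPY_def E_def)
      ultimately have "I (\<Sum>l' = 1..<Suc (K - \<sigma>). ?n l' * KX) E"
        unfolding I_def using e \<sigma>K by (intro exI[of _ 1]) simp
      then show "run (HWhile 1 ?B) (eval ?S s) ((\<Sum>l' = 1..<Suc (K - \<sigma>). ?n l' * KX) + 1) ?post"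
        unfolding E_def[symmetric] by (rule w)
    qed (auto simp: COPY_def heavy_def)
  qed
  then show ?thesis unfolding sum by (rule run_mono) auto
qed

text \<open>The number of processed records plus the sum of \<phi> over the pending ones never
  increases: a processed record trades its \<phi> for 1 and those of its children. As \<phi> is at
  least 1, the queue never exceeds \<phi> of the root, and the same invariant yields termination and
  the short addresses.\<close>

lemma run_BFS:
  fixes \<phi> :: "rec \<Rightarrow> real"
  assumes q: "queue [(K, 0, [])] s"
    and \<phi>: "\<And>\<rho>. 1 \<le> \<phi> \<rho>" "\<And>\<rho>. good \<rho> \<Longrightarrow> 1 + (\<Sum>c\<leftarrow>kidsall \<rho>. \<phi> c) \<le> \<phi> \<rho>" "\<phi> (K, 0, []) \<le> real Nmax"
  shows "run BFS s (Nmax * (KX + 30) + 10) (\<lambda>s'. \<exists>recs. queue recs s' \<and> length recs \<le> Nmax \<and> (K, 0, []) \<in> set recs \<and>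
     (\<forall>\<rho> \<in> set recs. set (kidsall \<rho>) \<subseteq> set recs) \<and> frame (regt \<union> {20, 21, 23, 25}) {3, 9, 10, 11} s s')"
proof -
  let ?B = "HGet 23 9 20 ;; HIf 23 (HGet 25 10 20 ;; REGION) HSkip ;; (HConst 2 1 ;; HAdd 20 20 2 ;; HAdd 21 21 18 ;; HSub 1 19 20)"
  let ?F = "regt \<union> {20, 21, 23, 25}"
  define I where "I t s' \<longleftrightarrow> (\<exists>recs h. queue recs s' \<and> h \<le> length recs \<and> s' 0 20 = h \<and> s' 0 21 = h * rho \<and> s' 0 1 = length recs - h \<and>
     (K, 0, []) \<in> set recs \<and> (\<forall>e < h. set (kidsall (recs ! e)) \<subseteq> set recs) \<and>
     real h + (\<Sum>c\<leftarrow>drop h recs. \<phi> c) \<le> real Nmax \<and> frame ?F {3, 9, 10, 11} s s' \<and>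
     t = (Nmax - length recs) * KX + (Nmax - h) * 30)" for t s'
  have lenN: "length recs \<le> Nmax" if "h \<le> length recs" "real h + (\<Sum>c\<leftarrow>drop h recs. \<phi> c) \<le> real Nmax" for recs :: "rec list" and h
  proof -
    have "(\<Sum>c\<leftarrow>drop h recs. 1) \<le> (\<Sum>c\<leftarrow>drop h recs. \<phi> c)" by (intro sum_list_mono \<phi>(1))
    then have "real (length recs) \<le> real Nmax" using that by (simp add: sum_list_triv of_nat_diff)
    then show ?thesis by simp
  qed
  let ?post = "\<lambda>s'. \<exists>recs. queue recs s' \<and> length recs \<le> Nmax \<and> (K, 0, []) \<in> set recs \<and>
     (\<forall>\<rho> \<in> set recs. set (kidsall \<rho>) \<subseteq> set recs) \<and> frame ?F {3, 9, 10, 11} s s'"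
  have w: "run (HWhile 1 ?B) s' (((Nmax - 1) * KX + Nmax * 30) + 1) ?post" if "I ((Nmax - 1) * KX + Nmax * 30) s'" for s'
  proof (rule run_While_budget[of _ I, OF _ _ _ _ that])
    fix t s' assume s': "bnd s'" "I t s'" "s' 0 1 \<noteq> 0"
    then obtain recs h where i: "queue recs s'" "s' 0 20 = h" "s' 0 21 = h * rho" "h < length recs" "(K, 0, []) \<in> set recs"
      "\<forall>e < h. set (kidsall (recs ! e)) \<subseteq> set recs" "real h + (\<Sum>c\<leftarrow>drop h recs. \<phi> c) \<le> real Nmax" "frame ?F {3, 9, 10, 11} s s'"
      "t = (Nmax - length recs) * KX + (Nmax - h) * 30" by (auto simp: I_def)
    obtain r \<sigma> ps where \<rho>: "recs ! h = (r, \<sigma>, ps)" by (cases "recs ! h")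
    let ?ks = "kidsall (r, \<sigma>, ps)"
    have good: "good (r, \<sigma>, ps)" using i(1,4) \<rho> nth_mem[of h recs] by (auto simp: queue_def simp del: good.simps)
    have rec: "s' 9 h = r" "s' 10 h = \<sigma> * L" using i(1,4) \<rho> by (auto simp: queue_def recs_ok_def)
    have drop: "drop h recs = (r, \<sigma>, ps) # drop (Suc h) recs" using Cons_nth_drop_Suc[OF i(4)] \<rho> by simp
    have pot: "real (Suc h) + (\<Sum>c\<leftarrow>drop (Suc h) (recs @ ?ks). \<phi> c) \<le> real Nmax"
      using i(4,7) \<phi>(2)[OF good] unfolding drop by simp
    have N: "length recs + length ?ks \<le> Nmax" using lenN[of "Suc h" "recs @ ?ks"] i(4) pot by simp
    define s1 where "s1 = upd s' 0 23 r"
    have e1: "eval (HGet 23 9 20) s' = s1" using i(2) rec by (simp add: s1_def)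
    have q1: "queue recs s1" unfolding s1_def by (intro queue_upd i(1)) auto
    let ?mid = "\<lambda>s'. queue (recs @ ?ks) s' \<and> s' 0 20 = h \<and> s' 0 21 = h * rho \<and> frame ?F {3, 9, 10, 11} s s'"
    have f1: "frame ?F {3, 9, 10, 11} s s1" using i(8) by (simp add: s1_def)
    have mid: "run (HIf 23 (HGet 25 10 20 ;; REGION) HSkip) s1 (hcost [23] + (1 + (length ?ks * KX + 10))) ?mid"
    proof (rule run_If)
      assume r: "s1 0 23 \<noteq> 0"
      then have r: "r \<noteq> 0" by (simp add: s1_def)
      define s2 where "s2 = upd s1 0 25 (\<sigma> * L)"
      have e2: "eval (HGet 25 10 20) s1 = s2" using i(2) rec by (simp add: s1_def s2_def)
      have q2: "queue recs s2" unfolding s2_def by (intro queue_upd q1) auto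
      show "run (HGet 25 10 20 ;; REGION) s1 (1 + (length ?ks * KX + 10)) ?mid"
      proof (rule run_step)
        show "run REGION (eval (HGet 25 10 20) s1) (length ?ks * KX + 10) ?mid"
          unfolding e2
        proof (rule run_mono[OF run_REGION[OF q2 i(4) \<rho> _ _ _ _ r N]])
          fix s3 assume s3: "queue (recs @ ?ks) s3 \<and> frame regt {3, 9, 10, 11} s2 s3"
          have "frame ?F {3, 9, 10, 11} s s2" using f1 by (simp add: s2_def)
          then have "frame ?F {3, 9, 10, 11} s s3" by (rule frame_trans) (use s3 in \<open>auto elim: frame_mono\<close>)
          moreover have "s3 0 20 = s2 0 20" "s3 0 21 = s2 0 21" using s3 by (auto simp: frameD0)
          ultimately show "?mid s3" using s3 i(2,3) by (simp add: s1_def s2_def)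
        qed (use i(2,3) in \<open>auto simp: s1_def s2_def\<close>)
      qed (auto simp: heavy_def)
    next
      assume "s1 0 23 = 0"
      then have "r = 0" by (simp add: s1_def)
      then have "?mid s1" using q1 f1 i(2,3) by (simp add: s1_def kidsall.simps)
      then show "run HSkip s1 (1 + (length ?ks * KX + 10)) ?mid" by (intro run_mono[OF run_Skip[where Q = ?mid]]) auto
    qed simp
    let ?t = "(Nmax - length (recs @ ?ks)) * KX + (Nmax - Suc h) * 30"
    have "run ?B s' (1 + ((hcost [23] + (1 + (length ?ks * KX + 10))) + 4)) (I ?t)"
    proof (rule run_step)
      show "run (HIf 23 (HGet 25 10 20 ;; REGION) HSkip ;; (HConst 2 1 ;; HAdd 20 20 2 ;; HAdd 21 21 18 ;; HSub 1 19 20))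
        (eval (HGet 23 9 20) s') ((hcost [23] + (1 + (length ?ks * KX + 10))) + 4) (I ?t)"
        unfolding e1
      proof (rule run_Seq[OF mid])
        fix s4 assume s4: "bnd s4" "?mid s4"
        then have p4: "s4 0 18 = rho" "s4 0 19 = length (recs @ ?ks)" by (auto simp: queue_def params_def)
        let ?S = "HConst 2 1 ;; HAdd 20 20 2 ;; HAdd 21 21 18 ;; HSub 1 19 20"
        show "run ?S s4 4 (I ?t)"
        proof (rule run_simple)
          have "h < Nmax" using i(4) N by simp
          then have hr: "h * rho + rho < 2 ^ \<beta>" using row_short[of h rho] by simp
          have "0 < rho" using K A_bounds M_pos by (simp add: rho_def)
          then have "Suc h \<le> h * rho + rho" using mult_le_mono2[of 1 rho "Suc h"] by simp
          then have "Suc h < 2 ^ \<beta>" using hr by (rule le_less_trans)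
          then show "safe ?S s4" using s4(2) p4 hr one_short by (simp add: heavy_def)
          define E where "E = eval ?S s4"
          have e: "E 0 x = (if x = 1 then length (recs @ ?ks) - Suc h else if x = 21 then Suc h * rho
              else if x = 20 then Suc h else if x = 2 then 1 else s4 0 x)" for x
            using s4(2) p4 unfolding E_def by simp
          have eq: "E q = s4 q" if "q \<noteq> 0" for q using that by (simp add: E_def)
          have "queue (recs @ ?ks) E" by (rule queue_cong[of _ s4]) (use e eq s4(2) in auto)
          moreover have "frame ?F {3, 9, 10, 11} s E" using s4(2) regtI by (simp add: E_def)
          moreover have "\<forall>e < Suc h. set (kidsall ((recs @ ?ks) ! e)) \<subseteq> set (recs @ ?ks)"
          proof (intro allI impI)
            fix e assume "e < Suc h"
            then consider "e < h" | "e = h" by fastforce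
            then show "set (kidsall ((recs @ ?ks) ! e)) \<subseteq> set (recs @ ?ks)"
            proof cases
              case 1 then show ?thesis using i(4,6) by (auto simp: nth_append)
            next
              case 2 then show ?thesis using i(4) \<rho> by (simp add: nth_append)
            qed
          qed
          ultimately show "I ?t (eval ?S s4)"
            unfolding I_def E_def[symmetric] using e i(4,5) pot by (intro exI[of _ "recs @ ?ks"] exI[of _ "Suc h"]) simp
        qed (auto simp: heavy_def)
      qed
    qed (auto simp: heavy_def)
    moreover have "1 + ((hcost [23] + (1 + (length ?ks * KX + 10))) + 4) + 1 + ?t \<le> t"
    proof -
      have "(Nmax - length recs) = length ?ks + (Nmax - length (recs @ ?ks))" "Nmax - h = 1 + (Nmax - Suc h)"
        using N i(4) by auto
      then have "t = (length ?ks + (Nmax - length (recs @ ?ks))) * KX + (1 + (Nmax - Suc h)) * 30" using i(9) by simp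
      then have "t = length ?ks * KX + 30 + ?t" by (simp add: add_mult_distrib)
      moreover have "hcost [23] = 1" by (simp add: heavy_def)
      ultimately show ?thesis by linarith
    qed
    ultimately show "\<exists>k t'. k + 1 + t' \<le> t \<and> run ?B s' k (I t')" by blast
  next
    fix t s' assume s': "bnd s'" "I t s'" "s' 0 1 = 0"
    then obtain recs h where i: "queue recs s'" "h = length recs" "(K, 0, []) \<in> set recs"
      "\<forall>e < h. set (kidsall (recs ! e)) \<subseteq> set recs" "real h + (\<Sum>c\<leftarrow>drop h recs. \<phi> c) \<le> real Nmax" "frame ?F {3, 9, 10, 11} s s'"
      by (auto simp: I_def)
    have c: "\<forall>\<rho> \<in> set recs. set (kidsall \<rho>) \<subseteq> set recs"
    proof
      fix \<rho> assume "\<rho> \<in> set recs"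
      then obtain e where "e < length recs" "recs ! e = \<rho>" by (meson in_set_conv_nth)
      then show "set (kidsall \<rho>) \<subseteq> set recs" using i(2,4) by blast
    qed
    have "length recs \<le> Nmax" by (rule lenN[of h]) (use i(2,5) in simp_all)
    then show "?post s'" using i(1,3,6) c by blast
  qed (auto simp: heavy_def)
  have N1: "1 \<le> Nmax" using \<phi>(1)[of "(K, 0, [])"] \<phi>(3) by linarith
  have "run BFS s (3 + (((Nmax - 1) * KX + Nmax * 30) + 1)) ?post"
    unfolding BFS_def
  proof (rule run_step)
    define E where "E = eval (HConst 20 0 ;; HConst 21 0 ;; HSub 1 19 20) s"
    have e: "E 0 x = (if x = 1 then 1 else if x = 20 \<or> x = 21 then 0 else s 0 x)" for x
      using q by (simp add: queue_def E_def)
    have eq: "E q = s q" if "q \<noteq> 0" for q using that by (simp add: E_def)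
    have f: "frame ?F {3, 9, 10, 11} s E" using regtI by (simp add: E_def)
    have "queue [(K, 0, [])] E" by (rule queue_cong[OF q]) (use e eq in auto)
    then have "I ((Nmax - 1) * KX + Nmax * 30) E"
      unfolding I_def using e \<phi>(3) f by (intro exI[of _ "[(K, 0, [])]"] exI[of _ 0]) auto
    then show "run (HWhile 1 ?B) (eval (HConst 20 0 ;; HConst 21 0 ;; HSub 1 19 20) s) (((Nmax - 1) * KX + Nmax * 30) + 1) ?post"
      unfolding E_def[symmetric] by (rule w)
  qed (auto simp: heavy_def)
  then show ?thesis
  proof (rule run_mono)
    have "(Nmax - 1) * KX \<le> Nmax * KX" by simp
    then show "3 + (((Nmax - 1) * KX + Nmax * 30) + 1) \<le> Nmax * (KX + 30) + 10" unfolding add_mult_distrib2 by linarith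
  qed
qed

lemma run_PARAMS:
  assumes s: "s 0 0 = n" "s 0 10 = k0" "s 0 11 = t0" "\<And>q. q \<in> {9, 10, 11} \<Longrightarrow> s q = (\<lambda>_. 0)"
    and Kv: "K = k0 + (1 - k0)" "v = (t0 + (1 - t0) + K * (A * M) - 1) div (K * (A * M))"
    and N: "1 \<le> Nmax"
  shows "run PARAMS s (10 * K + 5 * v + 10 * M + 5 * A + 5 * n + 100)
    (\<lambda>s'. queue [(K, 0, [])] s' \<and> frame ({1, 2, 10, 11, 12, 13, 14, 15, 16, 17, 18, 19, 22, 31, 36, 37, 38}) {9} s s')"
proof -
  define T where "T = t0 + (1 - t0)"
  define X where "X = K * (A * M)"
  have X0: "0 < X" using K A_bounds M_pos by (simp add: X_def)
  \<comment> \<open>The program tests the right-hand side; so v is the number of passes of its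
    loop.\<close>
  have vX: "i < v \<longleftrightarrow> i * X < T" for i
  proof -
    have "i < v \<longleftrightarrow> Suc i * X \<le> T + X - 1" using X0 unfolding Kv(2) X_def[symmetric] T_def[symmetric]
      by (metis Suc_le_eq less_eq_div_iff_mult_less_eq)
    also have "\<dots> \<longleftrightarrow> i * X < T" using X0 by auto
    finally show ?thesis .
  qed
  have CX: "C = v * X * M" by (simp add: C_def L_def X_def)
  have vXC: "v * X \<le> C" using M_pos unfolding CX by simp
  have TC: "T \<le> C" using vX[of v] vXC by simp
  have "1 * X \<le> v * X" by (rule mult_le_mono1[OF v])
  then have XC: "X \<le> C" using vXC by linarith
  have "K * 1 \<le> X" using A_bounds M_pos unfolding X_def by (intro mult_le_mono2) simp
  then have KC: "K \<le> C" using XC by linarith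
  have "v * 1 \<le> v * X" using X0 by (intro mult_le_mono2) simp
  then have vC: "v \<le> C" using vXC by linarith
  have LC: "L \<le> C" using K unfolding C_def by simp
  have Av: "M * v \<le> C" "A * M * v \<le> C" "L = M * (A * M * v)" "C = K * L"
  proof -
    show L: "L = M * (A * M * v)" by (simp add: L_def)
    have "1 * (A * M * v) \<le> M * (A * M * v)" using M_pos by (intro mult_le_mono1) simp
    then show AMv: "A * M * v \<le> C" using LC L by linarith
    have "1 * (M * v) \<le> A * (M * v)" using A_bounds by (intro mult_le_mono1) simp
    then show "M * v \<le> C" using AMv unfolding mult_1 mult.assoc by (rule le_trans)
  qed (simp add: C_def)
  have short: "x < 2 ^ \<beta>" if "x \<le> 2 * C" for x using that by (intro short_sum) simp
  have rho: "rho = (n + 1) * X" by (simp add: rho_def X_def algebra_simps)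
  have "rho < 2 ^ \<beta>" using row_short[of 0 rho] by simp
  have AMs: "A * M < 2 ^ \<beta>" "M < 2 ^ \<beta>" "A < 2 ^ \<beta>"
  proof -
    show "A * M < 2 ^ \<beta>" by (intro short_sum) simp
    have "M \<le> A * M" "A \<le> A * M" using A_bounds M_pos by auto
    then show "M < 2 ^ \<beta>" "A < 2 ^ \<beta>" using \<open>A * M < 2 ^ \<beta>\<close> by (meson le_less_trans)+
  qed
  let ?F = "{1, 2, 10, 11, 12, 13, 14, 15, 16, 17, 18, 19, 22, 31, 36, 37, 38} :: nat set"
  let ?S1 = "HConst 2 1 ;; HSub 2 2 10 ;; HAdd 10 10 2 ;; HConst 2 1 ;; HSub 2 2 11 ;; HAdd 11 11 2 ;; HConst 36 M ;; HConst 37 (A * M)"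
  let ?W = "HAdd 38 38 12 ;; HConst 2 1 ;; HAdd 13 13 2 ;; HSub 1 11 38"
  let ?S2 = "HConst 13 0 ;; HConst 38 0 ;; HSub 1 11 38"
  let ?S3 = "HConst 19 0 ;; HPut 9 19 10 ;; HConst 19 1 ;; HConst 22 0 ;; HAdd 22 22 18"
  define P where "P s' \<longleftrightarrow> frame ?F {} s s' \<and> s' 0 10 = K \<and> s' 0 36 = M \<and> s' 0 37 = A * M" for s'
  have Pf: "P s''" if "P s'" "frame Y {} s' s''" "Y \<subseteq> ?F - {10, 36, 37}" for s' s'' Y
  proof -
    have "10 \<notin> Y" "36 \<notin> Y" "37 \<notin> Y" using that(3) by blast+
    then have "s'' 0 10 = s' 0 10" "s'' 0 36 = s' 0 36" "s'' 0 37 = s' 0 37" by (simp_all add: frameD0[OF that(2)])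
    moreover have "frame ?F {} s' s''" by (rule frame_mono[OF that(2)]) (use that(3) in blast)+
    then have "frame ?F {} s s''" using that(1) unfolding P_def by (blast intro: frame_trans)
    ultimately show ?thesis using that(1) unfolding P_def by simp
  qed
  let ?post = "\<lambda>s'. queue [(K, 0, [])] s' \<and> frame ?F {9} s s'"
  define kW where "kW = v * 5 + 1"
  have "run PARAMS s (8 + ((5 * K + 4) + (3 + (kW + ((5 * M + 4) + (1 + ((5 * A + 4) + ((5 * M + 4) + ((5 * K + 4) +
    (2 + ((5 * (n + 1) + 4) + 5))))))))))) ?post"
    unfolding PARAMS_def
  proof (rule run_Seq)
    show "run ?S1 s 8 (\<lambda>s'. P s' \<and> s' 0 11 = T)"
      using s Kv(1) one_short AMs KC TC short[of K] short[of T]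
      by (intro run_simple) (auto simp: P_def T_def heavy_def)
  next
    fix s1 assume s1: "bnd s1" "P s1 \<and> s1 0 11 = T"
    show "run (MUL 12 37 10 ;; ?S2 ;; HWhile 1 ?W ;; MUL 14 13 36 ;; HConst 38 A ;; MUL 15 14 38 ;; MUL 16 15 36 ;; MUL 17 16 10 ;;
        (HConst 38 1 ;; HAdd 38 38 0) ;; MUL 18 12 38 ;; ?S3) s1 ((5 * K + 4) + (3 + (kW + ((5 * M + 4) + (1 + ((5 * A + 4) + ((5 * M + 4) + ((5 * K + 4) +
         (2 + ((5 * (n + 1) + 4) + 5)))))))))) ?post"
    proof (rule run_Seq)
      show "run (MUL 12 37 10) s1 (5 * K + 4) (\<lambda>s'. P s' \<and> s' 0 11 = T \<and> s' 0 12 = X)"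
      proof (rule run_mono[OF run_MUL])
        show "s1 0 10 * s1 0 37 < 2 ^ \<beta>" using s1(2) short[of X] XC by (simp add: P_def X_def)
        fix s' assume "s' 0 12 = s1 0 10 * s1 0 37 \<and> frame {1, 31, 12} {} s1 s'"
        then show "P s' \<and> s' 0 11 = T \<and> s' 0 12 = X" using s1(2) Pf[of s1 "{1, 31, 12}" s'] frameD0[of "{1, 31, 12}" "{}" s1 s']
                by (simp add: P_def X_def)
      qed (use s1(2) in \<open>auto simp: heavy_def P_def\<close>)
    next
      fix s2 assume s2: "bnd s2" "P s2 \<and> s2 0 11 = T \<and> s2 0 12 = X"
      show "run (?S2 ;; HWhile 1 ?W ;; MUL 14 13 36 ;; HConst 38 A ;; MUL 15 14 38 ;; MUL 16 15 36 ;; MUL 17 16 10 ;;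
          (HConst 38 1 ;; HAdd 38 38 0) ;; MUL 18 12 38 ;; ?S3) s2 (3 + (kW + ((5 * M + 4) + (1 + ((5 * A + 4) + ((5 * M + 4) + ((5 * K + 4) +
           (2 + ((5 * (n + 1) + 4) + 5))))))))) ?post"
      proof (rule run_Seq)
        define I where "I t s' \<longleftrightarrow> (\<exists>i \<le> v. P s' \<and> s' 0 11 = T \<and> s' 0 12 = X \<and> s' 0 38 = i * X \<and> s' 0 13 = i \<and>
          s' 0 1 = T - i * X \<and> t = (v - i) * 5)" for t s'
        have P2: "P (upd (upd (upd s2 0 13 0) 0 38 0) 0 1 y)" for y
          by (rule Pf[of s2 "{13, 38, 1}"]) (use s2(2) in auto)
        then show "run ?S2 s2 3 (I (v * 5))"
          using s2(2) by (intro run_simple) (auto simp: I_def heavy_def intro!: exI[of _ 0])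
        fix s3 assume s3: "bnd s3" "I (v * 5) s3"
        show "run (HWhile 1 ?W ;; MUL 14 13 36 ;; HConst 38 A ;; MUL 15 14 38 ;; MUL 16 15 36 ;; MUL 17 16 10 ;;
            (HConst 38 1 ;; HAdd 38 38 0) ;; MUL 18 12 38 ;; ?S3) s3 (kW + ((5 * M + 4) + (1 + ((5 * A + 4) + ((5 * M + 4) + ((5 * K + 4) +
             (2 + ((5 * (n + 1) + 4) + 5)))))))) ?post"
        proof (rule run_Seq)
          show "run (HWhile 1 ?W) s3 kW (\<lambda>s'. P s' \<and> s' 0 12 = X \<and> s' 0 13 = v)"
            unfolding kW_def
          proof (rule run_While_budget[where I = I, OF _ _ _ _ s3(2)])
            fix t s' assume s': "bnd s'" "I t s'" "s' 0 1 \<noteq> 0"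
            then obtain i where i: "i \<le> v" "P s'" "s' 0 11 = T" "s' 0 12 = X" "s' 0 38 = i * X" "s' 0 13 = i" "s' 0 1 = T - i * X"
              "t = (v - i) * 5" by (auto simp: I_def)
            have lt: "i < v" using i(7) s'(3) vX by simp
            have "run ?W s' 4 (I ((v - Suc i) * 5))"
            proof (rule run_simple)
              have "Suc i * X \<le> v * X" using lt by (intro mult_le_mono1) simp
              then have "i * X + X < 2 ^ \<beta>" using vXC by (intro short) simp
              moreover have "Suc i < 2 ^ \<beta>" using lt vC by (intro short) simp
              ultimately show "safe ?W s'" using i one_short by (simp add: heavy_def)
              have "P (eval ?W s')" by (rule Pf[of s' "{1, 2, 13, 38}"]) (use i in auto)
              then show "I ((v - Suc i) * 5) (eval ?W s')" unfolding I_def using i lt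
                by (intro exI[of _ "Suc i"]) (auto simp: algebra_simps)
            qed (auto simp: heavy_def)
            then show "\<exists>k t'. k + 1 + t' \<le> t \<and> run ?W s' k (I t')"
              using lt i(8) by (intro exI[of _ 4] exI[of _ "(v - Suc i) * 5"]) auto
          next
            fix t s' assume s': "bnd s'" "I t s'" "s' 0 1 = 0"
            then obtain i where i: "i \<le> v" "P s'" "s' 0 12 = X" "s' 0 13 = i" "T - i * X = 0" by (auto simp: I_def)
            then have "\<not> i < v" using vX by simp
            then show "P s' \<and> s' 0 12 = X \<and> s' 0 13 = v" using i by simp
          qed (auto simp: heavy_def)
        next
          fix s4 assume s4: "bnd s4" "P s4 \<and> s4 0 12 = X \<and> s4 0 13 = v"
          show "run (MUL 14 13 36 ;; HConst 38 A ;; MUL 15 14 38 ;; MUL 16 15 36 ;; MUL 17 16 10 ;;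
              (HConst 38 1 ;; HAdd 38 38 0) ;; MUL 18 12 38 ;; ?S3) s4 ((5 * M + 4) + (1 + ((5 * A + 4) + ((5 * M + 4) + ((5 * K + 4) +
               (2 + ((5 * (n + 1) + 4) + 5))))))) ?post"
          proof (rule run_Seq)
            show "run (MUL 14 13 36) s4 (5 * M + 4) (\<lambda>s'. P s' \<and> s' 0 12 = X \<and> s' 0 13 = v \<and> s' 0 14 = M * v)"
            proof (rule run_mono[OF run_MUL])
              show "s4 0 36 * s4 0 13 < 2 ^ \<beta>" using s4(2) short[of "M * v"] Av by (simp add: P_def)
              fix s' assume "s' 0 14 = s4 0 36 * s4 0 13 \<and> frame {1, 31, 14} {} s4 s'"
              then show "P s' \<and> s' 0 12 = X \<and> s' 0 13 = v \<and> s' 0 14 = M * v"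
                using s4(2) Pf[of s4 "{1, 31, 14}" s'] frameD0[of "{1, 31, 14}" "{}" s4 s']
                by (simp add: P_def)
            qed (use s4(2) in \<open>auto simp: heavy_def P_def\<close>)
            fix s5 assume s5: "bnd s5" "P s5 \<and> s5 0 12 = X \<and> s5 0 13 = v \<and> s5 0 14 = M * v"
            show "run (HConst 38 A ;; MUL 15 14 38 ;; MUL 16 15 36 ;; MUL 17 16 10 ;;
                (HConst 38 1 ;; HAdd 38 38 0) ;; MUL 18 12 38 ;; ?S3) s5 (1 + ((5 * A + 4) + ((5 * M + 4) + ((5 * K + 4) +
                 (2 + ((5 * (n + 1) + 4) + 5)))))) ?post"
            proof (rule run_Seq)
              have "P (upd s5 0 38 A)" by (rule Pf[of s5 "{38}"]) (use s5(2) in auto)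
              then show "run (HConst 38 A) s5 1 (\<lambda>s'. P s' \<and> s' 0 12 = X \<and> s' 0 13 = v \<and> s' 0 14 = M * v \<and> s' 0 38 = A)"
                using s5(2) AMs by (intro run_simple) auto
              fix s6 assume s6: "bnd s6" "P s6 \<and> s6 0 12 = X \<and> s6 0 13 = v \<and> s6 0 14 = M * v \<and> s6 0 38 = A"
              show "run (MUL 15 14 38 ;; MUL 16 15 36 ;; MUL 17 16 10 ;; (HConst 38 1 ;; HAdd 38 38 0) ;; MUL 18 12 38 ;; ?S3) s6
                 ((5 * A + 4) + ((5 * M + 4) + ((5 * K + 4) + (2 + ((5 * (n + 1) + 4) + 5))))) ?post"
              proof (rule run_Seq)
                show "run (MUL 15 14 38) s6 (5 * A + 4) (\<lambda>s'. P s' \<and> s' 0 12 = X \<and> s' 0 13 = v \<and> s' 0 14 = M * v \<and> s' 0 15 = A * M * v)"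
                proof (rule run_mono[OF run_MUL])
                  show "s6 0 38 * s6 0 14 < 2 ^ \<beta>" using s6(2) short[of "A * M * v"] Av by (simp add: P_def mult.assoc)
                  fix s' assume "s' 0 15 = s6 0 38 * s6 0 14 \<and> frame {1, 31, 15} {} s6 s'"
                  then show "P s' \<and> s' 0 12 = X \<and> s' 0 13 = v \<and> s' 0 14 = M * v \<and> s' 0 15 = A * M * v"
                    using s6(2) Pf[of s6 "{1, 31, 15}" s'] frameD0[of "{1, 31, 15}" "{}" s6 s']
                by (simp add: P_def mult.assoc)
                qed (use s6(2) in \<open>auto simp: heavy_def P_def\<close>)
                fix s7 assume s7: "bnd s7" "P s7 \<and> s7 0 12 = X \<and> s7 0 13 = v \<and> s7 0 14 = M * v \<and> s7 0 15 = A * M * v"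
                show "run (MUL 16 15 36 ;; MUL 17 16 10 ;; (HConst 38 1 ;; HAdd 38 38 0) ;; MUL 18 12 38 ;; ?S3) s7
                   ((5 * M + 4) + ((5 * K + 4) + (2 + ((5 * (n + 1) + 4) + 5)))) ?post"
                proof (rule run_Seq)
                  show "run (MUL 16 15 36) s7 (5 * M + 4)
                    (\<lambda>s'. P s' \<and> s' 0 12 = X \<and> s' 0 13 = v \<and> s' 0 14 = M * v \<and> s' 0 15 = A * M * v \<and> s' 0 16 = L)"
                  proof (rule run_mono[OF run_MUL])
                    show "s7 0 36 * s7 0 15 < 2 ^ \<beta>" using s7(2) short[of L] LC Av(3) by (simp add: P_def)
                    fix s' assume "s' 0 16 = s7 0 36 * s7 0 15 \<and> frame {1, 31, 16} {} s7 s'"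
                    then show "P s' \<and> s' 0 12 = X \<and> s' 0 13 = v \<and> s' 0 14 = M * v \<and> s' 0 15 = A * M * v \<and> s' 0 16 = L"
                      using s7(2) Pf[of s7 "{1, 31, 16}" s'] Av(3) frameD0[of "{1, 31, 16}" "{}" s7 s']
                by (simp add: P_def)
                  qed (use s7(2) in \<open>auto simp: heavy_def P_def\<close>)
                  fix s8 assume s8: "bnd s8"
                    "P s8 \<and> s8 0 12 = X \<and> s8 0 13 = v \<and> s8 0 14 = M * v \<and> s8 0 15 = A * M * v \<and> s8 0 16 = L"
                  show "run (MUL 17 16 10 ;; (HConst 38 1 ;; HAdd 38 38 0) ;; MUL 18 12 38 ;; ?S3) s8
                     ((5 * K + 4) + (2 + ((5 * (n + 1) + 4) + 5))) ?post"
                  proof (rule run_Seq)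
                    show "run (MUL 17 16 10) s8 (5 * K + 4)
                      (\<lambda>s'. P s' \<and> s' 0 12 = X \<and> s' 0 13 = v \<and> s' 0 14 = M * v \<and> s' 0 15 = A * M * v \<and> s' 0 16 = L \<and> s' 0 17 = C)"
                    proof (rule run_mono[OF run_MUL])
                      show "s8 0 10 * s8 0 16 < 2 ^ \<beta>" using s8(2) short[of C] by (simp add: P_def C_def)
                      fix s' assume "s' 0 17 = s8 0 10 * s8 0 16 \<and> frame {1, 31, 17} {} s8 s'"
                      then show "P s' \<and> s' 0 12 = X \<and> s' 0 13 = v \<and> s' 0 14 = M * v \<and> s' 0 15 = A * M * v \<and> s' 0 16 = L \<and> s' 0 17 = C"
                        using s8(2) Pf[of s8 "{1, 31, 17}" s'] frameD0[of "{1, 31, 17}" "{}" s8 s']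
                by (simp add: P_def C_def)
                    qed (use s8(2) in \<open>auto simp: heavy_def P_def\<close>)
                    fix s9 assume s9: "bnd s9" "P s9 \<and> s9 0 12 = X \<and> s9 0 13 = v \<and> s9 0 14 = M * v \<and> s9 0 15 = A * M * v \<and>
                      s9 0 16 = L \<and> s9 0 17 = C"
                    have n9: "s9 0 0 = n" using s9(2) s(1) by (auto simp: P_def frameD0)
                    have n1: "n + 1 < 2 ^ \<beta>"
                    proof -
                      have "(n + 1) * 1 \<le> rho" using X0 unfolding rho by (intro mult_le_mono2) simp
                      then have "n + 1 \<le> rho" by simp
                      then show ?thesis using \<open>rho < 2 ^ \<beta>\<close> by (rule le_less_trans)
                    qed
                    show "run ((HConst 38 1 ;; HAdd 38 38 0) ;; MUL 18 12 38 ;; ?S3) s9 (2 + ((5 * (n + 1) + 4) + 5)) ?post"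
                    proof (rule run_Seq)
                      let ?Q = "\<lambda>s'. P s' \<and> s' 0 12 = X \<and> s' 0 13 = v \<and> s' 0 14 = M * v \<and> s' 0 15 = A * M * v \<and>
                         s' 0 16 = L \<and> s' 0 17 = C"
                      have "P (upd (upd s9 0 38 1) 0 38 (n + 1))" by (rule Pf[of s9 "{38}"]) (use s9(2) in auto)
                      then show "run (HConst 38 1 ;; HAdd 38 38 0) s9 2 (\<lambda>s'. ?Q s' \<and> s' 0 38 = n + 1)"
                        using s9(2) n9 n1 one_short by (intro run_simple) (auto simp: heavy_def)
                      fix s10 assume s10: "bnd s10" "?Q s10 \<and> s10 0 38 = n + 1"
                      show "run (MUL 18 12 38 ;; ?S3) s10 ((5 * (n + 1) + 4) + 5) ?post"
                      proof (rule run_Seq)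
                        show "run (MUL 18 12 38) s10 (5 * (n + 1) + 4) (\<lambda>s'. ?Q s' \<and> s' 0 18 = rho)"
                        proof (rule run_mono[OF run_MUL])
                          show "s10 0 38 * s10 0 12 < 2 ^ \<beta>" using s10(2) \<open>rho < 2 ^ \<beta>\<close> rho by simp
                          fix s' assume "s' 0 18 = s10 0 38 * s10 0 12 \<and> frame {1, 31, 18} {} s10 s'"
                          then show "?Q s' \<and> s' 0 18 = rho"
                            using s10(2) Pf[of s10 "{1, 31, 18}" s'] rho frameD0[of "{1, 31, 18}" "{}" s10 s']
                by (simp add: P_def)
                        qed (use s10(2) in \<open>auto simp: heavy_def P_def\<close>)
                        fix s11 assume s11: "bnd s11" "?Q s11 \<and> s11 0 18 = rho"
                        have f11: "frame ?F {} s s11" using s11(2) by (simp add: P_def)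
                        have "s11 0 0 = n" "s11 9 = (\<lambda>_. 0)" "s11 10 = (\<lambda>_. 0)" "s11 11 = (\<lambda>_. 0)"
                          using f11 s by (auto simp: frame_def)
                        then show "run ?S3 s11 5 ?post"
                          using s11(2) \<open>rho < 2 ^ \<beta>\<close> one_short K f11
                          by (intro run_simple) (auto simp: heavy_def queue_def params_def recs_ok_def P_def elim: frame_mono)
                      qed
                    qed
                  qed
                qed
              qed
            qed
          qed
        qed
      qed
    qed
  qed
  then show ?thesis by (rule run_mono) (auto simp: kW_def)
qed

end

section \<open>Linear systems and the majority vote\<close>

definition LOADV :: hl where
  "LOADV = FOR 31 30 (HAdd 2 21 31 ;; HGet 2 3 2 ;; HRead 2 2 ;; HPut 7 31 2)"

definition XOR :: hl where
  "XOR = FOR 31 30 (HAdd 2 34 31 ;; HGet 2 6 2 ;;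
       HIf 2 (HGet 2 7 31 ;; HConst 29 1 ;; HSub 2 29 2 ;; HPut 7 31 2) HSkip) ;;
     (HAdd 2 21 35 ;; HGet 2 5 2 ;; HIf 2 (HConst 29 1 ;; HSub 32 29 32) HSkip)"

definition INSERT :: hl where
  "INSERT = (HConst 33 1 ;; HAdd 2 21 35 ;; HConst 29 1 ;; HPut 4 2 29 ;; HPut 5 2 32 ;; HPut 12 20 2) ;;
     FOR 31 30 (HAdd 2 34 31 ;; HGet 29 7 31 ;; HPut 6 2 29)"

text \<open>Gaussian elimination of the row in array 7. Where a column is nonzero, the row with this
  pivot is added, or, if there is none, the current row is stored there and register 33 set; after
  that only the counting goes on. Register 6 doubles at each slot found empty and ends as the number
  of solutions.\<close>

definition REDUCE :: hl where
  "REDUCE = FOR 35 30 (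
     (HAdd 2 21 35 ;; HGet 3 4 2 ;; HIf 3 HSkip (HAdd 6 6 6) ;; HGet 38 7 35) ;;
     HIf 38 (HIf 33 HSkip (HIf 3 XOR INSERT)) HSkip ;;
     HAdd 34 34 18)"

text \<open>A new equation is stored before the true value is known, with the right-hand side that
  fits the answer 0; the update flips it if the answer is 1. So no elimination is repeated, and
  mistakes and correct rounds are treated alike.\<close>

definition EXPERT :: hl where
  "EXPERT = HGet 30 11 20 ;; LOADV ;; (HConst 32 0 ;; HConst 33 0 ;; HConst 6 1 ;; COPY 34 23) ;; REDUCE ;;
     (HPut 13 20 32 ;; HPut 9 20 33 ;; HIf 33 HSkip (HIf 32 (HAdd 5 5 6) (HAdd 4 4 6)))"

text \<open>The list of expert e has length d e, at most D. Slot i of its system has number e * rho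
  + i, and its coefficients start at rho times this number.\<close>

locale rounds = machine a \<beta> \<eta> for a :: "nat list" and \<beta> \<eta> :: nat +
  fixes N rho D :: nat and d :: "nat \<Rightarrow> nat"
  assumes dD: "\<And>e. e < N \<Longrightarrow> d e \<le> D" and Drho: "D \<le> rho" and rho_pos: "0 < rho"
    and small: "(N + 1) * (rho + 2) * (rho + 2) \<le> 2 ^ \<beta>"
    and weight: "N * 2 ^ D < 2 ^ (\<beta> * \<eta>)"
begin

text \<open>Echelon form with slots indexed by pivot columns: an occupied slot i has its leading one
  in column i, so no pivot has to be searched.\<close>

definition row_ok :: "state \<Rightarrow> nat \<Rightarrow> nat \<Rightarrow> nat \<Rightarrow> bool" where
  "row_ok s k g i \<longleftrightarrow> s 4 g \<le> 1 \<and> (s 4 g \<noteq> 0 \<longrightarrow>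
     s 5 g \<le> 1 \<and> (\<forall>j<k. s 6 (g * rho + j) \<le> 1) \<and> (\<forall>j<i. s 6 (g * rho + j) = 0) \<and> s 6 (g * rho + i) = 1)"

definition wf_expert :: "state \<Rightarrow> nat \<Rightarrow> bool" where
  "wf_expert s e \<longleftrightarrow> (\<forall>i<d e. row_ok s (d e) (e * rho + i) i)"

text \<open>The assignment z solves the linear system of the expert e.\<close>

definition sat :: "state \<Rightarrow> nat \<Rightarrow> (nat \<Rightarrow> nat) \<Rightarrow> bool" where
  "sat s e z \<longleftrightarrow> (\<forall>i<d e. s 4 (e * rho + i) \<noteq> 0 \<longrightarrow>
     even ((\<Sum>j<d e. s 6 ((e * rho + i) * rho + j) * z j) + s 5 (e * rho + i)))"

definition example :: "state \<Rightarrow> nat \<Rightarrow> (nat \<Rightarrow> nat) \<Rightarrow> nat" where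
  "example s e z = (\<Sum>j<d e. input_at a (s 3 (e * rho + j)) * z j)"

definition free_upto :: "state \<Rightarrow> nat \<Rightarrow> nat \<Rightarrow> nat" where
  "free_upto s e i = card {i'. i' < i \<and> s 4 (e * rho + i') = 0}"

definition inserted :: "state \<Rightarrow> state \<Rightarrow> nat \<Rightarrow> nat \<Rightarrow> nat \<Rightarrow> bool" where
  "inserted s s' e p acc \<longleftrightarrow> s 4 (e * rho + p) = 0 \<and>
     s' 4 = (s 4)(e * rho + p := 1) \<and> s' 5 = (s 5)(e * rho + p := acc) \<and> s' 12 = (s 12)(e := e * rho + p) \<and>
     s' 6 = (\<lambda>x. if (e * rho + p) * rho \<le> x \<and> x < (e * rho + p) * rho + d e then s' 7 (x - (e * rho + p) * rho) else s 6 x)"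

definition unchanged :: "state \<Rightarrow> state \<Rightarrow> bool" where
  "unchanged s s' \<longleftrightarrow> s' 4 = s 4 \<and> s' 5 = s 5 \<and> s' 6 = s 6 \<and> s' 12 = s 12"

lemma inserted_cong:
  "inserted s s' e p acc \<Longrightarrow> (\<And>q. q \<noteq> 0 \<Longrightarrow> s'' q = s' q) \<Longrightarrow> inserted s s'' e p acc"
  by (simp add: inserted_def cong: if_cong)

lemma one_short: "1 < (2::nat) ^ \<beta>"
  using \<beta> by (intro one_less_power) auto

lemma idx_short:
  assumes "e < N" "i \<le> rho" "j \<le> rho"
  shows "e * rho + i < 2 ^ \<beta>" "(e * rho + i) * rho + j < 2 ^ \<beta>" "i < 2 ^ \<beta>" "(e * rho + i) * rho + rho < 2 ^ \<beta>"
    "e < 2 ^ \<beta>" "Suc e * rho < 2 ^ \<beta>" "Suc e * (rho * rho) < 2 ^ \<beta>"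
proof -
  have 1: "e * rho + i \<le> N * rho" using assms mult_le_mono1[of "Suc e" N rho] by simp
  then have "(e * rho + i) * rho + rho \<le> N * rho * rho + rho" by (simp add: mult_le_mono1)
  also have "\<dots> < (N + 1) * (rho + 2) * (rho + 2)" by (simp add: algebra_simps)
  finally show 2: "(e * rho + i) * rho + rho < 2 ^ \<beta>" using small by (rule less_le_trans)
  have "(e * rho + i) * rho + j \<le> (e * rho + i) * rho + rho" using assms(3) by simp
  then show "(e * rho + i) * rho + j < 2 ^ \<beta>" using 2 by (rule le_less_trans)
  have "(e * rho + i) * 1 \<le> (e * rho + i) * rho" using rho_pos by (intro mult_le_mono2) simp
  then have "e * rho + i \<le> (e * rho + i) * rho + rho" unfolding mult_1_right by (rule trans_le_add1)
  then show 3: "e * rho + i < 2 ^ \<beta>" using 2 by (rule le_less_trans)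
  have "i \<le> e * rho + i" by simp
  then show "i < 2 ^ \<beta>" using 3 by (rule le_less_trans)
  have "Suc e * rho * 1 \<le> N * rho * rho" using assms(1) rho_pos by (intro mult_le_mono) auto
  moreover have 4: "N * rho * rho < (N + 1) * (rho + 2) * (rho + 2)" by (simp add: algebra_simps)
  ultimately have "Suc e * rho < (N + 1) * (rho + 2) * (rho + 2)" by simp
  then show 5: "Suc e * rho < 2 ^ \<beta>" using small by (rule less_le_trans)
  have "e * 1 \<le> Suc e * rho" using rho_pos by (intro mult_le_mono) auto
  then have "e \<le> Suc e * rho" by simp
  then show "e < 2 ^ \<beta>" using 5 by (rule le_less_trans)
  have "Suc e * (rho * rho) \<le> N * (rho * rho)" using assms(1) by (intro mult_le_mono1) simp
  also have "\<dots> < (N + 1) * (rho + 2) * (rho + 2)" using 4 by (simp add: mult.assoc)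
  finally show "Suc e * (rho * rho) < 2 ^ \<beta>" using small by (rule less_le_trans)
qed

section \<open>Gaussian elimination for one expert\<close>

lemma run_LOADV:
  assumes s: "s 0 30 = d e" "s 0 21 = e * rho" and e: "e < N"
  shows "run LOADV s (8 * D + 3) (\<lambda>s'. (\<forall>j<d e. s' 7 j = input_at a (s 3 (e * rho + j))) \<and> frame {1, 2, 31} {7} s s')"
proof -
  let ?I = "\<lambda>j s'. (\<forall>j'<j. s' 7 j' = input_at a (s 3 (e * rho + j'))) \<and> frame {1, 2, 31} {7} s s'"
  have "run LOADV s ((\<Sum>j<d e. 4 + 4) + 3) (?I (d e))"
    unfolding LOADV_def
  proof (rule run_FOR[where I = ?I])
    fix j s' assume j: "j < d e" "bnd s'" "?I j s'" "s' 0 31 = j" "s' 0 30 = d e"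
    have k: "s' 0 21 = e * rho" "s' 3 = s 3" using j(3) s by (auto simp: frame_def)
    have "j \<le> rho" using j(1) dD[OF e] Drho by linarith
    note sh = idx_short[OF e this le0]
    show "run (HAdd 2 21 31 ;; HGet 2 3 2 ;; HRead 2 2 ;; HPut 7 31 2) s' 4 (\<lambda>s''. s'' 0 31 = j \<and> s'' 0 30 = d e \<and>
       (\<forall>t. ?I (Suc j) (upd (upd s'' 0 31 (Suc j)) 0 1 t)))"
      using sh j k by (intro run_simple) (auto simp: heavy_def less_Suc_eq)
  qed (use s in \<open>auto simp: heavy_def\<close>)
  then show ?thesis by (rule run_mono) (use dD[OF e] in auto)
qed

lemma run_XOR:
  assumes s: "s 0 30 = d e" "s 0 21 = e * rho" "s 0 35 = i" "s 0 34 = (e * rho + i) * rho" and e: "e < N" and i: "i < d e"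
  shows "run XOR s (11 * D + 10) (\<lambda>s'. (\<forall>j<d e. s' 7 j = (if s 6 ((e * rho + i) * rho + j) \<noteq> 0 then 1 - s 7 j else s 7 j)) \<and>
     s' 0 32 = (if s 5 (e * rho + i) \<noteq> 0 then 1 - s 0 32 else s 0 32) \<and> frame {1, 2, 29, 31, 32} {7} s s')"
proof -
  let ?g = "(e * rho + i) * rho"
  let ?I = "\<lambda>j s'. (\<forall>j'<j. s' 7 j' = (if s 6 (?g + j') \<noteq> 0 then 1 - s 7 j' else s 7 j')) \<and> (\<forall>j'\<ge>j. s' 7 j' = s 7 j') \<and>
     frame {1, 2, 29, 31} {7} s s'"
  have irho: "i \<le> rho" using i dD[OF e] Drho by linarith
  have "run XOR s (((\<Sum>j<d e. 7 + 4) + 3) + 5) (\<lambda>s'. (\<forall>j<d e. s' 7 j = (if s 6 (?g + j) \<noteq> 0 then 1 - s 7 j else s 7 j)) \<and>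
     s' 0 32 = (if s 5 (e * rho + i) \<noteq> 0 then 1 - s 0 32 else s 0 32) \<and> frame {1, 2, 29, 31, 32} {7} s s')"
    unfolding XOR_def
  proof (rule run_Seq)
    show "run (FOR 31 30 (HAdd 2 34 31 ;; HGet 2 6 2 ;; HIf 2 (HGet 2 7 31 ;; HConst 29 1 ;; HSub 2 29 2 ;; HPut 7 31 2) HSkip)) s
      ((\<Sum>j<d e. 7 + 4) + 3) (?I (d e))"
    proof (rule run_FOR[where I = ?I])
      fix j s' assume j: "j < d e" "bnd s'" "?I j s'" "s' 0 31 = j" "s' 0 30 = d e"
      have k: "s' 0 34 = ?g" "s' 6 = s 6" using j(3) s by (auto simp: frame_def)
      have "j \<le> rho" using j(1) dD[OF e] Drho by linarith
      note sh = idx_short[OF e irho this]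
      have v: "s' 7 j = s 7 j" using j(3) by simp
      show "run (HAdd 2 34 31 ;; HGet 2 6 2 ;; HIf 2 (HGet 2 7 31 ;; HConst 29 1 ;; HSub 2 29 2 ;; HPut 7 31 2) HSkip) s' 7
        (\<lambda>s''. s'' 0 31 = j \<and> s'' 0 30 = d e \<and> (\<forall>t. ?I (Suc j) (upd (upd s'' 0 31 (Suc j)) 0 1 t)))"
        using sh(2) j k v one_short by (intro run_simple) (auto simp: heavy_def less_Suc_eq)
    qed (use s in \<open>auto simp: heavy_def\<close>)
    fix s1 assume s1: "bnd s1" "?I (d e) s1"
    have k: "s1 0 21 = e * rho" "s1 0 35 = i" "s1 5 = s 5" "s1 0 32 = s 0 32" using s1(2) s by (auto simp: frame_def)
    have f: "frame {1, 2, 29, 31, 32} {7} s s1" using s1(2) by (auto elim: frame_mono)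
    show "run (HAdd 2 21 35 ;; HGet 2 5 2 ;; HIf 2 (HConst 29 1 ;; HSub 32 29 32) HSkip) s1 5
      (\<lambda>s'. (\<forall>j<d e. s' 7 j = (if s 6 (?g + j) \<noteq> 0 then 1 - s 7 j else s 7 j)) \<and>
       s' 0 32 = (if s 5 (e * rho + i) \<noteq> 0 then 1 - s 0 32 else s 0 32) \<and> frame {1, 2, 29, 31, 32} {7} s s')"
      using s1(2) k f idx_short[OF e irho le0] one_short by (intro run_simple) (auto simp: heavy_def)
  qed
  then show ?thesis by (rule run_mono) (use dD[OF e] in auto)
qed

lemma run_INSERT:
  assumes s: "s 0 30 = d e" "s 0 20 = e" "s 0 21 = e * rho" "s 0 35 = p" "s 0 34 = (e * rho + p) * rho"
    and e: "e < N" and p: "p < d e" "s 4 (e * rho + p) = 0"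
  shows "run INSERT s (7 * D + 10) (\<lambda>s'. inserted s s' e p (s 0 32) \<and> s' 0 33 = 1 \<and> frame {1, 2, 29, 31, 33} {4, 5, 6, 12} s s')"
proof -
  let ?g = "e * rho + p"
  have prho: "p \<le> rho" using p(1) dD[OF e] Drho by linarith
  let ?J = "\<lambda>s'. s' 4 = (s 4)(?g := 1) \<and> s' 5 = (s 5)(?g := s 0 32) \<and> s' 12 = (s 12)(e := ?g) \<and> s' 0 33 = 1 \<and>
     frame {1, 2, 29, 31, 33} {4, 5, 6, 12} s s'"
  let ?I = "\<lambda>j s'. ?J s' \<and> s' 6 = (\<lambda>x. if ?g * rho \<le> x \<and> x < ?g * rho + j then s 7 (x - ?g * rho) else s 6 x)"
  have "run INSERT s (6 + ((\<Sum>j<d e. 3 + 4) + 3)) (?I (d e))"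
    unfolding INSERT_def
  proof (rule run_Seq)
    show "run (HConst 33 1 ;; HAdd 2 21 35 ;; HConst 29 1 ;; HPut 4 2 29 ;; HPut 5 2 32 ;; HPut 12 20 2) s 6 (?I 0)"
      using s idx_short[OF e prho le0] one_short by (intro run_simple) (auto simp: heavy_def upd_def frame_def)
    fix s1 assume s1: "bnd s1" "?I 0 s1"
    show "run (FOR 31 30 (HAdd 2 34 31 ;; HGet 29 7 31 ;; HPut 6 2 29)) s1 ((\<Sum>j<d e. 3 + 4) + 3) (?I (d e))"
    proof (rule run_FOR[where I = ?I])
      show "s1 0 30 = d e" using s1(2) s by (auto simp: frame_def)
      fix j s' assume j: "j < d e" "bnd s'" "?I j s'" "s' 0 31 = j" "s' 0 30 = d e"
      have k: "s' 0 34 = ?g * rho" "s' 7 = s 7" using j(3) s by (auto simp: frame_def)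
      have "j \<le> rho" using j(1) dD[OF e] Drho by linarith
      note sh = idx_short[OF e prho this]
      have 6: "(\<lambda>x. if x = ?g * rho + j then s 7 j else s' 6 x) =
        (\<lambda>x. if ?g * rho \<le> x \<and> x < ?g * rho + Suc j then s 7 (x - ?g * rho) else s 6 x)"
        using j(3) by (intro ext) auto
      show "run (HAdd 2 34 31 ;; HGet 29 7 31 ;; HPut 6 2 29) s' 3
        (\<lambda>s''. s'' 0 31 = j \<and> s'' 0 30 = d e \<and> (\<forall>t. ?I (Suc j) (upd (upd s'' 0 31 (Suc j)) 0 1 t)))"
      proof (rule run_simple)
        let ?e = "eval (HAdd 2 34 31 ;; HGet 29 7 31 ;; HPut 6 2 29) s'"
        have e6: "?e 6 = (\<lambda>x. if ?g * rho \<le> x \<and> x < ?g * rho + Suc j then s 7 (x - ?g * rho) else s 6 x)"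
          unfolding 6[symmetric] using k j(4) by (intro ext) simp
        have eq: "?e q = s' q" if "q \<noteq> 0" "q \<noteq> 6" for q using that by simp
        have "frame {1, 2, 29, 31, 33} {4, 5, 6, 12} s ?e" using j(3) by simp
        moreover have "?e 0 33 = 1" "?e 0 31 = j" "?e 0 30 = d e" using j(3,4,5) by simp_all
        ultimately show "?e 0 31 = j \<and> ?e 0 30 = d e \<and> (\<forall>t. ?I (Suc j) (upd (upd ?e 0 31 (Suc j)) 0 1 t))"
          using j(3) e6 eq[of 4] eq[of 5] eq[of 12] by (simp add: fun_upd_def del: eval.simps)
        show "safe (HAdd 2 34 31 ;; HGet 29 7 31 ;; HPut 6 2 29) s'" using sh(2) k j(4) by (simp add: heavy_def)
      qed (auto simp: heavy_def)
    qed (use s1 in \<open>auto simp: heavy_def\<close>)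
  qed
  then show ?thesis
  proof (rule run_mono)
    show "6 + ((\<Sum>j<d e. 3 + 4) + 3) \<le> 7 * D + 10" using dD[OF e] by simp
    fix s' assume s': "?I (d e) s'"
    then have "s' 7 = s 7" by (simp add: frame_def)
    then show "inserted s s' e p (s 0 32) \<and> s' 0 33 = 1 \<and> frame {1, 2, 29, 31, 33} {4, 5, 6, 12} s s'"
      using s' p(2) by (simp add: inserted_def fun_upd_def cong: if_cong)
  qed
qed

lemma free_upto_Suc: "free_upto s e (Suc i) = free_upto s e i + (if s 4 (e * rho + i) = 0 then 1 else 0)"
proof -
  have "{i'. i' < Suc i \<and> s 4 (e * rho + i') = 0} =
      {i'. i' < i \<and> s 4 (e * rho + i') = 0} \<union> (if s 4 (e * rho + i) = 0 then {i} else {})"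
    by (auto simp: less_Suc_eq)
  then show ?thesis by (simp add: free_upto_def)
qed

lemma free_upto_le: "free_upto s e i \<le> i"
  by (induction i) (auto simp: free_upto_Suc, simp add: free_upto_def)

lemma xor_step:
  fixes v b :: nat
  assumes "v \<le> 1" "b \<le> 1"
  shows "even ((if b \<noteq> 0 then 1 - v else v) * z + v * z + b * z)" "(if b \<noteq> 0 then 1 - v else v) \<le> 1"
    "even ((if b \<noteq> 0 then 1 - v else v) + v + b)"
  using assms by (auto simp: le_Suc_eq)

text \<open>On every solution of the old system the example, the current row and the accumulated bit
  in register 32 sum to an even number. Before an insertion the first i columns are cleared; after
  it the row is frozen at its pivot p. Register 6 counts the free slots of the old system s.\<close>

definition reduced :: "state \<Rightarrow> nat \<Rightarrow> nat \<Rightarrow> state \<Rightarrow> bool" where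
  "reduced s e i s' \<longleftrightarrow> s' 0 32 \<le> 1 \<and> s' 0 33 \<le> 1 \<and> s' 0 6 = 2 ^ free_upto s e i \<and> s' 0 34 = (e * rho + i) * rho \<and>
     (\<forall>j<d e. s' 7 j \<le> 1) \<and> frame {1, 2, 3, 6, 29, 31, 32, 33, 34, 35, 38} {4, 5, 6, 7, 12} s s' \<and>
     (\<forall>z. sat s e z \<longrightarrow> even (example s e z + (\<Sum>j<d e. s' 7 j * z j) + s' 0 32)) \<and>
     (s' 0 33 = 0 \<longrightarrow> unchanged s s' \<and> (\<forall>j<i. s' 7 j = 0)) \<and>
     (s' 0 33 \<noteq> 0 \<longrightarrow> (\<exists>p<i. inserted s s' e p (s' 0 32) \<and> (\<forall>j<p. s' 7 j = 0) \<and> s' 7 p = 1))"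

lemma reduced_cong:
  assumes "reduced s e i s'" "\<And>x. x \<in> {32, 33, 6, 34} \<Longrightarrow> s'' 0 x = s' 0 x" "\<And>q. q \<noteq> 0 \<Longrightarrow> s'' q = s' q"
    "frame {1, 2, 3, 6, 29, 31, 32, 33, 34, 35, 38} {4, 5, 6, 7, 12} s s''"
  shows "reduced s e i s''"
  using assms by (simp add: reduced_def unchanged_def inserted_def cong: if_cong)

lemma run_reduce_body:
  assumes s: "s 0 30 = d e" "s 0 20 = e" "s 0 21 = e * rho" "s 0 18 = rho" and e: "e < N" and wf: "wf_expert s e"
    and i: "i < d e" and r: "reduced s e i s'" and k: "s' 0 35 = i"
  shows "run ((HAdd 2 21 35 ;; HGet 3 4 2 ;; HIf 3 HSkip (HAdd 6 6 6) ;; HGet 38 7 35) ;;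
     HIf 38 (HIf 33 HSkip (HIf 3 XOR INSERT)) HSkip ;; HAdd 34 34 18) s' (11 * D + \<eta> + 18)
     (\<lambda>s''. reduced s e (Suc i) s'' \<and> s'' 0 35 = i)"
proof -
  let ?g = "e * rho + i"
  let ?X = "{1, 2, 3, 6, 29, 31, 32, 33, 34, 35, 38} :: nat set"
  let ?Y = "{4, 5, 6, 7, 12} :: nat set"
  let ?S = "HAdd 2 21 35 ;; HGet 3 4 2 ;; HIf 3 HSkip (HAdd 6 6 6) ;; HGet 38 7 35"
  have iD: "Suc i \<le> D" using i dD[OF e] by linarith
  have irho: "i \<le> rho" using iD Drho by linarith
  note sh = idx_short[OF e irho le0]
  have fr: "frame ?X ?Y s s'" using r by (simp add: reduced_def)
  have c: "s' 0 21 = e * rho" "s' 0 30 = d e" "s' 0 18 = rho" "s' 0 20 = e" "s' 0 34 = ?g * rho"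
    using fr s r by (auto simp: frame_def reduced_def)
  \<comment> \<open>An insertion during this pass can only have filled a slot p < i, so the flag
    read at slot i is still the old one.\<close>
  have fl: "s' 4 ?g = s 4 ?g"
  proof (cases "s' 0 33 = 0")
    case True then show ?thesis using r by (simp add: reduced_def unchanged_def)
  next
    case False
    then obtain p where "p < i" "inserted s s' e p (s' 0 32)" using r by (auto simp: reduced_def)
    then show ?thesis by (simp add: inserted_def fun_upd_def cong: if_cong)
  qed
  define s1 where "s1 = eval ?S s'"
  have e1: "s1 0 x = (if x = 38 then s' 7 i else if x = 6 then 2 ^ free_upto s e (Suc i) else if x = 3 then s 4 ?g
      else if x = 2 then ?g else s' 0 x)" for x
    using c k fl r by (auto simp: s1_def free_upto_Suc reduced_def)
  have q1: "s1 q = s' q" if "q \<noteq> 0" for q using that by (simp add: s1_def)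
  have f1: "frame ?X ?Y s s1" using fr by (simp add: s1_def)
  have W: "2 ^ D < (2::nat) ^ (\<beta> * \<eta>)"
  proof -
    have "1 * 2 ^ D \<le> N * (2::nat) ^ D" using e by (intro mult_le_mono1) simp
    from le_less_trans[OF this weight] show ?thesis by (simp only: mult_1)
  qed
  have "(2::nat) ^ Suc (free_upto s e i) \<le> 2 ^ D"
    using free_upto_le[of s e i] iD by (intro power_increasing) auto
  then have "(2::nat) ^ free_upto s e i + 2 ^ free_upto s e i < 2 ^ (\<beta> * \<eta>)"
    using le_less_trans[OF _ W] by (simp add: mult_2)
  moreover have "s' 0 6 = 2 ^ free_upto s e i" using r by (simp add: reduced_def)
  ultimately have w6: "s' 0 6 + s' 0 6 < lim 6" by (simp add: lim_def heavy_def)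
  have even1: "even (example s e z + (\<Sum>j<d e. s' 7 j * z j) + s' 0 32)" if "sat s e z" for z
    using r that by (simp add: reduced_def)
  \<comment> \<open>Register 34 is advanced only after the branches, so the invariant for the next
    column is stated with its future value.\<close>
  define mid where "mid s'' \<longleftrightarrow> reduced s e (Suc i) (upd s'' 0 34 ((e * rho + Suc i) * rho)) \<and> s'' 0 35 = i \<and> s'' 0 34 = ?g * rho \<and>
    s'' 0 18 = rho" for s''
  have vle: "s' 7 j \<le> 1" if "j < d e" for j using r that by (simp add: reduced_def)
  have br: "run (HIf 38 (HIf 33 HSkip (HIf 3 XOR INSERT)) HSkip) s1 (hcost [38] + (hcost [33] + (hcost [3] + (11 * D + 10)))) mid"
  proof (rule run_If)
    assume v: "s1 0 38 \<noteq> 0"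
    then have v1: "s' 7 i = 1" using e1 vle[OF i] by simp
    show "run (HIf 33 HSkip (HIf 3 XOR INSERT)) s1 (hcost [33] + (hcost [3] + (11 * D + 10))) mid"
    proof (rule run_If)
      assume f: "s1 0 33 \<noteq> 0"
      then obtain p where p: "p < i" "inserted s s' e p (s' 0 32)" "\<forall>j<p. s' 7 j = 0" "s' 7 p = 1"
        using r e1 by (auto simp: reduced_def)
      have "reduced s e (Suc i) (upd s1 0 34 ((e * rho + Suc i) * rho))"
        unfolding reduced_def
      proof (intro conjI)
        show "upd s1 0 34 ((e * rho + Suc i) * rho) 0 33 \<noteq> 0 \<longrightarrow> (\<exists>p<Suc i. inserted s (upd s1 0 34 ((e * rho + Suc i) * rho)) e p
           (upd s1 0 34 ((e * rho + Suc i) * rho) 0 32) \<and> (\<forall>j<p. upd s1 0 34 ((e * rho + Suc i) * rho) 7 j = 0) \<and>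
           upd s1 0 34 ((e * rho + Suc i) * rho) 7 p = 1)"
          using p e1 q1 inserted_cong[OF p(2), of "upd s1 0 34 ((e * rho + Suc i) * rho)"] by (intro impI exI[of _ p]) simp
      qed (use r e1 q1 f1 f in \<open>auto simp: reduced_def\<close>)
      then have "mid s1" using e1 k c by (simp add: mid_def)
      from run_Skip[of mid, OF this] show "run HSkip s1 (hcost [3] + (11 * D + 10)) mid" by (rule run_mono) auto
    next
      assume "s1 0 33 = 0"
      then have f: "s' 0 33 = 0" using e1 by simp
      then have un: "unchanged s s'" and v0: "\<forall>j<i. s' 7 j = 0" using r by (auto simp: reduced_def)
      show "run (HIf 3 XOR INSERT) s1 (hcost [3] + (11 * D + 10)) mid"
      proof (rule run_If)
        assume "s1 0 3 \<noteq> 0"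
        then have fg: "s 4 ?g \<noteq> 0" using e1 by simp
        have row: "s 5 ?g \<le> 1" "\<forall>j<d e. s 6 (?g * rho + j) \<le> 1" "\<forall>j<i. s 6 (?g * rho + j) = 0" "s 6 (?g * rho + i) = 1"
          using wf i fg by (auto simp: wf_expert_def row_ok_def)
        have "run XOR s1 (11 * D + 10) (\<lambda>s'. (\<forall>j<d e. s' 7 j = (if s1 6 (?g * rho + j) \<noteq> 0 then 1 - s1 7 j else s1 7 j)) \<and>
           s' 0 32 = (if s1 5 ?g \<noteq> 0 then 1 - s1 0 32 else s1 0 32) \<and> frame {1, 2, 29, 31, 32} {7} s1 s')"
          by (rule run_XOR[OF _ _ _ _ e i]) (use e1 c k in auto)
        then show "run XOR s1 (11 * D + 10) mid"
        proof (rule run_mono)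
          fix s2 assume s2: "(\<forall>j<d e. s2 7 j = (if s1 6 (?g * rho + j) \<noteq> 0 then 1 - s1 7 j else s1 7 j)) \<and>
             s2 0 32 = (if s1 5 ?g \<noteq> 0 then 1 - s1 0 32 else s1 0 32) \<and> frame {1, 2, 29, 31, 32} {7} s1 s2"
          have v2: "s2 7 j = (if s 6 (?g * rho + j) \<noteq> 0 then 1 - s' 7 j else s' 7 j)" if "j < d e" for j
            using s2 that q1 un by (simp add: unchanged_def)
          have a2: "s2 0 32 = (if s 5 ?g \<noteq> 0 then 1 - s' 0 32 else s' 0 32)"
            using s2 q1 un e1 by (simp add: unchanged_def)
          have f2: "frame {1, 2, 29, 31, 32} {7} s1 s2" using s2 by simp
          have x2: "s2 0 x = s1 0 x" if "x \<notin> {1, 2, 29, 31, 32}" for x by (rule frameD0[OF f2 that])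
          have q2: "s2 q = s' q" if "q \<notin> {0, 7}" for q using frameDq[OF f2, of q] q1[of q] that by simp
          have "even (example s e z + (\<Sum>j<d e. s2 7 j * z j) + s2 0 32)" if z: "sat s e z" for z
          proof -
            \<comment> \<open>Entrywise, new row = old row + stored row modulo 2; the stored
              equation then transfers the parity invariant.\<close>
            have "even (\<Sum>j<d e. s2 7 j * z j + s' 7 j * z j + s 6 (?g * rho + j) * z j)"
              using xor_step(1) row(2) vle v2 by (intro dvd_sum) simp
            then have 1: "even ((\<Sum>j<d e. s2 7 j * z j) + (\<Sum>j<d e. s' 7 j * z j) + (\<Sum>j<d e. s 6 (?g * rho + j) * z j))"
              by (simp add: sum.distrib)
            have 2: "even ((\<Sum>j<d e. s 6 (?g * rho + j) * z j) + s 5 ?g)" using z i fg by (simp add: sat_def)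
            have "s' 0 32 \<le> 1" using r by (simp add: reduced_def)
            then have 3: "even (s2 0 32 + s' 0 32 + s 5 ?g)" using xor_step(3) row(1) a2 by simp
            show ?thesis using 1 2 3 even1[OF z] by (simp add: even_add) blast
          qed
          moreover have "s2 7 j \<le> 1" if "j < d e" for j
            using v2[OF that] xor_step(2)[OF vle[OF that]] row(2) that by simp
          moreover have "s2 0 32 \<le> 1" using a2 r by (auto simp: reduced_def)
          moreover have "s2 7 j = 0" if "j < Suc i" for j
            using that v2[of j] i v0 row(3,4) v1 by (auto simp: less_Suc_eq)
          moreover have "frame ?X ?Y s s2" by (rule frame_trans[OF f1]) (use f2 in \<open>auto elim: frame_mono\<close>)
          moreover have "s2 0 33 = 0" "s2 0 6 = 2 ^ free_upto s e (Suc i)" using x2 e1 f by auto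
          moreover have "unchanged s s2" using un q2 by (simp add: unchanged_def)
          ultimately have "reduced s e (Suc i) (upd s2 0 34 ((e * rho + Suc i) * rho))"
            by (simp add: reduced_def unchanged_def)
          then show "mid s2" using x2 e1 k c by (simp add: mid_def)
        qed simp
      next
        assume "s1 0 3 = 0"
        then have fg: "s 4 ?g = 0" using e1 by simp
        have "run INSERT s1 (7 * D + 10) (\<lambda>s'. inserted s1 s' e i (s1 0 32) \<and> s' 0 33 = 1 \<and> frame {1, 2, 29, 31, 33} {4, 5, 6, 12} s1 s')"
          by (rule run_INSERT[OF _ _ _ _ _ e i]) (use e1 c k q1 fl fg in auto)
        then show "run INSERT s1 (11 * D + 10) mid"
        proof (rule run_mono)
          fix s2 assume s2: "inserted s1 s2 e i (s1 0 32) \<and> s2 0 33 = 1 \<and> frame {1, 2, 29, 31, 33} {4, 5, 6, 12} s1 s2"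
          then have f2: "frame {1, 2, 29, 31, 33} {4, 5, 6, 12} s1 s2" by simp
          have x2: "s2 0 x = s1 0 x" if "x \<notin> {1, 2, 29, 31, 33}" for x by (rule frameD0[OF f2 that])
          have 7: "s2 7 = s' 7" using frameDq[OF f2, of 7] q1[of 7] by simp
          have "inserted s s2 e i (s' 0 32)"
            using s2 q1 un e1 fg by (simp add: inserted_def unchanged_def fun_upd_def cong: if_cong)
          moreover have "frame ?X ?Y s s2" by (rule frame_trans[OF f1]) (use f2 in \<open>auto elim: frame_mono\<close>)
          ultimately have "inserted s (upd s2 0 34 ((e * rho + Suc i) * rho)) e i (s' 0 32)"
            "frame ?X ?Y s (upd s2 0 34 ((e * rho + Suc i) * rho))"
            by (auto intro: inserted_cong)
          moreover have "s2 0 32 = s' 0 32" "s2 0 33 = 1" "s2 0 6 = 2 ^ free_upto s e (Suc i)" using x2 e1 s2 by auto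
          moreover have "s' 0 32 \<le> 1" using r by (simp add: reduced_def)
          ultimately have "reduced s e (Suc i) (upd s2 0 34 ((e * rho + Suc i) * rho))"
            unfolding reduced_def using 7 vle even1 v0 v1 by (auto intro!: exI[of _ i])
          then show "mid s2" using x2 e1 k c by (simp add: mid_def)
        qed simp
      qed simp
    qed simp
  next
    assume "s1 0 38 = 0"
    then have v0: "s' 7 i = 0" using e1 by simp
    have "reduced s e (Suc i) (upd s1 0 34 ((e * rho + Suc i) * rho))"
      unfolding reduced_def
    proof (intro conjI)
      show "upd s1 0 34 ((e * rho + Suc i) * rho) 0 33 \<noteq> 0 \<longrightarrow> (\<exists>p<Suc i. inserted s (upd s1 0 34 ((e * rho + Suc i) * rho)) e p
           (upd s1 0 34 ((e * rho + Suc i) * rho) 0 32) \<and> (\<forall>j<p. upd s1 0 34 ((e * rho + Suc i) * rho) 7 j = 0) \<and>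
           upd s1 0 34 ((e * rho + Suc i) * rho) 7 p = 1)"
      proof
        assume "upd s1 0 34 ((e * rho + Suc i) * rho) 0 33 \<noteq> 0"
        then obtain p where p: "p < i" "inserted s s' e p (s' 0 32)" "\<forall>j<p. s' 7 j = 0" "s' 7 p = 1"
          using r e1 by (auto simp: reduced_def)
        then show "\<exists>p<Suc i. inserted s (upd s1 0 34 ((e * rho + Suc i) * rho)) e p
           (upd s1 0 34 ((e * rho + Suc i) * rho) 0 32) \<and> (\<forall>j<p. upd s1 0 34 ((e * rho + Suc i) * rho) 7 j = 0) \<and>
           upd s1 0 34 ((e * rho + Suc i) * rho) 7 p = 1"
          using e1 q1 inserted_cong[OF p(2), of "upd s1 0 34 ((e * rho + Suc i) * rho)"] by (intro exI[of _ p]) simp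
      qed
    qed (use r e1 q1 f1 v0 in \<open>auto simp: reduced_def unchanged_def less_Suc_eq\<close>)
    then have "mid s1" using e1 k c by (simp add: mid_def)
    from run_Skip[of mid, OF this] show "run HSkip s1 (hcost [33] + (hcost [3] + (11 * D + 10))) mid" by (rule run_mono) auto
  qed simp
  have "run (?S ;; HIf 38 (HIf 33 HSkip (HIf 3 XOR INSERT)) HSkip ;; HAdd 34 34 18) s'
     ((\<eta> + 4) + ((hcost [38] + (hcost [33] + (hcost [3] + (11 * D + 10)))) + 1)) (\<lambda>s''. reduced s e (Suc i) s'' \<and> s'' 0 35 = i)"
  proof (rule run_step)
    show "safe ?S s'" using sh c k w6 by (auto simp: heavy_def)
    show "cost ?S \<le> \<eta> + 4" using \<eta> by (simp add: hcost_def heavy_def)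
    show "run (HIf 38 (HIf 33 HSkip (HIf 3 XOR INSERT)) HSkip ;; HAdd 34 34 18) (eval ?S s')
      ((hcost [38] + (hcost [33] + (hcost [3] + (11 * D + 10)))) + 1) (\<lambda>s''. reduced s e (Suc i) s'' \<and> s'' 0 35 = i)"
      unfolding s1_def[symmetric]
    proof (rule run_Seq[OF br])
      fix s2 assume s2: "bnd s2" "mid s2"
      have m: "reduced s e (Suc i) (upd s2 0 34 ((e * rho + Suc i) * rho))" "s2 0 35 = i" "s2 0 34 = ?g * rho" "s2 0 18 = rho"
        using s2(2) by (simp_all only: mid_def)
      have "eval (HAdd 34 34 18) s2 = upd s2 0 34 ((e * rho + Suc i) * rho)" by (simp add: m(3,4) add.commute)
      then show "run (HAdd 34 34 18) s2 1 (\<lambda>s''. reduced s e (Suc i) s'' \<and> s'' 0 35 = i)"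
        using m sh(4) by (intro run_simple) (simp_all add: heavy_def)
    qed
  qed
  then show ?thesis by (rule run_mono) (auto simp: heavy_def)
qed

lemma run_REDUCE:
  assumes s: "s 0 30 = d e" "s 0 20 = e" "s 0 21 = e * rho" "s 0 18 = rho" "s 0 34 = e * rho * rho" "s 0 32 = 0" "s 0 33 = 0"
      "s 0 6 = 1" "\<forall>j<d e. s 7 j = input_at a (s 3 (e * rho + j))"
    and e: "e < N" and wf: "wf_expert s e"
  shows "run REDUCE s (D * (11 * D + \<eta> + 22) + 3) (reduced s e (d e))"
proof -
  have "run REDUCE s ((\<Sum>i<d e. (11 * D + \<eta> + 18) + 4) + 3) (reduced s e (d e))"
    unfolding REDUCE_def
  proof (rule run_FOR[where I = "reduced s e"])
    have "even (example s e z + (\<Sum>j<d e. s 7 j * z j))" for z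
      using s(9) by (simp add: example_def)
    moreover have "\<forall>j<d e. s 7 j \<le> 1" using s(9) input_at_le by simp
    ultimately show "reduced s e 0 (upd (upd s 0 35 0) 0 1 t)" for t
      using s by (simp add: reduced_def free_upto_def unchanged_def)
    fix i s' assume i: "i < d e" "bnd s'" "reduced s e i s'" "s' 0 35 = i" "s' 0 30 = d e"
    show "run ((HAdd 2 21 35 ;; HGet 3 4 2 ;; HIf 3 HSkip (HAdd 6 6 6) ;; HGet 38 7 35) ;;
     HIf 38 (HIf 33 HSkip (HIf 3 XOR INSERT)) HSkip ;; HAdd 34 34 18) s' (11 * D + \<eta> + 18)
     (\<lambda>s''. s'' 0 35 = i \<and> s'' 0 30 = d e \<and> (\<forall>t. reduced s e (Suc i) (upd (upd s'' 0 35 (Suc i)) 0 1 t)))"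
    proof (rule run_mono[OF run_reduce_body[OF s(1-4) e wf i(1,3,4)]])
      fix s'' assume s'': "reduced s e (Suc i) s'' \<and> s'' 0 35 = i"
      then have f: "frame {1, 2, 3, 6, 29, 31, 32, 33, 34, 35, 38} {4, 5, 6, 7, 12} s s''" by (simp add: reduced_def)
      have "s'' 0 30 = d e" using frameD0[OF f, of 30] s(1) by simp
      moreover have "reduced s e (Suc i) (upd (upd s'' 0 35 (Suc i)) 0 1 t)" for t
        by (rule reduced_cong[of s e "Suc i" s'']) (use s'' f in auto)
      ultimately show "s'' 0 35 = i \<and> s'' 0 30 = d e \<and> (\<forall>t. reduced s e (Suc i) (upd (upd s'' 0 35 (Suc i)) 0 1 t))"
        using s'' by blast
    qed simp
  qed (use s in \<open>auto simp: heavy_def\<close>)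
  then show ?thesis
  proof (rule run_mono)
    have "d e * (11 * D + \<eta> + 22) \<le> D * (11 * D + \<eta> + 22)" using dD[OF e] by (rule mult_le_mono1)
    moreover have "(\<Sum>i<d e. (11 * D + \<eta> + 18) + 4) = d e * (11 * D + \<eta> + 22)" by (simp add: algebra_simps)
    ultimately show "(\<Sum>i<d e. (11 * D + \<eta> + 18) + 4) + 3 \<le> D * (11 * D + \<eta> + 22) + 3" by linarith
  qed
qed

definition same_row :: "state \<Rightarrow> state \<Rightarrow> nat \<Rightarrow> nat \<Rightarrow> bool" where
  "same_row s s' k g \<longleftrightarrow> s' 4 g = s 4 g \<and> s' 5 g = s 5 g \<and> (\<forall>j<k. s' 6 (g * rho + j) = s 6 (g * rho + j))"

text \<open>If s' 9 e = 0, the system forces the answer s' 13 e. Otherwise the example is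
  independent, and its equation occupies slot p with a provisional right-hand side.\<close>

definition outcome :: "state \<Rightarrow> state \<Rightarrow> nat \<Rightarrow> bool" where
  "outcome s s' e \<longleftrightarrow> s' 13 e \<le> 1 \<and> wf_expert s' e \<and>
     (s' 9 e = 0 \<longrightarrow> (\<forall>i<d e. same_row s s' (d e) (e * rho + i)) \<and> (\<forall>z. sat s e z \<longrightarrow> even (example s e z + s' 13 e))) \<and>
     (s' 9 e \<noteq> 0 \<longrightarrow> (\<exists>p<d e. s' 12 e = e * rho + p \<and> s 4 (e * rho + p) = 0 \<and> s' 4 (e * rho + p) = 1 \<and>
        (\<forall>i<d e. i \<noteq> p \<longrightarrow> same_row s s' (d e) (e * rho + i)) \<and>
        (\<forall>z. sat s e z \<longrightarrow> even (example s e z + (\<Sum>j<d e. s' 6 ((e * rho + p) * rho + j) * z j) + s' 5 (e * rho + p)))))"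

text \<open>The memory outside the rows of expert e is untouched, so the experts can be treated one
  after the other.\<close>

definition local :: "state \<Rightarrow> state \<Rightarrow> nat \<Rightarrow> bool" where
  "local s s' e \<longleftrightarrow> (\<forall>x. x < e * rho \<or> Suc e * rho \<le> x \<longrightarrow> s' 4 x = s 4 x \<and> s' 5 x = s 5 x) \<and>
     (\<forall>x. x < e * rho * rho \<or> Suc e * rho * rho \<le> x \<longrightarrow> s' 6 x = s 6 x) \<and>
     (\<forall>e'. e' \<noteq> e \<longrightarrow> s' 9 e' = s 9 e' \<and> s' 12 e' = s 12 e' \<and> s' 13 e' = s 13 e')"

abbreviation free :: "state \<Rightarrow> nat \<Rightarrow> nat" where
  "free s e \<equiv> free_upto s e (d e)"

lemma row_inj:
  assumes "i < rho" "j < rho" "g * rho + i = g' * rho + j" shows "g = g' \<and> i = j"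
proof -
  have "(i + g * rho) div rho = (j + g' * rho) div rho" using assms(3) by (simp add: add.commute)
  then have "g = g'" using assms(1,2) rho_pos by simp
  then show ?thesis using assms(3) by simp
qed

lemma reduced_outcome:
  assumes r: "reduced s e (d e) s'" and e: "e < N" and wf: "wf_expert s e"
    and s'': "s'' 4 = s' 4" "s'' 5 = s' 5" "s'' 6 = s' 6" "s'' 12 = s' 12"
      "s'' 13 = (s 13)(e := s' 0 32)" "s'' 9 = (s 9)(e := s' 0 33)"
  shows "outcome s s'' e" "local s s'' e"
proof -
  have drho: "d e \<le> rho" using dD[OF e] Drho by linarith
  have z: "even (example s e z + (\<Sum>j<d e. s' 7 j * z j) + s' 0 32)" if "sat s e z" for z
    using r that by (simp add: reduced_def)
  have "outcome s s'' e \<and> local s s'' e"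
  proof (cases "s' 0 33 = 0")
    case True
    then have un: "unchanged s s'" and v0: "\<forall>j<d e. s' 7 j = 0" using r by (auto simp: reduced_def)
    have "even (example s e z + s' 0 32)" if "sat s e z" for z using z[OF that] v0 by simp
    moreover have "wf_expert s'' e" using wf un s'' by (simp add: wf_expert_def row_ok_def unchanged_def)
    moreover have "s' 0 32 \<le> 1" using r by (simp add: reduced_def)
    ultimately show ?thesis
      using True un s'' by (simp add: outcome_def same_row_def local_def unchanged_def)
  next
    case False
    then obtain p where p: "p < d e" "inserted s s' e p (s' 0 32)" "\<forall>j<p. s' 7 j = 0" "s' 7 p = 1"
      using r by (auto simp: reduced_def)
    let ?g = "e * rho + p"
    have v1: "\<forall>j<d e. s' 7 j \<le> 1" and acc: "s' 0 32 \<le> 1" using r by (auto simp: reduced_def)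
    have 4: "s'' 4 x = (if x = ?g then 1 else s 4 x)" "s'' 5 x = (if x = ?g then s' 0 32 else s 5 x)"
      "s'' 6 x = (if ?g * rho \<le> x \<and> x < ?g * rho + d e then s' 7 (x - ?g * rho) else s 6 x)"
      "s'' 12 x = (if x = e then ?g else s 12 x)" for x
      using p(2) s'' by (auto simp: inserted_def)
    have new: "s'' 6 (?g * rho + j) = s' 7 j" if "j < d e" for j using 4(3) that by simp
    have old: "same_row s s'' (d e) (e * rho + i)" if "i < d e" "i \<noteq> p" for i
    proof -
      \<comment> \<open>Coefficient rows of different slots are disjoint, since a row has at most
        rho entries.\<close>
      have "\<not> (?g * rho \<le> (e * rho + i) * rho + j \<and> (e * rho + i) * rho + j < ?g * rho + d e)" if "j < d e" for j
      proof
        assume *: "?g * rho \<le> (e * rho + i) * rho + j \<and> (e * rho + i) * rho + j < ?g * rho + d e"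
        then have "(e * rho + i) * rho + j = ?g * rho + ((e * rho + i) * rho + j - ?g * rho)" by simp
        from row_inj[OF _ _ this] that * drho have "e * rho + i = ?g" by auto
        then show False using \<open>i \<noteq> p\<close> by simp
      qed
      then show ?thesis using that unfolding same_row_def 4 by auto
    qed
    have "wf_expert s'' e"
      unfolding wf_expert_def
    proof (intro allI impI)
      fix i assume i: "i < d e"
      show "row_ok s'' (d e) (e * rho + i) i"
      proof (cases "i = p")
        case True
        then show ?thesis using p v1 acc i by (auto simp: row_ok_def 4(1,2) new)
      next
        case False
        then show ?thesis using old[OF i False] wf i by (simp add: wf_expert_def row_ok_def same_row_def)
      qed
    qed
    moreover have "local s s'' e"
    proof -
      have prho: "p < rho" using p(1) drho by linarith
      have g: "e * rho \<le> ?g" "?g < Suc e * rho" using prho by auto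
      have "Suc ?g * rho \<le> Suc e * rho * rho" using g(2) by (intro mult_le_mono1) simp
      then have "?g * rho + d e \<le> Suc e * rho * rho" using drho by simp
      moreover have "e * rho * rho \<le> ?g * rho" using g(1) by (intro mult_le_mono1)
      ultimately have "s'' 6 x = s 6 x" if "x < e * rho * rho \<or> Suc e * rho * rho \<le> x" for x
        using that unfolding 4 by (meson leD le_trans less_le_trans)
      then show ?thesis using g s''(5,6) by (auto simp: local_def 4(1,2,4))
    qed
    moreover have "even (example s e z + (\<Sum>j<d e. s'' 6 (?g * rho + j) * z j) + s'' 5 ?g)" if "sat s e z" for z
      using z[OF that] new by (simp add: 4(2))
    moreover have "s 4 ?g = 0" using p(2) by (simp add: inserted_def)
    ultimately show ?thesis
      using False p(1) old acc s''(5,6) unfolding outcome_def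
      by (auto simp: 4(1,4) intro!: exI[of _ p])
  qed
  then show "outcome s s'' e" "local s s'' e" by auto
qed

lemma run_EXPERT:
  assumes s: "s 0 20 = e" "s 0 21 = e * rho" "s 0 18 = rho" "s 0 23 = e * rho * rho" "s 11 e = d e"
    and e: "e < N" and wf: "wf_expert s e"
    and W: "s 0 4 + 2 ^ D < 2 ^ (\<beta> * \<eta>)" "s 0 5 + 2 ^ D < 2 ^ (\<beta> * \<eta>)"
  shows "run EXPERT s (D * (11 * D + \<eta> + 30) + \<eta> + 20) (\<lambda>s'. outcome s s' e \<and> local s s' e \<and>
     s' 0 4 = s 0 4 + (if s' 9 e = 0 \<and> s' 13 e = 0 then 2 ^ free s e else 0) \<and>
     s' 0 5 = s 0 5 + (if s' 9 e = 0 \<and> s' 13 e \<noteq> 0 then 2 ^ free s e else 0) \<and>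
     frame {1, 2, 3, 4, 5, 6, 29, 30, 31, 32, 33, 34, 35, 38} {4, 5, 6, 7, 9, 12, 13} s s')"
proof -
  let ?X = "{1, 2, 3, 4, 5, 6, 29, 30, 31, 32, 33, 34, 35, 38} :: nat set"
  let ?Y = "{4, 5, 6, 7, 9, 12, 13} :: nat set"
  let ?post = "\<lambda>s'. outcome s s' e \<and> local s s' e \<and>
     s' 0 4 = s 0 4 + (if s' 9 e = 0 \<and> s' 13 e = 0 then 2 ^ free s e else 0) \<and>
     s' 0 5 = s 0 5 + (if s' 9 e = 0 \<and> s' 13 e \<noteq> 0 then 2 ^ free s e else 0) \<and> frame ?X ?Y s s'"
  let ?P = "HConst 32 0 ;; HConst 33 0 ;; HConst 6 1 ;; COPY 34 23"
  let ?E = "HPut 13 20 32 ;; HPut 9 20 33 ;; HIf 33 HSkip (HIf 32 (HAdd 5 5 6) (HAdd 4 4 6))"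
  define s1 where "s1 = eval (HGet 30 11 20) s"
  have s1: "s1 = upd s 0 30 (d e)" using s by (simp add: s1_def)
  have "run EXPERT s (1 + ((8 * D + 3) + (5 + ((D * (11 * D + \<eta> + 22) + 3) + (\<eta> + 4))))) ?post"
    unfolding EXPERT_def
  proof (rule run_step)
    show "run (LOADV ;; ?P ;; REDUCE ;; ?E) (eval (HGet 30 11 20) s) ((8 * D + 3) + (5 + ((D * (11 * D + \<eta> + 22) + 3) + (\<eta> + 4)))) ?post"
      unfolding s1_def[symmetric]
    proof (rule run_Seq[OF run_LOADV[OF _ _ e]])
      fix s2 assume s2: "bnd s2" "(\<forall>j<d e. s2 7 j = input_at a (s1 3 (e * rho + j))) \<and> frame {1, 2, 31} {7} s1 s2"
      have f2: "frame {1, 2, 31} {7} s1 s2" using s2 by simp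
      have x2: "s2 0 x = s1 0 x" if "x \<notin> {1, 2, 31}" for x by (rule frameD0[OF f2 that])
      have q2: "s2 q = s q" if "q \<notin> {0, 7}" for q using frameDq[OF f2, of q] that by (simp add: s1)
      define s3 where "s3 = eval ?P s2"
      have x3: "s3 0 x = (if x = 34 then e * rho * rho else if x = 6 then 1 else if x \<in> {32, 33} then 0 else s2 0 x)" for x
        using x2 s by (auto simp: s3_def COPY_def s1)
      have q3: "s3 q = s2 q" if "q \<noteq> 0" for q using that by (simp add: s3_def COPY_def)
      have ex: "example s3 e = example s e" "sat s3 e = sat s e" "wf_expert s3 e = wf_expert s e" "free s3 e = free s e"
        using q2 q3 by (auto simp: example_def sat_def wf_expert_def row_ok_def free_upto_def fun_eq_iff)
      show "run (?P ;; REDUCE ;; ?E) s2 (5 + ((D * (11 * D + \<eta> + 22) + 3) + (\<eta> + 4))) ?post"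
      proof (rule run_step)
        have "e * rho * rho < 2 ^ \<beta>" using idx_short(2)[OF e le0 le0] by simp
        then show "safe ?P s2" using x2 s one_short by (simp add: COPY_def heavy_def s1 lim_def)
        show "run (REDUCE ;; ?E) (eval ?P s2) ((D * (11 * D + \<eta> + 22) + 3) + (\<eta> + 4)) ?post"
          unfolding s3_def[symmetric]
        proof (rule run_Seq[OF run_REDUCE[OF _ _ _ _ _ _ _ _ _ e]])
          fix s4 assume s4: "bnd s4" "reduced s3 e (d e) s4"
          have f4: "frame {1, 2, 3, 6, 29, 31, 32, 33, 34, 35, 38} {4, 5, 6, 7, 12} s3 s4"
            and b4: "s4 0 32 \<le> 1" "s4 0 33 \<le> 1" "s4 0 6 = 2 ^ free s e" using s4(2) ex(4) by (auto simp: reduced_def)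
          have x4: "s4 0 x = s3 0 x" if "x \<notin> {1, 2, 3, 6, 29, 31, 32, 33, 34, 35, 38}" for x by (rule frameD0[OF f4 that])
          have q4: "s4 q = s q" if "q \<notin> {0, 4, 5, 6, 7, 12}" for q using frameDq[OF f4, of q] q2[of q] q3[of q] that by simp
          have k4: "s4 0 20 = e" "s4 0 4 = s 0 4" "s4 0 5 = s 0 5" using x4 x3 x2 s by (auto simp: s1)
          have "frame ?X ?Y s s1" "frame ?X ?Y s1 s2" "frame ?X ?Y s2 s3" "frame ?X ?Y s3 s4"
            using f2 f4 by (auto simp: s1 s3_def COPY_def elim: frame_mono)
          then have fr: "frame ?X ?Y s s4" by (meson frame_trans)
          define s5 where "s5 = eval ?E s4"
          have fD: "(2::nat) ^ free s e \<le> 2 ^ D"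
            using free_upto_le[of s e "d e"] dD[OF e] by (intro power_increasing) auto
          have q5: "s5 q = (if q = 13 then (s 13)(e := s4 0 32) else if q = 9 then (s 9)(e := s4 0 33) else s4 q)" if "q \<noteq> 0" for q
            using that k4 q4[of 13] q4[of 9] by (auto simp: s5_def upd_def)
          have out3: "outcome s3 s5 e" "local s3 s5 e"
            by (rule reduced_outcome[OF s4(2) e]; use ex wf q5 q2 q3 in simp)+
          have out: "outcome s s5 e" "local s s5 e"
            using out3 q2 q3 ex unfolding outcome_def local_def same_row_def by simp_all
          have W4: "s5 0 4 = s 0 4 + (if s5 9 e = 0 \<and> s5 13 e = 0 then 2 ^ free s e else 0)"
            "s5 0 5 = s 0 5 + (if s5 9 e = 0 \<and> s5 13 e \<noteq> 0 then 2 ^ free s e else 0)"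
            using k4 b4 by (auto simp: s5_def)
          show "run ?E s4 (\<eta> + 4) ?post"
          proof (rule run_simple)
            have "s 0 4 + 2 ^ free s e < 2 ^ (\<beta> * \<eta>)" "s 0 5 + 2 ^ free s e < 2 ^ (\<beta> * \<eta>)"
              using le_less_trans[OF add_left_mono[OF fD] W(1)] le_less_trans[OF add_left_mono[OF fD] W(2)] .
            then show "safe ?E s4" using k4 b4 by (simp add: heavy_def lim_def)
            show "cost ?E \<le> \<eta> + 4" using \<eta> by (simp add: hcost_def heavy_def)
            show "?post (eval ?E s4)" using out W4 fr unfolding s5_def[symmetric] by (simp add: s5_def)
          qed
        qed (use x3 x2 q2 q3 s s2(2) ex wf in \<open>auto simp: s1\<close>)
      qed (auto simp: COPY_def hcost_def heavy_def)
    qed (use s in \<open>auto simp: s1\<close>)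
  qed (use s in \<open>auto simp: heavy_def\<close>)
  then show ?thesis by (rule run_mono) (auto simp: algebra_simps)
qed

end

text \<open>Ties predict 0, because truncated subtraction tests whether the votes for 1 are strictly
  heavier.\<close>

definition PREDICT :: hl where
  "PREDICT = (HConst 4 0 ;; HConst 5 0 ;; HConst 21 0 ;; HConst 23 0) ;; MUL 24 18 18 ;;
     FOR 20 19 (HGet 2 8 20 ;; HIf 2 HSkip EXPERT ;; (HAdd 21 21 18 ;; HAdd 23 23 24)) ;;
     (HSub 7 5 4 ;; HIf 7 (HConst 9 1) (HConst 9 0))"

text \<open>An expert with a fresh equation may have to flip its right-hand side; an expert with a
  forced answer dies if that answer was wrong.\<close>

definition UPDATE1 :: hl where
  "UPDATE1 = HGet 2 8 20 ;; HIf 2 HSkip (HGet 2 9 20 ;;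
     HIf 2 (HIf 9 (HGet 3 12 20 ;; HGet 2 5 3 ;; HConst 29 1 ;; HSub 2 29 2 ;; HPut 5 3 2) HSkip)
       (HGet 2 13 20 ;; HConst 29 1 ;; HIf 9 (HIf 2 HSkip (HPut 8 20 29)) (HIf 2 (HPut 8 20 29) HSkip)))"

definition UPDATE :: hl where
  "UPDATE = FOR 20 19 UPDATE1"

section \<open>The vote of all experts\<close>

context rounds
begin

definition inv :: "state \<Rightarrow> bool" where
  "inv s \<longleftrightarrow> s 0 18 = rho \<and> s 0 19 = N \<and> (\<forall>e<N. s 11 e = d e \<and> (s 8 e = 0 \<longrightarrow> wf_expert s e))"

definition vote :: "state \<Rightarrow> state \<Rightarrow> bool \<Rightarrow> nat \<Rightarrow> nat" where
  "vote s s' b e = (if s 8 e = 0 \<and> s' 9 e = 0 \<and> (s' 13 e \<noteq> 0 \<longleftrightarrow> b) then 2 ^ free s e else 0)"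

definition predicted :: "state \<Rightarrow> state \<Rightarrow> bool" where
  "predicted s s' \<longleftrightarrow> (\<forall>e<N. s 8 e = 0 \<longrightarrow> outcome s s' e) \<and>
     frame {1, 2, 3, 4, 5, 6, 7, 9, 20, 21, 23, 24, 29, 30, 31, 32, 33, 34, 35, 38} {4, 5, 6, 7, 9, 12, 13} s s'"

text \<open>When the turn of expert e comes, its data are still those at the start of the round;
  this lets \<open>outcome\<close> refer to the original s.\<close>

definition same_from :: "state \<Rightarrow> state \<Rightarrow> nat \<Rightarrow> bool" where
  "same_from s s' e \<longleftrightarrow> (\<forall>x \<ge> e * rho. s' 4 x = s 4 x \<and> s' 5 x = s 5 x) \<and> (\<forall>x \<ge> e * rho * rho. s' 6 x = s 6 x)"

lemma outcome_base:
  assumes o: "outcome s' s'' e" and sm: "same_from s s' e" and 3: "s' 3 = s 3"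
  shows "outcome s s'' e"
proof -
  have 4: "s' 4 (e * rho + i) = s 4 (e * rho + i)" "s' 5 (e * rho + i) = s 5 (e * rho + i)"
    "s' 6 ((e * rho + i) * rho + j) = s 6 ((e * rho + i) * rho + j)" for i j
    using sm by (auto simp: same_from_def add_mult_distrib add.assoc)
  have "sat s' e = sat s e" by (simp add: sat_def fun_eq_iff 4)
  moreover have "example s' e = example s e" by (simp add: example_def fun_eq_iff 3)
  moreover have "same_row s' s'' k (e * rho + i) = same_row s s'' k (e * rho + i)" for k i
    by (simp add: same_row_def 4)
  ultimately show ?thesis using o by (simp add: outcome_def 4)
qed

lemma outcome_local:
  assumes o: "outcome s s' e'" and l: "local s' s'' e" and e: "e' < e" "e' < N"
  shows "outcome s s'' e'"
proof -
  have drho: "d e' \<le> rho" using dD[OF e(2)] Drho by linarith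
  have "Suc e' * rho \<le> e * rho" using e(1) by (intro mult_le_mono1) simp
  then have lt: "e' * rho + i < e * rho" if "i < d e'" for i using that drho by simp
  have lt2: "(e' * rho + i) * rho + j < e * rho * rho" if "i < d e'" "j < d e'" for i j
  proof -
    have "Suc (e' * rho + i) * rho \<le> e * rho * rho" using lt[OF that(1)] by (intro mult_le_mono1) simp
    then show ?thesis using that(2) drho by simp
  qed
  have 4: "i < d e' \<Longrightarrow> s'' 4 (e' * rho + i) = s' 4 (e' * rho + i)" "i < d e' \<Longrightarrow> s'' 5 (e' * rho + i) = s' 5 (e' * rho + i)"
    "i < d e' \<Longrightarrow> j < d e' \<Longrightarrow> s'' 6 ((e' * rho + i) * rho + j) = s' 6 ((e' * rho + i) * rho + j)"
    "s'' 9 e' = s' 9 e'" "s'' 12 e' = s' 12 e'" "s'' 13 e' = s' 13 e'" for i j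
    using l lt lt2 e(1) by (auto simp: local_def)
  have "wf_expert s'' e' = wf_expert s' e'" by (auto simp: wf_expert_def row_ok_def 4)
  moreover have "same_row s s'' (d e') (e' * rho + i) = same_row s s' (d e') (e' * rho + i)" if "i < d e'" for i
    using that by (simp add: same_row_def 4)
  ultimately show ?thesis using o by (auto simp: outcome_def 4)
qed

lemma same_from_step:
  assumes "same_from s s' e" "local s' s'' e" shows "same_from s s'' (Suc e)"
  using assms unfolding same_from_def local_def by (simp add: add_mult_distrib)

lemma run_PREDICT:
  assumes s: "inv s"
  shows "run PREDICT s (N * (D * (11 * D + \<eta> + 30) + \<eta> + 30) + 5 * rho + 5 * \<eta> + 20)
    (\<lambda>s'. predicted s s' \<and> s' 0 9 = (if (\<Sum>e<N. vote s s' False e) < (\<Sum>e<N. vote s s' True e) then 1 else 0))"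
proof -
  let ?X = "{1, 2, 3, 4, 5, 6, 7, 9, 20, 21, 23, 24, 29, 30, 31, 32, 33, 34, 35, 38} :: nat set"
  let ?Y = "{4, 5, 6, 7, 9, 12, 13} :: nat set"
  define T where "T = D * (11 * D + \<eta> + 30) + \<eta> + 20"
  have sN: "s 0 18 = rho" "s 0 19 = N" using s by (auto simp: inv_def)
  have fD: "(2::nat) ^ free s e \<le> 2 ^ D" if "e < N" for e
    using free_upto_le[of s e "d e"] dD[OF that] by (intro power_increasing) auto
  \<comment> \<open>Even with the next expert added, a partial sum is at most N * 2^D, so the heavy
    registers never overflow.\<close>
  have vote_le: "(\<Sum>e'<e. vote s s' b e') + 2 ^ D < 2 ^ (\<beta> * \<eta>)" if "e < N" for e s' b
  proof -
    have "(\<Sum>e'<e. vote s s' b e') \<le> (\<Sum>e'<e. 2 ^ D)" using fD that by (intro sum_mono) (auto simp: vote_def)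
    then have "(\<Sum>e'<e. vote s s' b e') + 2 ^ D \<le> Suc e * 2 ^ D" by simp
    also have "\<dots> \<le> N * 2 ^ D" using that by (intro mult_le_mono1) simp
    finally show ?thesis using weight by (rule le_less_trans)
  qed
  define I where "I e s' \<longleftrightarrow> (\<forall>e'<e. s 8 e' = 0 \<longrightarrow> outcome s s' e') \<and> same_from s s' e \<and> frame ?X ?Y s s' \<and>
     s' 0 21 = e * rho \<and> s' 0 23 = e * rho * rho \<and> s' 0 24 = rho * rho \<and>
     s' 0 4 = (\<Sum>e'<e. vote s s' False e') \<and> s' 0 5 = (\<Sum>e'<e. vote s s' True e')" for e s'
  let ?B = "HGet 2 8 20 ;; HIf 2 HSkip EXPERT ;; (HAdd 21 21 18 ;; HAdd 23 23 24)"
  have body: "run ?B s' (T + 4) (\<lambda>s''. s'' 0 20 = e \<and> s'' 0 19 = N \<and> (\<forall>t. I (Suc e) (upd (upd s'' 0 20 (Suc e)) 0 1 t)))"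
    if e: "e < N" and b: "bnd s'" and i: "I e s'" and k: "s' 0 20 = e" "s' 0 19 = N" for e s'
  proof -
    have fr: "frame ?X ?Y s s'" using i by (simp add: I_def)
    have c: "s' 0 18 = rho" "s' 8 = s 8" "s' 3 = s 3" "s' 11 = s 11" using fr sN by (auto simp: frame_def)
    define s1 where "s1 = upd s' 0 2 (s 8 e)"
    have e1: "eval (HGet 2 8 20) s' = s1" using k c by (simp add: s1_def)
    have i1: "same_from s s1 e" "\<forall>e'<e. s 8 e' = 0 \<longrightarrow> outcome s s1 e'" "frame ?X ?Y s s1"
      using i fr by (auto simp: I_def s1_def same_from_def outcome_def wf_expert_def row_ok_def same_row_def)
    let ?V = "\<lambda>s''. s'' 0 4 = (\<Sum>e'<Suc e. vote s s'' False e') \<and> s'' 0 5 = (\<Sum>e'<Suc e. vote s s'' True e')"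
    let ?M = "\<lambda>s''. (\<forall>e'<Suc e. s 8 e' = 0 \<longrightarrow> outcome s s'' e') \<and> same_from s s'' (Suc e) \<and> frame ?X ?Y s s'' \<and>
      frame ({0..} - {18, 19, 20, 21, 23, 24}) UNIV s' s'' \<and> ?V s''"
    have mid: "run (HIf 2 HSkip EXPERT) s1 (hcost [2] + T) ?M"
    proof (rule run_If)
      assume dead: "s1 0 2 \<noteq> 0"
      then have "s 8 e \<noteq> 0" by (simp add: s1_def)
      moreover have "same_from s s1 (Suc e)"
        by (rule same_from_step[OF i1(1)]) (simp add: local_def)
      moreover have "vote s s1 b e' = vote s s' b e'" for b e' by (simp add: vote_def s1_def)
      moreover have "vote s s1 b e = 0" for b using dead by (simp add: vote_def s1_def)
      ultimately have "?M s1" using i1 i by (auto simp: less_Suc_eq I_def s1_def)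
      from run_Skip[of ?M, OF this] show "run HSkip s1 T ?M" by (rule run_mono) (auto simp: T_def)
    next
      assume "s1 0 2 = 0"
      then have alive: "s 8 e = 0" by (simp add: s1_def)
      have 4: "s1 4 (e * rho + i) = s 4 (e * rho + i)" "s1 5 (e * rho + i) = s 5 (e * rho + i)"
        "s1 6 ((e * rho + i) * rho + j) = s 6 ((e * rho + i) * rho + j)" for i j
        using i1(1) by (auto simp: same_from_def add_mult_distrib add.assoc)
      have wf: "wf_expert s1 e" using s e alive by (simp add: inv_def wf_expert_def row_ok_def 4)
      have free: "free s1 e = free s e" by (simp add: free_upto_def 4)
      have "run EXPERT s1 T (\<lambda>s'. outcome s1 s' e \<and> local s1 s' e \<and>
         s' 0 4 = s1 0 4 + (if s' 9 e = 0 \<and> s' 13 e = 0 then 2 ^ free s1 e else 0) \<and>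
         s' 0 5 = s1 0 5 + (if s' 9 e = 0 \<and> s' 13 e \<noteq> 0 then 2 ^ free s1 e else 0) \<and>
         frame {1, 2, 3, 4, 5, 6, 29, 30, 31, 32, 33, 34, 35, 38} {4, 5, 6, 7, 9, 12, 13} s1 s')"
        unfolding T_def
      proof (rule run_EXPERT[OF _ _ _ _ _ e wf])
        show "s1 0 4 + 2 ^ D < 2 ^ (\<beta> * \<eta>)" "s1 0 5 + 2 ^ D < 2 ^ (\<beta> * \<eta>)"
          using i vote_le[OF e] by (auto simp: I_def s1_def)
        show "s1 11 e = d e" using s e c by (simp add: inv_def s1_def)
      qed (use i k c in \<open>auto simp: I_def s1_def\<close>)
      then show "run EXPERT s1 T ?M"
      proof (rule run_mono)
        fix s2 assume s2: "outcome s1 s2 e \<and> local s1 s2 e \<and>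
         s2 0 4 = s1 0 4 + (if s2 9 e = 0 \<and> s2 13 e = 0 then 2 ^ free s1 e else 0) \<and>
         s2 0 5 = s1 0 5 + (if s2 9 e = 0 \<and> s2 13 e \<noteq> 0 then 2 ^ free s1 e else 0) \<and>
         frame {1, 2, 3, 4, 5, 6, 29, 30, 31, 32, 33, 34, 35, 38} {4, 5, 6, 7, 9, 12, 13} s1 s2"
        have l: "local s1 s2 e" and f: "frame {1, 2, 3, 4, 5, 6, 29, 30, 31, 32, 33, 34, 35, 38} {4, 5, 6, 7, 9, 12, 13} s1 s2"
          using s2 by auto
        have "outcome s s2 e" by (rule outcome_base[OF _ i1(1)]) (use s2 c in \<open>auto simp: s1_def\<close>)
        moreover have "outcome s s2 e'" if "e' < e" "s 8 e' = 0" for e'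
          by (rule outcome_local[OF _ l that(1)]) (use that i1(2) e in auto)
        ultimately have "\<forall>e'<Suc e. s 8 e' = 0 \<longrightarrow> outcome s s2 e'" by (auto simp: less_Suc_eq)
        moreover have "same_from s s2 (Suc e)" by (rule same_from_step[OF i1(1) l])
        moreover have "frame ?X ?Y s s2" by (rule frame_trans[OF i1(3)]) (use f in \<open>auto elim: frame_mono\<close>)
        moreover have "frame ({0..} - {18, 19, 20, 21, 23, 24}) UNIV s' s2"
          using f unfolding frame_def by (auto simp: s1_def)
        moreover have "vote s s2 b e' = vote s s' b e'" if "e' < e" for b e'
          using l that by (simp add: vote_def local_def s1_def)
        moreover have "vote s s2 False e = (if s2 9 e = 0 \<and> s2 13 e = 0 then 2 ^ free s1 e else 0)"
          "vote s s2 True e = (if s2 9 e = 0 \<and> s2 13 e \<noteq> 0 then 2 ^ free s1 e else 0)"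
          using alive free by (auto simp: vote_def)
        ultimately show "?M s2" using s2 i by (simp add: I_def s1_def)
      qed simp
    qed simp
    have "run ?B s' (1 + ((hcost [2] + T) + 2)) (\<lambda>s''. s'' 0 20 = e \<and> s'' 0 19 = N \<and> (\<forall>t. I (Suc e) (upd (upd s'' 0 20 (Suc e)) 0 1 t)))"
    proof (rule run_step)
      show "run (HIf 2 HSkip EXPERT ;; (HAdd 21 21 18 ;; HAdd 23 23 24)) (eval (HGet 2 8 20) s') ((hcost [2] + T) + 2)
        (\<lambda>s''. s'' 0 20 = e \<and> s'' 0 19 = N \<and> (\<forall>t. I (Suc e) (upd (upd s'' 0 20 (Suc e)) 0 1 t)))"
        unfolding e1
      proof (rule run_Seq[OF mid])
        fix s2 assume s2: "bnd s2" "?M s2"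
        have "frame ({0..} - {18, 19, 20, 21, 23, 24}) UNIV s' s2" using s2(2) by blast
        then have x2: "s2 0 18 = rho" "s2 0 19 = N" "s2 0 20 = e" "s2 0 21 = e * rho" "s2 0 23 = e * rho * rho" "s2 0 24 = rho * rho"
          using c k i by (auto simp: frame_def I_def)
        let ?A = "HAdd 21 21 18 ;; HAdd 23 23 24"
        have "eval ?A s2 = upd (upd s2 0 21 (Suc e * rho)) 0 23 (Suc e * rho * rho)"
          using x2 by (simp add: add.commute add_mult_distrib)
        note ev = this
        have "outcome s (upd (upd (upd (upd s2 0 21 a1) 0 23 a2) 0 20 a3) 0 1 a4) e' = outcome s s2 e'" for a1 a2 a3 a4 e'
          by (simp add: outcome_def wf_expert_def row_ok_def same_row_def)
        moreover have "vote s (upd (upd (upd (upd s2 0 21 a1) 0 23 a2) 0 20 a3) 0 1 a4) b e' = vote s s2 b e'" for a1 a2 a3 a4 e' b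
          by (simp add: vote_def)
        moreover have "same_from s (upd (upd (upd (upd s2 0 21 a1) 0 23 a2) 0 20 a3) 0 1 a4) e' = same_from s s2 e'" for a1 a2 a3 a4 e'
          by (simp add: same_from_def)
        ultimately have I': "I (Suc e) (upd (upd (upd (upd s2 0 21 (Suc e * rho)) 0 23 (Suc e * rho * rho)) 0 20 (Suc e)) 0 1 t)" for t
          using s2(2) x2 unfolding I_def by simp
        show "run ?A s2 2 (\<lambda>s''. s'' 0 20 = e \<and> s'' 0 19 = N \<and> (\<forall>t. I (Suc e) (upd (upd s'' 0 20 (Suc e)) 0 1 t)))"
        proof (rule run_simple)
          have "Suc e * rho < 2 ^ \<beta>" "Suc e * (rho * rho) < 2 ^ \<beta>" using idx_short[OF e le0 le0] by auto
          then show "safe ?A s2" using x2 by (simp add: heavy_def algebra_simps)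
          show "eval ?A s2 0 20 = e \<and> eval ?A s2 0 19 = N \<and> (\<forall>t. I (Suc e) (upd (upd (eval ?A s2) 0 20 (Suc e)) 0 1 t))"
            unfolding ev using I' x2 by simp
        qed (auto simp: heavy_def)
      qed
    qed (auto simp: heavy_def)
    then show ?thesis by (rule run_mono) (auto simp: heavy_def)
  qed
  let ?post = "\<lambda>s'. predicted s s' \<and> s' 0 9 = (if (\<Sum>e<N. vote s s' False e) < (\<Sum>e<N. vote s s' True e) then 1 else 0)"
  let ?P = "HConst 4 0 ;; HConst 5 0 ;; HConst 21 0 ;; HConst 23 0"
  let ?E = "HSub 7 5 4 ;; HIf 7 (HConst 9 1) (HConst 9 0)"
  define s1 where "s1 = eval ?P s"
  have rr: "rho * rho < 2 ^ \<beta>"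
  proof -
    have "rho * rho < (N + 1) * (rho + 2) * (rho + 2)" by (simp add: algebra_simps)
    then show ?thesis using small by (rule less_le_trans)
  qed
  have "run PREDICT s (3 * \<eta> + 4 + ((5 * rho + 4) + (((\<Sum>e<N. (T + 4) + 4) + 3) + (2 * \<eta> + 1)))) ?post"
    unfolding PREDICT_def
  proof (rule run_step)
    show "run (MUL 24 18 18 ;; FOR 20 19 ?B ;; ?E) (eval ?P s) ((5 * rho + 4) + (((\<Sum>e<N. (T + 4) + 4) + 3) + (2 * \<eta> + 1))) ?post"
      unfolding s1_def[symmetric]
    proof (rule run_Seq)
      have x1: "s1 0 18 = rho" using sN by (simp add: s1_def)
      then show "run (MUL 24 18 18) s1 (5 * rho + 4) (\<lambda>s'. s' 0 24 = rho * rho \<and> frame {1, 31, 24} {} s1 s')"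
        using run_MUL[of 24 18 18 s1] rr by (auto simp: heavy_def)
      fix s2 assume s2: "bnd s2" "s2 0 24 = rho * rho \<and> frame {1, 31, 24} {} s1 s2"
      have x2: "s2 0 x = s1 0 x" if "x \<notin> {1, 31, 24}" for x using s2(2) that by (simp add: frame_def)
      have "frame ?X ?Y s s1" by (simp add: s1_def)
      then have f2: "frame ?X ?Y s s2" by (rule frame_trans) (use s2(2) in \<open>auto elim: frame_mono\<close>)
      have q2: "s2 q = s q" if "q \<noteq> 0" for q using s2(2) that by (simp add: frame_def s1_def)
      show "run (FOR 20 19 ?B ;; ?E) s2 (((\<Sum>e<N. (T + 4) + 4) + 3) + (2 * \<eta> + 1)) ?post"
      proof (rule run_Seq)
        show "run (FOR 20 19 ?B) s2 ((\<Sum>e<N. (T + 4) + 4) + 3) (I N)"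
        proof (rule run_FOR[where I = I])
          show "I 0 (upd (upd s2 0 20 0) 0 1 t)" for t
            using f2 s2(2) x2 q2 by (simp add: I_def same_from_def) (simp add: s1_def)
          show "s2 0 19 = N" using x2 sN by (simp add: s1_def)
        qed (use body in \<open>auto simp: heavy_def\<close>)
        fix s3 assume s3: "bnd s3" "I N s3"
        define s4 where "s4 = eval ?E s3"
        have s4: "s4 0 x = (if x = 9 then (if s3 0 4 < s3 0 5 then 1 else 0) else if x = 7 then s3 0 5 - s3 0 4 else s3 0 x)" for x
          by (auto simp: s4_def)
        have q4: "s4 q = s3 q" if "q \<noteq> 0" for q using that by (simp add: s4_def)
        have "outcome s s4 e = outcome s s3 e" for e by (simp add: outcome_def wf_expert_def row_ok_def same_row_def q4)
        moreover have "vote s s4 b e = vote s s3 b e" for b e by (simp add: vote_def q4)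
        moreover have "frame ?X ?Y s s4" using s3(2) by (auto simp: I_def s4_def)
        ultimately have "?post s4" using s3(2) s4 by (simp add: predicted_def I_def)
        then show "run ?E s3 (2 * \<eta> + 1) ?post"
          unfolding s4_def using one_short \<eta> by (intro run_simple) (auto simp: heavy_def hcost_def)
      qed
    qed
  qed (use one_short \<eta> in \<open>auto simp: heavy_def hcost_def\<close>)
  then show ?thesis
  proof (rule run_mono)
    have "N * (D * (11 * D + \<eta> + 30) + \<eta> + 30) = (\<Sum>e<N. (T + 4) + 4) + N * 2"
      unfolding T_def by (simp add: algebra_simps)
    then show "3 * \<eta> + 4 + ((5 * rho + 4) + (((\<Sum>e<N. (T + 4) + 4) + 3) + (2 * \<eta> + 1))) \<le>
        N * (D * (11 * D + \<eta> + 30) + \<eta> + 30) + 5 * rho + 5 * \<eta> + 20" by linarith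
  qed
qed

end

context rounds
begin

definition updated :: "state \<Rightarrow> state \<Rightarrow> nat \<Rightarrow> nat \<Rightarrow> bool" where
  "updated s s' y e \<longleftrightarrow> (s 8 e \<noteq> 0 \<longrightarrow> s' 8 e \<noteq> 0) \<and>
     (s 8 e = 0 \<and> s 9 e = 0 \<longrightarrow> s' 8 e = (if s 13 e = y then 0 else 1) \<and> (\<forall>i<d e. s' 5 (e * rho + i) = s 5 (e * rho + i))) \<and>
     (s 8 e = 0 \<and> s 9 e \<noteq> 0 \<longrightarrow> s' 8 e = 0 \<and>
        (\<forall>i<d e. s' 5 (e * rho + i) = (if e * rho + i = s 12 e \<and> y \<noteq> 0 then 1 - s 5 (e * rho + i) else s 5 (e * rho + i))))"

lemma run_UPDATE:
  assumes s: "s 0 9 = y" "y \<le> 1" "s 0 19 = N"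
    and p: "\<And>e. e < N \<Longrightarrow> s 8 e = 0 \<Longrightarrow> s 13 e \<le> 1" "\<And>e. e < N \<Longrightarrow> s 8 e = 0 \<Longrightarrow> s 9 e \<noteq> 0 \<Longrightarrow> \<exists>p<d e. s 12 e = e * rho + p"
  shows "run UPDATE s (N * 20 + 3) (\<lambda>s'. (\<forall>e<N. updated s s' y e) \<and> frame {1, 2, 3, 20, 29} {5, 8} s s')"
proof -
  define I where "I e s' \<longleftrightarrow> (\<forall>e'<e. updated s s' y e') \<and> (\<forall>e'\<ge>e. s' 8 e' = s 8 e') \<and> (\<forall>x\<ge>e * rho. s' 5 x = s 5 x) \<and>
    frame {1, 2, 3, 20, 29} {5, 8} s s'" for e s'
  have "run UPDATE s ((\<Sum>e<N. 12 + 4) + 3) (\<lambda>s'. (\<forall>e<N. updated s s' y e) \<and> frame {1, 2, 3, 20, 29} {5, 8} s s')"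
    unfolding UPDATE_def
  proof (rule run_FOR[where I = I])
    show "I 0 (upd (upd s 0 20 0) 0 1 t)" for t by (simp add: I_def)
    fix e s' assume e: "e < N" and b: "bnd s'" and i: "I e s'" and k: "s' 0 20 = e" "s' 0 19 = N"
    have fr: "frame {1, 2, 3, 20, 29} {5, 8} s s'" using i by (simp add: I_def)
    have c: "s' 0 9 = y" "s' 9 = s 9" "s' 12 = s 12" "s' 13 = s 13" using fr s by (auto simp: frame_def)
    have c8: "s' 8 e = s 8 e" using i by (simp add: I_def)
    define E where "E = eval UPDATE1 s'"
    have E0: "E 0 20 = e" "E 0 19 = N" "frame {1, 2, 3, 20, 29} {5, 8} s E"
      using fr k by (auto simp: E_def UPDATE1_def)
    have E8: "E 8 x = (if x = e \<and> s 8 e = 0 \<and> s 9 e = 0 \<and> (s 13 e = 0 \<longleftrightarrow> y \<noteq> 0) then 1 else s' 8 x)" for x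
      using k c c8 by (simp add: E_def UPDATE1_def)
    have E5: "E 5 x = (if s 8 e = 0 \<and> s 9 e \<noteq> 0 \<and> y \<noteq> 0 \<and> x = s 12 e then 1 - s' 5 x else s' 5 x)" for x
      using k c c8 by (simp add: E_def UPDATE1_def)
    \<comment> \<open>The recorded slot belongs to the rows of e itself, so flipping its right-hand
      side disturbs no other expert.\<close>
    have 12: "e * rho \<le> s 12 e \<and> s 12 e < Suc e * rho" if "s 8 e = 0" "s 9 e \<noteq> 0"
      using p(2)[OF e that] dD[OF e] Drho by auto
    have "updated s E y e'" if "e' < e" for e'
    proof -
      have "Suc e' * rho \<le> e * rho" using that by (intro mult_le_mono1) simp
      then have "e' * rho + i < e * rho" if "i < d e'" for i
        using that dD[of e'] \<open>e' < e\<close> e Drho by simp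
      then have 5: "E 5 (e' * rho + i) = s' 5 (e' * rho + i)" if "i < d e'" for i
        using 12 that unfolding E5 by (metis leD)
      have "E 8 e' = s' 8 e'" using that by (simp add: E8)
      then show ?thesis using i that 5 unfolding I_def updated_def by auto
    qed
    moreover have "updated s E y e"
    proof -
      have s5: "s' 5 (e * rho + i) = s 5 (e * rho + i)" for i using i by (simp add: I_def)
      have "E 8 e = (if s 13 e = y then 0 else 1)" if "s 8 e = 0" "s 9 e = 0"
        using p(1)[OF e that(1)] s(2) c8 that by (auto simp: E8 le_Suc_eq)
      moreover have "s' 5 (s 12 e) = s 5 (s 12 e)" if "s 8 e = 0" "s 9 e \<noteq> 0" using 12[OF that] i by (simp add: I_def)
      ultimately show ?thesis unfolding updated_def using c8 by (auto simp: E5 E8 s5)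
    qed
    ultimately have "\<forall>e'<Suc e. updated s E y e'" by (simp add: less_Suc_eq)
    moreover have "\<forall>e'\<ge>Suc e. E 8 e' = s 8 e'" using i by (simp add: E8 I_def)
    moreover have "E 5 x = s 5 x" if x: "Suc e * rho \<le> x" for x
    proof -
      have "e * rho \<le> x" using x by simp
      then have "s' 5 x = s 5 x" using i by (simp add: I_def)
      then show ?thesis using 12 x unfolding E5 by (metis leD)
    qed
    moreover have "updated s (upd (upd E 0 20 u) 0 1 t) y e' = updated s E y e'" for t u e' by (simp add: updated_def)
    ultimately have "I (Suc e) (upd (upd E 0 20 (Suc e)) 0 1 t)" for t
      using E0 by (simp add: I_def)
    then show "run UPDATE1 s' 12 (\<lambda>s''. s'' 0 20 = e \<and> s'' 0 19 = N \<and> (\<forall>t. I (Suc e) (upd (upd s'' 0 20 (Suc e)) 0 1 t)))"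
      using one_short E0 unfolding E_def by (intro run_simple) (auto simp: UPDATE1_def heavy_def)
  qed (use s in \<open>auto simp: heavy_def I_def\<close>)
  then show ?thesis by (rule run_mono) auto
qed

text \<open>In echelon form, 2 to the number of free slots is the number of solutions of the
  system.\<close>

definition weight_of :: "state \<Rightarrow> nat \<Rightarrow> nat" where
  "weight_of s e = (if s 8 e = 0 then 2 ^ free s e else 0)"

definition potential :: "state \<Rightarrow> nat" where
  "potential s = (\<Sum>e<N. weight_of s e)"

section \<open>The potential over one round\<close>

context
  fixes s s1 s2 :: state and y :: nat
  assumes inv: "inv s" and pred: "predicted s s1" and y: "y \<le> 1"
    and upd: "\<And>e. e < N \<Longrightarrow> updated s1 s2 y e" and fr: "frame {1, 2, 3, 20, 29} {5, 8} s1 s2"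
begin

lemma arrays: "s1 8 = s 8" "s1 3 = s 3" "s1 11 = s 11" "s2 4 = s1 4" "s2 6 = s1 6" "s2 11 = s 11" "s2 3 = s 3"
  using pred fr by (auto simp: predicted_def frame_def)

lemma outcomeI: "e < N \<Longrightarrow> s 8 e = 0 \<Longrightarrow> outcome s s1 e"
  using pred by (simp add: predicted_def)

lemma dead_stays: "e < N \<Longrightarrow> s 8 e \<noteq> 0 \<Longrightarrow> s2 8 e \<noteq> 0"
  using upd[of e] arrays(1) by (simp add: updated_def)

lemma wf_after:
  assumes e: "e < N" "s 8 e = 0" "s2 8 e = 0" shows "wf_expert s2 e"
proof -
  have wf: "wf_expert s1 e" using outcomeI[OF e(1,2)] by (simp add: outcome_def)
  have le: "s2 5 (e * rho + i) \<le> 1" if "i < d e" "s1 4 (e * rho + i) \<noteq> 0" for i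
  proof -
    have "s1 5 (e * rho + i) \<le> 1" using wf that by (simp add: wf_expert_def row_ok_def)
    then show ?thesis using upd[OF e(1)] that(1) e(2) arrays(1)
      by (cases "s1 9 e = 0") (auto simp: updated_def)
  qed
  show ?thesis using wf le unfolding wf_expert_def row_ok_def arrays by simp
qed

text \<open>The case of interest is z = the target restricted to the list of an expert that covers
  it: such an expert survives every round. A forced answer must then agree with y, and a new
  equation is satisfied after the possible flip.\<close>

lemma alive_correct:
  assumes e: "e < N" "s 8 e = 0" and z: "sat s e z" "even (example s e z + y)"
  shows "s2 8 e = 0" "sat s2 e z"
proof -
  note o = outcomeI[OF e]
  have "s2 8 e = 0 \<and> sat s2 e z"
  proof (cases "s1 9 e = 0")
    case True
    have same: "\<forall>i<d e. same_row s s1 (d e) (e * rho + i)" and ev: "even (example s e z + s1 13 e)" and le: "s1 13 e \<le> 1"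
      using o True z(1) by (auto simp: outcome_def)
    have "s1 13 e = y"
    proof -
      have "even (s1 13 e + y)" using ev z(2) by (simp add: even_add)
      then show ?thesis using le y by (auto simp: le_Suc_eq)
    qed
    then have "s2 8 e = 0" "\<forall>i<d e. s2 5 (e * rho + i) = s1 5 (e * rho + i)"
      using upd[OF e(1)] e(2) True arrays(1) by (auto simp: updated_def)
    moreover have "sat s2 e z" using z(1) same calculation(2) unfolding sat_def arrays by (simp add: same_row_def)
    ultimately show ?thesis by simp
  next
    case False
    then obtain p where p: "p < d e" "s1 12 e = e * rho + p" "s 4 (e * rho + p) = 0" "s1 4 (e * rho + p) = 1"
      "\<forall>i<d e. i \<noteq> p \<longrightarrow> same_row s s1 (d e) (e * rho + i)"
      "even (example s e z + (\<Sum>j<d e. s1 6 ((e * rho + p) * rho + j) * z j) + s1 5 (e * rho + p))"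
      using o z(1) unfolding outcome_def by blast
    have u: "s2 8 e = 0" "\<And>i. i < d e \<Longrightarrow> s2 5 (e * rho + i) = (if i = p \<and> y \<noteq> 0 then 1 - s1 5 (e * rho + i) else s1 5 (e * rho + i))"
      using upd[OF e(1)] e(2) False arrays(1) p(2) by (auto simp: updated_def)
    have "sat s2 e z"
      unfolding sat_def arrays
    proof (intro allI impI)
      fix i assume i: "i < d e" "s1 4 (e * rho + i) \<noteq> 0"
      show "even ((\<Sum>j<d e. s1 6 ((e * rho + i) * rho + j) * z j) + s2 5 (e * rho + i))"
      proof (cases "i = p")
        case True
        have "s1 5 (e * rho + p) \<le> 1" using o p(1,4) by (auto simp: outcome_def wf_expert_def row_ok_def)
        then have "even (s2 5 (e * rho + p) + s1 5 (e * rho + p) + y)" using u(2)[OF p(1)] y by (auto simp: le_Suc_eq)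
        then show ?thesis using p(6) z(2) True by (simp add: even_add) blast
      next
        case False
        then show ?thesis using z(1) p(5) i u(2)[OF i(1)] unfolding sat_def by (simp add: same_row_def)
      qed
    qed
    then show ?thesis using u(1) by simp
  qed
  then show "s2 8 e = 0" "sat s2 e z" by auto
qed

text \<open>Let u be the old weight of a living expert. Forced and right: 2 u + 0 against u + u.
  Forced and wrong: it dies, 0 + u against u + 0. Independent: the weight halves and nobody gets a
  vote, u against u.\<close>

lemma weight_step:
  assumes e: "e < N"
  shows "2 * weight_of s2 e + vote s s1 (y = 0) e \<le> weight_of s e + vote s s1 (y \<noteq> 0) e" "weight_of s2 e \<le> weight_of s e"
proof -
  have "2 * weight_of s2 e + vote s s1 (y = 0) e \<le> weight_of s e + vote s s1 (y \<noteq> 0) e \<and> weight_of s2 e \<le> weight_of s e"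
  proof (cases "s 8 e = 0")
    case False
    then show ?thesis using dead_stays[OF e False] by (simp add: weight_of_def vote_def)
  next
    case True
    note o = outcomeI[OF e True]
    show ?thesis
    proof (cases "s1 9 e = 0")
      case c: True
      have same: "\<forall>i<d e. same_row s s1 (d e) (e * rho + i)" using o c by (simp add: outcome_def)
      have "{i'. i' < d e \<and> s2 4 (e * rho + i') = 0} = {i'. i' < d e \<and> s 4 (e * rho + i') = 0}"
        using same by (auto simp: same_row_def arrays)
      then have free: "free s2 e = free s e" by (simp add: free_upto_def)
      have le: "s1 13 e \<le> 1" using o by (simp add: outcome_def)
      have "s2 8 e = (if s1 13 e = y then 0 else 1)" using upd[OF e] True c arrays(1) by (simp add: updated_def)
      then show ?thesis using True c free le y
        by (auto simp: weight_of_def vote_def le_Suc_eq)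
    next
      case c: False
      then obtain p where p: "p < d e" "s 4 (e * rho + p) = 0" "s1 4 (e * rho + p) = 1"
        "\<forall>i<d e. i \<noteq> p \<longrightarrow> same_row s s1 (d e) (e * rho + i)"
        using o unfolding outcome_def by blast
      have "{i'. i' < d e \<and> s 4 (e * rho + i') = 0} = insert p {i'. i' < d e \<and> s2 4 (e * rho + i') = 0}"
        using p by (auto simp: same_row_def arrays)
      moreover have "p \<notin> {i'. i' < d e \<and> s2 4 (e * rho + i') = 0}" using p(3) by (simp add: arrays)
      ultimately have "free s e = Suc (free s2 e)" by (simp add: free_upto_def)
      then show ?thesis using True c by (simp add: weight_of_def vote_def)
    qed
  qed
  then show "2 * weight_of s2 e + vote s s1 (y = 0) e \<le> weight_of s e + vote s s1 (y \<noteq> 0) e" "weight_of s2 e \<le> weight_of s e" by auto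
qed

lemma inv_after: "inv s2"
proof -
  have "s2 0 18 = rho" "s2 0 19 = N" using inv pred fr by (auto simp: inv_def predicted_def frame_def)
  moreover have "wf_expert s2 e" if "e < N" "s2 8 e = 0" for e
    using wf_after[OF that(1) _ that(2)] dead_stays[OF that(1)] that(2) by blast
  ultimately show ?thesis using inv arrays by (simp add: inv_def)
qed

lemma potential_mono: "potential s2 \<le> potential s"
  unfolding potential_def by (intro sum_mono) (simp add: weight_step)

text \<open>Summed over all experts, twice the new potential plus the wrong votes is at most the old
  potential plus the right votes; after a mistake, ties included, the right votes do not outweigh
  the wrong ones.\<close>

lemma potential_mistake:
  assumes "b = (if (\<Sum>e<N. vote s s1 False e) < (\<Sum>e<N. vote s s1 True e) then 1 else 0)" "b \<noteq> y"
  shows "2 * potential s2 \<le> potential s"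
proof -
  have "(\<Sum>e<N. 2 * weight_of s2 e + vote s s1 (y = 0) e) \<le> (\<Sum>e<N. weight_of s e + vote s s1 (y \<noteq> 0) e)"
    by (intro sum_mono weight_step(1)) simp
  then have "2 * potential s2 + (\<Sum>e<N. vote s s1 (y = 0) e) \<le> potential s + (\<Sum>e<N. vote s s1 (y \<noteq> 0) e)"
    by (simp add: potential_def sum.distrib sum_distrib_left)
  moreover have "(\<Sum>e<N. vote s s1 (y \<noteq> 0) e) \<le> (\<Sum>e<N. vote s s1 (y = 0) e)"
    using assms y by (cases "y = 0") (auto split: if_splits)
  ultimately show ?thesis by linarith
qed

end

end

section \<open>The learner\<close>

text \<open>Addresses 1 and 2 are register 0 of the two embedded machines and receive n; 17 and 18
  are their result registers, copied into the scalars 10 and 11. Address 144, scalar 9, is still 0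
  and serves as the second summand of a copy.\<close>

definition INIT :: "com \<Rightarrow> com \<Rightarrow> com" where
  "INIT ck ct = Seq (Add 1 0 144) (Seq (Add 2 0 144) (Seq (emb 1 ck) (Seq (emb 2 ct)
     (Seq (Add 160 17 144) (Seq (Add 176 18 144) (cmp (SETUP ;; HConst 8 1)))))))"

text \<open>Address 128, scalar 8, is 0 only before the first round. The prediction is copied from
  scalar 9 to the real register 1, which lies in class 1 and is free once k is known.\<close>

definition predictor :: "com \<Rightarrow> com \<Rightarrow> com" where
  "predictor ck ct = Seq (Cond 128 Skip (INIT ck ct)) (Seq (cmp PREDICT) (Seq (Const 16 0) (Add 1 144 16)))"

definition updater :: com where
  "updater = Seq (Const 16 0) (Seq (Add 144 1 16) (cmp UPDATE))"

text \<open>Lists may contain a position several times; giving the target's bit to the first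
  occurrence only keeps the linear form correct.\<close>

lemma sum_first_occurrences:
  "(\<Sum>j<length ps. if \<forall>i<j. ps ! i \<noteq> ps ! j then f (ps ! j) else 0) = (\<Sum>q\<in>set ps. f q :: nat)"
proof (induction ps rule: rev_induct)
  case (snoc p ps)
  have "(\<Sum>j<length ps. if \<forall>i<j. (ps @ [p]) ! i \<noteq> (ps @ [p]) ! j then f ((ps @ [p]) ! j) else 0) =
    (\<Sum>j<length ps. if \<forall>i<j. ps ! i \<noteq> ps ! j then f (ps ! j) else 0)"
    by (rule sum.cong) (auto simp: nth_append)
  moreover have "(\<forall>i<length ps. (ps @ [p]) ! i \<noteq> p) \<longleftrightarrow> p \<notin> set ps"
    by (auto simp: nth_append in_set_conv_nth)
  ultimately show ?case using snoc by (auto simp: insert_absorb)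
qed simp

text \<open>The target x, restricted to the positions of an expert; repeated positions count once.\<close>

definition solution :: "nat list \<Rightarrow> nat list \<Rightarrow> nat \<Rightarrow> nat" where
  "solution x ps j = (if (\<forall>i<j. ps ! i \<noteq> ps ! j) \<and> ps ! j < length x \<and> x ! (ps ! j) \<noteq> 0 then 1 else 0)"

text \<open>If the list covers the support of the target, the parity becomes a linear form in the
  unknowns of the expert, with the target as one of its assignments.\<close>

lemma sum_solution:
  assumes x: "x \<in> cube n" and a: "a \<in> cube n" and cov: "{i. i < n \<and> x ! i \<noteq> 0} \<subseteq> set ps"
  shows "(\<Sum>j<length ps. input_at a (ps ! j) * solution x ps j) = (\<Sum>i<length x. x ! i * a ! i)"
proof -
  let ?f = "\<lambda>q. if q < n then x ! q * a ! q else 0"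
  have len: "length x = n" "length a = n" using x a by (auto simp: cube_def)
  have x1: "x ! q = 0 \<or> x ! q = 1" if "q < n" for q
    using x nth_mem[of q x] that unfolding cube_def by blast
  have "(\<Sum>j<length ps. input_at a (ps ! j) * solution x ps j) =
    (\<Sum>j<length ps. if \<forall>i<j. ps ! i \<noteq> ps ! j then ?f (ps ! j) else 0)"
  proof (rule sum.cong)
    fix j
    show "input_at a (ps ! j) * solution x ps j = (if \<forall>i<j. ps ! i \<noteq> ps ! j then ?f (ps ! j) else 0)"
      using x1[of "ps ! j"] len by (cases "ps ! j < n") (auto simp: solution_def input_at_def)
  qed simp
  also have "\<dots> = (\<Sum>q\<in>set ps. ?f q)" by (rule sum_first_occurrences)
  also have "\<dots> = (\<Sum>q\<in>set ps \<inter> {..<n}. x ! q * a ! q)"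
    by (simp add: sum.inter_restrict lessThan_def)
  also have "\<dots> = (\<Sum>q<n. x ! q * a ! q)"
    using cov by (intro sum.mono_neutral_left) auto
  finally show ?thesis using len by simp
qed

definition points :: "(nat \<times> nat \<times> nat list) list \<Rightarrow> nat \<Rightarrow> nat list" where
  "points recs e = snd (snd (recs ! e))"

text \<open>The size Nmax of the family and the potential \<phi> remain abstract here; correctness
  and time in terms of Nmax are separated from the estimate of Nmax.\<close>

locale learning = family n K v for n K v :: nat +
  fixes k0 t0 \<beta> Nmax \<tau>k \<tau>t :: nat and ck ct :: com and mk mt :: mem and \<phi> :: "nat \<times> nat \<times> nat list \<Rightarrow> real"
  assumes Kv: "K = k0 + (1 - k0)" "v = (t0 + (1 - t0) + K * (A * M) - 1) div (K * (A * M))"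
    and ck: "exec [] ck (init_mem n) \<tau>k mk" "mk 1 = k0"
    and ct: "exec [] ct (init_mem n) \<tau>t mt" "mt 1 = t0"
    and \<beta>: "11 \<le> \<beta>" "k0 < 2 ^ \<beta>" "t0 < 2 ^ \<beta>"
    and bigN: "32 * (C + n + F + A * M + (Nmax + 1) * (K * A * M * (n + 1) + 2) * (K * A * M * (n + 1) + 2)) \<le> 2 ^ \<beta>"
    and Npos: "1 \<le> Nmax"
    and \<phi>: "\<And>\<rho>. 1 \<le> \<phi> \<rho>" "\<And>\<rho>. good \<rho> \<Longrightarrow> 1 + (\<Sum>c\<leftarrow>kidsall \<rho>. \<phi> c) \<le> \<phi> \<rho>" "\<phi> (K, 0, []) \<le> real Nmax"
begin

definition D :: nat where "D = K * M * bc"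
text \<open>Weights sum to at most Nmax * 2^D; Nmax fits into one word of \<beta> digits and 2^D
  into D words.\<close>

definition \<eta> :: nat where "\<eta> = Suc D"
abbreviation \<rho>o :: nat where "\<rho>o \<equiv> gen.rho n K"

abbreviation ok :: "state \<Rightarrow> bool" where "ok \<equiv> machine.bnd \<beta> \<eta>"

text \<open>The state between rounds: potential at most p, and some living expert covers the target
  and has it among its solutions.\<close>

definition ready :: "nat list \<Rightarrow> mem \<Rightarrow> nat \<Rightarrow> bool" where
  "ready x m p \<longleftrightarrow> (\<exists>recs s. rel m s \<and> ok s \<and> length recs \<le> Nmax \<and> (\<forall>c \<in> set recs. good c) \<and> s 0 8 \<noteq> 0 \<and>
     rounds.inv (length recs) \<rho>o (\<lambda>e. length (points recs e)) s \<and>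
     (\<forall>e<length recs. \<forall>j<length (points recs e). s 3 (e * \<rho>o + j) = points recs e ! j) \<and>
     rounds.potential (length recs) \<rho>o (\<lambda>e. length (points recs e)) s \<le> p \<and>
     (\<exists>e<length recs. s 8 e = 0 \<and> {i. i < n \<and> x ! i \<noteq> 0} \<subseteq> set (points recs e) \<and>
        rounds.sat \<rho>o (\<lambda>e. length (points recs e)) s e (solution x (points recs e))))"

lemma gen: "a \<in> cube n \<Longrightarrow> gen a \<beta> \<eta> n K v Nmax"
  by unfold_locales (use \<beta> bigN in \<open>auto simp: cube_def \<eta>_def\<close>)

lemma rounds:
  assumes a: "a \<in> cube n" and recs: "length recs \<le> Nmax" "\<forall>c \<in> set recs. good c"
  shows "rounds a \<beta> \<eta> (length recs) \<rho>o D (\<lambda>e. length (points recs e))"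
proof -
  interpret gen a \<beta> \<eta> n K v Nmax by (rule gen[OF a])
  have rho0: "0 < rho" using K A_bounds M_pos by (simp add: rho_def)
  have b: "32 * ((Nmax + 1) * (rho + 2) * (rho + 2)) \<le> 2 ^ \<beta>" by (rule bigs(5))
  have N1: "Nmax + 1 \<le> 32 * ((Nmax + 1) * (rho + 2) * (rho + 2))" by (simp add: algebra_simps)
  show ?thesis
  proof unfold_locales
    fix e assume "e < length recs"
    then have "good (recs ! e)" using recs(2) by simp
    then show "length (points recs e) \<le> D" using good_length
      unfolding points_def D_def by (metis prod.collapse)
  next
    show "D \<le> rho" unfolding D_def by (rule bc_le)
  next
    have "(length recs + 1) * (rho + 2) * (rho + 2) \<le> (Nmax + 1) * (rho + 2) * (rho + 2)"
      using recs(1) by (intro mult_le_mono1) simp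
    also have "\<dots> \<le> 32 * ((Nmax + 1) * (rho + 2) * (rho + 2))" by simp
    finally show "(length recs + 1) * (rho + 2) * (rho + 2) \<le> 2 ^ \<beta>" using b by (rule le_trans)
  next
    have "length recs < 2 ^ \<beta>" using le_trans[OF N1 b] recs(1) by linarith
    moreover have "(2::nat) ^ D \<le> 2 ^ (\<beta> * D)" using \<beta> by (intro power_increasing) auto
    ultimately have "length recs * 2 ^ D < 2 ^ \<beta> * 2 ^ (\<beta> * D)" by (intro mult_less_le_imp_less) auto
    then show "length recs * 2 ^ D < 2 ^ (\<beta> * \<eta>)" by (simp add: \<eta>_def power_add)
  qed (use rho0 in auto)
qed

definition vote_steps :: nat where
  "vote_steps = Nmax * (D * (11 * D + \<eta> + 30) + \<eta> + 50) + 5 * \<rho>o + 5 * \<eta> + 25"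

section \<open>Single rounds and whole plays\<close>

lemma vote_round:
  assumes a: "a \<in> cube n" and x: "x \<in> cube n" and r: "ready x m p"
  shows "\<exists>\<tau>1 m1 \<tau>2 m2. exec a (Seq (cmp PREDICT) (Seq (Const 16 0) (Add 1 144 16))) m \<tau>1 m1 \<and>
    exec a updater (m1(1 := parity x a)) \<tau>2 m2 \<and> \<tau>1 + \<tau>2 \<le> 300 * \<beta> * vote_steps \<and>
    ready x m2 (if m1 1 \<noteq> parity x a then p div 2 else p)"
proof -
  from r obtain recs s e where r: "rel m s" "ok s" "length recs \<le> Nmax" "\<forall>c \<in> set recs. good c" "s 0 8 \<noteq> 0"
    "rounds.inv (length recs) \<rho>o (\<lambda>e. length (points recs e)) s"
    "\<And>e j. e<length recs \<Longrightarrow> j<length (points recs e) \<Longrightarrow> s 3 (e * \<rho>o + j) = points recs e ! j"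
    "rounds.potential (length recs) \<rho>o (\<lambda>e. length (points recs e)) s \<le> p"
    and e: "e<length recs" "s 8 e = 0" "{i. i < n \<and> x ! i \<noteq> 0} \<subseteq> set (points recs e)"
      "rounds.sat \<rho>o (\<lambda>e. length (points recs e)) s e (solution x (points recs e))"
    unfolding ready_def by blast
  let ?d = "\<lambda>e. length (points recs e)"
  let ?N = "length recs"
  interpret rounds a \<beta> \<eta> ?N \<rho>o D ?d by (rule rounds[OF a r(3,4)])
  define y where "y = parity x a"
  have y1: "y \<le> 1" by (simp add: y_def parity_def)
  have ex: "example s e (solution x (points recs e)) = (\<Sum>i<length x. x ! i * a ! i)"
    unfolding example_def using sum_solution[OF x a e(3)] r(7)[OF e(1)] by simp
  \<comment> \<open>The true value is the parity of the example on the restricted target, as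
    \<open>alive_correct\<close> requires.\<close>
  have ev: "even (example s e (solution x (points recs e)) + y)"
    unfolding ex y_def parity_def by presburger
  obtain \<tau>1 m1 s1 where
    e1: "exec a (cmp PREDICT) m \<tau>1 m1" "rel m1 s1" "bnd s1"
       "\<tau>1 \<le> unit * (?N * (D * (11 * D + \<eta> + 30) + \<eta> + 30) + 5 * \<rho>o + 5 * \<eta> + 20)"
       and p1: "predicted s s1 \<and> s1 0 9 = (if (\<Sum>e<?N. vote s s1 False e) < (\<Sum>e<?N. vote s s1 True e) then 1 else 0)"
    by (rule runE[OF run_PREDICT[OF r(6)] r(2,1)])
  note 1 = e1 conjunct1[OF p1] conjunct2[OF p1]
  define b where "b = s1 0 9"
  have b1: "b \<le> 1" using 1(6) by (simp add: b_def)
  define m1' where "m1' = m1(16 := 0, 1 := b)"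
  have m144: "m1 144 = b" using relD[OF 1(2), of 9] by (simp add: b_def)
  have e2: "exec a (Seq (Const 16 0) (Add 1 144 16)) m1
     ((len 16 + len 0) + (len 1 + len 144 + len 16 + len b + len 0)) m1'"
    unfolding m1'_def using exec.Const[of a 16 0 m1] exec.Add[of a 1 144 16 "m1(16 := 0)"] m144
    by (auto intro!: exec.Seq)
  define m2 where "m2 = (m1'(1 := y))(16 := 0, 144 := y)"
  have e3: "exec a (Seq (Const 16 0) (Add 144 1 16)) (m1'(1 := y))
     ((len 16 + len 0) + (len 144 + len 1 + len 16 + len y + len 0)) m2"
    unfolding m2_def using exec.Const[of a 16 0 "m1'(1 := y)"] exec.Add[of a 144 1 16 "(m1'(1 := y))(16 := 0)"]
    by (auto intro!: exec.Seq)
  define s2 where "s2 = upd (upd s1 0 1 0) 0 9 y"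
  have rel1: "rel (m(1 := w)) s" if "rel m s" for m s w
    using that by (auto simp: rel_def classes_def)
  have m2: "m2 = ((m1'(1 := y))(16 * 1 + 0 := 0))(16 * 9 + 0 := y)" by (simp add: m2_def)
  have m1'2: "rel (m1'(1 := y)) (upd s1 0 1 0)"
    unfolding m1'_def using rel1[OF rel_upd[OF 1(2), of 0 1 0], of y] by (simp add: classes_def)
  have "rel m2 (upd (upd (upd s1 0 1 0) 0 1 0) 0 9 y)"
    unfolding m2 by (intro rel_upd m1'2) (auto simp: classes_def)
  moreover have "upd (upd (upd s1 0 1 0) 0 1 0) 0 9 y = s2"
    by (simp add: s2_def fun_eq_iff)
  ultimately have rel2: "rel m2 s2" by simp
  have s21: "s2 q = s1 q" if "q \<noteq> 0" for q using that by (simp add: s2_def)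
  have bnd2: "bnd s2" unfolding s2_def using y1 one_short by (intro bnd_upd0 1(3)) (auto simp: lim_light heavy_def)
  have out: "outcome s s1 e'" if "e' < ?N" "s1 8 e' = 0" for e'
    using 1(5) that by (simp add: predicted_def frame_def)
  have ru: "run UPDATE s2 (?N * 20 + 3) (\<lambda>s'. (\<forall>e<?N. updated s2 s' y e) \<and> frame {1, 2, 3, 20, 29} {5, 8} s2 s')"
  proof (rule run_UPDATE)
    show "s2 0 9 = y" "y \<le> 1" using y1 by (auto simp: s2_def)
    show "s2 0 19 = ?N" using r(6) 1(5) by (simp add: s2_def inv_def predicted_def frame_def)
    fix e assume e: "e < ?N" "s2 8 e = 0"
    then have o: "outcome s s1 e" using out s21 by simp
    show "s2 13 e \<le> 1" using o s21 by (simp add: outcome_def)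
    assume "s2 9 e \<noteq> 0"
    then show "\<exists>p<?d e. s2 12 e = e * \<rho>o + p" using o s21[of 9] s21[of 12] unfolding outcome_def by fastforce
  qed
  obtain \<tau>3 m3 s3 where
    3: "exec a (cmp UPDATE) m2 \<tau>3 m3" "rel m3 s3" "bnd s3" "\<tau>3 \<le> unit * (?N * 20 + 3)"
       and u3: "(\<forall>e<?N. updated s2 s3 y e) \<and> frame {1, 2, 3, 20, 29} {5, 8} s2 s3"
    by (rule runE[OF ru bnd2 rel2])
  have updated3: "updated s2 s3 y e" if "e < ?N" for e using u3 that by blast
  have frame3: "frame {1, 2, 3, 20, 29} {5, 8} s2 s3" using u3 by (rule conjunct2)
  have predicted2: "predicted s s2"
  proof -
    have "outcome s s2 e'" if "outcome s s1 e'" for e'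
      using that s21 by (simp add: outcome_def wf_expert_def row_ok_def same_row_def)
    moreover have "frame {1, 2, 3, 4, 5, 6, 7, 9, 20, 21, 23, 24, 29, 30, 31, 32, 33, 34, 35, 38} {4, 5, 6, 7, 9, 12, 13} s s2"
      using 1(5) by (simp add: predicted_def s2_def)
    ultimately show ?thesis using 1(5) by (simp add: predicted_def)
  qed
  have bvote: "b = (if (\<Sum>e<?N. vote s s2 False e) < (\<Sum>e<?N. vote s s2 True e) then 1 else 0)"
    using 1(6) s21 by (simp add: b_def vote_def)
  note after = r(6) predicted2 y1 updated3 frame3
  have ready: "ready x m3 (if b \<noteq> y then p div 2 else p)"
    unfolding ready_def
  proof (intro exI[of _ recs] exI[of _ s3] conjI)
    show "s3 0 8 \<noteq> 0" using r(5) predicted2 frame3 by (simp add: predicted_def frame_def)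
    show "inv s3" using inv_after[OF after] .
    have "s3 3 = s 3" using predicted2 frame3 by (simp add: predicted_def frame_def)
    then show "\<forall>e<?N. \<forall>j<?d e. s3 3 (e * \<rho>o + j) = points recs e ! j" using r(7) by simp
    show "potential s3 \<le> (if b \<noteq> y then p div 2 else p)"
    proof (cases "b = y")
      case False
      have "2 * potential s3 \<le> potential s" by (rule potential_mistake[OF after bvote False])
      then show ?thesis using False r(8) by simp
    next
      case True
      then show ?thesis using potential_mono[OF after] r(8) by simp
    qed
    show "\<exists>e<?N. s3 8 e = 0 \<and> {i. i < n \<and> x ! i \<noteq> 0} \<subseteq> set (points recs e) \<and> sat s3 e (solution x (points recs e))"
      using alive_correct[OF after e(1,2,4) ev] e by blast
  qed (use 3 r in auto)
  have l: "len 16 \<le> 5" "len 0 \<le> 1" "len 1 \<le> 1" "len 144 \<le> 8" "len b \<le> 1" "len y \<le> 1"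
    using b1 y1 by (auto intro!: len_le)
  have u: "60 \<le> unit" using \<beta> by (simp add: unit_def)
  have "(\<tau>1 + ((len 16 + len 0) + (len 1 + len 144 + len 16 + len b + len 0))) +
     ((len 16 + len 0) + (len 144 + len 1 + len 16 + len y + len 0) + \<tau>3) \<le> \<tau>1 + \<tau>3 + 60" using l by simp
  also have "\<dots> \<le> unit * ((?N * (D * (11 * D + \<eta> + 30) + \<eta> + 30) + 5 * \<rho>o + 5 * \<eta> + 20) + (?N * 20 + 3) + 1)"
    using 1(4) 3(4) u by (simp add: distrib_left)
  also have "\<dots> = unit * (?N * (D * (11 * D + \<eta> + 30) + \<eta> + 50) + 5 * \<rho>o + 5 * \<eta> + 24)" by (simp add: algebra_simps)
  also have "\<dots> \<le> unit * vote_steps" unfolding vote_steps_def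
    using r(3) by (intro mult_le_mono2 add_mono mult_le_mono1) auto
  finally have t: "(\<tau>1 + ((len 16 + len 0) + (len 1 + len 144 + len 16 + len b + len 0))) +
     ((len 16 + len 0) + (len 144 + len 1 + len 16 + len y + len 0) + \<tau>3) \<le> unit * vote_steps" .
  have "exec a updater (m1'(1 := y)) ((len 16 + len 0) + (len 144 + len 1 + len 16 + len y + len 0) + \<tau>3) m3"
    unfolding updater_def
  proof -
    from e3 show "exec a (Seq (Const 16 0) (Seq (Add 144 1 16) (cmp UPDATE))) (m1'(1 := y))
       ((len 16 + len 0) + (len 144 + len 1 + len 16 + len y + len 0) + \<tau>3) m3"
    proof (cases rule: exec.cases)
      case (Seq \<tau>1 m1 \<tau>2)
      then show ?thesis using exec.Seq[OF Seq(2) exec.Seq[OF Seq(3) 3(1)]] by (simp add: add.assoc)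
    qed
  qed
  then show ?thesis using exec.Seq[OF 1(1) e2] t ready unfolding y_def[symmetric] unit_def
    by (intro exI[of _ "\<tau>1 + ((len 16 + len 0) + (len 1 + len 144 + len 16 + len b + len 0))"] exI[of _ m1']
       exI[of _ "(len 16 + len 0) + (len 144 + len 1 + len 16 + len y + len 0) + \<tau>3"] exI[of _ m3])
       (auto simp: m1'_def)
qed

definition setup_steps :: nat where
  "setup_steps = (10 * K + 5 * v + 10 * M + 5 * A + 5 * n + 100) + (Nmax * (KX + 30) + 10) + 2"

text \<open>The whole family is built before the first prediction, so its cost enters the time per
  round. At the start no equation is stored: every expert is consistent with any target, and the
  closure of the queue under children gives one that covers it.\<close>

lemma first_round:
  assumes a: "a \<in> cube n"
  shows "\<exists>\<tau> m'. exec a (INIT ck ct) (init_mem n) \<tau> m' \<and> \<tau> \<le> 200 * (\<tau>k + \<tau>t) + 300 * \<beta> * setup_steps \<and>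
     (\<forall>x \<in> PAR n k0. ready x m' (Nmax * 2 ^ D))"
proof -
  note kt = \<beta>(2,3)
  interpret gen a \<beta> \<eta> n K v Nmax by (rule gen[OF a])
  define m1 where "m1 = (init_mem n)(1 := n, 2 := n)"
  have e1: "exec a (Add 1 0 144) (init_mem n) (len 1 + len 0 + len 144 + len n + len 0) ((init_mem n)(1 := n))"
    using exec.Add[of a 1 0 144 "init_mem n"] by (simp add: init_mem_def)
  have e2: "exec a (Add 2 0 144) ((init_mem n)(1 := n)) (len 2 + len 0 + len 144 + len n + len 0) m1"
    using exec.Add[of a 2 0 144 "(init_mem n)(1 := n)"] by (simp add: init_mem_def m1_def)
  have c1: "m1 (16 * i + 1) = init_mem n i" "m1 (16 * i + 2) = init_mem n i" for i
    by (auto simp: m1_def init_mem_def)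
  from exec_emb[OF ck(1), of 1 m1 a] c1 obtain \<tau>1 m2 where
    e3: "exec a (emb 1 ck) m1 \<tau>1 m2" "\<tau>1 \<le> 200 * \<tau>k" "\<And>i. m2 (16 * i + 1) = mk i"
      "\<And>x. x mod 16 \<noteq> 1 \<Longrightarrow> x mod 16 \<noteq> 14 \<Longrightarrow> m2 x = m1 x" by auto
  have c2: "m2 (16 * i + 2) = init_mem n i" for i
  proof -
    have "(16 * i + 2) mod 16 = (2::nat)" by presburger
    then show ?thesis using e3(4)[of "16 * i + 2"] c1(2)[of i] by linarith
  qed
  from exec_emb[OF ct(1), of 2 m2 a] c2 obtain \<tau>2 m3 where
    e4: "exec a (emb 2 ct) m2 \<tau>2 m3" "\<tau>2 \<le> 200 * \<tau>t" "\<And>i. m3 (16 * i + 2) = mt i"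
      "\<And>x. x mod 16 \<noteq> 2 \<Longrightarrow> x mod 16 \<noteq> 14 \<Longrightarrow> m3 x = m2 x" by auto
  have m17: "m3 17 = k0" using e4(4)[of 17] e3(3)[of 1] ck(2) by simp
  have m18: "m3 18 = t0" using e4(3)[of 1] ct(2) by simp
  have m3: "m3 (16 * i + q) = init_mem n (16 * i + q)" if "q \<in> classes" for i q
  proof -
    have "q < 14" "q \<noteq> 1" "q \<noteq> 2" using that by (auto simp: classes_def)
    then have "(16 * i + q) mod 16 \<noteq> 1" "(16 * i + q) mod 16 \<noteq> 2" "(16 * i + q) mod 16 \<noteq> 14" by auto
    moreover have "16 * i + q \<noteq> 1" "16 * i + q \<noteq> 2" using \<open>q \<noteq> 1\<close> \<open>q \<noteq> 2\<close> by presburger+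
    ultimately show ?thesis using e4(4) e3(4) by (simp add: m1_def)
  qed
  have m144: "m3 144 = 0" using m3[of 0 9] by (simp add: classes_def init_mem_def)
  define m4 where "m4 = m3(160 := k0)"
  have e5: "exec a (Add 160 17 144) m3 (len 160 + len 17 + len 144 + len k0 + len 0) m4"
    using exec.Add[of a 160 17 144 m3] m144 m17 by (simp add: m4_def)
  define m5 where "m5 = m4(176 := t0)"
  have e6: "exec a (Add 176 18 144) m4 (len 176 + len 18 + len 144 + len t0 + len 0) m5"
    using exec.Add[of a 176 18 144 m4] m144 m18 by (simp add: m4_def m5_def)
  define s0 :: state where "s0 = upd (upd (\<lambda>q i. init_mem n (16 * i + q)) 0 10 k0) 0 11 t0"
  have m5': "m5 = (m3(16 * 10 + 0 := k0))(16 * 11 + 0 := t0)" by (simp add: m5_def m4_def)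
  have "rel m3 (\<lambda>q i. init_mem n (16 * i + q))" using m3 by (simp add: rel_def)
  then have rel5: "rel m5 s0" unfolding m5' s0_def by (intro rel_upd) (auto simp: classes_def)
  have nb: "n < 2 ^ \<beta>"
  proof -
    have "n \<le> 32 * n" by simp
    have "32 * (n + 1) \<le> 32 * (C + n + F + A * M + (Nmax + 1) * (K * A * M * (n + 1) + 2) * (K * A * M * (n + 1) + 2))"
      using C_pos by (intro mult_le_mono2) simp
    then have "32 * (n + 1) \<le> 2 ^ \<beta>" using bigN by (rule le_trans)
    then show ?thesis by simp
  qed
  have bnd0: "bnd (\<lambda>q i. init_mem n (16 * i + q))"
    using nb by (auto simp: bnd_def init_mem_def heavy_def lim_def)
  have s0: "s0 0 0 = n" "s0 0 10 = k0" "s0 0 11 = t0" "\<And>q. 3 \<le> q \<Longrightarrow> s0 q = (\<lambda>_. 0)"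
    by (auto simp: s0_def init_mem_def fun_eq_iff)
  have bnds0: "bnd s0" unfolding s0_def using kt by (intro bnd_upd0 bnd0) (auto simp: lim_def heavy_def)
  have run: "run (SETUP ;; HConst 8 1) s0 (((10 * K + 5 * v + 10 * M + 5 * A + 5 * n + 100) + (Nmax * (KX + 30) + 10)) + 1)
     (\<lambda>s'. \<exists>recs. queue recs s' \<and> length recs \<le> Nmax \<and> (K, 0, []) \<in> set recs \<and>
     (\<forall>\<rho> \<in> set recs. set (kidsall \<rho>) \<subseteq> set recs) \<and> s' 0 8 = 1 \<and> s' 4 = (\<lambda>_. 0) \<and> s' 5 = (\<lambda>_. 0) \<and> s' 6 = (\<lambda>_. 0) \<and> s' 8 = (\<lambda>_. 0))"
    unfolding SETUP_def
  proof (rule run_Seq, rule run_Seq)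
    show "run PARAMS s0 (10 * K + 5 * v + 10 * M + 5 * A + 5 * n + 100)
    (\<lambda>s'. queue [(K, 0, [])] s' \<and> frame ({1, 2, 10, 11, 12, 13, 14, 15, 16, 17, 18, 19, 22, 31, 36, 37, 38}) {9} s0 s')"
      by (rule run_PARAMS) (use s0 Kv Npos in auto)
  next
    fix s1 assume s1: "bnd s1" "queue [(K, 0, [])] s1 \<and> frame ({1, 2, 10, 11, 12, 13, 14, 15, 16, 17, 18, 19, 22, 31, 36, 37, 38}) {9} s0 s1"
    show "run BFS s1 (Nmax * (KX + 30) + 10) (\<lambda>s'. \<exists>recs. queue recs s' \<and> length recs \<le> Nmax \<and> (K, 0, []) \<in> set recs \<and>
     (\<forall>\<rho> \<in> set recs. set (kidsall \<rho>) \<subseteq> set recs) \<and> s' 4 = (\<lambda>_. 0) \<and> s' 5 = (\<lambda>_. 0) \<and> s' 6 = (\<lambda>_. 0) \<and> s' 8 = (\<lambda>_. 0))"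
      by (rule run_mono[OF run_BFS[OF conjunct1[OF s1(2)] \<phi>] order_refl])
         (use s1(2) s0(4) in \<open>auto simp: frame_def\<close>)
  next
    fix s1 assume "bnd s1" and s1: "\<exists>recs. queue recs s1 \<and> length recs \<le> Nmax \<and> (K, 0, []) \<in> set recs \<and>
     (\<forall>\<rho> \<in> set recs. set (kidsall \<rho>) \<subseteq> set recs) \<and> s1 4 = (\<lambda>_. 0) \<and> s1 5 = (\<lambda>_. 0) \<and> s1 6 = (\<lambda>_. 0) \<and> s1 8 = (\<lambda>_. 0)"
    have "(1::nat) < 2 ^ \<beta>" using \<beta> by (intro one_less_power) auto
    moreover have "queue recs (upd s1 0 8 1) \<longleftrightarrow> queue recs s1" for recs
      by (simp add: queue_def params_def recs_ok_def)
    ultimately show "run (HConst 8 1) s1 1 (\<lambda>s'. \<exists>recs. queue recs s' \<and> length recs \<le> Nmax \<and> (K, 0, []) \<in> set recs \<and>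
     (\<forall>\<rho> \<in> set recs. set (kidsall \<rho>) \<subseteq> set recs) \<and> s' 0 8 = 1 \<and> s' 4 = (\<lambda>_. 0) \<and> s' 5 = (\<lambda>_. 0) \<and> s' 6 = (\<lambda>_. 0) \<and> s' 8 = (\<lambda>_. 0))"
      using s1 by (intro run_Const) auto
  qed
  obtain \<tau> m' s where
    7: "exec a (cmp (SETUP ;; HConst 8 1)) m5 \<tau> m'" "rel m' s" "bnd s"
      "\<tau> \<le> unit * (((10 * K + 5 * v + 10 * M + 5 * A + 5 * n + 100) + (Nmax * (KX + 30) + 10)) + 1)"
    and "\<exists>recs. queue recs s \<and> length recs \<le> Nmax \<and> (K, 0, []) \<in> set recs \<and>
     (\<forall>\<rho> \<in> set recs. set (kidsall \<rho>) \<subseteq> set recs) \<and> s 0 8 = 1 \<and> s 4 = (\<lambda>_. 0) \<and> s 5 = (\<lambda>_. 0) \<and> s 6 = (\<lambda>_. 0) \<and> s 8 = (\<lambda>_. 0)"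
    by (rule runE[OF run bnds0 rel5])
  then obtain recs where q: "queue recs s" "length recs \<le> Nmax" "(K, 0, []) \<in> set recs"
      "\<And>\<rho>. \<rho> \<in> set recs \<Longrightarrow> set (kidsall \<rho>) \<subseteq> set recs" "s 0 8 = 1" "s 4 = (\<lambda>_. 0)" "s 5 = (\<lambda>_. 0)" "s 6 = (\<lambda>_. 0)" "s 8 = (\<lambda>_. 0)"
    by blast
  have goods: "\<forall>c \<in> set recs. good c" using q(1) by (simp add: queue_def)
  let ?d = "\<lambda>e. length (points recs e)"
  let ?N = "length recs"
  interpret R: rounds a \<beta> \<eta> ?N rho D ?d by (rule rounds[OF a q(2) goods])
  have ready: "ready x m' (Nmax * 2 ^ D)" if x: "x \<in> PAR n k0" for x
    unfolding ready_def
  proof (intro exI[of _ recs] exI[of _ s] conjI 7 q(2) goods)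
    show "s 0 8 \<noteq> 0" using q(5) by simp
    show "R.inv s" using q unfolding R.inv_def R.wf_expert_def R.row_ok_def
      by (simp add: queue_def params_def recs_ok_def points_def)
    show "\<forall>e<?N. \<forall>j<?d e. s 3 (e * rho + j) = points recs e ! j"
      using q(1) by (simp add: queue_def recs_ok_def points_def)
    have "R.potential s \<le> (\<Sum>e<?N. 2 ^ D)"
      unfolding R.potential_def
    proof (rule sum_mono)
      fix e assume "e \<in> {..<?N}"
      then have "R.free s e \<le> D" using R.free_upto_le[of s e "?d e"] R.dD[of e] by simp
      then show "R.weight_of s e \<le> 2 ^ D" by (simp add: R.weight_of_def)
    qed
    also have "\<dots> \<le> Nmax * 2 ^ D" using q(2) by simp
    finally show "R.potential s \<le> Nmax * 2 ^ D" .
    let ?Y = "{i. i < n \<and> x ! i \<noteq> 0}"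
    have "card ?Y \<le> K" using x Kv(1) by (auto simp: PAR_def hamming_weight_def cube_def)
    moreover have "?Y \<subseteq> {..<n}" by auto
    ultimately have "\<exists>r' \<sigma>' ps'. (r', \<sigma>', ps') \<in> set recs \<and> set [] \<union> ?Y \<subseteq> set ps'"
      by (intro cover[of "set recs", OF subsetD[OF q(4)] q(3)]) (use K in auto)
    then obtain r' \<sigma>' ps' where ps': "(r', \<sigma>', ps') \<in> set recs" "set [] \<union> ?Y \<subseteq> set ps'" by blast
    then obtain e where e: "e < ?N" "recs ! e = (r', \<sigma>', ps')" by (auto simp: in_set_conv_nth)
    show "\<exists>e<?N. s 8 e = 0 \<and> ?Y \<subseteq> set (points recs e) \<and> R.sat s e (solution x (points recs e))"
    proof (intro exI[of _ e] conjI e(1))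
      show "s 8 e = 0" using q(9) by simp
      show "?Y \<subseteq> set (points recs e)" using e(2) ps'(2) by (simp add: points_def)
      show "R.sat s e (solution x (points recs e))" unfolding R.sat_def using q(6) by simp
    qed
  qed
  have l: "len 0 \<le> 1" "len 1 \<le> 1" "len 2 \<le> 2" "len 17 \<le> 5" "len 18 \<le> 5" "len 144 \<le> 8" "len 160 \<le> 8" "len 176 \<le> 8"
    "len n \<le> \<beta>" "len k0 \<le> \<beta>" "len t0 \<le> \<beta>" using nb \<beta> kt by (auto intro!: len_le)
  let ?\<tau> = "(len 1 + len 0 + len 144 + len n + len 0) + ((len 2 + len 0 + len 144 + len n + len 0) + (\<tau>1 + (\<tau>2 +
     ((len 160 + len 17 + len 144 + len k0 + len 0) + ((len 176 + len 18 + len 144 + len t0 + len 0) + \<tau>)))))"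
  have "exec a (INIT ck ct) (init_mem n) ?\<tau> m'"
    unfolding INIT_def by (intro exec.Seq[OF e1] exec.Seq[OF e2] exec.Seq[OF e3(1)] exec.Seq[OF e4(1)] exec.Seq[OF e5] exec.Seq[OF e6] 7(1))
  moreover have "?\<tau> \<le> 200 * (\<tau>k + \<tau>t) + (\<tau> + unit)"
    using l e3(2) e4(2) \<beta> by (simp add: unit_def)
  moreover have "\<tau> + unit \<le> 300 * \<beta> * setup_steps"
    using add_right_mono[OF 7(4), of unit] unfolding unit_def setup_steps_def by (simp add: distrib_left)
  ultimately show ?thesis using ready by (intro exI[of _ ?\<tau>] exI[of _ m']) auto
qed

abbreviation learner :: learner where "learner \<equiv> (predictor ck ct, updater)"

definition round_time :: nat where
  "round_time = 200 * (\<tau>k + \<tau>t) + 300 * \<beta> * (setup_steps + vote_steps + 1)"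

text \<open>The untouched memory counts as a state of full potential, which makes the induction over
  the rounds uniform.\<close>

definition started :: "nat list \<Rightarrow> mem \<Rightarrow> nat \<Rightarrow> bool" where
  "started x m p \<longleftrightarrow> m = init_mem n \<and> p = Nmax * 2 ^ D \<or> ready x m p"

lemma round:
  assumes a: "a \<in> cube n" and x: "x \<in> PAR n k0" and s: "started x m p"
  shows "\<exists>b \<tau> m'. learning_round learner a (parity x a) m b \<tau> m' \<and> \<tau> \<le> round_time \<and>
    started x m' (if b \<noteq> parity x a then p div 2 else p)"
proof -
  have l: "len 128 \<le> 8" "len 0 \<le> 1" by (auto intro: len_le)
  have "\<exists>\<tau> m'. exec a (Cond 128 Skip (INIT ck ct)) m \<tau> m' \<and> \<tau> \<le> 200 * (\<tau>k + \<tau>t) + 300 * \<beta> * (setup_steps + 1) \<and> ready x m' p"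
  proof (cases "ready x m p")
    case True
    then obtain s where "rel m s" "ok s" "s 0 8 \<noteq> 0" by (auto simp: ready_def)
    then have m: "m 128 \<noteq> 0" "m 128 < 2 ^ \<beta>"
      using machine.relD[of a \<beta> \<eta> m s 8] machine.bndD[of a \<beta> \<eta> s 8] gen[OF a] by (auto simp: gen_def heavy_def)
    have "exec a (Cond 128 Skip (INIT ck ct)) m (len 128 + len (m 128) + 1) m"
      using exec.CondTrue[of m 128, OF m(1) exec.Skip] .
    moreover have "len (m 128) \<le> \<beta>" using m \<beta> by (intro len_le) auto
    then have "len 128 + len (m 128) + 1 \<le> 300 * \<beta> * 1" using l \<beta> by simp
    moreover have "300 * \<beta> * 1 \<le> 300 * \<beta> * (setup_steps + 1)" by (intro mult_le_mono2) simp
    ultimately show ?thesis using True by (intro exI[of _ "len 128 + len (m 128) + 1"] exI[of _ m]) auto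
  next
    case False
    then have m: "m = init_mem n" "p = Nmax * 2 ^ D" using s by (auto simp: started_def)
    from first_round[OF a] x obtain \<tau> m' where
      1: "exec a (INIT ck ct) m \<tau> m'" "\<tau> \<le> 200 * (\<tau>k + \<tau>t) + 300 * \<beta> * setup_steps" "ready x m' p"
      unfolding m by blast
    have m0: "m 128 = 0" by (simp add: m init_mem_def)
    have "exec a (Cond 128 Skip (INIT ck ct)) m (len 128 + len (m 128) + \<tau>) m'"
      by (rule exec.CondFalse[OF m0 1(1)])
    moreover have "len 128 + len (m 128) \<le> 300 * \<beta>" using l m0 \<beta> by simp
    ultimately show ?thesis using 1 by (intro exI[of _ "len 128 + len (m 128) + \<tau>"] exI[of _ m']) (auto simp: distrib_left)
  qed
  then obtain \<tau>0 m0 where 0: "exec a (Cond 128 Skip (INIT ck ct)) m \<tau>0 m0"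
    "\<tau>0 \<le> 200 * (\<tau>k + \<tau>t) + 300 * \<beta> * (setup_steps + 1)" "ready x m0 p" by blast
  have xc: "x \<in> cube n" using x by (simp add: PAR_def)
  from vote_round[OF a xc 0(3)] obtain \<tau>1 m1 \<tau>2 m2 where
    1: "exec a (Seq (cmp PREDICT) (Seq (Const 16 0) (Add 1 144 16))) m0 \<tau>1 m1"
    "exec a updater (m1(1 := parity x a)) \<tau>2 m2" "\<tau>1 + \<tau>2 \<le> 300 * \<beta> * vote_steps"
    "ready x m2 (if m1 1 \<noteq> parity x a then p div 2 else p)" by blast
  have "learning_round learner a (parity x a) m (m1 1) (\<tau>0 + \<tau>1 + \<tau>2) m2"
    unfolding predictor_def by (intro learning_round.intros exec.Seq[OF 0(1) 1(1)] 1(2))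
  moreover have "\<tau>0 + \<tau>1 + \<tau>2 \<le> round_time"
    using add_mono[OF 0(2) 1(3)] by (simp add: round_time_def distrib_left)
  ultimately show ?thesis using 1(4) unfolding started_def by blast
qed

text \<open>The expert that covers the target is alive and has at least one solution. So the
  potential never falls below 1, which bounds the number of halvings.\<close>

lemma started_pos:
  assumes "started x m p" shows "1 \<le> p"
proof (cases "ready x m p")
  case False
  then show ?thesis using assms Npos by (simp add: started_def)
next
  case True
  then obtain recs s e where r: "length recs \<le> Nmax" "\<forall>c \<in> set recs. good c"
    "rounds.potential (length recs) \<rho>o (\<lambda>e. length (points recs e)) s \<le> p" "e < length recs" "s 8 e = 0"
    unfolding ready_def by blast
  have "replicate n 0 \<in> cube n" by (auto simp: cube_def)
  then interpret rounds "replicate n 0" \<beta> \<eta> "length recs" \<rho>o D "\<lambda>e. length (points recs e)"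
    using rounds r by blast
  have "1 \<le> weight_of s e" using r(5) by (simp add: weight_of_def)
  also have "\<dots> \<le> potential s" unfolding potential_def using r(4) by (intro member_le_sum) auto
  finally show ?thesis using r(3) by simp
qed

lemma play_bounds:
  assumes x: "x \<in> PAR n k0"
  shows "as \<in> lists (cube n) \<Longrightarrow> started x m p \<Longrightarrow> \<exists>tr. play learner x m as tr \<and> 2 ^ length (filter fst tr) \<le> p \<and> (\<forall>(w, \<tau>) \<in> set tr. \<tau> \<le> round_time)"
proof (induction as arbitrary: m p)
  case Nil
  then show ?case using started_pos by (intro exI[of _ "[]"]) (auto intro: play.intros)
next
  case (Cons a as)
  have a: "a \<in> cube n" "as \<in> lists (cube n)" using Cons.prems(1) by simp_all
  from round[OF a(1) x Cons.prems(2)] obtain b \<tau> m' where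
    1: "learning_round learner a (parity x a) m b \<tau> m'" "\<tau> \<le> round_time"
      "started x m' (if b \<noteq> parity x a then p div 2 else p)" by blast
  from Cons.IH[OF a(2) 1(3)] obtain tr where
    2: "play learner x m' as tr" "2 ^ length (filter fst tr) \<le> (if b \<noteq> parity x a then p div 2 else p)"
      "\<forall>(w, \<tau>) \<in> set tr. \<tau> \<le> round_time" by blast
  show ?case
    using play.intros(2)[OF 1(1) 2(1)] 2(2,3) 1(2) by (intro exI[of _ "(b \<noteq> parity x a, \<tau>) # tr"]) (auto split: if_splits)
qed

end

lemma learning_round_det:
  "learning_round L a y m b \<tau> m' \<Longrightarrow> learning_round L a y m b' \<tau>' m'' \<Longrightarrow> b' = b \<and> \<tau>' = \<tau> \<and> m'' = m'"
  by (auto elim!: learning_round.cases dest: exec_det)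

lemma play_det: "play L x m as tr \<Longrightarrow> play L x m as tr' \<Longrightarrow> tr' = tr"
proof (induction arbitrary: tr' rule: play.induct)
  case (1 m)
  then show ?case by (auto elim: play.cases)
next
  case (2 a m b \<tau> m' as tr)
  from 2(4) obtain b' \<tau>' m'' tr'' where "learning_round L a (parity x a) m b' \<tau>' m''" "play L x m'' as tr''"
    "tr' = (b' \<noteq> parity x a, \<tau>') # tr''" by (auto elim: play.cases)
  then show ?case using 2(3) learning_round_det[OF 2(1)] by blast
qed

lemma ereal_of_enat_mono: "b \<le> c \<Longrightarrow> ereal_of_enat b \<le> ereal_of_enat c"
  by (simp only: ereal_of_enat_le_iff)

context learning
begin

lemma plays_bounds:
  assumes "tr \<in> plays learner n k0"
  shows "2 ^ length (filter fst tr) \<le> Nmax * 2 ^ D" "\<forall>(w, \<tau>) \<in> set tr. \<tau> \<le> round_time"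
proof -
  from assms obtain x as where x: "x \<in> PAR n k0" "as \<in> lists (cube n)" "play learner x (init_mem n) as tr"
    by (auto simp: plays_def)
  have "started x (init_mem n) (Nmax * 2 ^ D)" by (simp add: started_def)
  from play_bounds[OF x(1,2) this] play_det[OF x(3)]
  show "2 ^ length (filter fst tr) \<le> Nmax * 2 ^ D" "\<forall>(w, \<tau>) \<in> set tr. \<tau> \<le> round_time" by auto
qed

lemma mistakes_le: "mistake_bound learner n k0 \<le> enat (floor_log (Nmax * 2 ^ D))"
  unfolding mistake_bound_def
proof (rule SUP_least)
  fix tr assume "tr \<in> plays learner n k0"
  from floor_log_le_iff[OF plays_bounds(1)[OF this]]
  show "enat (length (filter fst tr)) \<le> enat (floor_log (Nmax * 2 ^ D))" by simp
qed

lemma time_le: "time_per_round learner n k0 \<le> enat round_time"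
  unfolding time_per_round_def
  by (intro SUP_least) (use plays_bounds(2) in fastforce)

lemma learns: "learns_PAR learner n k0"
proof -
  have "\<exists>tr. play learner x (init_mem n) as tr" if "x \<in> PAR n k0" "as \<in> lists (cube n)" for x as
    using play_bounds[OF that, of "init_mem n"] by (auto simp: started_def)
  moreover have "mistake_bound learner n k0 < \<infinity>"
    using mistakes_le by (metis enat_ord_code(4) le_less_trans)
  ultimately show ?thesis by (simp add: learns_PAR_def)
qed

lemma mistakes_real: "ereal_of_enat (mistake_bound learner n k0) \<le> ereal (log 2 (real Nmax) + real D)"
proof -
  let ?P = "Nmax * 2 ^ D"
  have P: "0 < ?P" using Npos by simp
  have "ereal_of_enat (mistake_bound learner n k0) \<le> ereal_of_enat (enat (floor_log ?P))"
    using mistakes_le by (rule ereal_of_enat_mono)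
  also have "\<dots> = ereal (real (floor_log ?P))" by simp
  also have "real (floor_log ?P) \<le> log 2 (real ?P)"
  proof -
    have "1 \<le> real ?P" using P by linarith
    then have "0 \<le> log 2 (real ?P)" by simp
    then show ?thesis using P of_nat_floor[of "log 2 (real ?P)"] by (simp only: floor_log_altdef if_False neq0_conv[symmetric])
  qed
  also have "log 2 (real ?P) = log 2 (real Nmax) + real D"
    using Npos by (simp add: log_mult log_nat_power)
  finally show ?thesis by simp
qed

lemma time_real: "ereal_of_enat (time_per_round learner n k0) \<le> ereal (real round_time)"
proof -
  have "ereal_of_enat (time_per_round learner n k0) \<le> ereal_of_enat (enat round_time)"
    using time_le by (rule ereal_of_enat_mono)
  then show ?thesis by simp
qed

end

section \<open>The size of the family\<close>

text \<open>The bound telescopes because 11 / 10 is at most exp (1 / 10); stated without division by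
  1 - exp (- 1 / 10).\<close>

lemma sum_exp_tenth: "(\<Sum>l = 1..<Suc m. exp (- (real l / 10))) \<le> 10 * (1 - exp (- (real m / 10)))"
proof (induction m)
  case (Suc m)
  have "11 / 10 \<le> exp (1 / 10 :: real)" using exp_ge_add_one_self[of "1 / 10 :: real"] by simp
  then have "11 / 10 * exp (- (real (Suc m) / 10)) \<le> exp (1 / 10) * exp (- (real (Suc m) / 10))"
    by (intro mult_right_mono) auto
  also have "\<dots> = exp (- (real m / 10))" by (simp add: exp_add[symmetric] field_simps)
  finally show ?case using Suc by simp
qed simp

text \<open>From y \<le> exp (y - 1) with y = 0.9 * l / c, raised to the power c; it is sharp at l =
  c / 0.9, where l^c * exp (- 0.9 * l) is largest.\<close>

lemma power_le_exp:
  assumes "0 < c" shows "real l ^ c \<le> (real c / (9 / 10 * exp 1)) ^ c * exp (9 / 10 * real l)"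
proof -
  let ?y = "9 / 10 * real l / real c"
  have "?y \<le> exp (?y - 1)" using exp_ge_add_one_self[of "?y - 1"] by simp
  then have "?y ^ c \<le> exp (?y - 1) ^ c" by (intro power_mono) auto
  also have "\<dots> = exp (9 / 10 * real l) / exp 1 ^ c"
    using assms by (simp add: exp_of_nat_mult[symmetric] exp_diff[symmetric] field_simps)
  finally have *: "?y ^ c \<le> exp (9 / 10 * real l) / exp 1 ^ c" .
  have "real l = ?y * (real c / (9 / 10))" using assms by simp
  then have "real l ^ c = ?y ^ c * (real c / (9 / 10)) ^ c" by (metis power_mult_distrib)
  also have "\<dots> \<le> exp (9 / 10 * real l) / exp 1 ^ c * (real c / (9 / 10)) ^ c"
    using * by (intro mult_right_mono) auto
  also have "\<dots> = (real c / (9 / 10 * exp 1)) ^ c * exp (9 / 10 * real l)"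
    by (simp add: power_divide power_mult_distrib mult_ac)
  finally show ?thesis .
qed

text \<open>Spending only 0.9 of the exponent leaves exp (- l / 10) for the convergence of the sum,
  at most 10; with e at most 3 this makes 30. The exponent 1 - l reflects that consecutive spans
  share a block.\<close>

lemma sum_power_exp:
  assumes "0 < c"
  shows "(\<Sum>l = 1..<Suc m. real l ^ c * exp (1 - real l)) \<le> 30 * (real c / (9 / 10 * exp 1)) ^ c"
proof -
  let ?b = "(real c / (9 / 10 * exp 1)) ^ c"
  have "(\<Sum>l = 1..<Suc m. real l ^ c * exp (1 - real l)) \<le> (\<Sum>l = 1..<Suc m. (?b * exp 1) * exp (- (real l / 10)))"
  proof (rule sum_mono)
    fix l
    have "real l ^ c * exp (1 - real l) \<le> (?b * exp (9 / 10 * real l)) * exp (1 - real l)"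
      using power_le_exp[OF assms] by (intro mult_right_mono) auto
    also have "\<dots> = ?b * exp (9 / 10 * real l + (1 - real l))" by (simp only: exp_add mult.assoc)
    also have "9 / 10 * real l + (1 - real l) = 1 + - (real l / 10)" by simp
    finally show "real l ^ c * exp (1 - real l) \<le> (?b * exp 1) * exp (- (real l / 10))" by (simp only: exp_add mult.assoc)
  qed
  also have "\<dots> = (?b * exp 1) * (\<Sum>l = 1..<Suc m. exp (- (real l / 10)))" by (simp only: sum_distrib_left)
  also have "\<dots> \<le> (?b * exp 1) * 10"
  proof (rule mult_left_mono)
    show "(\<Sum>l = 1..<Suc m. exp (- (real l / 10))) \<le> 10" by (rule order_trans[OF sum_exp_tenth]) simp
  qed auto
  also have "\<dots> \<le> (?b * 3) * 10" using exp_le by (intro mult_right_mono mult_left_mono) auto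
  finally show ?thesis by simp
qed

lemma sum_list_map_concat: "(\<Sum>x\<leftarrow>concat xss. f x) = (\<Sum>xs\<leftarrow>xss. \<Sum>x\<leftarrow>xs. f x)"
  by (induction xss) auto

context family
begin

definition kap :: nat where "kap = M * v + F"
text \<open>The growth per target position: \<open>kap\<close> bounds the choices per unit of l, and
  the remaining factor comes from summing over the unknown span lengths.\<close>

definition xx :: real where "xx = real kap * real A / (9 / 10 * exp 1)"

text \<open>A potential function for the number of descendants of a record. A step with a span of l blocks has
  at most \<open>2 * (l * kap)^A\<close> children, and \<open>l^A\<close> is at most \<open>(A / (0.9 * e))^A * exp (0.9 * l)\<close>;
  so the factor \<open>exp (K - \<sigma>)\<close> makes the sum over all l converge.\<close>

definition weight :: "rec \<Rightarrow> real" where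
  "weight \<rho> = 70 ^ (fst \<rho> div A + fst \<rho> mod A) * xx ^ fst \<rho> * exp (real (K - fst (snd \<rho>)))"

lemma xx_ge: "1 \<le> xx"
proof -
  have "1 \<le> kap" using F_pos by (simp add: kap_def)
  then have "1 * 20 \<le> real kap * real A" by (intro mult_mono) (auto simp: A_def)
  moreover have "9 / 10 * exp 1 \<le> (20::real)" using exp_le by simp
  ultimately show ?thesis by (simp add: xx_def field_simps)
qed

lemma weight_ge: "1 \<le> weight \<rho>"
proof -
  have "1 * 1 * 1 \<le> weight \<rho>" unfolding weight_def using xx_ge by (intro mult_mono one_le_power) auto
  then show ?thesis by simp
qed

lemma length_kids_long:
  assumes "A \<le> r" "1 \<le> l" shows "real (length (kids (r, \<sigma>, ps) l)) \<le> 2 * (real l * real kap) ^ A"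
proof -
  have lMv: "1 \<le> l * M * v" using assms(2) M_pos v by simp
  have Fl: "F \<le> l * F" using assms(2) by simp
  have "pmod (l * M * v) \<le> l * kap" using le_trans[OF pmod_le[OF lMv] add_left_mono[OF Fl]] by (simp add: kap_def distrib_left mult.assoc)
  then have 1: "pmod (l * M * v) ^ A \<le> (l * kap) ^ A" by (rule power_mono) simp
  have "A - 2 + 2 = A" using A_bounds by simp
  then have pw: "y ^ (A - 2) * y\<^sup>2 = y ^ A" for y :: nat by (metis power_add)
  \<comment> \<open>This identity is why M is A^(A - 1): the choices for blocks with a collision
    then number exactly (l * M * v)^A.\<close>
  have A1: "A ^ (A - 2) * A = M"
    unfolding M_def using power_Suc2[of A "A - 2"] A_bounds by (simp add: Suc_diff_Suc numeral_2_eq_2)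
  have "(l * A * M * v) ^ (A - 2) * (A * M * (l * v * (l * v))) =
    (A ^ (A - 2) * A) * ((l * v * M) ^ (A - 2) * (l * v)\<^sup>2 * M)"
    by (simp add: power_mult_distrib power2_eq_square algebra_simps)
  also have "\<dots> = (l * v * M) ^ (A - 2) * (l * v * M)\<^sup>2"
    unfolding A1 by (simp add: power2_eq_square)
  also have "\<dots> = (l * v * M) ^ A" by (rule pw)
  also have "\<dots> \<le> (l * kap) ^ A" by (intro power_mono) (auto simp: kap_def distrib_left)
  finally have 2: "(l * A * M * v) ^ (A - 2) * (A * M * (l * v * (l * v))) \<le> (l * kap) ^ A" .
  have "length (kids (r, \<sigma>, ps) l) = pmod (l * M * v) ^ A + (l * A * M * v) ^ (A - 2) * (A * M * (l * v * (l * v)))"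
    using assms(1) by (simp add: kids.simps length_box box1_def box2_def prod_list_replicate)
  also have "\<dots> \<le> 2 * (l * kap) ^ A" using 1 2 by simp
  finally have "real (length (kids (r, \<sigma>, ps) l)) \<le> real (2 * (l * kap) ^ A)" by (simp only: of_nat_le_iff)
  then show ?thesis by simp
qed

lemma length_kids_short:
  assumes "\<not> A \<le> r" shows "real (length (kids (r, \<sigma>, ps) l)) \<le> real l * (real kap * real A)"
proof -
  have "length (kids (r, \<sigma>, ps) l) = l * A * M * v" using assms by (simp add: kids.simps length_box box3_def)
  also have "\<dots> \<le> l * (kap * A)" by (simp add: kap_def algebra_simps)
  finally have "real (length (kids (r, \<sigma>, ps) l)) \<le> real (l * (kap * A))" by (simp only: of_nat_le_iff)
  then show ?thesis by simp
qed

lemma sum_kidsall: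
  assumes c: "0 < c" and r: "r \<noteq> 0" and \<sigma>: "\<sigma> < K"
    and len: "\<And>l. 1 \<le> l \<Longrightarrow> real (length (kids (r, \<sigma>, ps) l)) \<le> B * real l ^ c"
    and kid: "\<And>l \<rho>. \<rho> \<in> set (kids (r, \<sigma>, ps) l) \<Longrightarrow> fst \<rho> = r' \<and> fst (snd \<rho>) = \<sigma> + l - 1" and B: "0 \<le> B"
    and W: "W = 70 ^ (r' div A + r' mod A) * xx ^ r'"
  shows "(\<Sum>\<rho>\<leftarrow>kidsall (r, \<sigma>, ps). weight \<rho>) \<le> 30 * B * (real c / (9 / 10 * exp 1)) ^ c * W * exp (real (K - \<sigma>))"
proof -
  have W0: "0 \<le> W" using xx_ge by (simp add: W)
  have kw: "(\<Sum>\<rho>\<leftarrow>kids (r, \<sigma>, ps) l. weight \<rho>) = real (length (kids (r, \<sigma>, ps) l)) * (W * exp (real (K - \<sigma>)) * exp (1 - real l))"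
    if l: "1 \<le> l" "l < Suc (K - \<sigma>)" for l
  proof -
    have "weight \<rho> = W * exp (real (K - \<sigma>)) * exp (1 - real l)" if "\<rho> \<in> set (kids (r, \<sigma>, ps) l)" for \<rho>
    proof -
      \<comment> \<open>Only l - 1 blocks are used up by a span of l, whence the factor exp (1 -
        l).\<close>
      have "real (K - (\<sigma> + l - 1)) = real (K - \<sigma>) + (1 - real l)" using l \<sigma> by (simp add: of_nat_diff)
      then show ?thesis using kid[OF that] by (simp only: weight_def W exp_add mult.assoc)
    qed
    then have "map weight (kids (r, \<sigma>, ps) l) = map (\<lambda>_. W * exp (real (K - \<sigma>)) * exp (1 - real l)) (kids (r, \<sigma>, ps) l)"
      by (rule map_cong[OF refl])
    then show ?thesis by (simp only: sum_list_triv)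
  qed
  have "(\<Sum>\<rho>\<leftarrow>kidsall (r, \<sigma>, ps). weight \<rho>) = (\<Sum>l = 1..<Suc (K - \<sigma>). \<Sum>\<rho>\<leftarrow>kids (r, \<sigma>, ps) l. weight \<rho>)"
    unfolding kidsall_eq[OF r] by (simp add: sum_list_map_concat comp_def sum_set_upt_conv_sum_list_nat[symmetric] del: upt_Suc)
  also have "\<dots> = (\<Sum>l = 1..<Suc (K - \<sigma>). real (length (kids (r, \<sigma>, ps) l)) * (W * exp (real (K - \<sigma>)) * exp (1 - real l)))"
    by (intro sum.cong refl kw) auto
  also have "\<dots> \<le> (\<Sum>l = 1..<Suc (K - \<sigma>). (B * real l ^ c) * (W * exp (real (K - \<sigma>)) * exp (1 - real l)))"
    using W0 len by (intro sum_mono mult_right_mono) auto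
  also have "\<dots> = (B * W * exp (real (K - \<sigma>))) * (\<Sum>l = 1..<Suc (K - \<sigma>). real l ^ c * exp (1 - real l))"
    by (simp add: sum_distrib_left algebra_simps)
  also have "\<dots> \<le> (B * W * exp (real (K - \<sigma>))) * (30 * (real c / (9 / 10 * exp 1)) ^ c)"
    using W0 B by (intro mult_left_mono sum_power_exp[OF c]) auto
  finally show ?thesis by (simp add: mult_ac)
qed

text \<open>A group multiplies by 2 for the two kinds of block and 30 for the sum over l. With 60
  replaced by 70, the children get at most 6 / 7 of the parent's weight; the remaining seventh, at
  least 10, pays for the summand 1.\<close>

lemma weight_step:
  assumes "good \<rho>" shows "1 + (\<Sum>c\<leftarrow>kidsall \<rho>. weight c) \<le> weight \<rho>"
proof -
  obtain r \<sigma> ps where \<rho>: "\<rho> = (r, \<sigma>, ps)" by (cases \<rho>)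
  show ?thesis
  proof (cases "r = 0")
    case True
    then show ?thesis using weight_ge[of \<rho>] by (simp add: \<rho> kidsall.simps)
  next
    case False
    have \<sigma>: "\<sigma> < K" using assms by (simp add: \<rho>)
    have A0: "0 < A" using A_bounds by simp
    have big: "7 * 10 \<le> weight \<rho>"
    proof -
      have "1 \<le> r div A + r mod A"
      proof (rule ccontr)
        assume "\<not> 1 \<le> r div A + r mod A"
        then have "r div A = 0" "r mod A = 0" by auto
        then show False using False div_mult_mod_eq[of r A] by simp
      qed
      then have "(70::real) ^ 1 \<le> 70 ^ (r div A + r mod A)" by (intro power_increasing) auto
      then have "70 * 1 * 1 \<le> weight \<rho>" unfolding weight_def \<rho> using xx_ge by (intro mult_mono one_le_power) auto
      then show ?thesis by simp
    qed
    have "(\<Sum>c\<leftarrow>kidsall \<rho>. weight c) \<le> 6 / 7 * weight \<rho>"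
    proof (cases "A \<le> r")
      case True
      let ?W = "70 ^ ((r - A) div A + (r - A) mod A) * xx ^ (r - A)"
      have "(\<Sum>c\<leftarrow>kidsall (r, \<sigma>, ps). weight c) \<le> 30 * (2 * real kap ^ A) * (real A / (9 / 10 * exp 1)) ^ A * ?W * exp (real (K - \<sigma>))"
      proof (rule sum_kidsall[OF A0 False \<sigma>])
        fix l :: nat assume "1 \<le> l"
        from length_kids_long[OF True this, of \<sigma> ps] show "real (length (kids (r, \<sigma>, ps) l)) \<le> 2 * real kap ^ A * real l ^ A"
          by (simp only: power_mult_distrib mult_ac)
      next
        fix l \<rho>' assume "\<rho>' \<in> set (kids (r, \<sigma>, ps) l)"
        then show "fst \<rho>' = r - A \<and> fst (snd \<rho>') = \<sigma> + l - 1" using True by (auto simp: kids.simps)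
      qed auto
      also have "30 * (2 * real kap ^ A) * (real A / (9 / 10 * exp 1)) ^ A * ?W = 6 / 7 * (70 * 70 ^ ((r - A) div A + (r - A) mod A)) * (xx ^ A * xx ^ (r - A))"
        unfolding xx_def by (simp add: power_divide power_mult_distrib)
      also have "xx ^ A * xx ^ (r - A) = xx ^ r" using True by (simp add: power_add[symmetric])
      also have "70 * 70 ^ ((r - A) div A + (r - A) mod A) = (70::real) ^ (r div A + r mod A)"
        using True A0 by (simp add: le_div_geq le_mod_geq)
      finally show ?thesis by (simp add: \<rho> weight_def mult.assoc)
    next
      case nA: False
      let ?W = "70 ^ ((r - 1) div A + (r - 1) mod A) * xx ^ (r - 1)"
      have "(\<Sum>c\<leftarrow>kidsall (r, \<sigma>, ps). weight c) \<le> 30 * (real kap * real A) * (real 1 / (9 / 10 * exp 1)) ^ 1 * ?W * exp (real (K - \<sigma>))"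
      proof (rule sum_kidsall[OF zero_less_one False \<sigma>])
        fix l :: nat assume "1 \<le> l"
        from length_kids_short[OF nA, of \<sigma> ps l] show "real (length (kids (r, \<sigma>, ps) l)) \<le> real kap * real A * real l ^ 1"
          by (simp only: power_one_right mult_ac)
      next
        fix l \<rho>' assume "\<rho>' \<in> set (kids (r, \<sigma>, ps) l)"
        then show "fst \<rho>' = r - 1 \<and> fst (snd \<rho>') = \<sigma> + l - 1" using nA by (auto simp: kids.simps)
      qed auto
      also have "30 * (real kap * real A) * (real 1 / (9 / 10 * exp 1)) ^ 1 * ?W =
         3 / 7 * (70 * 70 ^ ((r - 1) div A + (r - 1) mod A)) * (xx * xx ^ (r - 1))"
        unfolding xx_def by simp
      also have "xx * xx ^ (r - 1) = xx ^ r" using False by (simp add: power_eq_if)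
      also have "70 * 70 ^ ((r - 1) div A + (r - 1) mod A) = (70::real) ^ (r div A + r mod A)"
        using nA False by (simp add: power_eq_if)
      finally have "(\<Sum>c\<leftarrow>kidsall \<rho>. weight c) \<le> 3 / 7 * weight \<rho>" by (simp add: \<rho> weight_def mult.assoc)
      then show ?thesis using big by linarith
    qed
    then show ?thesis using big by linarith
  qed
qed

lemma weight_root: "weight (K, 0, []) = 70 ^ (K div A + K mod A) * (xx * exp 1) ^ K"
  by (simp add: weight_def power_mult_distrib exp_of_nat_mult[symmetric])

end

section \<open>Asymptotics\<close>

text \<open>The induction step is (k / (k + 1))^(k + 1) \<le> 1 / e, from 1 + x \<le> exp x. The
  factor linear in k is harmless, as exponentials in k will absorb it.\<close>

lemma fact_le_stirling: "1 \<le> k \<Longrightarrow> fact k \<le> exp 1 * real k * (real k / exp 1) ^ k"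
proof (induction k rule: nat_induct_at_least)
  case (Suc k)
  let ?q = "real k / real (Suc k)"
  have "?q = 1 + - (1 / real (Suc k))" by (simp add: field_simps)
  also have "\<dots> \<le> exp (- (1 / real (Suc k)))" by (rule exp_ge_add_one_self)
  finally have "?q ^ Suc k \<le> exp (- (1 / real (Suc k))) ^ Suc k" by (intro power_mono) auto
  also have "\<dots> = exp (real (Suc k) * - (1 / real (Suc k)))" by (simp only: exp_of_nat_mult)
  also have "real (Suc k) * - (1 / real (Suc k)) = - 1" by simp
  also have "exp (- 1) = 1 / exp (1::real)" by (simp add: exp_minus inverse_eq_divide)
  finally have q: "real k ^ Suc k / real (Suc k) ^ Suc k \<le> 1 / exp 1" by (simp only: power_divide)
  define X where "X = real (Suc k) ^ Suc k"
  have "0 < X" by (simp add: X_def)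
  then have "real k ^ Suc k \<le> 1 / exp 1 * X" using q unfolding X_def[symmetric] by (simp only: pos_divide_le_eq)
  then have "real k ^ Suc k * exp 1 \<le> 1 / exp 1 * X * exp 1" by (rule mult_right_mono) simp
  also have "1 / exp 1 * X * exp 1 = X" by simp
  finally have *: "real k ^ Suc k * exp 1 \<le> real (Suc k) ^ Suc k" by (simp only: X_def)
  have "fact (Suc k) \<le> real (Suc k) * (exp 1 * real k * (real k / exp 1) ^ k)"
    using Suc by (simp only: fact_Suc of_nat_mult of_nat_Suc) (intro mult_left_mono, auto)
  also have "\<dots> = real (Suc k) * (real k ^ Suc k * exp 1) / exp 1 ^ k" by (simp add: power_divide)
  also have "\<dots> \<le> real (Suc k) * real (Suc k) ^ Suc k / exp 1 ^ k"
    using * by (intro divide_right_mono mult_left_mono) auto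
  also have "\<dots> = exp 1 * real (Suc k) * (real (Suc k) / exp 1) ^ Suc k" by (simp add: power_divide)
  finally show ?case .
qed simp

text \<open>Each factor t - i is at least t * (1 - 1 / 200), hence at least t * exp (- 1 / 100). So
  only one hundredth of the exponent of e^k is lost.\<close>

lemma binomial_lower:
  assumes k: "1 \<le> k" and t: "200 * k \<le> t"
  shows "(real t / real k) ^ k * exp (99 / 100 * real k) \<le> 3 * real k * real (t choose k)"
proof -
  have t0: "0 < t" using assms by simp
  have "fact k * real (t choose k) = (\<Prod>i = 0..<k. real (t - i))"
    using t k by (simp add: binomial_altdef_of_nat prod_dividef fact_prod_rev)
  also have "\<dots> \<ge> (\<Prod>i = 0..<k. real t * exp (- (1 / 100)))"
  proof (rule prod_mono, intro conjI)
    fix i assume "i \<in> {0..<k}"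
    have "exp (- (1 / 100 :: real)) \<le> 1 - 1 / 200"
    proof -
      have "101 / 100 \<le> exp (1 / 100 :: real)" using exp_ge_add_one_self[of "1 / 100 :: real"] by simp
      then show ?thesis by (simp add: exp_minus field_simps)
    qed
    then have "real t * exp (- (1 / 100)) \<le> real t * (1 - 1 / 200)" by (intro mult_left_mono) auto
    also have "\<dots> \<le> real t - real i" using t \<open>i \<in> {0..<k}\<close> by simp
    finally show "real t * exp (- (1 / 100)) \<le> real (t - i)" using t \<open>i \<in> {0..<k}\<close> by simp
  qed simp
  finally have 1: "real t ^ k * exp (- (real k / 100)) \<le> fact k * real (t choose k)"
    by (simp add: power_mult_distrib exp_of_nat_mult[symmetric])
  have "fact k \<le> 3 * real k * (real k / exp 1) ^ k"
    by (rule order_trans[OF fact_le_stirling[OF k]]) (use exp_le in \<open>auto intro!: mult_right_mono\<close>)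
  then have "real t ^ k * exp (- (real k / 100)) \<le> 3 * real k * (real k / exp 1) ^ k * real (t choose k)"
    by (intro order_trans[OF 1] mult_right_mono) auto
  also have "\<dots> = 3 * real k * real (t choose k) * real k ^ k * exp (- real k)"
    by (simp add: power_divide exp_of_nat_mult[symmetric] exp_minus field_simps)
  finally have "real t ^ k * exp (- (real k / 100)) * exp (real k) \<le>
     3 * real k * real (t choose k) * real k ^ k * (exp (- real k) * exp (real k))"
    by (simp only: mult.assoc[symmetric]) (intro mult_right_mono, auto)
  also have "exp (- real k) * exp (real k) = 1" by (simp add: exp_minus)
  also have "real t ^ k * exp (- (real k / 100)) * exp (real k) = real t ^ k * exp (99 / 100 * real k)"
    by (simp add: exp_add[symmetric] mult.assoc)
  finally show ?thesis using k by (simp add: power_divide field_simps)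
qed

lemma (in learning) gen_rho: "\<rho>o = K * A * M * (n + 1)"
proof -
  have "replicate n 0 \<in> cube n" by (auto simp: cube_def)
  then interpret gen "replicate n 0" \<beta> \<eta> n K v Nmax by (rule gen)
  show ?thesis by (rule rho_def)
qed

text \<open>What holds for all but finitely many n. In \<open>c0\<close> the power of 70 is for the
  at most 19 positions outside full groups, the 2 for rounding up. \<open>kt\<close> makes the
  additive constants at most 1 / 200 of t / k, \<open>tn\<close> makes the rounding of cells at most
  the main term, and \<open>len_n\<close> carries log log n = o(k).\<close>

locale large = learning n K v k0 t0 \<beta> Nmax \<tau>k \<tau>t ck ct mk mt "family.weight K v"
  for n K v k0 t0 \<beta> Nmax \<tau>k \<tau>t :: nat and ck ct :: com and mk mt :: mem +
  fixes c0 :: real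
  assumes c0: "c0 = 2 * 70 ^ 20"
    and N_def: "Nmax = nat \<lceil>weight (K, 0, [])\<rceil>"
    and \<beta>_def: "\<beta> = 11 + len k0 + len t0 +
      len (32 * (C + n + F + A * M + (Nmax + 1) * (K * A * M * (n + 1) + 2) * (K * A * M * (n + 1) + 2)))"
    and k_const: "160 + F + A * M + nat \<lceil>c0\<rceil> \<le> k0"
    and k_exp: "(3 * c0 + 52) * real k0 \<le> exp (9 / 1000 * real k0)"
    and kt: "200 * (A * (M + F)) * k0 \<le> t0"
    and tn: "M * t0 \<le> n"
    and len_n: "real (len n) \<le> 2 * exp (real k0 / 1000)"
begin

abbreviation k :: real where "k \<equiv> real k0"
abbreviation t :: real where "t \<equiv> real t0"

lemma k_pos: "160 \<le> k0" using k_const by simp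

lemma K_eq: "K = k0" using Kv(1) k_pos by simp

lemma kt200: "200 * k0 \<le> t0"
proof -
  have "1 \<le> A * (M + F)" using A_bounds M_pos by simp
  then have "200 * 1 * k0 \<le> 200 * (A * (M + F)) * k0" by (intro mult_le_mono) auto
  from le_trans[OF this kt] show ?thesis by simp
qed

lemma t_pos: "160 \<le> t0" using k_pos kt200 by simp

lemma t_le_n: "t0 \<le> n"
  using le_trans[OF mult_le_mono1[of 1 M t0] tn] M_pos by simp

lemma k_le_n: "k0 \<le> n" using kt200 t_le_n by simp

lemma tk1: "1 \<le> t / k" using kt200 k_pos by simp

lemma v_bounds: "real A * real M * real v \<le> t / k + real A * real M" "t / k \<le> real A * real M * real v"
proof -
  have AM: "0 < A * M" using A_bounds M_pos by simp
  let ?X = "k0 * (A * M)"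
  have X: "0 < ?X" using k_pos AM by simp
  have ve: "v = (t0 + ?X - 1) div ?X" using Kv(2) t_pos by (simp add: K_eq)
  have "v * ?X \<le> t0 + ?X - 1" unfolding ve by (rule div_times_less_eq_dividend)
  then have 1: "v * ?X \<le> t0 + ?X" by linarith
  have "t0 + ?X - 1 < Suc v * ?X" unfolding ve using dividend_less_div_times[OF X] by (simp add: add.commute)
  then have 2: "t0 \<le> v * ?X" by simp
  have "real (v * ?X) \<le> real (t0 + ?X)" "real t0 \<le> real (v * ?X)" using 1 2 by (simp_all only: of_nat_le_iff)
  then show "real A * real M * real v \<le> t / k + real A * real M" "t / k \<le> real A * real M * real v"
    using k_pos by (simp_all add: field_simps)
qed

text \<open>The exponent 3 / 8 is 1 / 8 + 1 / 4: per position 1.005 / 0.9 is below 9 / 8, and 70 per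
  group of 20 is at most exp 5.\<close>

lemma N_le: "real Nmax \<le> c0 * exp (3 / 8 * k) * (t / k) ^ k0"
proof -
  have "real kap * real A = real A * real M * real v + real A * real F" by (simp add: kap_def algebra_simps)
  also have "\<dots> \<le> t / k + real A * (real M + real F)" using v_bounds(1) by (simp add: algebra_simps)
  also have "\<dots> \<le> t / k * (1 + 1 / 200)"
  proof -
    have "real (200 * (A * (M + F)) * k0) \<le> t" using kt by (simp only: of_nat_le_iff)
    then have "(real A * (real M + real F)) * (200 * k) \<le> t" by (simp add: mult_ac)
    then have "real A * (real M + real F) \<le> t / (200 * k)" using k_pos by (subst pos_le_divide_eq) auto
    also have "t / (200 * k) = t / k * (1 / 200)" by simp
    finally show ?thesis unfolding distrib_left mult_1_right by linarith
  qed
  finally have "xx * exp 1 \<le> t / k * ((1 + 1 / 200) / (9 / 10))" by (simp add: xx_def)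
  also have "(1 + 1 / 200) / (9 / 10) \<le> exp (1 / 8 :: real)" using exp_ge_add_one_self[of "1 / 8 :: real"] by simp
  then have "t / k * ((1 + 1 / 200) / (9 / 10)) \<le> t / k * exp (1 / 8)" by (intro mult_left_mono) auto
  finally have "(xx * exp 1) ^ k0 \<le> (t / k * exp (1 / 8)) ^ k0" using xx_ge by (intro power_mono) auto
  also have "\<dots> = (t / k) ^ k0 * exp (k / 8)" by (simp only: power_mult_distrib exp_of_nat_mult[symmetric]) simp
  finally have x: "(xx * exp 1) ^ k0 \<le> (t / k) ^ k0 * exp (k / 8)" .
  have e5: "70 \<le> exp (5 :: real)"
  proof -
    have "5 / 2 \<le> exp (1 :: real)" using exp_lower_Taylor_quadratic[of 1] by simp
    then have "(5 / 2) ^ 5 \<le> exp (1 :: real) ^ 5" by (intro power_mono) auto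
    moreover have "70 \<le> (5 / 2 :: real) ^ 5" by (simp add: power_divide)
    moreover have "exp (1 :: real) ^ 5 = exp 5" by (simp add: exp_of_nat_mult[symmetric])
    ultimately show ?thesis by linarith
  qed
  have "(70::real) ^ (k0 div A) \<le> exp 5 ^ (k0 div A)" using e5 by (intro power_mono) auto
  also have "\<dots> = exp (real (k0 div A) * 5)" by (simp add: exp_of_nat_mult)
  also have "\<dots> \<le> exp (k / 4)"
  proof -
    have "k0 div A * 20 \<le> k0" unfolding A_def by (rule div_times_less_eq_dividend)
    then have "real (k0 div A) * 20 \<le> k" by (metis of_nat_le_iff of_nat_mult of_nat_numeral)
    then show ?thesis by simp
  qed
  finally have p70: "(70::real) ^ (k0 div A) * 70 ^ (k0 mod A) \<le> exp (k / 4) * 70 ^ 20"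
    by (intro mult_mono power_increasing) (auto simp: A_def intro: less_imp_le)
  have "weight (K, 0, []) \<le> (exp (k / 4) * 70 ^ 20) * ((t / k) ^ k0 * exp (k / 8))"
    unfolding weight_root unfolding K_eq power_add using xx_ge by (intro mult_mono[OF p70 x]) auto
  also have "\<dots> = 70 ^ 20 * (exp (k / 4) * exp (k / 8)) * (t / k) ^ k0" by (simp only: mult_ac)
  also have "exp (k / 4) * exp (k / 8) = exp (3 / 8 * k)" by (simp add: exp_add[symmetric])
  finally have w: "weight (K, 0, []) \<le> 70 ^ 20 * exp (3 / 8 * k) * (t / k) ^ k0" .
  have "real Nmax \<le> weight (K, 0, []) + 1" unfolding N_def using weight_ge[of "(K, 0, [])"] by linarith
  also have "\<dots> \<le> 2 * weight (K, 0, [])" using weight_ge[of "(K, 0, [])"] by simp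
  also have "\<dots> \<le> 2 * (70 ^ 20 * exp (3 / 8 * k) * (t / k) ^ k0)" using w by (rule mult_left_mono) simp
  finally show ?thesis by (simp only: c0 mult.assoc)
qed

text \<open>A crude bound, sufficient for counting digits: Nmax has O(k log n) of them.\<close>

lemma N_le_power: "Nmax + 1 \<le> n ^ (k0 + 1)"
proof -
  have n0: "0 < n" using k_le_n k_pos by simp
  have "exp (3 / 8 :: real) \<le> 3" by (rule order_trans[OF _ exp_le]) simp
  then have "exp (3 / 8) * (t / k) \<le> 3 * (t / k)" by (intro mult_right_mono) auto
  also have "\<dots> \<le> t" using k_pos mult_right_mono[of 3 k t] by (simp add: divide_le_eq mult.commute)
  also have "\<dots> \<le> real n" using t_le_n by simp
  finally have "(exp (3 / 8) * (t / k)) ^ k0 \<le> real n ^ k0" by (intro power_mono) auto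
  moreover have "(exp (3 / 8) * (t / k)) ^ k0 = exp (3 / 8 * k) * (t / k) ^ k0"
    by (simp only: power_mult_distrib exp_of_nat_mult[symmetric] mult.commute)
  ultimately have p: "exp (3 / 8 * k) * (t / k) ^ k0 \<le> real n ^ k0" by simp
  have "real Nmax \<le> c0 * (exp (3 / 8 * k) * (t / k) ^ k0)" using N_le by (simp only: mult.assoc)
  also have "\<dots> \<le> c0 * real n ^ k0" using p by (intro mult_left_mono) (auto simp: c0)
  also have "\<dots> \<le> real (nat \<lceil>c0\<rceil>) * real n ^ k0" by (intro mult_right_mono real_nat_ceiling_ge) auto
  finally have "real Nmax \<le> real (nat \<lceil>c0\<rceil> * n ^ k0)" by simp
  then have "Nmax \<le> nat \<lceil>c0\<rceil> * n ^ k0" by (simp only: of_nat_le_iff)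
  moreover have "1 \<le> n ^ k0" using n0 by simp
  ultimately have "Nmax + 1 \<le> (nat \<lceil>c0\<rceil> + 1) * n ^ k0" by simp
  also have "\<dots> \<le> n * n ^ k0" using k_const k_le_n by (intro mult_le_mono1) simp
  finally show ?thesis by simp
qed

lemma v_le: "v \<le> t0"
proof -
  have AM: "1 \<le> A * M" using A_bounds M_pos by simp
  have "real A * real M * real v \<le> t / k + real (A * M)" using v_bounds(1) by simp
  also have "t / k \<le> t / 160" using k_pos by (intro divide_left_mono) auto
  also have "t / 160 + real (A * M) \<le> real (A * M) * (t / 160 + 1)"
  proof -
    have "1 * (t / 160) \<le> real (A * M) * (t / 160)" using of_nat_mono[OF AM, where 'a = real] by (intro mult_right_mono) auto
    then show ?thesis by (simp only: distrib_left mult_1_right mult_1)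
  qed
  finally have "real (A * M) * real v \<le> real (A * M) * (t / 160 + 1)" by simp
  then have "real v \<le> t / 160 + 1" using AM by (subst (asm) mult_le_cancel_left_pos) auto
  then show ?thesis using t_pos by simp
qed

text \<open>All indices are below n^(k + 12), so \<beta> is O(k * len n). Here the assumption on log
  log n is used: with len n at most 2 * exp (k / 1000), this disappears in exp (k / 100).\<close>

lemma beta_le: "real \<beta> \<le> exp (k / 100)"
proof -
  have n160: "160 \<le> n" using k_le_n k_pos by simp
  have c: "F \<le> n" "A * M \<le> n" using k_const k_le_n by auto
  have Mn: "M \<le> n" using le_trans[OF mult_le_mono2[of 1 t0 M] tn] t_pos by simp
  have vn: "v \<le> n" using v_le t_le_n by simp
  let ?P = "n ^ (k0 + 11)"
  have pw: "n ^ j \<le> ?P" if "j \<le> 11" for j using n160 that by (intro power_increasing) auto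
  have C: "C \<le> ?P"
  proof -
    have "C = K * (A * M) * M * v" by (simp add: C_def L_def mult.assoc)
    also have "\<dots> \<le> n * n * n * n" using k_le_n K_eq by (intro mult_le_mono c Mn vn) simp
    also have "\<dots> = n ^ 4" by (simp add: power4_eq_xxxx)
    finally show ?thesis using pw[of 4] by simp
  qed
  have R: "K * A * M * (n + 1) + 2 \<le> n ^ 5"
  proof -
    have "K * A * M * (n + 1) = k0 * (A * M) * (n + 1)" by (simp add: K_eq mult.assoc)
    also have "\<dots> \<le> n * n * (2 * n)" using n160 by (intro mult_le_mono k_le_n c) auto
    finally have "K * A * M * (n + 1) + 2 \<le> n * n * (2 * n) + n * n * n" using n160 le_trans[of 2 n "n * n * n"] by simp
    also have "\<dots> = 3 * n ^ 3" by (simp add: power3_eq_cube)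
    also have "\<dots> \<le> n ^ 2 * n ^ 3" using n160 le_trans[of 3 n "n ^ 2"] by (intro mult_le_mono1) (simp add: power2_eq_square)
    also have "\<dots> = n ^ 5" by (simp add: power_add[symmetric])
    finally show ?thesis .
  qed
  have "(Nmax + 1) * (K * A * M * (n + 1) + 2) * (K * A * M * (n + 1) + 2) \<le> n ^ (k0 + 1) * n ^ 5 * n ^ 5"
    by (intro mult_le_mono N_le_power R)
  also have "\<dots> = n ^ (k0 + 1 + 5 + 5)" by (simp only: power_add)
  also have "k0 + 1 + 5 + 5 = k0 + 11" by simp
  finally have NR: "(Nmax + 1) * (K * A * M * (n + 1) + 2) * (K * A * M * (n + 1) + 2) \<le> ?P" .
  let ?B = "32 * (C + n + F + A * M + (Nmax + 1) * (K * A * M * (n + 1) + 2) * (K * A * M * (n + 1) + 2))"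
  have "n \<le> ?P" using pw[of 1] by simp
  then have "?B \<le> 32 * (?P + ?P + ?P + ?P + ?P)"
    using c by (intro mult_le_mono2 add_mono C NR) auto
  also have "\<dots> = 160 * ?P" by simp
  also have "\<dots> \<le> n * ?P" using n160 by (rule mult_le_mono1)
  also have "\<dots> = n ^ Suc (k0 + 11)" by (rule power_Suc[symmetric])
  also have "Suc (k0 + 11) = k0 + 12" by simp
  finally have "?B \<le> n ^ (k0 + 12)" .
  also have "n ^ (k0 + 12) < (2 ^ len n) ^ (k0 + 12)" using less_two_power_len[of n] by (intro power_strict_mono) auto
  also have "\<dots> = 2 ^ (len n * (k0 + 12))" by (simp only: power_mult)
  finally have "len ?B \<le> len n * (k0 + 12)" using len_pos[of n] by (intro len_le) auto
  moreover have "len k0 \<le> len n" "len t0 \<le> len n" using k_le_n t_le_n by (auto intro: len_mono)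
  ultimately have "\<beta> \<le> 11 + len n + len n + len n * (k0 + 12)" unfolding \<beta>_def by linarith
  also have "\<dots> \<le> len n * (k0 + 25)" using len_pos[of n] by (simp add: distrib_left)
  also have "\<dots> \<le> len n * (2 * k0)" using k_pos by (intro mult_le_mono2) simp
  finally have "real \<beta> \<le> real (len n * (2 * k0))" by (simp only: of_nat_le_iff)
  also have "\<dots> = real (len n) * (2 * k)" by simp
  also have "\<dots> \<le> (2 * exp (k / 1000)) * (2 * k)" using len_n by (intro mult_right_mono) auto
  also have "\<dots> = exp (k / 1000) * (4 * k)" by simp
  also have "\<dots> \<le> exp (k / 1000) * exp (9 / 1000 * k)"
  proof (intro mult_left_mono order_trans[OF _ k_exp])
    have "0 \<le> c0" by (simp add: c0)
    then show "4 * k \<le> (3 * c0 + 52) * k" by (intro mult_right_mono) auto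
  qed auto
  also have "\<dots> = exp (k / 100)" by (simp add: exp_add[symmetric])
  finally show ?thesis .
qed

section \<open>Comparison with the binomial coefficient\<close>

definition Z :: real where "Z = exp (- k / 4.01) * real (t0 choose k0)"
definition g :: real where "g = k * real n / t"

text \<open>99 / 100 - 1 / 4.01 exceeds 7 / 10. Against the 3 / 8 of \<open>N_le\<close> this leaves
  room for every factor subexponential in k and for the numbers' lengths.\<close>

lemma Z_ge: "(t / k) ^ k0 * exp (7 / 10 * k) \<le> (3 * k) * Z"
proof -
  have "(t / k) ^ k0 * exp (7 / 10 * k) \<le> (t / k) ^ k0 * exp (99 / 100 * k + - k / 4.01)"
    by (intro mult_left_mono) auto
  also have "\<dots> = ((t / k) ^ k0 * exp (99 / 100 * k)) * exp (- k / 4.01)" by (simp only: exp_add mult.assoc)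
  also have "\<dots> \<le> (3 * k * real (t0 choose k0)) * exp (- k / 4.01)"
    using k_pos kt200 by (intro mult_right_mono binomial_lower) auto
  finally show ?thesis by (simp only: Z_def mult_ac)
qed

lemma k_small: "c0 * (3 * k) \<le> exp (k / 100)" "3 * k \<le> exp (k / 100)" "k \<le> exp (k / 100)"
proof -
  have e: "exp (9 / 1000 * k) \<le> exp (k / 100)" by simp
  have c: "0 \<le> c0" by (simp add: c0)
  have "c0 * (3 * k) \<le> (3 * c0 + 52) * k" "3 * k \<le> (3 * c0 + 52) * k" "k \<le> (3 * c0 + 52) * k"
    using c k_pos mult_right_mono[of 3 "3 * c0 + 52" k] mult_right_mono[of 1 "3 * c0 + 52" k] by (auto simp: algebra_simps)
  then show "c0 * (3 * k) \<le> exp (k / 100)" "3 * k \<le> exp (k / 100)" "k \<le> exp (k / 100)"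
    using k_exp e by linarith+
qed

text \<open>The exponents 3 / 8 + 1 / 100 + 1 / 100 stay below 7 / 10; so even multiplied by \<beta>
  the family remains within the allowed size.\<close>

lemma N_beta: "real Nmax * real \<beta> \<le> Z"
proof -
  have tk: "0 \<le> (t / k) ^ k0" by simp
  have "(3 * k) * (real Nmax * real \<beta>) \<le> (3 * k) * ((c0 * exp (3 / 8 * k) * (t / k) ^ k0) * exp (k / 100))"
    by (intro mult_left_mono mult_mono N_le beta_le) (auto simp: c0)
  also have "\<dots> = (c0 * (3 * k)) * (exp (3 / 8 * k) * exp (k / 100)) * (t / k) ^ k0" by (simp only: mult_ac)
  also have "\<dots> \<le> exp (k / 100) * (exp (3 / 8 * k) * exp (k / 100)) * (t / k) ^ k0"
    using k_small(1) tk by (intro mult_right_mono) auto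
  also have "\<dots> = (t / k) ^ k0 * exp (k / 100 + (3 / 8 * k + k / 100))" by (simp only: exp_add mult_ac)
  also have "\<dots> \<le> (t / k) ^ k0 * exp (7 / 10 * k)" using tk by (intro mult_left_mono) auto
  also have "\<dots> \<le> (3 * k) * Z" by (rule Z_ge)
  finally show ?thesis using k_pos by (subst (asm) mult_le_cancel_left_pos) auto
qed

lemma beta_k: "real \<beta> * k \<le> exp (k / 2)"
proof -
  have "real \<beta> * k \<le> exp (k / 100) * exp (k / 100)" by (intro mult_mono beta_le k_small) auto
  also have "\<dots> \<le> exp (k / 2)" by (simp add: exp_add[symmetric])
  finally show ?thesis .
qed

text \<open>For costs not proportional to the number of experts, such as computing k and t in time
  O(n^2): since n = (t / k) * g, the square (t / k)^2 has to be absorbed. This works as k is at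
  least 2.\<close>

lemma Z_square: "exp (k / 2) * (t / k)\<^sup>2 \<le> Z"
proof -
  have "(t / k)\<^sup>2 \<le> (t / k) ^ k0" using tk1 k_pos by (intro power_increasing) auto
  then have "(3 * k) * (exp (k / 2) * (t / k)\<^sup>2) \<le> exp (k / 100) * (exp (k / 2) * (t / k) ^ k0)"
    by (intro mult_mono k_small) auto
  also have "\<dots> = (t / k) ^ k0 * exp (k / 100 + k / 2)" by (simp only: exp_add mult_ac)
  also have "\<dots> \<le> (t / k) ^ k0 * exp (7 / 10 * k)" by (intro mult_left_mono) auto
  also have "\<dots> \<le> (3 * k) * Z" by (rule Z_ge)
  finally show ?thesis using k_pos by (subst (asm) mult_le_cancel_left_pos) auto
qed

lemma N_choose: "real Nmax \<le> real (t0 choose k0)"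
proof -
  have "real Nmax * 1 \<le> real Nmax * real \<beta>" using \<beta> by (intro mult_left_mono) auto
  also have "\<dots> \<le> Z" by (rule N_beta)
  also have "\<dots> \<le> 1 * real (t0 choose k0)" unfolding Z_def by (intro mult_right_mono) auto
  finally show ?thesis by simp
qed

text \<open>The average cell gives K * M * n / C = n / (A * M * v), at most kn / t since v is
  rounded up; rounding the size of each of the K * M cells up adds k * M.\<close>

lemma D_le: "real D \<le> g + k * real M"
proof -
  have AMv: "0 < real A * real M * real v" using A_bounds M_pos v by simp
  have tk0: "0 < t / k" using tk1 by linarith
  have "real bc \<le> real n / real C + 1" unfolding bc_def by (simp add: of_nat_div_le_of_nat)
  then have "real D \<le> (real K * real M) * (real n / real C + 1)"
    unfolding D_def of_nat_mult by (intro mult_left_mono) auto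
  also have "\<dots> = real n / (real A * real M * real v) + real K * real M"
    using K M_pos by (simp add: C_def L_def field_simps)
  also have "real n / (real A * real M * real v) \<le> real n / (t / k)"
    using v_bounds(2) mult_pos_pos[OF AMv tk0] by (intro divide_left_mono) auto
  finally show ?thesis using K_eq by (simp add: g_def mult.commute)
qed

lemma g_ge: "k * real M \<le> g" "1 \<le> g"
proof -
  have "real (M * t0) \<le> real n" using tn by (simp only: of_nat_le_iff)
  then have "k * (real M * t) \<le> k * real n" by (intro mult_left_mono) auto
  then show 1: "k * real M \<le> g" using t_pos by (simp add: g_def field_simps)
  have "1 * 1 \<le> k * real M" using k_pos M_pos by (intro mult_mono) auto
  then show "1 \<le> g" using 1 by simp
qed

text \<open>The excess k * M equals g * (M * t / n), and M * t / n tends to 0: this is the o(1) of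
  the theorem.\<close>

lemma mistakes_final: "ereal_of_enat (mistake_bound learner n k0) \<le> ereal (log 2 (real (t0 choose k0)) + g * (1 + real M * (t / real n)))"
proof -
  have "log 2 (real Nmax) \<le> log 2 (real (t0 choose k0))" using N_choose Npos kt200 by (intro log_mono) auto
  moreover have "g * (1 + real M * (t / real n)) = g + k * real M"
    using t_pos t_le_n by (simp add: g_def field_simps)
  ultimately have "log 2 (real Nmax) + real D \<le> log 2 (real (t0 choose k0)) + g * (1 + real M * (t / real n))"
    using D_le by linarith
  then show ?thesis using mistakes_real by (meson ereal_less_eq(3) order_trans)
qed

definition c4 :: real where "c4 = 10 + 7 * real (A * M) + real (A * M * (6 * A + 30) + 7 * A + 86)"
definition c5 :: real where "c5 = 218 + 10 * real (A * M)"
definition c6 :: real where "c6 = 2 * c4 + 380"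

lemma KX_le: "real (KX + 30) \<le> c4 * real D"
proof -
  have 1: "1 * 1 \<le> K * M" using K M_pos by (intro mult_le_mono) auto
  have "bc \<le> D" using mult_le_mono1[OF 1, of bc] by (simp add: D_def)
  moreover have "1 * 1 \<le> K * M * bc" using 1 by (intro mult_le_mono) (auto simp: bc_def)
  then have D1: "1 \<le> D" by (simp add: D_def)
  ultimately have "A * M * (7 * bc) \<le> 7 * (A * M) * D" "A * M * (6 * A + 30) + 7 * A + 86 \<le> (A * M * (6 * A + 30) + 7 * A + 86) * D"
    by simp_all
  then have "KX + 30 \<le> 10 * D + 7 * (A * M) * D + (A * M * (6 * A + 30) + 7 * A + 86) * D"
    unfolding KX_def KB_def D_def[symmetric] distrib_left by linarith
  then have "real (KX + 30) \<le> real (10 * D + 7 * (A * M) * D + (A * M * (6 * A + 30) + 7 * A + 86) * D)"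
    by (simp only: of_nat_le_iff)
  also have "\<dots> = c4 * real D" unfolding c4_def of_nat_add of_nat_mult by (simp add: algebra_simps)
  finally show ?thesis .
qed

lemma D_pos: "1 \<le> D"
proof -
  have "1 * 1 * 1 \<le> K * M * bc" using K M_pos by (intro mult_le_mono) (auto simp: bc_def)
  then show ?thesis by (simp add: D_def)
qed

lemma g_le: "g \<le> k * real n"
proof -
  have "k * real n / t \<le> k * real n / 1" using t_pos by (intro divide_left_mono) auto
  then show ?thesis by (simp add: g_def)
qed

lemma D_le_2g: "real D \<le> 2 * g"
  using D_le g_ge by linarith

lemma vote_term: "real (D * (11 * D + \<eta> + 30) + \<eta> + 50) \<le> 380 * g\<^sup>2"
proof -
  have "D * 1 \<le> D * D" using D_pos by (intro mult_le_mono2) simp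
  then have DD: "D \<le> D * D" by (simp only: mult_1_right)
  have "D * (11 * D + \<eta> + 30) + \<eta> + 50 = 12 * (D * D) + 32 * D + 51"
    by (simp add: \<eta>_def distrib_left)
  then have "D * (11 * D + \<eta> + 30) + \<eta> + 50 \<le> 95 * (D * D)"
    using DD D_pos by linarith
  then have "real (D * (11 * D + \<eta> + 30) + \<eta> + 50) \<le> real (95 * (D * D))" by (simp only: of_nat_le_iff)
  also have "\<dots> = 95 * (real D)\<^sup>2" by (simp add: power2_eq_square)
  also have "\<dots> \<le> 95 * (2 * g)\<^sup>2" using D_le_2g by (intro mult_left_mono power_mono) auto
  finally show ?thesis by (simp add: power_mult_distrib)
qed

lemma steps_le: "real (setup_steps + vote_steps + 1) \<le> c5 * (k * real n) + c6 * (real Nmax * g\<^sup>2)"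
proof -
  have kn: "n \<le> k0 * n" "160 \<le> k0 * n"
    using mult_le_mono1[of 1 k0 n] mult_le_mono[of 160 k0 1 n] k_pos k_le_n by auto
  have Mn: "M \<le> n" using le_trans[OF mult_le_mono2[of 1 t0 M] tn] t_pos by simp
  have An: "A \<le> n" using k_pos k_le_n by (simp add: A_def)
  have vn: "v \<le> n" using v_le t_le_n by simp
  have "10 * K + 5 * v + 10 * M + 5 * A + 5 * n + 100 + 10 + 2 + 1 \<le> 148 * (k0 * n)"
    using kn Mn An vn k_le_n k_pos unfolding K_eq by linarith
  then have 1: "real (10 * K + 5 * v + 10 * M + 5 * A + 5 * n + 100 + 10 + 2 + 1) \<le> real (148 * (k0 * n))"
    by (simp only: of_nat_le_iff)
  have "n + 1 \<le> 2 * n" using k_pos k_le_n by simp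
  then have "K * A * M * (n + 1) \<le> K * A * M * (2 * n)" by (rule mult_le_mono2)
  then have "5 * \<rho>o \<le> 10 * (A * M) * (k0 * n)"
    unfolding gen_rho by (simp add: K_eq mult_ac)
  then have 2: "real (5 * \<rho>o) \<le> real (10 * (A * M) * (k0 * n))" by (simp only: of_nat_le_iff)
  have "real (5 * \<eta> + 25) \<le> 35 * real D" using D_pos by (simp add: \<eta>_def)
  also have "\<dots> \<le> 70 * (k * real n)" using D_le_2g g_le by linarith
  finally have 3: "real (5 * \<eta> + 25) \<le> 70 * (k * real n)" .
  have c40: "0 \<le> c4" unfolding c4_def by simp
  have "real (KX + 30) \<le> c4 * (2 * g)" using KX_le mult_left_mono[OF D_le_2g c40] by linarith
  also have "\<dots> \<le> c4 * (2 * g\<^sup>2)"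
    using c40 g_ge(2) by (intro mult_left_mono) (auto simp: power2_eq_square)
  finally have "real Nmax * (real (KX + 30) + real (D * (11 * D + \<eta> + 30) + \<eta> + 50)) \<le> real Nmax * (c4 * (2 * g\<^sup>2) + 380 * g\<^sup>2)"
    using vote_term by (intro mult_left_mono add_mono) auto
  also have "\<dots> = c6 * (real Nmax * g\<^sup>2)" by (simp add: c6_def algebra_simps)
  finally have 4: "real Nmax * (real (KX + 30) + real (D * (11 * D + \<eta> + 30) + \<eta> + 50)) \<le> c6 * (real Nmax * g\<^sup>2)" .
  have "setup_steps + vote_steps + 1 = (10 * K + 5 * v + 10 * M + 5 * A + 5 * n + 100 + 10 + 2 + 1) + 5 * \<rho>o + (5 * \<eta> + 25) +
     Nmax * ((KX + 30) + (D * (11 * D + \<eta> + 30) + \<eta> + 50))"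
    unfolding setup_steps_def vote_steps_def by (simp only: distrib_left)
  then have "real (setup_steps + vote_steps + 1) = real (10 * K + 5 * v + 10 * M + 5 * A + 5 * n + 100 + 10 + 2 + 1) + real (5 * \<rho>o) +
     real (5 * \<eta> + 25) + real Nmax * (real (KX + 30) + real (D * (11 * D + \<eta> + 30) + \<eta> + 50))"
    by (simp only: of_nat_add of_nat_mult)
  moreover have "real (148 * (k0 * n)) + real (10 * (A * M) * (k0 * n)) + 70 * (k * real n) = c5 * (k * real n)"
    by (simp add: c5_def algebra_simps)
  ultimately show ?thesis using 1 2 3 4 by linarith
qed

lemma n_square: "(real n)\<^sup>2 = (t / k)\<^sup>2 * g\<^sup>2"
  using k_pos t_pos by (simp add: g_def power_divide power_mult_distrib)

text \<open>Three sources of time: Nmax * g^2 for building the family and for the votes, k * n for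
  parameters and short preparations, both multiplied by \<beta>, and n^2 for computing k and t. Each
  is at most a constant times Z * g^2.\<close>

lemma time_final:
  assumes \<tau>: "real (\<tau>k + \<tau>t) \<le> c\<tau> * (real n)\<^sup>2" and c\<tau>: "0 \<le> c\<tau>"
  shows "real round_time \<le> Z * ((200 * c\<tau> + 300 * (c5 + c6)) * g\<^sup>2)"
proof -
  have e1: "1 \<le> exp (k / 2)" by simp
  have "1 * (t / k)\<^sup>2 \<le> exp (k / 2) * (t / k)\<^sup>2" using e1 by (intro mult_right_mono) auto
  then have "(t / k)\<^sup>2 \<le> Z" using Z_square by linarith
  then have n2: "(real n)\<^sup>2 \<le> Z * g\<^sup>2" unfolding n_square by (intro mult_right_mono) auto
  have "real \<beta> * k * real n \<le> exp (k / 2) * (real n)\<^sup>2"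
  proof (rule mult_mono[OF beta_k])
    show "real n \<le> (real n)\<^sup>2" using k_pos k_le_n by (simp add: power2_eq_square)
  qed auto
  also have "\<dots> = (exp (k / 2) * (t / k)\<^sup>2) * g\<^sup>2" by (simp only: n_square mult.assoc)
  also have "\<dots> \<le> Z * g\<^sup>2" by (intro mult_right_mono Z_square) auto
  finally have bk: "real \<beta> * k * real n \<le> Z * g\<^sup>2" .
  have bN: "real Nmax * real \<beta> * g\<^sup>2 \<le> Z * g\<^sup>2" by (intro mult_right_mono N_beta) auto
  have c: "0 \<le> c5" "0 \<le> c6" unfolding c6_def c5_def c4_def by auto
  have "real round_time = 200 * real (\<tau>k + \<tau>t) + 300 * real \<beta> * real (setup_steps + vote_steps + 1)"
    unfolding round_time_def by (simp add: distrib_left)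
  also have "\<dots> \<le> 200 * (c\<tau> * (real n)\<^sup>2) + 300 * real \<beta> * (c5 * (k * real n) + c6 * (real Nmax * g\<^sup>2))"
    by (intro add_mono mult_left_mono \<tau> steps_le) auto
  also have "\<dots> = 200 * (c\<tau> * (real n)\<^sup>2) + 300 * (c5 * (real \<beta> * k * real n) + c6 * (real Nmax * real \<beta> * g\<^sup>2))"
    by (simp add: algebra_simps)
  also have "\<dots> \<le> 200 * (c\<tau> * (Z * g\<^sup>2)) + 300 * (c5 * (Z * g\<^sup>2) + c6 * (Z * g\<^sup>2))"
    using c c\<tau> n2 bk bN by (intro add_mono mult_left_mono) auto
  also have "\<dots> = Z * ((200 * c\<tau> + 300 * (c5 + c6)) * g\<^sup>2)" by (simp add: algebra_simps)
  finally show ?thesis .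
qed

end

text \<open>Already the quadratic Taylor term exceeds c * x from 2 * c / a^2 on.\<close>

lemma linear_less_exp:
  fixes a c x :: real
  assumes "0 < a" "0 \<le> c" "2 * c / a\<^sup>2 \<le> x" "0 \<le> x" shows "c * x \<le> exp (a * x)"
proof -
  have "2 * c \<le> a\<^sup>2 * x" using assms by (simp add: pos_divide_le_eq mult.commute)
  then have "2 * c * x \<le> a\<^sup>2 * x * x" using assms(4) by (rule mult_right_mono)
  then have "c * x \<le> (a * x)\<^sup>2 / 2" by (simp add: power2_eq_square algebra_simps)
  also have "\<dots> \<le> 1 + a * x + (a * x)\<^sup>2 / 2" using assms by simp
  also have "\<dots> \<le> exp (a * x)" using assms by (intro exp_lower_Taylor_quadratic) simp
  finally show ?thesis .
qed

section \<open>Instantiation for all n\<close>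

definition cells :: "nat \<Rightarrow> nat \<Rightarrow> nat" where
  "cells k t = (t + (1 - t) + (k + (1 - k)) * (A * M) - 1) div ((k + (1 - k)) * (A * M))"

lemma family_cells: "family (k + (1 - k)) (cells k t)"
proof
  define X where "X = (k + (1 - k)) * (A * M)"
  have X: "0 < X" using A_bounds M_pos by (auto simp: X_def)
  have "X div X \<le> (t + (1 - t) + X - 1) div X" by (rule div_le_mono) simp
  then show "1 \<le> cells k t" using X unfolding cells_def X_def[symmetric] by simp
qed simp

definition experts :: "nat \<Rightarrow> nat \<Rightarrow> nat" where
  "experts k t = nat \<lceil>family.weight (k + (1 - k)) (cells k t) (k + (1 - k), 0, [])\<rceil>"

definition width :: "nat \<Rightarrow> nat \<Rightarrow> nat \<Rightarrow> nat" where
  "width n k t = 11 + len k + len t +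
      len (32 * (family.C (k + (1 - k)) (cells k t) + n + F + A * M + (experts k t + 1) * ((k + (1 - k)) * A * M * (n + 1) + 2) * ((k + (1 - k)) * A * M * (n + 1) + 2)))"

lemma learning_instance:
  assumes "exec [] ck (init_mem n) \<tau>k mk" "mk 1 = k" "exec [] ct (init_mem n) \<tau>t mt" "mt 1 = t"
  shows "learning n (k + (1 - k)) (cells k t) k t (width n k t) (experts k t) \<tau>k \<tau>t ck ct mk mt
    (family.weight (k + (1 - k)) (cells k t))"
proof -
  interpret family n "k + (1 - k)" "cells k t" by (rule family_cells)
  have le: "u < 2 ^ width n k t" if "len u \<le> width n k t" for u
    using less_two_power_len[of u] power_increasing[OF that, of "2::nat"] by linarith
  have w: "weight (k + (1 - k), 0, []) \<le> real (experts k t)"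
    unfolding experts_def by (rule real_nat_ceiling_ge)
  show ?thesis
  proof unfold_locales
    show "k < 2 ^ width n k t" "t < 2 ^ width n k t" by (intro le, simp add: width_def)+
    show "32 * (C + n + F + A * M + (experts k t + 1) * ((k + (1 - k)) * A * M * (n + 1) + 2) * ((k + (1 - k)) * A * M * (n + 1) + 2)) \<le> 2 ^ width n k t"
      by (intro less_imp_le le) (simp add: width_def)
    show "1 \<le> experts k t" using w weight_ge[of "(k + (1 - k), 0, [])"] by linarith
  qed (use assms w weight_ge weight_step in \<open>auto simp: width_def cells_def\<close>)
qed

definition big :: "real \<Rightarrow> nat \<Rightarrow> nat \<Rightarrow> nat \<Rightarrow> nat \<Rightarrow> bool" where
  "big c n k t \<tau> \<longleftrightarrow> 160 + F + A * M + nat \<lceil>2 * 70 ^ 20 :: real\<rceil> \<le> k \<and>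
     (3 * (2 * 70 ^ 20) + 52) * real k \<le> exp (9 / 1000 * real k) \<and>
     200 * (A * (M + F)) * k \<le> t \<and> M * t \<le> n \<and> real (len n) \<le> 2 * exp (real k / 1000) \<and> real \<tau> \<le> c * (real n)\<^sup>2"

text \<open>The learner must be correct and bounded at every n, but the explicit bounds are
  available only for large parameters. Elsewhere B and R are just some finite numbers, which the
  asymptotic notions forgive.\<close>

lemma learner_bounds:
  fixes c :: real
  assumes ex: "exec [] ck (init_mem n) \<tau>k mk" "mk 1 = k" "exec [] ct (init_mem n) \<tau>t mt" "mt 1 = t" and c: "0 \<le> c"
  shows "\<exists>R B. learns_PAR (predictor ck ct, updater) n k \<and>
    ereal_of_enat (mistake_bound (predictor ck ct, updater) n k) \<le> ereal B \<and>
    ereal_of_enat (time_per_round (predictor ck ct, updater) n k) \<le> ereal R \<and>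
    (big c n k t (\<tau>k + \<tau>t) \<longrightarrow>
       B = log 2 (real (t choose k)) + real k * real n / real t * (1 + real M * (real t / real n)) \<and>
       R = exp (- real k / 4.01) * real (t choose k) * ((200 * c + 300 * (large.c5 + large.c6)) * (real k * real n / real t)\<^sup>2))"
proof -
  note l = learning_instance[OF ex]
  interpret learning n "k + (1 - k)" "cells k t" k t "width n k t" "experts k t" \<tau>k \<tau>t ck ct mk mt
    "family.weight (k + (1 - k)) (cells k t)" by (rule l)
  show ?thesis
  proof (cases "big c n k t (\<tau>k + \<tau>t)")
    case False
    then show ?thesis using learns mistakes_real time_real by blast
  next
    case True
    have "large n (k + (1 - k)) (cells k t) k t (width n k t) (experts k t) \<tau>k \<tau>t ck ct mk mt (2 * 70 ^ 20)"
      by (intro large.intro l large_axioms.intro) (use True in \<open>simp_all only: big_def experts_def width_def\<close>)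
    then interpret large n "k + (1 - k)" "cells k t" k t "width n k t" "experts k t" \<tau>k \<tau>t ck ct mk mt "2 * 70 ^ 20" .
    have "real (\<tau>k + \<tau>t) \<le> c * (real n)\<^sup>2" using True by (simp only: big_def)
    from time_final[OF this c] have "ereal_of_enat (time_per_round (predictor ck ct, updater) n k) \<le>
       ereal (Z * ((200 * c + 300 * (large.c5 + large.c6)) * g\<^sup>2))"
      by (intro order_trans[OF time_real]) simp
    then show ?thesis using learns mistakes_final unfolding Z_def g_def by blast
  qed
qed

lemma eventually_big:
  fixes k t :: "nat \<Rightarrow> nat"
  assumes 1: "(\<lambda>n. log 2 (log 2 (real n))) \<in> o(\<lambda>n. real (k n))"
    and 2: "(\<lambda>n. real (k n)) \<in> o(\<lambda>n. real (t n))"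
    and 3: "(\<lambda>n. real (t n)) \<in> o(\<lambda>n. real n)"
    and \<tau>: "eventually (\<lambda>n. real (\<tau> n) \<le> c * (real n)\<^sup>2) sequentially"
  shows "eventually (\<lambda>n. big c n (k n) (t n) (\<tau> n)) sequentially"
proof -
  \<comment> \<open>A constant that k must exceed eventually: the first summand is the threshold of
    \<open>linear_less_exp\<close>, the second the constant in \<open>big\<close>.\<close>
  define X where "X = nat \<lceil>2 * (3 * (2 * 70 ^ 20) + 52) / (9 / 1000)\<^sup>2 :: real\<rceil> + (160 + F + A * M + nat \<lceil>2 * 70 ^ 20 :: real\<rceil>)"
  have e1: "eventually (\<lambda>n. \<bar>log 2 (log 2 (real n))\<bar> \<le> 1 / 1000 * real (k n)) sequentially"
    using landau_o.smallD[OF 1, of "1 / 1000"] by simp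
  have e2: "eventually (\<lambda>n. real (k n) \<le> 1 / real (200 * (A * (M + F))) * real (t n)) sequentially"
    using landau_o.smallD[OF 2, of "1 / real (200 * (A * (M + F)))"] A_bounds M_pos by simp
  have e3: "eventually (\<lambda>n. real (t n) \<le> 1 / real M * real n) sequentially"
    using landau_o.smallD[OF 3, of "1 / real M"] M_pos by simp
  have e4: "eventually (\<lambda>n. 2 ^ 2 ^ (X + 1) \<le> n) sequentially" by (rule eventually_ge_at_top)
  show ?thesis using e1 e2 e3 e4 \<tau>
  proof eventually_elim
    case (elim n)
    have "real (2 ^ 2 ^ (X + 1)) \<le> real n" using elim(4) by (simp only: of_nat_le_iff)
    then have n: "2 ^ 2 ^ (X + 1) \<le> real n" by simp
    then have n0: "0 < real n" by (rule less_le_trans[rotated]) simp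
    have ln: "2 ^ (X + 1) \<le> log 2 (real n)"
    proof -
      have "log 2 (2 ^ 2 ^ (X + 1)) \<le> log 2 (real n)" using n by (intro log_mono) auto
      then show ?thesis by (simp add: log_nat_power)
    qed
    have ln1: "1 \<le> log 2 (real n)" by (rule order_trans[OF one_le_power ln]) simp
    \<comment> \<open>That k exceeds every constant follows from log log n = o(k), because log log n
      is unbounded.\<close>
    have lln: "real (X + 1) \<le> log 2 (log 2 (real n))"
    proof -
      have "log 2 (2 ^ (X + 1)) \<le> log 2 (log 2 (real n))" using ln by (intro log_mono) auto
      moreover have "log 2 (2 ^ (X + 1)) = real (X + 1)" by (simp only: log_nat_power) simp
      ultimately show ?thesis by (simp only:)
    qed
    have "real X \<le> real (k n)" using elim(1) lln by linarith
    then have Xk: "X \<le> k n" by (simp only: of_nat_le_iff)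
    have b1: "160 + F + A * M + nat \<lceil>2 * 70 ^ 20 :: real\<rceil> \<le> k n" using Xk by (simp only: X_def)
    have "2 * (3 * (2 * 70 ^ 20) + 52) / (9 / 1000)\<^sup>2 \<le> real (nat \<lceil>2 * (3 * (2 * 70 ^ 20) + 52) / (9 / 1000)\<^sup>2 :: real\<rceil>)"
      by (rule real_nat_ceiling_ge)
    also have "\<dots> \<le> real (k n)" using Xk unfolding of_nat_le_iff X_def by linarith
    finally have b2: "(3 * (2 * 70 ^ 20) + 52) * real (k n) \<le> exp (9 / 1000 * real (k n))"
      by (intro linear_less_exp) auto
    have scale: "y * u \<le> w" if "u \<le> 1 / y * w" "0 < y" for y u w :: real
      using that by (simp add: field_simps)
    have AMF: "0 < real (200 * (A * (M + F)))" using A_bounds M_pos by simp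
    have "real (200 * (A * (M + F))) * real (k n) \<le> real (t n)"
      by (rule scale[OF elim(2) AMF])
    then have b3: "200 * (A * (M + F)) * k n \<le> t n" by (simp only: of_nat_mult[symmetric] of_nat_le_iff)
    have "real M * real (t n) \<le> real n"
      using elim(3) M_pos by (simp add: pos_le_divide_eq mult.commute)
    then have b4: "M * t n \<le> n" by (simp only: of_nat_mult[symmetric] of_nat_le_iff)
    \<comment> \<open>A bound on log log n becomes one on log n by exponentiation, and base 2 is
      below e.\<close>
    have "log 2 (real n) = 2 powr log 2 (log 2 (real n))" using ln1 by simp
    also have "\<dots> \<le> 2 powr (real (k n) / 1000)" using elim(1) by (intro powr_mono) auto
    also have "\<dots> = exp (real (k n) / 1000 * ln 2)" by (simp add: powr_def)
    also have "\<dots> \<le> exp (real (k n) / 1000 * 1)" using ln_2_less_1 by (subst exp_le_cancel_iff, intro mult_left_mono) auto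
    finally have "log 2 (real n) \<le> exp (real (k n) / 1000)" by simp
    moreover have "real (floor_log n) \<le> log 2 (real n)"
      using n0 ln1 of_nat_floor[of "log 2 (real n)"] by (simp add: floor_log_altdef)
    moreover have "1 \<le> exp (real (k n) / 1000)" by simp
    ultimately have b5: "real (len n) \<le> 2 * exp (real (k n) / 1000)" unfolding len_def of_nat_add of_nat_1 by linarith
    show ?case unfolding big_def using b1 b2 b3 b4 b5 elim(5) by blast
  qed
qed

theorem theorem8:
  fixes k t :: "nat \<Rightarrow> nat"
  assumes "quadratic_time_constructible k"
    and "quadratic_time_constructible t"
    and "(\<lambda>n. log 2 (log 2 (real n))) \<in> o(\<lambda>n. real (k n))"
    and "(\<lambda>n. real (k n)) \<in> o(\<lambda>n. real (t n))"
    and "(\<lambda>n. real (t n)) \<in> o(\<lambda>n. real n)"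
  shows "\<exists>(L :: learner) (\<epsilon> :: nat \<Rightarrow> real) (S :: nat \<Rightarrow> real).
    \<epsilon> \<in> o(\<lambda>_. 1) \<and>
    S \<in> soft_O (\<lambda>n. (real (k n) * real n / real (t n))\<^sup>2) \<and>
    (\<forall>n. learns_PAR L n (k n)) \<and>
    (\<forall>n. 0 < n \<and> 0 < k n \<and> k n \<le> t n \<longrightarrow>
       ereal_of_enat (mistake_bound L n (k n)) \<le>
         ereal ((1 + \<epsilon> n) * (real (k n) * real n / real (t n)) + log 2 (real (t n choose k n))) \<and>
       ereal_of_enat (time_per_round L n (k n)) \<le>
         ereal (exp (- real (k n) / 4.01) * real (t n choose k n) * S n))"
proof -
  from assms(1) obtain ck \<tau>k where "\<forall>n. \<exists>m. exec [] ck (init_mem n) (\<tau>k n) m \<and> m 1 = k n"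
    and \<tau>k: "(\<lambda>n. real (\<tau>k n)) \<in> O(\<lambda>n. real n ^ 2)" by (auto simp: quadratic_time_constructible_def)
  then obtain mk where mk: "\<And>n. exec [] ck (init_mem n) (\<tau>k n) (mk n)" "\<And>n. mk n 1 = k n" by metis
  from assms(2) obtain ct \<tau>t where "\<forall>n. \<exists>m. exec [] ct (init_mem n) (\<tau>t n) m \<and> m 1 = t n"
    and \<tau>t: "(\<lambda>n. real (\<tau>t n)) \<in> O(\<lambda>n. real n ^ 2)" by (auto simp: quadratic_time_constructible_def)
  then obtain mt where mt: "\<And>n. exec [] ct (init_mem n) (\<tau>t n) (mt n)" "\<And>n. mt n 1 = t n" by metis
  have "(\<lambda>n. real (\<tau>k n + \<tau>t n)) \<in> O(\<lambda>n. real n ^ 2)" using sum_in_bigo(1)[OF \<tau>k \<tau>t] by simp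
  then obtain c where c: "0 < c" "eventually (\<lambda>n. norm (real (\<tau>k n + \<tau>t n)) \<le> c * norm (real n ^ 2)) sequentially"
    by (rule landau_o.bigE)
  have \<tau>: "eventually (\<lambda>n. real (\<tau>k n + \<tau>t n) \<le> c * (real n)\<^sup>2) sequentially" using c(2) by simp
  define bg where "bg n \<longleftrightarrow> big c n (k n) (t n) (\<tau>k n + \<tau>t n)" for n
  have bg: "eventually bg sequentially"
    unfolding bg_def by (rule eventually_big[OF assms(3-5) \<tau>])
  define G where "G n = real (k n) * real n / real (t n)" for n
  define W where "W n = exp (- real (k n) / 4.01) * real (t n choose k n)" for n
  define C where "C = 200 * c + 300 * (large.c5 + large.c6)"
  let ?L = "(predictor ck ct, updater)"
  have "\<exists>R B. learns_PAR ?L n (k n) \<and> ereal_of_enat (mistake_bound ?L n (k n)) \<le> ereal B \<and>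
    ereal_of_enat (time_per_round ?L n (k n)) \<le> ereal R \<and>
    (bg n \<longrightarrow> B = log 2 (real (t n choose k n)) + G n * (1 + real M * (real (t n) / real n)) \<and> R = W n * (C * (G n)\<^sup>2))" for n
    using learner_bounds[OF mk mt less_imp_le[OF c(1)], of n] unfolding bg_def G_def W_def C_def .
  then obtain R B where RB: "\<And>n. learns_PAR ?L n (k n)" "\<And>n. ereal_of_enat (mistake_bound ?L n (k n)) \<le> ereal (B n)"
    "\<And>n. ereal_of_enat (time_per_round ?L n (k n)) \<le> ereal (R n)"
    "\<And>n. bg n \<Longrightarrow> B n = log 2 (real (t n choose k n)) + G n * (1 + real M * (real (t n) / real n))"
    "\<And>n. bg n \<Longrightarrow> R n = W n * (C * (G n)\<^sup>2)" by metis
  \<comment> \<open>Outside \<open>bg\<close>, at finitely many n, \<epsilon> and S are solved for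
    so that the bounds B and R hold with equality; the limits do not see these n.\<close>
  define \<epsilon> where "\<epsilon> n = (if bg n then real M * (real (t n) / real n) else (B n - log 2 (real (t n choose k n))) / G n - 1)" for n
  define S where "S n = (if bg n then C * (G n)\<^sup>2 else R n / W n)" for n
  have "(\<lambda>n. real (t n) / real n) \<in> o(\<lambda>n. real n / real n)"
    using assms(5) by (intro landau_o.small.divide_right) (auto intro: eventually_gt_at_top[of 0, THEN eventually_mono])
  moreover have "eventually (\<lambda>n. real n / real n = 1) sequentially"
    using eventually_gt_at_top[of 0] by eventually_elim simp
  ultimately have "(\<lambda>n. real (t n) / real n) \<in> o(\<lambda>n. 1)"
    by (subst (asm) landau_o.small.cong) auto
  then have "(\<lambda>n. real M * (real (t n) / real n)) \<in> o(\<lambda>n. 1)"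
    using M_pos by (subst landau_o.small.cmult_in_iff) auto
  moreover have "eventually (\<lambda>n. \<epsilon> n = real M * (real (t n) / real n)) sequentially"
    using bg by eventually_elim (simp add: \<epsilon>_def)
  ultimately have "\<epsilon> \<in> o(\<lambda>_. 1)" by (subst landau_o.small.in_cong) auto
  moreover have "S \<in> soft_O (\<lambda>n. (real (k n) * real n / real (t n))\<^sup>2)"
  proof -
    have "eventually (\<lambda>n. S n = C * (G n)\<^sup>2) sequentially" using bg by eventually_elim (simp add: S_def)
    then have "S \<in> O(\<lambda>n. (G n)\<^sup>2)" by (subst landau_o.big.in_cong) auto
    \<comment> \<open>The witness for the power of the logarithm is 0: the lengths of numbers are
      already absorbed in W.\<close>
    then show ?thesis unfolding soft_O_def G_def by (intro CollectI exI[of _ 0]) simp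
  qed
  moreover have "ereal_of_enat (mistake_bound ?L n (k n)) \<le> ereal ((1 + \<epsilon> n) * (real (k n) * real n / real (t n)) + log 2 (real (t n choose k n))) \<and>
       ereal_of_enat (time_per_round ?L n (k n)) \<le> ereal (exp (- real (k n) / 4.01) * real (t n choose k n) * S n)"
    if n: "0 < n \<and> 0 < k n \<and> k n \<le> t n" for n
  proof -
    have "0 < G n" "0 < W n" using n by (simp_all add: G_def W_def zero_less_binomial)
    then have "B n = (1 + \<epsilon> n) * G n + log 2 (real (t n choose k n))" "R n = W n * S n"
      using RB(4,5)[of n] by (auto simp: \<epsilon>_def S_def)
    then show ?thesis using RB(2,3)[of n] by (simp add: G_def W_def)
  qed
  ultimately show ?thesis using RB(1) by blast
qed

end
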